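(* There exists an absolute constant $c_2>0$ such that for every centered convex body $K$ in $\mathbb{R}^n$ and every $1\le k\le n-1$, $$\mathrm{as}(K)\le (c_2L_K)^k\,|K|^{\frac{k}{n}}\,\max_{E\in \mathrm{Gr}_{n-k}}\mathrm{as}(K\cap E),$$ where $L_K$ is the isotropic constant of $K$.
   Context: $|\cdot|$ denotes volume in the appropriate dimension (the $0$-dimensional volume of a point is $1$), and $\mathrm{Gr}_{m}$ is the Grassmannian of $m$-dimensional linear subspaces of $\mathbb{R}^n$. A convex body in $\mathbb{R}^n$ is a compact convex set with non-empty interior; it is centered if its barycenter is at the origin. An absolute constant does not depend on $n,k,K$. The average section functional is $\mathrm{as}(K)=\int_{S^{n-1}}|K\cap\xi^\perp|\,d\sigma(\xi)$, where $\sigma$ is the rotationally invariant probability measure on $S^{n-1}$; for a linear subspace $E$, $\mathrm{as}(K\cap E)=\int_{S^{n-1}\cap E}|K\cap E\cap\xi^\perp|\,d\sigma_E(\xi)$, where $\sigma_E$ is the rotationally invariant probability measure on $S^{n-1}\cap E$. A centered convex body $K$ of volume $1$ in $\mathbb{R}^n$ is called isotropic if there is a constant $L_K>0$ with $\int_K\langle x,\xi\rangle^2dx=L_K^2$ for every $\xi\in S^{n-1}$. Every centered convex body $K$ has an isotropic position $T(K)$, $T\in GL(n)$ (i.e. $T(K)$ is isotropic), unique up to orthogonal transformations, and the isotropic constant of $K$ is $L_K:=L_{T(K)}$. *)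

theory Defs
  imports "HOL-Probability.Probability"
begin

text \<open>
  The constant of the theorem must not depend on the dimension \<open>n\<close>, so \<open>n\<close> has to be a bound
  variable and cannot be encoded in a type. We therefore work in the inner product space of
  finitely supported real sequences, which contains every \<open>\<real>\<^sup>n\<close> as the subspace
  \<open>Rn n\<close> of sequences supported on \<open>{..<n}\<close>, with the Euclidean inner product.
\<close>

typedef fseq = "{x :: nat \<Rightarrow> real. finite {i. x i \<noteq> 0}}"
  morphisms coord Fseq
  by (rule exI[of _ "\<lambda>_. 0"]) simp

setup_lifting type_definition_fseq

lemma finite_coord [simp]: "finite {i. coord x i \<noteq> 0}"
  using coord[of x] by simp

lemma fseq_eqI: "(\<And>i. coord x i = coord y i) \<Longrightarrow> x = y"
  by (metis coord_inject ext)

instantiation fseq :: real_vector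
begin

lift_definition zero_fseq :: fseq is "\<lambda>_. 0" by simp

lift_definition plus_fseq :: "fseq \<Rightarrow> fseq \<Rightarrow> fseq" is "\<lambda>x y i. x i + y i"
proof -
  fix x y :: "nat \<Rightarrow> real" assume "finite {i. x i \<noteq> 0}" "finite {i. y i \<noteq> 0}"
  then have "finite ({i. x i \<noteq> 0} \<union> {i. y i \<noteq> 0})" by simp
  then show "finite {i. x i + y i \<noteq> 0}" by (rule rev_finite_subset) auto
qed

lift_definition uminus_fseq :: "fseq \<Rightarrow> fseq" is "\<lambda>x i. - x i" by simp

lift_definition minus_fseq :: "fseq \<Rightarrow> fseq \<Rightarrow> fseq" is "\<lambda>x y i. x i - y i"
proof -
  fix x y :: "nat \<Rightarrow> real" assume "finite {i. x i \<noteq> 0}" "finite {i. y i \<noteq> 0}"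
  then have "finite ({i. x i \<noteq> 0} \<union> {i. y i \<noteq> 0})" by simp
  then show "finite {i. x i - y i \<noteq> 0}" by (rule rev_finite_subset) auto
qed

lift_definition scaleR_fseq :: "real \<Rightarrow> fseq \<Rightarrow> fseq" is "\<lambda>r x i. r * x i"
proof -
  fix r and x :: "nat \<Rightarrow> real" assume "finite {i. x i \<noteq> 0}"
  then show "finite {i. r * x i \<noteq> 0}" by (rule rev_finite_subset) auto
qed

instance
  by standard (transfer; auto simp: algebra_simps)+

end

lemma coord_simps [simp]:
  "coord 0 i = 0" "coord (x + y) i = coord x i + coord y i" "coord (- x) i = - coord x i"
  "coord (x - y) i = coord x i - coord y i" "coord (r *\<^sub>R x) i = r * coord x i"
  by (transfer; simp)+

instantiation fseq :: real_inner
begin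

definition inner_fseq :: "fseq \<Rightarrow> fseq \<Rightarrow> real"
  where "inner_fseq x y = (\<Sum>i | coord x i \<noteq> 0. coord x i * coord y i)"

definition norm_fseq :: "fseq \<Rightarrow> real"
  where "norm_fseq x = sqrt (inner x x)"

definition sgn_fseq :: "fseq \<Rightarrow> fseq"
  where "sgn_fseq x = x /\<^sub>R norm x"

definition dist_fseq :: "fseq \<Rightarrow> fseq \<Rightarrow> real"
  where "dist_fseq x y = norm (x - y)"

definition uniformity_fseq :: "(fseq \<times> fseq) filter"
  where "uniformity_fseq = (INF e\<in>{0<..}. principal {(x, y). dist x y < e})"

definition open_fseq :: "fseq set \<Rightarrow> bool"
  where "open_fseq U \<longleftrightarrow> (\<forall>x\<in>U. \<forall>\<^sub>F (x', y) in uniformity. x' = x \<longrightarrow> y \<in> U)"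

lemma inner_fseq_superset:
  assumes "finite S" "{i. coord x i \<noteq> 0} \<subseteq> S"
  shows "inner x y = (\<Sum>i\<in>S. coord x i * coord y i)"
  unfolding inner_fseq_def using assms by (intro sum.mono_neutral_left) auto

instance
proof
  fix x y z :: fseq and r :: real
  let ?S = "{i. coord x i \<noteq> 0} \<union> {i. coord y i \<noteq> 0}"
  have "finite ?S" by simp
  show "inner x y = inner y x"
    by (subst (1 2) inner_fseq_superset[OF \<open>finite ?S\<close>]) (auto simp: mult.commute)
  show "inner (x + y) z = inner x z + inner y z"
    by (subst (1 2 3) inner_fseq_superset[OF \<open>finite ?S\<close>])
      (auto simp: algebra_simps sum.distrib)
  show "inner (r *\<^sub>R x) y = r * inner x y"
    by (subst (1 2) inner_fseq_superset[OF \<open>finite ?S\<close>])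
      (auto simp: algebra_simps sum_distrib_left)
  show "0 \<le> inner x x"
    unfolding inner_fseq_def by (intro sum_nonneg) auto
  show "inner x x = 0 \<longleftrightarrow> x = 0"
    unfolding inner_fseq_def by (subst sum_nonneg_eq_0_iff) (auto intro: fseq_eqI)
qed (simp_all only: norm_fseq_def sgn_fseq_def dist_fseq_def uniformity_fseq_def open_fseq_def)

end

definition Rn :: "nat \<Rightarrow> fseq set"
  where "Rn n = {x. \<forall>i\<ge>n. coord x i = 0}"

lift_definition unit_fseq :: "nat \<Rightarrow> fseq" is "\<lambda>j i. if i = j then 1 else 0" by simp

definition Grassmannian :: "nat \<Rightarrow> nat \<Rightarrow> fseq set set"
  where "Grassmannian n m = {E. subspace E \<and> E \<subseteq> Rn n \<and> dim E = m}"

definition orthonormal_basis :: "fseq set \<Rightarrow> (nat \<Rightarrow> fseq) \<Rightarrow> bool"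
  where "orthonormal_basis E b \<longleftrightarrow>
    (\<forall>i<dim E. \<forall>j<dim E. b i \<bullet> b j = (if i = j then 1 else 0)) \<and>
    span (b ` {..<dim E}) = E"

text \<open>
  Lebesgue measure, on Borel sets, of a finite-dimensional subspace \<open>E\<close>: product Lebesgue measure
  transported by an orthonormal basis. By orthogonal invariance of Lebesgue measure the choice of
  the basis is immaterial. For \<open>E = {0}\<close> the product over the empty index set has total mass 1,
  so that a point has volume 1.
\<close>

definition lebesgue_sub :: "fseq set \<Rightarrow> fseq measure"
  where "lebesgue_sub E =
    (let b = (SOME b. orthonormal_basis E b) in
     distr (\<Pi>\<^sub>M i\<in>{..<dim E}. lborel) (restrict_space borel E)
       (\<lambda>c. \<Sum>i<dim E. c i *\<^sub>R b i))"

definition vol :: "fseq set \<Rightarrow> fseq set \<Rightarrow> real"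
  where "vol E A = measure (lebesgue_sub E) A"

text \<open>
  Every orthogonal map of a finite-dimensional subspace \<open>E\<close> extends to an orthogonal
  transformation of the ambient space that maps \<open>E\<close> onto itself.
\<close>

definition rotation_invariant_prob :: "fseq set \<Rightarrow> fseq measure \<Rightarrow> bool"
  where "rotation_invariant_prob E \<sigma> \<longleftrightarrow>
    prob_space \<sigma> \<and> sets \<sigma> = sets (restrict_space borel (sphere 0 1 \<inter> E)) \<and>
    (\<forall>U. orthogonal_transformation U \<and> U ` E = E \<longrightarrow> distr \<sigma> \<sigma> U = \<sigma>)"

text \<open>For finite-dimensional \<open>E \<noteq> {0}\<close> there is exactly one such measure.\<close>

definition sphere_measure :: "fseq set \<Rightarrow> fseq measure"
  where "sphere_measure E = (SOME \<sigma>. rotation_invariant_prob E \<sigma>)"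

text \<open>
  \<open>avg_section E A\<close> is \<open>as(A)\<close> for a set \<open>A\<close> regarded as a subset of the space \<open>E\<close>; thus
  \<open>as(K)\<close> is \<open>avg_section (Rn n) K\<close> and \<open>as(K \<inter> E)\<close> is \<open>avg_section E (K \<inter> E)\<close>.
  For a centered convex body \<open>K\<close> the supremum of the latter over a Grassmannian is a maximum.
\<close>

definition avg_section :: "fseq set \<Rightarrow> fseq set \<Rightarrow> real"
  where "avg_section E A =
    (LINT \<xi>|sphere_measure E. vol (E \<inter> {x. x \<bullet> \<xi> = 0}) (A \<inter> {x. x \<bullet> \<xi> = 0}))"

definition convex_body :: "nat \<Rightarrow> fseq set \<Rightarrow> bool"
  where "convex_body n K \<longleftrightarrow>
    K \<subseteq> Rn n \<and> compact K \<and> convex K \<and> top_of_set (Rn n) interior_of K \<noteq> {}"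

text \<open>Coordinatewise, because the Bochner integral requires a complete space.\<close>

definition barycenter :: "nat \<Rightarrow> fseq set \<Rightarrow> fseq"
  where "barycenter n K =
    (\<Sum>i<n. ((LINT x:K|lebesgue_sub (Rn n). coord x i) / vol (Rn n) K) *\<^sub>R unit_fseq i)"

definition centered_convex_body :: "nat \<Rightarrow> fseq set \<Rightarrow> bool"
  where "centered_convex_body n K \<longleftrightarrow> convex_body n K \<and> barycenter n K = 0"

definition isotropic_with :: "nat \<Rightarrow> fseq set \<Rightarrow> real \<Rightarrow> bool"
  where "isotropic_with n K L \<longleftrightarrow>
    centered_convex_body n K \<and> vol (Rn n) K = 1 \<and> L > 0 \<and>
    (\<forall>\<xi>\<in>sphere 0 1 \<inter> Rn n. (LINT x:K|lebesgue_sub (Rn n). (x \<bullet> \<xi>)\<^sup>2) = L\<^sup>2)"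

text \<open>
  The maps in \<open>GL n\<close> are defined on the whole ambient space, but only their restriction to
  \<open>Rn n\<close> matters; every linear automorphism of \<open>Rn n\<close> arises as such a restriction.
\<close>

definition GL :: "nat \<Rightarrow> (fseq \<Rightarrow> fseq) set"
  where "GL n = {T. linear T \<and> bij_betw T (Rn n) (Rn n)}"

text \<open>
  The value does not depend on the isotropic position, since isotropic positions of a centered
  convex body are unique up to orthogonal transformations.
\<close>

definition isotropic_constant :: "nat \<Rightarrow> fseq set \<Rightarrow> real"
  where "isotropic_constant n K = (SOME L. \<exists>T\<in>GL n. isotropic_with n (T ` K) L)"

end

theory Submission
  imports Defs
begin

text \<open>
  For a convex body \<open>K\<close> with barycenter 0 let \<open>lam i\<close> be the eigenvalues of its covariance matrix, let \<open>E\<close> be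
  spanned by all eigenvectors but the \<open>k\<close> with the smallest eigenvalues, and let \<open>Q\<close> be the covariance quadratic form.
  A one-dimensional moment inequality for log-concave functions bounds \<open>vol (K \<inter> x\<^sup>\<bottom>) / norm x\<close> from above by
  a constant times \<open>vol K / sqrt (Q x)\<close>. Conversely, log-concavity of the section function and Jensen's
  inequality bound \<open>vol (K \<inter> E \<inter> y\<^sup>\<bottom>) / norm y\<close>, for the projection \<open>y\<close> of \<open>x\<close> to \<open>E\<close>, from below by \<open>vol K / sqrt (Q x)\<close>
  divided by a constant to the power \<open>k + 1\<close> and by the product of the \<open>k\<close> smallest \<open>sqrt (lam i)\<close>. Integrating over
  \<open>x\<close> with the weight \<open>exp (- (norm x)\<^sup>2 / 2)\<close> turns both sides into average sections. An isotropic position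
  maps the covariance ellipsoid into a ball of radius the isotropic constant \<open>L\<close>, whence
  \<open>(\<Prod>i<n. sqrt (lam i)) \<le> L ^ n * vol K\<close>. If \<open>E\<close> is a line, the average section of \<open>K \<inter> E\<close> is 1, and the
  average section of \<open>K\<close> is estimated directly by a Gaussian integral of \<open>1 / sqrt (Q x)\<close>.
\<close>

section \<open>Log-concave functions\<close>

text \<open>The two section bounds can be compared only if they share the factor involving
  \<open>Q x\<close>, which is not determined by the projection \<open>y\<close>. Hence the lower
  bound takes \<open>x\<close> itself, and not \<open>y\<close>, as one of the \<open>k + 1\<close>
  directions whose second moments enter Jensen's inequality; \<open>Q x\<close> then cancels,
  leaving a constant per direction and the \<open>k\<close> discarded eigenvalues. As these are the
  smallest, the product of their square roots is at most the full product to the power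
  \<open>k / n\<close>, and this produces \<open>L ^ k\<close> and the power of the volume. The
  Gaussian factorises over \<open>E\<close> and its orthogonal complement, and an extra factor
  \<open>1 / norm x\<close> in the weight matches the normalisation of both bounds. The masses of
  the weight in dimensions \<open>n\<close> and \<open>n - k\<close> then differ, up to constants,
  by a power of \<open>sqrt (2 * pi)\<close> and by \<open>sqrt (n / (n - k))\<close>, which is at
  most \<open>2 ^ k\<close>. On a line \<open>1 / norm x\<close> is not integrable, hence the
  separate case. Constants independent of \<open>k\<close> are absorbed into the \<open>k\<close>-th
  power because \<open>1 \<le> k\<close>.\<close>

definition log_concave :: "('a::real_vector \<Rightarrow> real) \<Rightarrow> bool" where
  "log_concave f \<longleftrightarrow> (\<forall>x. 0 \<le> f x) \<and>
     (\<forall>x y t. 0 < t \<and> t < 1 \<longrightarrow> f x powr (1 - t) * f y powr t \<le> f ((1 - t) *\<^sub>R x + t *\<^sub>R y))"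

lemma log_concave_nonneg: "log_concave f \<Longrightarrow> 0 \<le> f x"
  by (simp add: log_concave_def)

lemma log_concaveD:
  "log_concave f \<Longrightarrow> 0 < t \<Longrightarrow> t < 1 \<Longrightarrow> f x powr (1 - t) * f y powr t \<le> f ((1 - t) *\<^sub>R x + t *\<^sub>R y)"
  by (simp add: log_concave_def)

lemma log_concave_line:
  assumes "log_concave f"
  shows "log_concave (\<lambda>s::real. f (v + s *\<^sub>R e))"
  unfolding log_concave_def
proof (intro conjI allI impI)
  fix x y t :: real assume t: "0 < t \<and> t < 1"
  have "v + ((1 - t) *\<^sub>R x + t *\<^sub>R y) *\<^sub>R e = (1 - t) *\<^sub>R (v + x *\<^sub>R e) + t *\<^sub>R (v + y *\<^sub>R e)"
    by (simp add: algebra_simps)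
  then show "f (v + x *\<^sub>R e) powr (1 - t) * f (v + y *\<^sub>R e) powr t \<le> f (v + ((1 - t) *\<^sub>R x + t *\<^sub>R y) *\<^sub>R e)"
    using log_concaveD[OF assms, of t "v + x *\<^sub>R e" "v + y *\<^sub>R e"] t by simp
qed (use assms in \<open>simp add: log_concave_nonneg\<close>)

lemma log_concave_indicator:
  assumes "convex K"
  shows "log_concave (indicat_real K)"
  unfolding log_concave_def
proof (intro conjI allI impI)
  fix x y and t :: real assume t: "0 < t \<and> t < 1"
  have "(1 - t) *\<^sub>R x + t *\<^sub>R y \<in> K" if "x \<in> K" "y \<in> K"
    using assms that t by (auto simp: convex_def)
  then show "indicat_real K x powr (1 - t) * indicat_real K y powr t
      \<le> indicat_real K ((1 - t) *\<^sub>R x + t *\<^sub>R y)"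
    using t by (auto simp: indicator_def)
qed simp

lemma log_concave_superlevel_convex:
  fixes f :: "'a::real_vector \<Rightarrow> real"
  assumes f: "log_concave f" and r: "0 \<le> r"
  shows "convex {x. r < f x}"
  unfolding convex_alt
proof (intro ballI allI impI)
  fix x y and t :: real assume xy: "x \<in> {x. r < f x}" "y \<in> {x. r < f x}" and t: "0 \<le> t \<and> t \<le> 1"
  show "(1 - t) *\<^sub>R x + t *\<^sub>R y \<in> {x. r < f x}"
  proof (cases "0 < t \<and> t < 1")
    case True
    define m where "m = min (f x) (f y)"
    have m: "r < m" "0 < m" using xy r by (auto simp: m_def)
    have "m = m powr (1 - t) * m powr t" using m by (simp flip: powr_add)
    also have "\<dots> \<le> f x powr (1 - t) * f y powr t"
      using True m by (intro mult_mono powr_mono2) (auto simp: m_def)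
    also have "\<dots> \<le> f ((1 - t) *\<^sub>R x + t *\<^sub>R y)" using log_concaveD[OF f] True by blast
    finally show ?thesis using m by simp
  next
    case False
    then have "t = 0 \<or> t = 1" using t by auto
    then show ?thesis using xy by auto
  qed
qed

text \<open>Superlevel sets at nonnegative levels are convex, hence intervals, and those at negative
  levels are the whole line. Section functions along lines thus become measurable without a separate
  argument.\<close>

lemma log_concave_measurable:
  fixes f :: "real \<Rightarrow> real"
  assumes f: "log_concave f"
  shows "f \<in> borel_measurable borel"
proof -
  have "{x. r < f x} \<in> sets borel" for r
  proof (cases "0 \<le> r")
    case True
    then have "is_interval {x. r < f x}"
      using log_concave_superlevel_convex[OF f] by (simp add: is_interval_convex_1)
    then show ?thesis by (simp add: real_interval_borel_measurable)
  next
    case False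
    then have "{x. r < f x} = UNIV" using log_concave_nonneg[OF f] by (auto simp: not_le intro: less_le_trans)
    then show ?thesis by simp
  qed
  then show ?thesis by (simp add: borel_measurable_iff_greater)
qed

text \<open>For intervals the Brunn-Minkowski inequality is a statement about end points:
  \<open>H\<close> contains the segment from a combination of two left points to the same
  combination of two right points, and these can be chosen almost the combined length apart.\<close>

lemma interval_Minkowski_measure:
  fixes A B H :: "real set"
  assumes A: "convex A" "A \<noteq> {}" and B: "convex B" "B \<noteq> {}"
    and sub: "\<And>x y. x \<in> A \<Longrightarrow> y \<in> B \<Longrightarrow> (1 - t) * x + t * y \<in> H"
    and t: "0 < t" "t < 1" and H: "convex H" "H \<in> sets borel"
    and A': "A \<in> sets borel" "bounded A" and B': "B \<in> sets borel" "bounded B" and H': "bounded H"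
  shows "(1 - t) * measure lborel A + t * measure lborel B \<le> measure lborel H"
proof -
  have meas: "measure lborel A \<le> Sup A - Inf A" if "A \<noteq> {}" "bounded A" for A :: "real set"
  proof -
    have "A \<subseteq> {Inf A .. Sup A}"
      using cInf_lower[OF _ bounded_imp_bdd_below] cSup_upper[OF _ bounded_imp_bdd_above] that
      by fastforce
    then have "measure lborel A \<le> measure lborel {Inf A .. Sup A}"
    proof (cases "A \<in> sets borel")
      case True
      then show ?thesis using \<open>A \<subseteq> _\<close>
        by (intro measure_mono_fmeasurable) (auto simp: fmeasurable_def emeasure_lborel_Icc_eq)
    qed (simp add: measure_notin_sets)
    moreover have "Inf A \<le> Sup A"
      using that bounded_imp_bdd_above bounded_imp_bdd_below cInf_le_cSup by blast
    ultimately show ?thesis by simp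
  qed
  have low: "c2 - c1 \<le> measure lborel H" if "c1 \<in> H" "c2 \<in> H" for c1 c2
  proof (cases "c1 \<le> c2")
    case True
    have "{c1..c2} \<subseteq> H" using that H(1)
      by (metis closed_segment_eq_real_ivl closed_segment_subset True)
    moreover have "H \<in> fmeasurable lborel"
      using emeasure_bounded_finite[OF H'] H by (simp add: fmeasurable_def)
    ultimately have "measure lborel {c1..c2} \<le> measure lborel H"
      using H by (intro measure_mono_fmeasurable) auto
    then show ?thesis using True by simp
  next
    case False then show ?thesis using measure_nonneg[of lborel H] by linarith
  qed
  have key: "(1 - t) * (a2 - a1) + t * (b2 - b1) \<le> measure lborel H"
    if "a1 \<in> A" "a2 \<in> A" "b1 \<in> B" "b2 \<in> B" for a1 a2 b1 b2
    using low[OF sub[OF that(1,3)] sub[OF that(2,4)]] by (simp add: algebra_simps)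
  have t': "1 - t > 0" using t by simp
  \<comment> \<open>The four points in \<open>key\<close> are pushed to the end points one at a
    time, since suprema and infima need not be attained.\<close>
  have "(1 - t) * (Sup A - Inf A) + t * (Sup B - Inf B) \<le> measure lborel H"
  proof -
    have s1: "Sup A \<le> (measure lborel H - t * (b2 - b1)) / (1 - t) + a1"
      if "a1 \<in> A" "b1 \<in> B" "b2 \<in> B" for a1 b1 b2
      using key[OF that(1) _ that(2,3)] A t' by (intro cSup_least) (auto simp: field_simps)
    have s2: "Sup A - (measure lborel H - t * (b2 - b1)) / (1 - t) \<le> Inf A"
      if "b1 \<in> B" "b2 \<in> B" for b1 b2
      using s1[OF _ that] A by (intro cInf_greatest) (auto simp: algebra_simps)
    have s3: "Sup B \<le> (measure lborel H - (1 - t) * (Sup A - Inf A)) / t + b1" if "b1 \<in> B" for b1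
    proof (rule cSup_least)
      fix b2 assume "b2 \<in> B"
      from s2[OF that this] have "(Sup A - Inf A) \<le> (measure lborel H - t * (b2 - b1)) / (1 - t)" by simp
      then have "(1 - t) * (Sup A - Inf A) \<le> measure lborel H - t * (b2 - b1)"
        using t' by (simp add: field_simps)
      then show "b2 \<le> (measure lborel H - (1 - t) * (Sup A - Inf A)) / t + b1"
        using t by (simp add: field_simps)
    qed (use B in auto)
    have "Sup B - (measure lborel H - (1 - t) * (Sup A - Inf A)) / t \<le> Inf B"
      using s3 B by (intro cInf_greatest) (auto simp: algebra_simps)
    then show ?thesis using t by (simp add: field_simps)
  qed
  moreover have "(1 - t) * measure lborel A + t * measure lborel B
      \<le> (1 - t) * (Sup A - Inf A) + t * (Sup B - Inf B)"
    using meas A B A' B' t by (intro add_mono mult_left_mono) auto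
  ultimately show ?thesis by linarith
qed

text \<open>Tonelli's theorem for the region under the graph. Levels are measured relative to
  \<open>M\<close>, so that functions with different bounds can be compared at a common parameter
  \<open>r\<close> in the unit interval. Measurability and integrability are stated as well because
  the comparison takes place under Bochner integrals.\<close>

lemma integral_layer_cake:
  fixes f :: "real \<Rightarrow> real"
  assumes f: "f \<in> borel_measurable borel" "\<And>x. 0 \<le> f x" "\<And>x. f x \<le> M" "0 < M"
    and supp: "\<And>x. f x \<noteq> 0 \<Longrightarrow> \<bar>x\<bar> \<le> R"
  shows "integrable lborel f"
    and "(\<lambda>r. indicator {0<..<1} r * measure lborel {x. r * M < f x}) \<in> borel_measurable borel"
    and "integrable lborel (\<lambda>r. indicator {0<..<1} r * measure lborel {x. r * M < f x})"
    and "integral\<^sup>L lborel f = M * (\<integral>r. indicator {0<..<1} r * measure lborel {x. r * M < f x} \<partial>lborel)"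
proof -
  have fin: "emeasure lborel {x. r * M < f x} = ennreal (measure lborel {x. r * M < f x})"
    if "r \<in> {0<..<1}" for r
  proof -
    have "x \<in> {-R..R}" if "r * M < f x" for x
    proof -
      have "0 < r * M" using \<open>r \<in> {0<..<1}\<close> assms(4) by simp
      then show ?thesis using that supp[of x] by (auto simp: abs_le_iff)
    qed
    then have "{x. r * M < f x} \<subseteq> {-R..R}" by blast
    then have "emeasure lborel {x. r * M < f x} \<le> emeasure lborel {-R..R}" by (intro emeasure_mono) auto
    also have "\<dots> < \<infinity>" by (intro emeasure_bounded_finite) auto
    finally show ?thesis by (simp add: emeasure_eq_ennreal_measure)
  qed
  have [measurable]: "f \<in> borel_measurable borel" by fact
  have bound: "f x \<le> M * indicator {-R..R} x" for x
    using supp[of x] f(3)[of x] f(2)[of x] by (cases "f x = 0") (auto simp: indicator_def abs_le_iff)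
  show int: "integrable lborel f"
    by (rule Bochner_Integration.integrable_bound[where f="\<lambda>x. M * indicator {-R..R} x"])
      (use bound f in \<open>simp_all add: emeasure_lborel_Icc_eq\<close>)
  let ?g = "\<lambda>r. indicator {0<..<1} r * measure lborel {x. r * M < f x}"
  \<comment> \<open>The inner integral of Tonelli's theorem; its measurability in \<open>r\<close>
    is that of the distribution function.\<close>
  let ?G = "\<lambda>r. \<integral>\<^sup>+x. indicator {0<..<1} r * indicator {x. r * M < f x} x \<partial>lborel"
  have G: "?G r = ennreal (?g r)" for r
    by (cases "r \<in> {0<..<1}") (auto simp: fin)
  have "(\<lambda>r. ?G r) \<in> borel_measurable lborel"
    by measurable
  then have Gm: "(\<lambda>r. ennreal (?g r)) \<in> borel_measurable borel" unfolding G by simp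
  then have "(\<lambda>r. enn2real (ennreal (?g r))) \<in> borel_measurable borel" by measurable
  then show gm: "?g \<in> borel_measurable borel" by simp
  have "(\<integral>\<^sup>+r. ?G r \<partial>lborel) = (\<integral>\<^sup>+x. \<integral>\<^sup>+r. indicator {0<..<1} r * indicator {x. r * M < f x} x \<partial>lborel \<partial>lborel)"
    by (rule lborel_pair.Fubini') measurable
  also have "\<dots> = (\<integral>\<^sup>+x. ennreal (f x / M) \<partial>lborel)"
  proof (rule nn_integral_cong)
    fix x
    have iff: "(0 < r \<and> r < 1) \<and> r * M < f x \<longleftrightarrow> 0 < r \<and> r < f x / M" for r
    proof -
      have "f x / M \<le> 1" using f(3)[of x] f(4) by simp
      moreover have "r * M < f x \<longleftrightarrow> r < f x / M" using f(4) by (simp add: pos_less_divide_eq)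
      ultimately show ?thesis by auto
    qed
    have "indicator {0<..<1} r * indicator {x. r * M < f x} x = (indicator {0<..<f x / M} r :: ennreal)" for r
      using iff[of r] by (auto simp: indicator_def)
    then show "(\<integral>\<^sup>+r. indicator {0<..<1} r * indicator {x. r * M < f x} x \<partial>lborel) = ennreal (f x / M)"
      using f(2)[of x] f(4) by simp
  qed
  also have "\<dots> = ennreal (integral\<^sup>L lborel (\<lambda>x. f x / M))"
    using int f by (intro nn_integral_eq_integral) auto
  finally have nn: "(\<integral>\<^sup>+r. ennreal (?g r) \<partial>lborel) = ennreal (integral\<^sup>L lborel f / M)"
    unfolding G by simp
  show gi: "integrable lborel ?g"
    by (rule integrableI_nonneg) (use gm nn in auto)
  have "integral\<^sup>L lborel ?g = integral\<^sup>L lborel f / M"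
    by (rule integral_eq_nn_integral[THEN trans]) (use gm nn f in \<open>auto intro!: integral_nonneg divide_nonneg_pos\<close>)
  then show "integral\<^sup>L lborel f = M * integral\<^sup>L lborel ?g" using f(4) by simp
qed

text \<open>The Prekopa-Leindler inequality on the line. At equal relative levels the superlevel
  sets of the three functions satisfy \<open>interval_Minkowski_measure\<close>; integrating over
  the levels gives an additive inequality for the normalised functions, and the weighted
  arithmetic-geometric mean inequality makes it multiplicative. Log-concavity enters by turning
  superlevel sets into intervals.\<close>

lemma integral_log_concave_mult_le:
  fixes f g h :: "real \<Rightarrow> real"
  assumes f: "log_concave f" "\<And>x. f x \<le> Mf" "\<And>x. f x \<noteq> 0 \<Longrightarrow> \<bar>x\<bar> \<le> R"
    and g: "log_concave g" "\<And>x. g x \<le> Mg" "\<And>x. g x \<noteq> 0 \<Longrightarrow> \<bar>x\<bar> \<le> R"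
    and h: "log_concave h" "\<And>x. h x \<le> Mh" "\<And>x. h x \<noteq> 0 \<Longrightarrow> \<bar>x\<bar> \<le> R"
    and t: "0 < t" "t < 1"
    and le: "\<And>x y. f x powr (1 - t) * g y powr t \<le> h ((1 - t) * x + t * y)"
  shows "integral\<^sup>L lborel f powr (1 - t) * integral\<^sup>L lborel g powr t \<le> integral\<^sup>L lborel h"
proof (cases "(\<exists>x. f x > 0) \<and> (\<exists>x. g x > 0)")
  case False
  then consider "\<forall>x. \<not> f x > 0" | "\<forall>x. \<not> g x > 0" by blast
  then have "f = (\<lambda>x. 0) \<or> g = (\<lambda>x. 0)"
  proof cases
    case 1
    have "f x = 0" for x using 1[rule_format, of x] log_concave_nonneg[OF f(1), of x] by linarith
    then show ?thesis by blast
  next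
    case 2
    have "g x = 0" for x using 2[rule_format, of x] log_concave_nonneg[OF g(1), of x] by linarith
    then show ?thesis by blast
  qed
  then have "integral\<^sup>L lborel f powr (1 - t) * integral\<^sup>L lborel g powr t = 0"
    by auto
  also have "0 \<le> integral\<^sup>L lborel h"
    using log_concave_nonneg[OF h(1)] by (intro Bochner_Integration.integral_nonneg)
  finally show ?thesis .
next
  case True
  then obtain x0 y0 where x0: "f x0 > 0" and y0: "g y0 > 0" by auto
  \<comment> \<open>Normalising by the suprema keeps the superlevel sets of \<open>f\<close> and
    \<open>g\<close> nonempty at every relative level below 1, as the Brunn-Minkowski step
    requires.\<close>
  define F where "F = (SUP x. f x)"
  define G where "G = (SUP x. g x)"
  define H where "H = F powr (1 - t) * G powr t"
  have fb: "bdd_above (range f)" and gb: "bdd_above (range g)"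
    using f(2) g(2) unfolding bdd_above_def by blast+
  have fF: "f x \<le> F" for x unfolding F_def using fb by (intro cSUP_upper) auto
  have gG: "g x \<le> G" for x unfolding G_def using gb by (intro cSUP_upper) auto
  have pos: "0 < F" "0 < G" using fF[of x0] gG[of y0] x0 y0 by auto
  then have Hpos: "0 < H" by (simp add: H_def)
  \<comment> \<open>Cutting \<open>h\<close> at \<open>H\<close> yields a function bounded by
    \<open>H\<close>, as the layer formula demands, with the same superlevel sets at levels below
    \<open>H\<close>.\<close>
  define h' where "h' = (\<lambda>x. min (h x) H)"
  have mf: "f \<in> borel_measurable borel" and mg: "g \<in> borel_measurable borel" and mh: "h \<in> borel_measurable borel"
    using f g h log_concave_measurable by auto
  have mh': "h' \<in> borel_measurable borel" unfolding h'_def using mh by measurable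
  note LF = integral_layer_cake[OF mf log_concave_nonneg[OF f(1)] fF pos(1) f(3)]
  note LG = integral_layer_cake[OF mg log_concave_nonneg[OF g(1)] gG pos(2) g(3)]
  have h'0: "0 \<le> h' x" for x using log_concave_nonneg[OF h(1)] Hpos by (simp add: h'_def)
  have h'R: "h' x \<noteq> 0 \<Longrightarrow> \<bar>x\<bar> \<le> R" for x using h(3) Hpos by (auto simp: h'_def)
  have h'H: "h' x \<le> H" for x by (simp add: h'_def)
  note LH = integral_layer_cake[OF mh' h'0 h'H Hpos h'R]
  have bd: "bounded {x. r < q x}" if "0 \<le> r" "\<And>x. q x \<noteq> 0 \<Longrightarrow> \<bar>x\<bar> \<le> R" for r and q :: "real \<Rightarrow> real"
    using that by (intro boundedI[of _ R]) force
  have lev: "(1 - t) * measure lborel {x. r * F < f x} + t * measure lborel {x. r * G < g x}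
      \<le> measure lborel {x. r * H < h' x}" if r: "r \<in> {0<..<1}" for r
  proof -
    have rH: "r * H < H" using r Hpos by simp
    then have eq: "{x. r * H < h' x} = {x. r * H < h x}" by (auto simp: h'_def)
    have r0: "0 \<le> r * F" "0 \<le> r * G" "0 \<le> r * H" using r pos Hpos by auto
    show ?thesis unfolding eq
    proof (rule interval_Minkowski_measure)
      show "convex {x. r * F < f x}" "convex {x. r * G < g x}" "convex {x. r * H < h x}"
        using log_concave_superlevel_convex f g h r0 by auto
      show "bounded {x. r * F < f x}" "bounded {x. r * G < g x}" "bounded {x. r * H < h x}"
        using bd f g h r0 by auto
      show "{x. r * F < f x} \<in> sets borel" "{x. r * G < g x} \<in> sets borel" "{x. r * H < h x} \<in> sets borel"
        using mf mg mh by auto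
      have "r * F < F" "r * G < G" using r pos by auto
      then show "{x. r * F < f x} \<noteq> {}" "{x. r * G < g x} \<noteq> {}"
        using less_cSUP_iff[OF _ fb] less_cSUP_iff[OF _ gb] unfolding F_def[symmetric] G_def[symmetric] by auto
      fix x y assume x: "x \<in> {x. r * F < f x}" and y: "y \<in> {x. r * G < g x}"
      have "r * H = r powr (1 - t) * r powr t * (F powr (1 - t) * G powr t)"
        using r by (simp add: H_def flip: powr_add)
      also have "\<dots> = (r * F) powr (1 - t) * (r * G) powr t"
        using r pos by (simp add: powr_mult)
      also have "\<dots> < f x powr (1 - t) * g y powr t"
        using x y r0 t r pos by (intro mult_strict_mono' powr_less_mono2) auto
      also have "\<dots> \<le> h ((1 - t) * x + t * y)" by (rule le)
      finally show "(1 - t) * x + t * y \<in> {x. r * H < h x}" by simp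
    qed (use t in auto)
  qed
  let ?I = "\<lambda>F f. \<integral>r. indicator {0<..<1} r * measure lborel {x. r * F < f x} \<partial>lborel"
  have "(1 - t) * ?I F f + t * ?I G g = (\<integral>r. (1 - t) * (indicator {0<..<1} r * measure lborel {x. r * F < f x})
     + t * (indicator {0<..<1} r * measure lborel {x. r * G < g x}) \<partial>lborel)"
    using LF(3) LG(3) by simp
  also have "\<dots> \<le> ?I H h'"
  proof (rule integral_mono)
    fix r :: real
    show "(1 - t) * (indicator {0<..<1} r * measure lborel {x. r * F < f x})
     + t * (indicator {0<..<1} r * measure lborel {x. r * G < g x})
      \<le> indicator {0<..<1} r * measure lborel {x. r * H < h' x}"
    proof (cases "r \<in> {0<..<1}")
      case True
      then show ?thesis using lev[OF True] by (simp only: indicator_simps mult_1)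
    qed simp
  qed (use LF(3) LG(3) LH(3) in auto)
  finally have I: "(1 - t) * ?I F f + t * ?I G g \<le> ?I H h'" .
  have I0: "0 \<le> ?I F f" "0 \<le> ?I G g" by (auto intro!: Bochner_Integration.integral_nonneg)
  have young: "a powr (1 - t) * b powr t \<le> (1 - t) * a + t * b" if "0 \<le> a" "0 \<le> b" for a b :: real
    using Youngs_inequality_0[of "1 - t" t a b] that t by (cases "a = 0 \<or> b = 0") auto
  \<comment> \<open>The two normalising constants recombine to \<open>H\<close>, so that the layer
    formula for \<open>h'\<close> can take over on the right-hand side.\<close>
  have scale: "(F * a) powr (1 - t) * (G * b) powr t = H * (a powr (1 - t) * b powr t)"
    if "0 \<le> a" "0 \<le> b" for a b :: real
  proof -
    have "(F * a) powr (1 - t) = F powr (1 - t) * a powr (1 - t)" "(G * b) powr t = G powr t * b powr t"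
      using that pos by (auto intro: powr_mult)
    then show ?thesis by (simp only: H_def mult_ac)
  qed
  have eF: "integral\<^sup>L lborel f = F * ?I F f" by (rule LF(4))
  have eG: "integral\<^sup>L lborel g = G * ?I G g" by (rule LG(4))
  have "integral\<^sup>L lborel f powr (1 - t) * integral\<^sup>L lborel g powr t
      = (F * ?I F f) powr (1 - t) * (G * ?I G g) powr t"
    by (simp only: eF eG)
  also have "\<dots> = H * (?I F f powr (1 - t) * ?I G g powr t)"
    by (rule scale) (rule I0)+
  also have "\<dots> \<le> H * ((1 - t) * ?I F f + t * ?I G g)"
    using young[OF I0] Hpos by (rule mult_left_mono[OF _ less_imp_le])
  also have "\<dots> \<le> H * ?I H h'" using I Hpos by simp
  also have "\<dots> = integral\<^sup>L lborel h'" using LH(4) by simp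
  also have "\<dots> \<le> integral\<^sup>L lborel h"
  proof (rule integral_mono)
    have "0 < max Mh 1" by simp
    moreover have "h x \<le> max Mh 1" for x using h(2)[of x] by simp
    ultimately show "integrable lborel h"
      using integral_layer_cake(1)[OF mh log_concave_nonneg[OF h(1)] _ _ h(3), of "max Mh 1"] by blast
    show "integrable lborel h'" by (rule LH(1))
  qed (simp add: h'_def)
  finally show ?thesis .
qed

text \<open>The fibres over \<open>v\<close>, \<open>w\<close> and their combination satisfy the
  Prekopa-Leindler hypothesis. Integrating along one line at a time lets the one-dimensional
  inequality handle sections of any dimension. The support bound may vary with \<open>v\<close>;
  only three base points occur at once, and the largest of their bounds serves for all.\<close>

lemma log_concave_marginal:
  fixes f :: "'a::real_vector \<Rightarrow> real" and e :: 'a and R :: "'a \<Rightarrow> real"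
  assumes f: "log_concave f" "\<And>x. f x \<le> M"
    and supp: "\<And>v s. f (v + s *\<^sub>R e) \<noteq> 0 \<Longrightarrow> \<bar>s\<bar> \<le> R v"
  shows "log_concave (\<lambda>v. \<integral>s. f (v + s *\<^sub>R e) \<partial>lborel)"
  unfolding log_concave_def
proof (intro conjI allI impI)
  fix v w :: 'a and t :: real assume t: "0 < t \<and> t < 1"
  let ?u = "(1 - t) *\<^sub>R v + t *\<^sub>R w"
  define R' where "R' = max (max (R v) (R w)) (R ?u)"
  have R': "R v \<le> R'" "R w \<le> R'" "R ?u \<le> R'" by (auto simp: R'_def)
  show "(\<integral>s. f (v + s *\<^sub>R e) \<partial>lborel) powr (1 - t) * (\<integral>s. f (w + s *\<^sub>R e) \<partial>lborel) powr t
      \<le> (\<integral>s. f (?u + s *\<^sub>R e) \<partial>lborel)"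
  proof (rule integral_log_concave_mult_le[where R = R' and Mf = M and Mg = M and Mh = M])
    fix x y :: real
    have "?u + ((1 - t) * x + t * y) *\<^sub>R e = (1 - t) *\<^sub>R (v + x *\<^sub>R e) + t *\<^sub>R (w + y *\<^sub>R e)"
      by (simp add: algebra_simps)
    then show "f (v + x *\<^sub>R e) powr (1 - t) * f (w + y *\<^sub>R e) powr t \<le> f (?u + ((1 - t) * x + t * y) *\<^sub>R e)"
      using log_concaveD[OF f(1), of t "v + x *\<^sub>R e" "w + y *\<^sub>R e"] t by simp
    show "\<bar>x\<bar> \<le> R'" if "f (v + x *\<^sub>R e) \<noteq> 0" using supp[OF that] R' by linarith
    show "\<bar>x\<bar> \<le> R'" if "f (w + x *\<^sub>R e) \<noteq> 0" using supp[OF that] R' by linarith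
    show "\<bar>x\<bar> \<le> R'" if "f (?u + x *\<^sub>R e) \<noteq> 0" using supp[OF that] R' by linarith
  qed (use t log_concave_line[OF f(1)] f(2) in auto)
qed (use log_concave_nonneg[OF f(1)] in \<open>auto intro!: Bochner_Integration.integral_nonneg\<close>)

text \<open>A Hahn-Banach argument for the concave function \<open>ln \<phi>\<close> at 0, one basis
  vector at a time: the new coefficient of the linear form must lie above all slopes seen on the
  positive side and below all slopes seen on the negative side. Positivity of \<open>\<phi>\<close>
  on both sides along each basis vector keeps these bounds finite.\<close>

lemma log_concave_subgradient:
  fixes \<phi> :: "'a::real_vector \<Rightarrow> real" and b :: "nat \<Rightarrow> 'a"
  assumes lc: "log_concave \<phi>" and pos: "\<phi> 0 > 0"
    and dir: "\<And>i. i < m \<Longrightarrow> \<exists>\<delta>>0. \<phi> (\<delta> *\<^sub>R b i) > 0 \<and> \<phi> (- \<delta> *\<^sub>R b i) > 0"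
  shows "\<exists>v. \<forall>c. \<phi> (\<Sum>i<m. c i *\<^sub>R b i) \<le> \<phi> 0 * exp (\<Sum>i<m. c i * v i)"
  using dir
proof (induction m)
  case 0
  then show ?case by simp
next
  case (Suc m)
  then obtain v where v: "\<And>c. \<phi> (\<Sum>i<m. c i *\<^sub>R b i) \<le> \<phi> 0 * exp (\<Sum>i<m. c i * v i)"
    using less_SucI by metis
  obtain \<delta> where \<delta>: "\<delta> > 0" "\<phi> (\<delta> *\<^sub>R b m) > 0" "\<phi> (- \<delta> *\<^sub>R b m) > 0"
    using Suc.prems by blast
  let ?x = "\<lambda>c. \<Sum>i<m. c i *\<^sub>R b i" and ?l = "\<lambda>c. \<Sum>i<m. c i * v i"
  \<comment> \<open>Lower bounds for the new coefficient, one for each point of positive value on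
    the positive side; \<open>sep\<close> shows that every upper bound from the negative side
    dominates them all.\<close>
  define A where "A = {(ln (\<phi> (?x c + a *\<^sub>R b m)) - ln (\<phi> 0) - ?l c) / a | a c.
                          a > 0 \<and> \<phi> (?x c + a *\<^sub>R b m) > 0}"
  have sep: "u \<le> (ln (\<phi> 0) + ?l c' - ln (\<phi> (?x c' - \<beta> *\<^sub>R b m))) / \<beta>"
    if H: "u \<in> A" "\<beta> > 0" "\<phi> (?x c' - \<beta> *\<^sub>R b m) > 0" for u c' \<beta>
  proof -
    obtain a c where u: "u = (ln (\<phi> (?x c + a *\<^sub>R b m)) - ln (\<phi> 0) - ?l c) / a"
      and a: "a > 0" "\<phi> (?x c + a *\<^sub>R b m) > 0" using H(1) unfolding A_def by blast
    \<comment> \<open>These weights cancel the component along \<open>b m\<close>, so that the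
      convex combination falls into the span covered by the induction hypothesis.\<close>
    define t where "t = a / (a + \<beta>)"
    have t: "0 < t" "t < 1" "1 - t = \<beta> / (a + \<beta>)" using a H(2) by (auto simp: t_def field_simps)
    have "(1 - t) * a - t * \<beta> = 0" using a H(2) by (simp add: t(3)) (simp add: t_def)
    have "(1 - t) *\<^sub>R (?x c + a *\<^sub>R b m) + t *\<^sub>R (?x c' - \<beta> *\<^sub>R b m)
        = (1 - t) *\<^sub>R ?x c + t *\<^sub>R ?x c' + ((1 - t) * a - t * \<beta>) *\<^sub>R b m"
      by (simp add: algebra_simps)
    also have "\<dots> = ?x (\<lambda>i. (1 - t) * c i + t * c' i)"
      unfolding \<open>(1 - t) * a - t * \<beta> = 0\<close>
      by (simp add: scaleR_sum_right sum.distrib scaleR_left_distrib)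
    finally have z: "(1 - t) *\<^sub>R (?x c + a *\<^sub>R b m) + t *\<^sub>R (?x c' - \<beta> *\<^sub>R b m)
        = ?x (\<lambda>i. (1 - t) * c i + t * c' i)" .
    have "\<phi> (?x c + a *\<^sub>R b m) powr (1 - t) * \<phi> (?x c' - \<beta> *\<^sub>R b m) powr t
       \<le> \<phi> (?x (\<lambda>i. (1 - t) * c i + t * c' i))"
      using log_concaveD[OF lc t(1,2), of "?x c + a *\<^sub>R b m" "?x c' - \<beta> *\<^sub>R b m"] unfolding z .
    also have "\<dots> \<le> \<phi> 0 * exp (?l (\<lambda>i. (1 - t) * c i + t * c' i))" by (rule v)
    also have "?l (\<lambda>i. (1 - t) * c i + t * c' i) = (1 - t) * ?l c + t * ?l c'"
      by (simp add: sum_distrib_left sum.distrib algebra_simps sum_subtractf)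
    finally have "ln (\<phi> (?x c + a *\<^sub>R b m) powr (1 - t) * \<phi> (?x c' - \<beta> *\<^sub>R b m) powr t)
       \<le> ln (\<phi> 0 * exp ((1 - t) * ?l c + t * ?l c'))"
      using a H(3) pos by (subst ln_le_cancel_iff) auto
    then have "(1 - t) * ln (\<phi> (?x c + a *\<^sub>R b m)) + t * ln (\<phi> (?x c' - \<beta> *\<^sub>R b m))
       \<le> ln (\<phi> 0) + (1 - t) * ?l c + t * ?l c'"
      using a H(3) pos by (simp add: ln_mult ln_powr)
    then have "(1 - t) * (ln (\<phi> (?x c + a *\<^sub>R b m)) - ln (\<phi> 0) - ?l c)
       \<le> t * (ln (\<phi> 0) + ?l c' - ln (\<phi> (?x c' - \<beta> *\<^sub>R b m)))"
      by (simp add: algebra_simps)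
    then have "\<beta> * (ln (\<phi> (?x c + a *\<^sub>R b m)) - ln (\<phi> 0) - ?l c)
       \<le> a * (ln (\<phi> 0) + ?l c' - ln (\<phi> (?x c' - \<beta> *\<^sub>R b m)))"
      using a H(2) by (simp add: t(3) divide_right_mono_neg) (simp add: t_def divide_le_cancel)
    then show ?thesis unfolding u using a H(2) by (simp add: field_simps)
  qed
  \<comment> \<open>The point \<open>\<delta> *\<^sub>R b m\<close> provides one lower bound, and
    the opposite point bounds all of them from above.\<close>
  have "(ln (\<phi> (?x (\<lambda>_. 0) + \<delta> *\<^sub>R b m)) - ln (\<phi> 0) - ?l (\<lambda>_. 0)) / \<delta> \<in> A"
    using \<delta>(1,2) unfolding A_def by (intro CollectI exI[of _ \<delta>] exI[of _ "\<lambda>_. 0"] conjI refl) auto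
  then have ne: "A \<noteq> {}" by blast
  have bdd: "bdd_above A"
    using sep[of _ \<delta> "\<lambda>_. 0"] \<delta> by (auto intro!: bdd_aboveI)
  define \<tau> where "\<tau> = Sup A"
  have fin: "y \<le> \<phi> 0 * exp q" if "0 < y" "ln y \<le> ln (\<phi> 0) + q" for y q :: real
  proof -
    have "y = exp (ln y)" using that(1) by simp
    also have "\<dots> \<le> exp (ln (\<phi> 0) + q)" using that(2) by (simp only: exp_le_cancel_iff)
    finally show ?thesis using pos by (simp add: exp_add)
  qed
  have "\<phi> (\<Sum>i<Suc m. c i *\<^sub>R b i) \<le> \<phi> 0 * exp (\<Sum>i<Suc m. c i * (v(m := \<tau>)) i)" for c
  proof -
    have eq: "(\<Sum>i<Suc m. c i * (v(m := \<tau>)) i) = ?l c + c m * \<tau>" by simp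
    consider "\<phi> (?x c + c m *\<^sub>R b m) \<le> 0" | "c m = 0"
      | "c m > 0" "\<phi> (?x c + c m *\<^sub>R b m) > 0" | "c m < 0" "\<phi> (?x c + c m *\<^sub>R b m) > 0"
      by linarith
    then have "\<phi> (?x c + c m *\<^sub>R b m) \<le> \<phi> 0 * exp (?l c + c m * \<tau>)"
    proof cases
      case 1
      then show ?thesis using pos by (auto intro: order_trans)
    next
      case 2
      then show ?thesis using v by simp
    next
      case 3
      then have "(ln (\<phi> (?x c + c m *\<^sub>R b m)) - ln (\<phi> 0) - ?l c) / c m \<le> \<tau>"
        unfolding \<tau>_def by (intro cSup_upper bdd) (auto simp: A_def)
      then have "ln (\<phi> (?x c + c m *\<^sub>R b m)) \<le> ln (\<phi> 0) + (?l c + c m * \<tau>)"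
        using 3 by (simp add: field_simps)
      then show ?thesis by (rule fin[OF 3(2)])
    next
      case 4
      have "\<tau> \<le> (ln (\<phi> 0) + ?l c - ln (\<phi> (?x c - (- c m) *\<^sub>R b m))) / (- c m)"
        unfolding \<tau>_def by (intro cSup_least ne sep) (use 4 in auto)
      then have "ln (\<phi> (?x c + c m *\<^sub>R b m)) \<le> ln (\<phi> 0) + (?l c + c m * \<tau>)"
        using 4 by (simp add: field_simps)
      then show ?thesis by (rule fin[OF 4(2)])
    qed
    then show ?thesis unfolding eq by (simp only: sum.lessThan_Suc)
  qed
  then show ?case by blast
qed

section \<open>Second moments of log-concave functions on the line\<close>

lemma has_bochner_integral_power_exp:
  assumes "\<beta> > 0"
  shows "has_bochner_integral lborel (\<lambda>s::real. indicator {0..} s * (s ^ k * exp (- (\<beta> * s)))) (fact k / \<beta> ^ Suc k)"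
proof (rule has_bochner_integral_nn_integral)
  have "ennreal (fact k) = (\<integral>\<^sup>+x. ennreal (x^k * exp (-x)) * indicator {0 ..} x \<partial>lborel)"
    using nn_intergal_power_times_exp_Ici[of k] by simp
  also have "\<dots> = ennreal \<bar>\<beta>\<bar> * (\<integral>\<^sup>+x. ennreal ((0 + \<beta> * x)^k * exp (-(0 + \<beta> * x))) * indicator {0 ..} (0 + \<beta> * x) \<partial>lborel)"
    using assms by (intro nn_integral_real_affine) auto
  also have "(\<lambda>x. ennreal ((0 + \<beta> * x)^k * exp (-(0 + \<beta> * x))) * indicator {0 ..} (0 + \<beta> * x))
    = (\<lambda>x. ennreal (\<beta> ^ k) * ennreal (indicator {0..} x * (x ^ k * exp (- (\<beta> * x)))))"
    using assms by (auto simp: fun_eq_iff indicator_def ennreal_mult' power_mult_distrib zero_le_mult_iff mult.assoc)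
  also have "ennreal \<bar>\<beta>\<bar> * (\<integral>\<^sup>+x. ennreal (\<beta> ^ k) * ennreal (indicator {0..} x * (x ^ k * exp (- (\<beta> * x)))) \<partial>lborel)
     = ennreal (\<beta> ^ Suc k) * (\<integral>\<^sup>+x. ennreal (indicator {0..} x * (x ^ k * exp (- (\<beta> * x)))) \<partial>lborel)"
    using assms by (subst nn_integral_cmult) (auto simp: mult.assoc[symmetric] ennreal_mult')
  finally have *: "ennreal (\<beta> ^ Suc k) * (\<integral>\<^sup>+x. ennreal (indicator {0..} x * (x ^ k * exp (- (\<beta> * x)))) \<partial>lborel) = ennreal (fact k)"
    by simp
  have "ennreal (fact k / \<beta> ^ Suc k) = ennreal (1 / \<beta> ^ Suc k) * ennreal (fact k)"
    using assms by (subst ennreal_mult[symmetric]) auto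
  also have "\<dots> = (\<integral>\<^sup>+x. ennreal (indicator {0..} x * (x ^ k * exp (- (\<beta> * x)))) \<partial>lborel)"
    unfolding *[symmetric] using assms
    by (subst mult.assoc[symmetric]) (simp flip: ennreal_mult del: power_Suc)
  finally show "(\<integral>\<^sup>+x. ennreal (indicator {0..} x * (x ^ k * exp (- (\<beta> * x)))) \<partial>lborel) = ennreal (fact k / \<beta> ^ Suc k)" ..
qed (use assms in \<open>auto simp: indicator_def\<close>)

text \<open>Among log-concave functions on the half-line with given value at 0 and given integral, the
  exponential has the largest second moment, because the difference changes sign exactly once.\<close>
lemma log_concave_half_line_moment:
  fixes f :: "real \<Rightarrow> real"
  assumes f: "log_concave f" "f 0 > 0" "\<And>x. f x \<le> M" "\<And>x. f x \<noteq> 0 \<Longrightarrow> \<bar>x\<bar> \<le> R"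
  defines "m \<equiv> \<integral>s. indicator {0..} s * f s \<partial>lborel"
  shows "(\<integral>s. indicator {0..} s * (s\<^sup>2 * f s) \<partial>lborel) \<le> 2 * m ^ 3 / (f 0)\<^sup>2"
proof -
  have [measurable]: "f \<in> borel_measurable borel" using f log_concave_measurable by blast
  have f0: "0 \<le> f x" for x using log_concave_nonneg[OF f(1)] .
  have M: "0 < M" using f(2) f(3)[of 0] by linarith
  have R: "0 \<le> R" using f(4)[of 0] f(2) by simp
  have bd: "integrable lborel (\<lambda>s. M * R\<^sup>2 * indicator {-R..R} s)" "integrable lborel (\<lambda>s. M * indicator {-R..R} s)"
    by (simp_all add: emeasure_lborel_Icc_eq)
  have i2: "integrable lborel (\<lambda>s. indicator {0..} s * (s\<^sup>2 * f s))"
  proof (rule Bochner_Integration.integrable_bound[OF bd(1)])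
    have "norm (indicator {0..} s * (s\<^sup>2 * f s)) \<le> M * R\<^sup>2 * indicator {-R..R} s" for s
    proof (cases "f s = 0")
      case False
      then have s: "\<bar>s\<bar> \<le> R" using f(4) by blast
      then have "s\<^sup>2 \<le> R\<^sup>2" using abs_le_square_iff[of s R] by simp
      then have "s\<^sup>2 * f s \<le> R\<^sup>2 * M" using f(3)[of s] f0[of s] by (intro mult_mono) auto
      then show ?thesis using s f0[of s] M by (auto simp: indicator_def abs_le_iff mult.commute)
    qed (use M in \<open>simp add: indicator_def\<close>)
    then show "AE s in lborel. norm (indicator {0..} s * (s\<^sup>2 * f s)) \<le> norm (M * R\<^sup>2 * indicator {-R..R} s)"
      by (intro AE_I2) (metis abs_ge_self order_trans real_norm_def)
  qed simp
  have i1: "integrable lborel (\<lambda>s. indicator {0..} s * f s)"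
  proof (rule Bochner_Integration.integrable_bound[OF bd(2)])
    have "norm (indicator {0..} s * f s) \<le> M * indicator {-R..R} s" for s
      using f(4)[of s] f(3)[of s] f0[of s] M by (cases "f s = 0") (auto simp: indicator_def abs_le_iff)
    then show "AE s in lborel. norm (indicator {0..} s * f s) \<le> norm (M * indicator {-R..R} s)"
      by (intro AE_I2) (metis abs_ge_self order_trans real_norm_def)
  qed simp
  have m0: "0 \<le> m" unfolding m_def using f0 by (intro Bochner_Integration.integral_nonneg) auto
  show ?thesis
  proof (cases "m = 0")
    \<comment> \<open>The mass on the half-line can vanish in spite of \<open>f 0 > 0\<close>,
      namely when 0 is the right end of the support.\<close>
    case True
    then have "AE s in lborel. indicator {0..} s * f s = 0"
      using i1 f0 unfolding m_def by (subst (asm) integral_nonneg_eq_0_iff_AE) auto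
    then have "AE s in lborel. indicator {0..} s * (s\<^sup>2 * f s) = 0" by eventually_elim auto
    then have "(\<integral>s. indicator {0..} s * (s\<^sup>2 * f s) \<partial>lborel) = 0" by (rule integral_eq_zero_AE)
    then show ?thesis using m0 by simp
  next
    case False
    \<comment> \<open>The rate for which the exponential with value \<open>f 0\<close> at 0 has the
      same mass \<open>m\<close> on the half-line as \<open>f\<close>.\<close>
    define \<beta> where "\<beta> = f 0 / m"
    have \<beta>: "\<beta> > 0" using f(2) m0 False by (simp add: \<beta>_def)
    define P where "P = {s. 0 \<le> s \<and> f 0 * exp (- (\<beta> * s)) \<le> f s}"
    have "0 \<in> P" by (simp add: P_def)
    have PR: "s \<le> R" if "s \<in> P" for s
    proof -
      have "0 < f 0 * exp (- (\<beta> * s))" using f(2) by simp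
      then have "f s \<noteq> 0" using that by (auto simp: P_def)
      then show ?thesis using f(4)[of s] by simp
    qed
    then have bddP: "bdd_above P" unfolding bdd_above_def by blast
    define s0 where "s0 = Sup P"
    have s00: "0 \<le> s0" unfolding s0_def using \<open>0 \<in> P\<close> bddP by (rule cSup_upper)
    \<comment> \<open>The quotient of \<open>f\<close> by the exponential is log-concave with value
      1 at 0, so \<open>P\<close> is an interval starting at 0, and the difference changes sign at
      its right end \<open>s0\<close>.\<close>
    have down: "s' \<in> P" if "s \<in> P" "0 < s'" "s' < s" for s s'
    proof -
      define t where "t = s' / s"
      have t: "0 < t" "t < 1" "t * s = s'" using that by (auto simp: t_def)
      have "f 0 * exp (- (\<beta> * s')) = f 0 powr (1 - t) * (f 0 * exp (- (\<beta> * s))) powr t"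
        using f(2) t(3) by (simp add: powr_mult exp_powr_real algebra_simps flip: powr_add)
      also have "\<dots> \<le> f 0 powr (1 - t) * f s powr t"
        using that(1) t f(2) by (intro mult_left_mono powr_mono2) (auto simp: P_def)
      also have "\<dots> \<le> f s'" using log_concaveD[OF f(1) t(1,2), of 0 s] t(3) by simp
      finally show ?thesis using that by (simp add: P_def)
    qed
    have lt: "s \<in> P" if H: "0 \<le> s" "s < s0" for s
    proof (cases "s = 0")
      case False
      obtain r where "r \<in> P" "s < r"
        using H(2) less_cSup_iff[OF _ bddP] \<open>0 \<in> P\<close> unfolding s0_def by auto
      then show ?thesis using down[of r s] False H by auto
    qed (use \<open>0 \<in> P\<close> in simp)
    have gt: "s \<notin> P" if "s > s0" for s
      using that bddP cSup_upper unfolding s0_def by (meson not_le)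
    let ?e = "\<lambda>k s. indicator {0..} s * (s ^ k * exp (- (\<beta> * s)))"
    note E0 = has_bochner_integral_power_exp[OF \<beta>, of 0] and E2 = has_bochner_integral_power_exp[OF \<beta>, of 2]
    have iE: "integrable lborel (?e 0)" "integrable lborel (?e 2)" and
      vE: "integral\<^sup>L lborel (?e 0) = 1 / \<beta>" "integral\<^sup>L lborel (?e 2) = 2 / \<beta> ^ 3"
      using E0 E2 unfolding has_bochner_integral_iff
      by (simp_all add: eval_nat_numeral fact_numeral mult.assoc)
    \<comment> \<open>On the half-line this is \<open>s\<^sup>2 - s0\<^sup>2\<close> times the
      difference of \<open>f\<close> and the exponential. It is nowhere positive, and since both
      functions have the same mass, the terms with \<open>s0\<^sup>2\<close> cancel in its integral
      and the comparison of second moments remains.\<close>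
    let ?D = "\<lambda>s. indicator {0..} s * (s\<^sup>2 * f s) - s0\<^sup>2 * (indicator {0..} s * f s)
        - f 0 * ?e 2 s + s0\<^sup>2 * f 0 * ?e 0 s"
    have "integral\<^sup>L lborel ?D \<le> integral\<^sup>L lborel (\<lambda>_::real. 0)"
    proof (rule integral_mono)
      show "integrable lborel ?D"
        by (intro Bochner_Integration.integrable_add Bochner_Integration.integrable_diff
          integrable_mult_right i1 i2 iE)
      fix s :: real
      have "(s\<^sup>2 - s0\<^sup>2) * (f s - f 0 * exp (- (\<beta> * s))) \<le> 0" if "0 \<le> s"
      proof (cases s s0 rule: linorder_cases)
        case less
        then have "s\<^sup>2 \<le> s0\<^sup>2" using that by (intro power_mono) auto
        then show ?thesis using lt[OF that less] by (auto simp: P_def mult_le_0_iff)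
      next
        case greater
        then have "s0\<^sup>2 \<le> s\<^sup>2" using s00 by (intro power_mono) auto
        then show ?thesis using gt[OF greater] that by (auto simp: P_def mult_le_0_iff)
      qed simp
      then show "?D s \<le> 0" by (auto simp: indicator_def algebra_simps)
    qed simp
    also have "integral\<^sup>L lborel ?D = (\<integral>s. indicator {0..} s * (s\<^sup>2 * f s) \<partial>lborel) - s0\<^sup>2 * m
        - f 0 * (2 / \<beta> ^ 3) + s0\<^sup>2 * f 0 * (1 / \<beta>)"
      unfolding m_def vE[symmetric]
      by (intro has_bochner_integral_integral_eq has_bochner_integral_add has_bochner_integral_diff
          has_bochner_integral_mult_right has_bochner_integral_integrable i1 i2 iE)
    also have "s0\<^sup>2 * f 0 * (1 / \<beta>) = s0\<^sup>2 * m" using f(2) False by (simp add: \<beta>_def)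
    finally have "(\<integral>s. indicator {0..} s * (s\<^sup>2 * f s) \<partial>lborel) \<le> f 0 * (2 / \<beta> ^ 3)" by simp
    also have "\<dots> = 2 * m ^ 3 / (f 0)\<^sup>2" using f(2) False
      by (simp add: \<beta>_def field_simps eval_nat_numeral)
    finally show ?thesis .
  qed
qed

lemma log_concave_reflect: "log_concave f \<Longrightarrow> log_concave (\<lambda>x. f (- x :: real))"
  using log_concave_line[of f 0 "-1"] by simp

text \<open>The half-line bound is applied to \<open>f\<close> and to its reflection. The masses of
  the two halves enter as cubes, and a sum of cubes of nonnegative numbers is at most the cube of
  the sum, so the position of 0 in the support does not matter.\<close>

lemma log_concave_second_moment:
  fixes f :: "real \<Rightarrow> real"
  assumes f: "log_concave f" "f 0 > 0" "\<And>x. f x \<le> M" "\<And>x. f x \<noteq> 0 \<Longrightarrow> \<bar>x\<bar> \<le> R"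
  shows "(\<integral>s. s\<^sup>2 * f s \<partial>lborel) \<le> 2 * (integral\<^sup>L lborel f) ^ 3 / (f 0)\<^sup>2"
proof -
  let ?g = "\<lambda>x. f (- x)"
  have [measurable]: "f \<in> borel_measurable borel" using f log_concave_measurable by blast
  have f0: "0 \<le> f x" for x using log_concave_nonneg[OF f(1)] .
  have M: "0 < M" using f(2) f(3)[of 0] by linarith
  have bd: "integrable lborel (\<lambda>s. M * R\<^sup>2 * indicator {-R..R} s)" "integrable lborel (\<lambda>s. M * indicator {-R..R} s)"
    by (simp_all add: emeasure_lborel_Icc_eq)
  have R: "0 \<le> R" using f(4)[of 0] f(2) by simp
  have b2: "s\<^sup>2 * f s \<le> M * R\<^sup>2 * indicator {-R..R} s" for s
  proof (cases "f s = 0")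
    case False
    then have s: "\<bar>s\<bar> \<le> R" using f(4) by blast
    then have "s\<^sup>2 \<le> R\<^sup>2" using abs_le_square_iff[of s R] by simp
    then have "s\<^sup>2 * f s \<le> R\<^sup>2 * M" using f(3)[of s] f0[of s] by (intro mult_mono) auto
    then show ?thesis using s by (auto simp: indicator_def abs_le_iff mult.commute)
  qed (use M in \<open>simp add: indicator_def\<close>)
  have b1: "f s \<le> M * indicator {-R..R} s" for s
    using f(4)[of s] f(3)[of s] M by (cases "f s = 0") (auto simp: indicator_def abs_le_iff)
  have i2: "integrable lborel (\<lambda>s. s\<^sup>2 * f s)"
    by (rule Bochner_Integration.integrable_bound[OF bd(1)])
      (use b2 f0 M in \<open>auto intro!: AE_I2 simp: abs_mult\<close>)
  have i1: "integrable lborel f"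
    by (rule Bochner_Integration.integrable_bound[OF bd(2)])
      (use b1 f0 M in \<open>auto intro!: AE_I2 simp: abs_mult\<close>)
  have split: "integral\<^sup>L lborel q = (\<integral>s. indicator {0..} s * q s \<partial>lborel) + (\<integral>s. indicator {0..} s * q (-s) \<partial>lborel)"
    if q: "integrable lborel q" for q :: "real \<Rightarrow> real"
  proof -
    have "integral\<^sup>L lborel q = (\<integral>s. indicator {0..} s * q s + indicator {..<0} s * q s \<partial>lborel)"
      by (intro Bochner_Integration.integral_cong) (auto simp: indicator_def)
    also have "\<dots> = (\<integral>s. indicator {0..} s * q s \<partial>lborel) + (\<integral>s. indicator {..<0} s * q s \<partial>lborel)"
      using integrable_real_mult_indicator[OF _ q]
      by (intro Bochner_Integration.integral_add) (auto simp: mult.commute)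
    also have "(\<integral>s. indicator {..<0} s * q s \<partial>lborel) = (\<integral>s. indicator {..<0} (0 + (-1) * s) * q (0 + (-1) * s) \<partial>lborel)"
      using lborel_integral_real_affine[of "-1" "\<lambda>s. indicator {..<0} s * q s" 0] by simp
    \<comment> \<open>Reflection produces the open half-line; the added point 0 is a null
      set.\<close>
    also have "\<dots> = (\<integral>s. indicator {0..} s * q (-s) \<partial>lborel)"
      using AE_lborel_singleton[of "0::real"] q
      by (intro integral_cong_AE) (auto simp: indicator_def elim!: eventually_mono)
    finally show ?thesis .
  qed
  have h1: "(\<integral>s. indicator {0..} s * (s\<^sup>2 * f s) \<partial>lborel) \<le> 2 * (\<integral>s. indicator {0..} s * f s \<partial>lborel) ^ 3 / (f 0)\<^sup>2"
    using log_concave_half_line_moment[OF f] .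
  have h2: "(\<integral>s. indicator {0..} s * (s\<^sup>2 * f (-s)) \<partial>lborel) \<le> 2 * (\<integral>s. indicator {0..} s * f (-s) \<partial>lborel) ^ 3 / (f 0)\<^sup>2"
    using log_concave_half_line_moment[OF log_concave_reflect[OF f(1)], of M R] f(2,3) f(4)[of "- _"] by force
  let ?m1 = "\<integral>s. indicator {0..} s * f s \<partial>lborel" and ?m2 = "\<integral>s. indicator {0..} s * f (-s) \<partial>lborel"
  have m: "0 \<le> ?m1" "0 \<le> ?m2" using f0 by (auto intro!: Bochner_Integration.integral_nonneg)
  have "(\<integral>s. s\<^sup>2 * f s \<partial>lborel) \<le> 2 * ?m1 ^ 3 / (f 0)\<^sup>2 + 2 * ?m2 ^ 3 / (f 0)\<^sup>2"
    using split[OF i2] h1 h2 by simp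
  also have "\<dots> = 2 * (?m1 ^ 3 + ?m2 ^ 3) / (f 0)\<^sup>2" by (simp add: add_divide_distrib algebra_simps)
  also have "\<dots> \<le> 2 * (?m1 + ?m2) ^ 3 / (f 0)\<^sup>2"
  proof -
    have "(?m1 + ?m2) ^ 3 = ?m1 ^ 3 + ?m2 ^ 3 + 3 * ?m1 * ?m2 * (?m1 + ?m2)"
      by (simp add: eval_nat_numeral algebra_simps)
    moreover have "0 \<le> 3 * ?m1 * ?m2 * (?m1 + ?m2)" using m by simp
    ultimately show ?thesis by (intro divide_right_mono) auto
  qed
  also have "?m1 + ?m2 = integral\<^sup>L lborel f" using split[OF i1] by simp
  finally show ?thesis .
qed

section \<open>Continuity, and values as limits of averages\<close>

lemma log_concave_continuous_on:
  fixes f :: "real \<Rightarrow> real"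
  assumes f: "log_concave f" and pos: "\<And>x. \<bar>x\<bar> < \<rho> \<Longrightarrow> f x > 0"
  shows "continuous_on {-\<rho><..<\<rho>} f"
proof -
  have "convex_on {-\<rho><..<\<rho>} (\<lambda>x. - ln (f x))"
  proof (rule convex_onI)
    fix t x y :: real assume t: "0 < t" "t < 1" and xy: "x \<in> {-\<rho><..<\<rho>}" "y \<in> {-\<rho><..<\<rho>}"
    have p: "f x > 0" "f y > 0" using pos xy by (auto simp: abs_less_iff)
    have le: "f x powr (1 - t) * f y powr t \<le> f ((1 - t) *\<^sub>R x + t *\<^sub>R y)"
      by (rule log_concaveD[OF f t])
    have p2: "0 < f x powr (1 - t) * f y powr t" using p by simp
    have "ln (f x powr (1 - t) * f y powr t) \<le> ln (f ((1 - t) *\<^sub>R x + t *\<^sub>R y))"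
      using le p2 by (subst ln_le_cancel_iff) linarith+
    then show "- ln (f ((1 - t) *\<^sub>R x + t *\<^sub>R y)) \<le> (1 - t) * - ln (f x) + t * - ln (f y)"
      using p by (simp add: ln_mult ln_powr)
  qed simp
  then have "continuous_on {-\<rho><..<\<rho>} (\<lambda>x. - ln (f x))" by (rule convex_on_continuous[rotated]) simp
  then have "continuous_on {-\<rho><..<\<rho>} (\<lambda>x. exp (- (- ln (f x))))"
    by (rule continuous_on_exp[OF continuous_on_minus])
  moreover have "exp (- (- ln (f x))) = f x" if "x \<in> {-\<rho><..<\<rho>}" for x
    using pos[of x] that by (simp add: abs_less_iff)
  ultimately show ?thesis by (rule continuous_on_eq)
qed

text \<open>This recovers the volume of a central section, which is a null set of the full space,
  from the volumes of thin slabs.\<close>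

lemma slab_average_tendsto:
  fixes f :: "real \<Rightarrow> real"
  assumes f: "integrable lborel f" "isCont f 0" and \<epsilon>: "\<And>j. \<epsilon> j > 0" "\<epsilon> \<longlonglongrightarrow> 0"
  shows "(\<lambda>j. (\<integral>s. indicator {-\<epsilon> j..\<epsilon> j} s * f s \<partial>lborel) / (2 * \<epsilon> j)) \<longlonglongrightarrow> f 0"
proof (rule LIMSEQ_I)
  fix r :: real assume r: "r > 0"
  then obtain \<delta> where \<delta>: "\<delta> > 0" "\<And>x. \<bar>x\<bar> < \<delta> \<Longrightarrow> \<bar>f x - f 0\<bar> < r / 2"
    using f(2) unfolding continuous_at_eps_delta dist_real_def by (metis diff_zero half_gt_zero)
  obtain N where N: "\<And>j. j \<ge> N \<Longrightarrow> \<epsilon> j < \<delta>"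
    using \<epsilon> \<delta>(1) by (metis LIMSEQ_D diff_zero real_norm_def abs_less_iff)
  have "\<bar>(\<integral>s. indicator {-\<epsilon> j..\<epsilon> j} s * f s \<partial>lborel) / (2 * \<epsilon> j) - f 0\<bar> < r" if "j \<ge> N" for j
  proof -
    have e: "0 < \<epsilon> j" "\<epsilon> j < \<delta>" using \<epsilon> N that by auto
    have if1: "integrable lborel (\<lambda>s. indicator {-\<epsilon> j..\<epsilon> j} s * f s)"
      using integrable_real_mult_indicator[OF _ f(1), of "{-\<epsilon> j..\<epsilon> j}"] by (simp add: mult.commute)
    have if2: "integrable lborel (\<lambda>s. indicator {-\<epsilon> j..\<epsilon> j} s * a)" for a :: real
      using e by (simp add: emeasure_lborel_Icc_eq)
    have I: "(\<integral>s. indicator {-\<epsilon> j..\<epsilon> j} s * a \<partial>lborel) = 2 * \<epsilon> j * a" for a :: real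
      using e by simp
    have "(\<integral>s. indicator {-\<epsilon> j..\<epsilon> j} s * f s \<partial>lborel) \<le> (\<integral>s. indicator {-\<epsilon> j..\<epsilon> j} s * (f 0 + r / 2) \<partial>lborel)"
    proof (intro integral_mono if1 if2)
      show "indicator {-\<epsilon> j..\<epsilon> j} s * f s \<le> indicator {-\<epsilon> j..\<epsilon> j} s * (f 0 + r / 2)" for s
      proof (cases "s \<in> {-\<epsilon> j..\<epsilon> j}")
        case True
        then have "\<bar>f s - f 0\<bar> < r / 2" using \<delta>(2)[of s] e by (auto simp: abs_less_iff)
        then show ?thesis using True unfolding abs_less_iff by simp
      qed simp
    qed
    moreover have "(\<integral>s. indicator {-\<epsilon> j..\<epsilon> j} s * (f 0 - r / 2) \<partial>lborel) \<le> (\<integral>s. indicator {-\<epsilon> j..\<epsilon> j} s * f s \<partial>lborel)"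
    proof (intro integral_mono if1 if2)
      show "indicator {-\<epsilon> j..\<epsilon> j} s * (f 0 - r / 2) \<le> indicator {-\<epsilon> j..\<epsilon> j} s * f s" for s
      proof (cases "s \<in> {-\<epsilon> j..\<epsilon> j}")
        case True
        then have "\<bar>f s - f 0\<bar> < r / 2" using \<delta>(2)[of s] e by (auto simp: abs_less_iff)
        then show ?thesis using True unfolding abs_less_iff by simp
      qed simp
    qed
    ultimately have "\<bar>(\<integral>s. indicator {-\<epsilon> j..\<epsilon> j} s * f s \<partial>lborel) / (2 * \<epsilon> j) - f 0\<bar> \<le> r / 2"
      unfolding I using e by (simp add: abs_le_iff field_simps)
    then show ?thesis using r by linarith
  qed
  then show "\<exists>no. \<forall>n\<ge>no. norm ((\<integral>s. indicator {-\<epsilon> n..\<epsilon> n} s * f s \<partial>lborel) / (2 * \<epsilon> n) - f 0) < r"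
    by auto
qed

section \<open>Orthonormal bases of subspaces\<close>

lemma coord_unit_fseq [simp]: "coord (unit_fseq j) i = (if i = j then 1 else 0)"
  by transfer simp

lemma coord_sum [simp]: "coord (\<Sum>i\<in>I. f i) j = (\<Sum>i\<in>I. coord (f i) j)"
  by (induction I rule: infinite_finite_induct) simp_all

lemma inner_unit_fseq [simp]: "unit_fseq i \<bullet> x = coord x i"
  by (subst inner_fseq_superset[of "{i}"]) auto

lemma inner_unit_fseq' [simp]: "x \<bullet> unit_fseq i = coord x i"
  by (subst inner_commute) simp

lemma norm_unit_fseq [simp]: "norm (unit_fseq i) = 1"
  by (simp add: norm_eq_sqrt_inner)

lemma Rn_expand: "x \<in> Rn n \<Longrightarrow> x = (\<Sum>i<n. coord x i *\<^sub>R unit_fseq i)"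
  by (rule fseq_eqI) (auto simp: Rn_def if_distrib[of "(*) _"] sum.delta' cong: if_cong)

lemma unit_fseq_in_Rn: "i < n \<Longrightarrow> unit_fseq i \<in> Rn n"
  by (auto simp: Rn_def)

lemma subspace_Rn: "subspace (Rn n)"
  by (auto simp: subspace_def Rn_def)

lemma ex_Rn: "\<exists>n. x \<in> Rn n"
proof -
  have "\<forall>i. i \<in> {i. coord x i \<noteq> 0} \<longrightarrow> i \<le> Max (insert 0 {i. coord x i \<noteq> 0})"
    by (intro allI impI Max_ge) auto
  then have "x \<in> Rn (Suc (Max (insert 0 {i. coord x i \<noteq> 0})))"
    unfolding Rn_def by (auto simp: Suc_le_eq)
  then show ?thesis ..
qed

lemma fseq_countable_dense:
  "\<exists>D::fseq set. countable D \<and> (\<forall>x. \<forall>e>0. \<exists>d\<in>D. dist x d < e)"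
proof -
  define g :: "rat list \<Rightarrow> fseq" where "g l = (\<Sum>i<length l. of_rat (l ! i) *\<^sub>R unit_fseq i)" for l
  have "\<exists>d\<in>range g. dist x d < e" if "e > 0" for x e
  proof -
    obtain n where x: "x \<in> Rn n" using ex_Rn by blast
    have "\<exists>q::rat. \<bar>coord x i - of_rat q\<bar> < e / (n + 1)" for i
    proof -
      have "coord x i - e / (n + 1) < coord x i + e / (n + 1)" using that by simp
      from of_rat_dense[OF this] obtain q where
        "coord x i - e / (n + 1) < of_rat q" "of_rat q < coord x i + e / (n + 1)" by blast
      then show ?thesis by (intro exI[of _ q]) (simp only: abs_less_iff, linarith)
    qed
    then obtain q :: "nat \<Rightarrow> rat" where q: "\<And>i. \<bar>coord x i - of_rat (q i)\<bar> < e / (n + 1)" by metis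
    have "g (map q [0..<n]) = (\<Sum>i<n. of_rat (q i) *\<^sub>R unit_fseq i)" by (simp add: g_def)
    then have "x - g (map q [0..<n]) = (\<Sum>i<n. (coord x i - of_rat (q i)) *\<^sub>R unit_fseq i)"
      by (subst Rn_expand[OF x]) (simp add: sum_subtractf scaleR_diff_left)
    then have "dist x (g (map q [0..<n])) \<le> (\<Sum>i<n. \<bar>coord x i - of_rat (q i)\<bar>)"
      unfolding dist_norm by (simp add: order_trans[OF norm_sum])
    also have "\<dots> \<le> (\<Sum>i<n. e / (n + 1))" using q by (intro sum_mono less_imp_le)
    also have "\<dots> < e" using that by (simp add: field_simps)
    finally show ?thesis by blast
  qed
  then show ?thesis by (intro exI[of _ "range g"]) auto
qed

text \<open>Second countability makes the Borel sets of a product space the product of the Borel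
  sets. The measurability of sums and inner products of measurable maps, and all uses of Tonelli's
  theorem, rest on it.\<close>

instance fseq :: second_countable_topology
proof
  obtain D :: "fseq set" where D: "countable D" "\<And>x e. e > 0 \<Longrightarrow> \<exists>d\<in>D. dist x d < e"
    using fseq_countable_dense by blast
  define B where "B = (\<lambda>(d, m). ball d (1 / real (Suc m))) ` (D \<times> UNIV)"
  have "topological_basis B"
  proof (rule topological_basisI)
    fix U :: "fseq set" and x assume "open U" "x \<in> U"
    then obtain e where e: "e > 0" "ball x e \<subseteq> U" by (auto simp: open_contains_ball)
    obtain m where m: "1 / real (Suc m) < e / 2" using nat_approx_posE[of "e / 2"] e by auto
    obtain d where d: "d \<in> D" "dist x d < 1 / real (Suc m)" using D(2)[of "1 / real (Suc m)" x] by auto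
    have "ball d (1 / real (Suc m)) \<subseteq> ball x e"
    proof
      fix y assume "y \<in> ball d (1 / real (Suc m))"
      then have "dist d y < 1 / real (Suc m)" by simp
      then show "y \<in> ball x e" using dist_triangle[of x y d] d(2) m by (simp del: of_nat_Suc)
    qed
    then show "\<exists>B'\<in>B. x \<in> B' \<and> B' \<subseteq> U" using d e
      by (intro bexI[of _ "ball d (1 / real (Suc m))"]) (auto simp: B_def dist_commute)
  qed (auto simp: B_def)
  then have "countable B \<and> open = generate_topology B"
    using D(1) topological_basis_imp_subbasis by (auto simp: B_def)
  then show "\<exists>B::fseq set set. countable B \<and> open = generate_topology B" by blast
qed

text \<open>The length \<open>m\<close> is a parameter, whereas \<open>orthonormal_basis\<close>
  takes it to be \<open>dim E\<close>; inductions on the length and prefixes of a basis can then be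
  handled without computing dimensions.\<close>

definition onb :: "fseq set \<Rightarrow> nat \<Rightarrow> (nat \<Rightarrow> fseq) \<Rightarrow> bool" where
  "onb E m b \<longleftrightarrow> (\<forall>i<m. \<forall>j<m. b i \<bullet> b j = (if i = j then 1 else 0)) \<and> span (b ` {..<m}) = E"

definition comb :: "nat \<Rightarrow> (nat \<Rightarrow> fseq) \<Rightarrow> (nat \<Rightarrow> real) \<Rightarrow> fseq" where
  "comb m b c = (\<Sum>i<m. c i *\<^sub>R b i)"

lemma comb_cong: "(\<And>i. i < m \<Longrightarrow> c i = c' i) \<Longrightarrow> comb m b c = comb m b c'"
  by (auto simp: comb_def intro!: sum.cong)

lemma onb_inner: "onb E m b \<Longrightarrow> i < m \<Longrightarrow> j < m \<Longrightarrow> b i \<bullet> b j = (if i = j then 1 else 0)"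
  by (simp add: onb_def)

lemma onb_subspace: "onb E m b \<Longrightarrow> subspace E"
  by (auto simp: onb_def)

lemma onb_in: "onb E m b \<Longrightarrow> i < m \<Longrightarrow> b i \<in> E"
  by (auto simp: onb_def intro: span_base)

lemma onb_norm: "onb E m b \<Longrightarrow> i < m \<Longrightarrow> norm (b i) = 1"
  by (simp add: norm_eq_sqrt_inner onb_inner)

lemma comb_in: "onb E m b \<Longrightarrow> comb m b c \<in> E"
  unfolding comb_def using onb_in onb_subspace by (intro subspace_sum subspace_scale) auto

lemma comb_inner:
  assumes "onb E m b" "i < m"
  shows "comb m b c \<bullet> b i = c i"
proof -
  have "comb m b c \<bullet> b i = (\<Sum>j<m. c j * (if j = i then 1 else 0))"
    unfolding comb_def inner_sum_left using assms by (intro sum.cong) (auto simp: onb_inner)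
  also have "\<dots> = c i" using assms(2) by (simp add: if_distrib[of "(*) _"] sum.delta' cong: if_cong)
  finally show ?thesis .
qed

lemma comb_inner_comb:
  assumes "onb E m b"
  shows "comb m b c \<bullet> comb m b c' = (\<Sum>i<m. c i * c' i)"
  by (subst (2) comb_def) (simp add: inner_sum_right comb_inner[OF assms] mult.commute)

lemma norm_comb:
  assumes "onb E m b"
  shows "(norm (comb m b c))\<^sup>2 = (\<Sum>i<m. (c i)\<^sup>2)"
  unfolding power2_norm_eq_inner comb_inner_comb[OF assms] by (simp add: power2_eq_square)

lemma onb_expand:
  assumes b: "onb E m b" and x: "x \<in> E"
  shows "comb m b (\<lambda>i. x \<bullet> b i) = x"
proof -
  have "x \<in> span (b ` {..<m})" using assms by (simp add: onb_def)
  then obtain u where "x = (\<Sum>v\<in>b ` {..<m}. u v *\<^sub>R v)"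
    by (subst (asm) span_finite) auto
  moreover have inj: "inj_on b {..<m}"
    using onb_inner[OF b] by (intro inj_onI) (metis lessThan_iff zero_neq_one)
  ultimately have e: "x = comb m b (\<lambda>i. u (b i))"
    by (simp add: comb_def sum.reindex)
  show ?thesis by (subst (2) e, rule comb_cong) (simp add: e comb_inner[OF b])
qed

lemma onb_dim:
  assumes "onb E m b"
  shows "dim E = m"
proof -
  have inj: "inj_on b {..<m}"
    using onb_inner[OF assms] by (intro inj_onI) (metis lessThan_iff zero_neq_one)
  have "independent (b ` {..<m})"
  proof (rule pairwise_orthogonal_independent)
    show "pairwise orthogonal (b ` {..<m})"
      using onb_inner[OF assms] by (auto simp: pairwise_def orthogonal_def)
    show "0 \<notin> b ` {..<m}" using onb_norm[OF assms] by (auto; metis norm_zero zero_neq_one)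
  qed
  then have "dim E = card (b ` {..<m})"
    using assms unfolding onb_def by (intro dim_eq_card) (metis span_span)
  then show ?thesis using inj by (simp add: card_image)
qed

lemma onb_iff: "orthonormal_basis E b \<longleftrightarrow> onb E (dim E) b"
  by (simp add: orthonormal_basis_def onb_def)

lemma onb_Rn: "onb (Rn n) n unit_fseq"
proof -
  have "span (unit_fseq ` {..<n}) = Rn n"
  proof
    show "span (unit_fseq ` {..<n}) \<subseteq> Rn n"
      using unit_fseq_in_Rn by (intro span_minimal subspace_Rn) auto
    show "Rn n \<subseteq> span (unit_fseq ` {..<n})"
    proof
      fix x assume "x \<in> Rn n"
      then have "x = (\<Sum>i<n. coord x i *\<^sub>R unit_fseq i)" by (rule Rn_expand)
      also have "\<dots> \<in> span (unit_fseq ` {..<n})" by (intro span_sum span_scale span_base) auto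
      finally show "x \<in> span (unit_fseq ` {..<n})" .
    qed
  qed
  then show ?thesis by (auto simp: onb_def)
qed

lemma dim_Rn: "dim (Rn n) = n"
  by (rule onb_dim[OF onb_Rn])

text \<open>Gram-Schmidt. The induction ends because an orthonormal family in \<open>Rn n\<close>
  has at most \<open>n\<close> members, which makes \<open>n - m\<close> decrease.\<close>

lemma ex_onb_extend:
  assumes E: "subspace E" "E \<subseteq> Rn n"
    and b: "onb W m b" "W \<subseteq> E"
  shows "\<exists>b'. onb E (dim E) b' \<and> (\<forall>i<m. b' i = b i) \<and> m \<le> dim E"
  using b
proof (induction "n - m" arbitrary: m b W rule: less_induct)
  case less
  show ?case
  proof (cases "W = E")
    case True
    then show ?thesis using less.prems onb_dim by blast
  next
    case False
    then obtain x where x: "x \<in> E" "x \<notin> W" using less.prems by blast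
    define y where "y = x - comb m b (\<lambda>i. x \<bullet> b i)"
    have cW: "comb m b (\<lambda>i. x \<bullet> b i) \<in> W" by (rule comb_in[OF less.prems(1)])
    have "y \<noteq> 0" using x cW by (auto simp: y_def)
    have yE: "y \<in> E" unfolding y_def using x cW less.prems E by (auto intro: subspace_diff)
    have orth: "y \<bullet> b i = 0" if "i < m" for i
      using that by (simp add: y_def inner_diff_left comb_inner[OF less.prems(1)])
    define b' where "b' = b(m := y /\<^sub>R norm y)"
    have yy: "b' m \<bullet> b' m = 1"
      using \<open>y \<noteq> 0\<close> by (simp add: b'_def dot_square_norm power2_eq_square)
    define W' where "W' = span (b' ` {..<Suc m})"
    have on: "onb W' (Suc m) b'"
      unfolding onb_def
    proof (intro conjI allI impI)
      fix i j assume "i < Suc m" "j < Suc m"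
      moreover have "b' l = b l" "b' m \<bullet> b l = 0" "b l \<bullet> b' m = 0" if "l < m" for l
        using that orth[OF that] by (simp_all add: b'_def inner_commute)
      ultimately show "b' i \<bullet> b' j = (if i = j then 1 else 0)"
        using onb_inner[OF less.prems(1)] yy by (auto simp: less_Suc_eq)
    qed (simp add: W'_def)
    have W'E: "W' \<subseteq> E"
      unfolding W'_def using onb_in[OF less.prems(1)] less.prems(2) yE E(1)
      by (intro span_minimal) (auto simp: b'_def less_Suc_eq subspace_scale)
    have "Suc m \<le> n"
    proof -
      have "dim W' \<le> card (unit_fseq ` {..<n})"
        using W'E E(2) onb_Rn[of n] by (intro dim_le_card) (auto simp: onb_def)
      also have "\<dots> \<le> n" by (rule order_trans[OF card_image_le]) auto
      finally show ?thesis using onb_dim[OF on] by simp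
    qed
    then obtain b'' where "onb E (dim E) b''" "\<forall>i<Suc m. b'' i = b' i" "Suc m \<le> dim E"
      using less.hyps[OF _ on W'E] by (metis Suc_le_lessD diff_less_mono2 lessI)
    then show ?thesis by (intro exI[of _ b'']) (auto simp: b'_def)
  qed
qed

lemma onb_empty: "onb {0} 0 b"
  by (simp add: onb_def)

lemma ex_onb:
  assumes "subspace E" "E \<subseteq> Rn n"
  shows "\<exists>b. onb E (dim E) b"
  using ex_onb_extend[OF assms onb_empty] subspace_0[OF assms(1)] by blast

lemma subspace_hyperplane_Int: "subspace E \<Longrightarrow> subspace (E \<inter> {x. x \<bullet> \<eta> = 0})"
  by (intro subspace_inter) (auto simp: subspace_def inner_add_left)

lemma onb_add_normal:
  assumes E: "subspace E" and b: "onb (E \<inter> {x. x \<bullet> \<eta> = 0}) m b" and \<eta>: "\<eta> \<in> E" "norm \<eta> = 1"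
  shows "onb E (Suc m) (b(m := \<eta>))"
  unfolding onb_def
proof (intro conjI allI impI)
  have on: "b i \<bullet> \<eta> = 0" "b i \<in> E" if "i < m" for i using onb_in[OF b that] by auto
  moreover have "\<eta> \<bullet> b i = 0" if "i < m" for i using on(1)[OF that] by (simp add: inner_commute)
  moreover have "\<eta> \<bullet> \<eta> = 1" using \<eta>(2) by (simp add: norm_eq_1)
  moreover fix i j assume "i < Suc m" "j < Suc m"
  ultimately show "(b(m := \<eta>)) i \<bullet> (b(m := \<eta>)) j = (if i = j then 1 else 0)"
    using onb_inner[OF b] by (auto simp: less_Suc_eq)
next
  have on: "b i \<bullet> \<eta> = 0" "b i \<in> E" if "i < m" for i using onb_in[OF b that] by auto
  show "span ((b(m := \<eta>)) ` {..<Suc m}) = E"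
  proof
    show "span ((b(m := \<eta>)) ` {..<Suc m}) \<subseteq> E"
      using on \<eta> E by (intro span_minimal) (auto simp: less_Suc_eq)
    show "E \<subseteq> span ((b(m := \<eta>)) ` {..<Suc m})"
    proof
      fix x assume x: "x \<in> E"
      define y where "y = x - (x \<bullet> \<eta>) *\<^sub>R \<eta>"
      have "y \<in> E \<inter> {x. x \<bullet> \<eta> = 0}"
        using x \<eta> E by (auto simp: y_def subspace_diff subspace_scale inner_diff_left dot_square_norm)
      then have "y \<in> span (b ` {..<m})" using b by (simp add: onb_def)
      also have "\<dots> \<subseteq> span ((b(m := \<eta>)) ` {..<Suc m})" by (intro span_mono) (auto intro!: image_eqI)
      finally have "y \<in> span ((b(m := \<eta>)) ` {..<Suc m})" .
      moreover have "\<eta> \<in> span ((b(m := \<eta>)) ` {..<Suc m})" by (intro span_base) (auto intro!: image_eqI[of _ _ m])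
      ultimately have "y + (x \<bullet> \<eta>) *\<^sub>R \<eta> \<in> span ((b(m := \<eta>)) ` {..<Suc m})"
        by (intro span_add span_scale)
      then show "x \<in> span ((b(m := \<eta>)) ` {..<Suc m})" by (simp add: y_def)
    qed
  qed
qed

section \<open>Compactness in finite-dimensional subspaces\<close>

lemma continuous_comb: "continuous_on UNIV (comb m b)"
proof -
  have "continuous_on UNIV (\<lambda>c::nat \<Rightarrow> real. c i)" for i
    by (rule continuous_on_product_coordinates)
  then show ?thesis unfolding comb_def by (intro continuous_intros)
qed

lemma compact_box: "compact {c :: nat \<Rightarrow> real. \<forall>i. \<bar>c i\<bar> \<le> r}"
proof -
  have "compactin (product_topology (\<lambda>_::nat. euclidean) UNIV) (Pi\<^sub>E UNIV (\<lambda>_. {-r..r::real}))"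
    by (subst compactin_PiE) auto
  then have "compact (Pi\<^sub>E UNIV (\<lambda>_::nat. {-r..r::real}))"
    by (simp add: euclidean_product_topology)
  moreover have "Pi\<^sub>E UNIV (\<lambda>_::nat. {-r..r::real}) = {c. \<forall>i. \<bar>c i\<bar> \<le> r}"
    by (auto simp: PiE_UNIV_domain abs_le_iff Pi_iff; metis minus_le_iff)
  ultimately show ?thesis by simp
qed

lemma abs_coord_le_norm_comb: "onb E m b \<Longrightarrow> i < m \<Longrightarrow> \<bar>c i\<bar> \<le> norm (comb m b c)"
  using Cauchy_Schwarz_ineq2[of "comb m b c" "b i"] by (simp add: comb_inner onb_norm)

text \<open>Closed bounded sets of the infinite-dimensional ambient space need not be compact.
  Compactness is imported from the coordinate space, where a box is compact by Tychonoff's theorem,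
  along the continuous map \<open>comb m b\<close>.\<close>

lemma compact_cball_Int:
  assumes b: "onb E m b"
  shows "compact (cball 0 r \<inter> E)"
proof -
  have "compact ({c. \<forall>i. \<bar>c i\<bar> \<le> max r 0} \<inter> {c. norm (comb m b c) \<le> r})"
  proof (rule compact_Int_closed[OF compact_box])
    show "closed {c. norm (comb m b c) \<le> r}"
      by (intro closed_Collect_le continuous_on_norm continuous_comb continuous_on_const)
  qed
  then have "compact (comb m b ` ({c. \<forall>i. \<bar>c i\<bar> \<le> max r 0} \<inter> {c. norm (comb m b c) \<le> r}))"
    by (rule compact_continuous_image[rotated]) (rule continuous_on_subset[OF continuous_comb subset_UNIV])
  also have "comb m b ` ({c. \<forall>i. \<bar>c i\<bar> \<le> max r 0} \<inter> {c. norm (comb m b c) \<le> r}) = cball 0 r \<inter> E"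
  proof (intro equalityI subsetI)
    fix x assume x: "x \<in> cball 0 r \<inter> E"
    \<comment> \<open>Coordinates from \<open>m\<close> on do not affect \<open>comb m b\<close>;
      the value 0 keeps \<open>c\<close> inside the infinite product of intervals.\<close>
    define c where "c = (\<lambda>i. if i < m then x \<bullet> b i else 0)"
    have e: "comb m b c = x"
      using onb_expand[OF b, of x] x by (subst comb_cong[of m c "\<lambda>i. x \<bullet> b i"]) (auto simp: c_def)
    have "\<bar>c i\<bar> \<le> max r 0" for i
      using abs_coord_le_norm_comb[OF b, of i c] e x by (cases "i < m") (auto simp: c_def)
    then show "x \<in> comb m b ` ({c. \<forall>i. \<bar>c i\<bar> \<le> max r 0} \<inter> {c. norm (comb m b c) \<le> r})"
      using e x by (intro image_eqI[of _ _ c]) auto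
  qed (use comb_in[OF b] in auto)
  finally show ?thesis .
qed

lemma compact_sphere_Int:
  assumes b: "onb E m b"
  shows "compact (sphere 0 r \<inter> E)"
proof -
  have "sphere 0 r \<inter> E = (cball 0 r \<inter> E) \<inter> {x. norm x = r}" by auto
  moreover have "closed {x::fseq. norm x = r}"
    by (intro closed_Collect_eq continuous_intros)
  ultimately show ?thesis using compact_Int_closed[OF compact_cball_Int[OF b]] by simp
qed

text \<open>\<open>E\<close> is the fixed point set of the orthogonal projection onto it, which is
  continuous.\<close>

lemma closed_onb:
  assumes b: "onb E m b"
  shows "closed E"
proof -
  have "E = {x. comb m b (\<lambda>i. x \<bullet> b i) = x}"
    using onb_expand[OF b] comb_in[OF b] by (auto; metis)
  moreover have "closed {x. comb m b (\<lambda>i. x \<bullet> b i) = x}"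
    unfolding comb_def by (intro closed_Collect_eq continuous_intros)
  ultimately show ?thesis by simp
qed

text \<open>The variational proof of the spectral theorem: a unit vector \<open>u\<close> minimising
  the quadratic form on the sphere of \<open>E\<close> is \<open>B\<close>-orthogonal to the
  orthogonal complement of \<open>u\<close> in \<open>E\<close>, where the induction continues. It
  will be applied to the second moments of a convex body.\<close>

lemma ex_diagonalizing_onb:
  fixes B :: "fseq \<Rightarrow> fseq \<Rightarrow> real"
  assumes E: "subspace E" "E \<subseteq> Rn n"
    and add: "\<And>x y z. B (x + y) z = B x z + B y z"
    and scale: "\<And>r x z. B (r *\<^sub>R x) z = r * B x z"
    and sym: "\<And>x y. B x y = B y x"
  shows "\<exists>b. onb E (dim E) b \<and> (\<forall>i<dim E. \<forall>j<dim E. i \<noteq> j \<longrightarrow> B (b i) (b j) = 0)"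
  using E
proof (induction "dim E" arbitrary: E)
  case 0
  then show ?case using ex_onb by force
next
  case (Suc d)
  obtain b where b: "onb E (Suc d) b" using ex_onb[OF Suc.prems] Suc.hyps(2) by auto
  have B0: "B 0 z = 0" for z using scale[of 0 0 z] by simp
  have Bsum: "B (\<Sum>i\<in>I. f i) z = (\<Sum>i\<in>I. B (f i) z)" for f z and I :: "nat set"
    by (induction I rule: infinite_finite_induct) (auto simp: add B0)
  have add2: "B z (x + y) = B z x + B z y" and scale2: "B z (r *\<^sub>R x) = r * B z x" for x y z r
    by (metis add sym, metis scale sym)
  have Bsum2: "B z (\<Sum>i\<in>I. f i) = (\<Sum>i\<in>I. B z (f i))" for f z and I :: "nat set"
    using Bsum[of f I z] by (simp add: sym[of z])
  have Bcomb: "B (comb (Suc d) b c) (comb (Suc d) b c) = (\<Sum>i<Suc d. \<Sum>j<Suc d. c i * (c j * B (b j) (b i)))" for c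
    unfolding comb_def Bsum2 scale2 Bsum scale by (simp only: sum_distrib_left)
  have cont: "continuous_on E (\<lambda>x. B x x)"
  proof -
    have "continuous_on E (\<lambda>x. \<Sum>i<Suc d. \<Sum>j<Suc d. (x \<bullet> b i) * ((x \<bullet> b j) * B (b j) (b i)))"
      by (intro continuous_on_sum continuous_on_mult continuous_on_inner continuous_on_id continuous_on_const)
    then show ?thesis
    proof (rule continuous_on_eq)
      fix x assume "x \<in> E"
      then show "(\<Sum>i<Suc d. \<Sum>j<Suc d. (x \<bullet> b i) * ((x \<bullet> b j) * B (b j) (b i))) = B x x"
        using Bcomb[of "\<lambda>i. x \<bullet> b i"] onb_expand[OF b] by simp
    qed
  qed
  have "b 0 \<in> sphere 0 1 \<inter> E" using onb_in[OF b] onb_norm[OF b] by auto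
  then obtain u where u: "u \<in> sphere 0 1 \<inter> E" "\<And>x. x \<in> sphere 0 1 \<inter> E \<Longrightarrow> B u u \<le> B x x"
    using continuous_attains_inf[OF compact_sphere_Int[OF b, of 1] _ continuous_on_subset[OF cont]]
    by blast
  let ?E = "E \<inter> {x. x \<bullet> u = 0}"
  have uE: "u \<in> E" "norm u = 1" "u \<bullet> u = 1" using u by (auto simp: dot_square_norm)
  have Bnorm: "B u u * (norm x)\<^sup>2 \<le> B x x" if "x \<in> E" for x
  proof (cases "x = 0")
    case False
    have "B u u \<le> B (x /\<^sub>R norm x) (x /\<^sub>R norm x)"
      using False that Suc.prems by (intro u(2)) (auto simp: subspace_scale)
    also have "\<dots> = B x x / (norm x)\<^sup>2"
      by (simp add: scale scale2 power2_eq_square field_simps)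
    finally show ?thesis using False by (simp add: field_simps)
  qed (simp add: B0)
  have orth: "B u w = 0" if w: "w \<in> ?E" for w
  proof (rule ccontr)
    assume nz: "B u w \<noteq> 0"
    define q where "q = B w w - B u u * (norm w)\<^sup>2"
    have ineq: "0 \<le> 2 * t * B u w + t\<^sup>2 * q" for t
    proof -
      have "u + t *\<^sub>R w \<in> E" using w uE Suc.prems by (auto intro!: subspace_add subspace_scale)
      then have "B u u * (norm (u + t *\<^sub>R w))\<^sup>2 \<le> B (u + t *\<^sub>R w) (u + t *\<^sub>R w)" by (rule Bnorm)
      moreover have "(norm (u + t *\<^sub>R w))\<^sup>2 = 1 + t\<^sup>2 * (norm w)\<^sup>2"
        using w uE(3) unfolding power2_norm_eq_inner
        by (simp add: inner_add_left inner_add_right inner_commute[of u w] power2_eq_square)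
      moreover have "B (u + t *\<^sub>R w) (u + t *\<^sub>R w) = B u u + 2 * t * B u w + t\<^sup>2 * B w w"
        by (simp add: add scale add2 scale2 sym[of w u] power2_eq_square algebra_simps)
      ultimately show ?thesis by (simp add: q_def algebra_simps)
    qed
    \<comment> \<open>For this \<open>t\<close> the linear term of \<open>ineq\<close> is negative
      and outweighs the quadratic one, against the minimality of \<open>u\<close>.\<close>
    define t where "t = - B u w / (\<bar>q\<bar> + 1)"
    have "B u w = - (\<bar>q\<bar> + 1) * t"
      using abs_ge_zero[of q] unfolding t_def by (simp add: field_simps del: abs_ge_zero)
    then have "t * B u w = - (\<bar>q\<bar> + 1) * t\<^sup>2" by (simp add: power2_eq_square)
    then have "0 \<le> t\<^sup>2 * (q - 2 * (\<bar>q\<bar> + 1))" using ineq[of t] by (simp add: algebra_simps)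
    moreover have "t\<^sup>2 > 0" using nz by (simp add: t_def)
    ultimately show False by (simp add: zero_le_mult_iff)
  qed
  have E': "subspace ?E" "?E \<subseteq> Rn n" using Suc.prems subspace_hyperplane_Int by auto
  obtain b1 where b1: "onb ?E (dim ?E) b1" using ex_onb[OF E'] by blast
  have "dim E = Suc (dim ?E)" using onb_dim[OF onb_add_normal[OF Suc.prems(1) b1 uE(1,2)]] .
  then have d: "d = dim ?E" using Suc.hyps(2) by simp
  obtain b' where b': "onb ?E d b'" "\<And>i j. i < d \<Longrightarrow> j < d \<Longrightarrow> i \<noteq> j \<Longrightarrow> B (b' i) (b' j) = 0"
    using Suc.hyps(1)[OF d E'] d by auto
  have "B ((b'(d := u)) i) ((b'(d := u)) j) = 0" if "i < Suc d" "j < Suc d" "i \<noteq> j" for i j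
    using that b'(2) orth onb_in[OF b'(1)] sym[of _ u] by (auto simp: less_Suc_eq)
  then show ?case using onb_add_normal[OF Suc.prems(1) b'(1) uE(1,2)] Suc.hyps(2)
    by (metis (no_types, lifting))
qed

text \<open>The reflection in the hyperplane orthogonal to \<open>x - y\<close>. It acts on the
  whole ambient space, as \<open>rotation_invariant_prob\<close> demands, and shows that rotations
  preserving \<open>E\<close> are transitive on each of its spheres.\<close>

lemma ex_reflection:
  fixes x y :: fseq
  assumes E: "subspace E" and x: "x \<in> E" "y \<in> E" "norm x = norm y"
  shows "\<exists>U. orthogonal_transformation U \<and> U ` E = E \<and> U x = y"
proof (cases "x = y")
  case True
  then show ?thesis by (intro exI[of _ "\<lambda>x. x"]) auto
next
  case False
  define v where "v = x - y"
  have v: "v \<in> E" "v \<noteq> 0" "v \<bullet> v \<noteq> 0" using False x E by (auto simp: v_def subspace_diff)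
  define U where "U = (\<lambda>z. z - (2 * (z \<bullet> v) / (v \<bullet> v)) *\<^sub>R v)"
  have lin: "linear U"
    by (rule linearI) (auto simp: U_def inner_add_left algebra_simps add_divide_distrib)
  have "U z \<bullet> U w = z \<bullet> w" for z w
    using v by (simp add: U_def inner_diff_left inner_diff_right field_simps inner_commute)
  then have orth: "orthogonal_transformation U" using lin by (simp add: orthogonal_transformation_def)
  have UU: "U (U z) = z" for z
    using v by (simp add: U_def inner_diff_left field_simps flip: scaleR_add_left)
  have UE: "U z \<in> E" if "z \<in> E" for z
    using that v E by (auto simp: U_def intro!: subspace_diff subspace_scale)
  have "U ` E = E"
  proof
    show "U ` E \<subseteq> E" using UE by blast
    show "E \<subseteq> U ` E"
    proof
      fix z assume "z \<in> E"
      then show "z \<in> U ` E" by (intro image_eqI[of z U "U z"]) (simp_all only: UU UE)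
    qed
  qed
  moreover have "U x = y"
  proof -
    have "x \<bullet> x = y \<bullet> y" using x(3) by (simp only: power2_norm_eq_inner[symmetric])
    then have "2 * (x \<bullet> v) = v \<bullet> v"
      by (simp add: v_def inner_diff_left inner_diff_right inner_commute[of y x])
    then have "2 * (x \<bullet> v) / (v \<bullet> v) = 1" using v(3) by simp
    then have "U x = x - 1 *\<^sub>R v" by (simp only: U_def)
    then show ?thesis by (simp add: v_def)
  qed
  ultimately show ?thesis using orth by blast
qed

text \<open>Compactness provides a nearest point \<open>p\<close> although the ambient space is not
  complete, and the hyperplane through \<open>p\<close> orthogonal to \<open>z - p\<close>
  separates.\<close>

lemma closest_point_separation:
  fixes C :: "fseq set"
  assumes C: "compact C" "convex C" "C \<noteq> {}" and z: "z \<notin> C"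
  shows "\<exists>p\<in>C. z \<noteq> p \<and> (\<forall>x\<in>C. (x - p) \<bullet> (z - p) \<le> 0)"
proof -
  have "continuous_on C (dist z)" by (intro continuous_on_dist continuous_on_const continuous_on_id)
  from continuous_attains_inf[OF C(1,3) this]
  obtain p where p: "p \<in> C" "\<And>x. x \<in> C \<Longrightarrow> dist z p \<le> dist z x" by blast
  have "(z - p) \<bullet> (x - p) \<le> 0" if "x \<in> C" for x
    using any_closest_point_dot[OF C(2) compact_imp_closed[OF C(1)] p(1) that] p(2) by blast
  then show ?thesis using p z by (intro bexI[of _ p]) (auto simp: inner_commute)
qed

section \<open>Lebesgue measure on subspaces\<close>

abbreviation lpi :: "nat set \<Rightarrow> (nat \<Rightarrow> real) measure" where
  "lpi I \<equiv> Pi\<^sub>M I (\<lambda>_. lborel)"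

interpretation lpi: product_sigma_finite "\<lambda>_::nat. lborel :: real measure"
  by standard

lemma sigma_finite_lpi: "finite I \<Longrightarrow> sigma_finite_measure (lpi I)"
  by (rule lpi.sigma_finite)

lemma measurable_comb [measurable]: "comb m b \<in> borel_measurable (lpi {..<m})"
  unfolding comb_def by (intro borel_measurable_sum borel_measurable_scaleR) auto

text \<open>Translations and diagonal maps are the only changes of variables carried out in
  coordinates, one variable at a time; orthogonal and general linear maps will follow from the
  uniqueness of translation-invariant measures.\<close>

lemma nn_integral_lpi_affine:
  assumes "finite I" "\<And>i. i \<in> I \<Longrightarrow> s i \<noteq> 0" "f \<in> borel_measurable (lpi I)"
  shows "(\<Prod>i\<in>I. ennreal \<bar>s i\<bar>) * (\<integral>\<^sup>+c. f (\<lambda>i\<in>I. a i + s i * c i) \<partial>lpi I) = (\<integral>\<^sup>+c. f c \<partial>lpi I)"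
  using assms
proof (induction I arbitrary: f rule: finite_induct)
  case empty
  have "restrict (\<lambda>i. a i + s i * c i) {} = c" if "c \<in> space (lpi {})" for c
    using that by (auto simp: space_PiM)
  then show ?case by (simp cong: nn_integral_cong)
next
  case (insert j J)
  let ?I = "insert j J"
  have fm [measurable]: "f \<in> borel_measurable (lpi ?I)" by fact
  have aff: "(\<lambda>c. \<lambda>i\<in>?I. a i + s i * c i) \<in> lpi ?I \<rightarrow>\<^sub>M lpi ?I"
    by (intro measurable_restrict) measurable
  have upd: "(\<lambda>(x, y). x(j := y)) \<in> lpi J \<Otimes>\<^sub>M lborel \<rightarrow>\<^sub>M lpi ?I"
    using measurable_add_dim[of j J "\<lambda>_. lborel"] by simp
  define g where "g = (\<lambda>x. \<integral>\<^sup>+y. f (x(j := y)) \<partial>lborel)"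
  have "(\<lambda>p. f ((fst p)(j := snd p))) \<in> borel_measurable (lpi J \<Otimes>\<^sub>M lborel)"
    using measurable_compose[OF upd fm] by (simp add: case_prod_beta)
  then have gm: "g \<in> borel_measurable (lpi J)"
    unfolding g_def by (intro lborel.borel_measurable_nn_integral) (simp add: case_prod_beta)
  have sj: "s j \<noteq> 0" using insert.prems by simp
  have inner: "ennreal \<bar>s j\<bar> * (\<integral>\<^sup>+y. f (\<lambda>i\<in>?I. a i + s i * (x(j := y)) i) \<partial>lborel) = g (\<lambda>i\<in>J. a i + s i * x i)"
    if "x \<in> space (lpi J)" for x
  proof -
    let ?x = "\<lambda>i\<in>J. a i + s i * x i"
    have eq: "(\<lambda>i\<in>?I. a i + s i * (x(j := y)) i) = ?x(j := a j + s j * y)" for y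
      using insert.hyps(2) by (auto simp: fun_eq_iff)
    have xs: "?x \<in> space (lpi J)" by (auto simp: space_PiM)
    have "(\<lambda>y. ?x(j := y)) \<in> borel \<rightarrow>\<^sub>M lpi ?I"
      using measurable_compose[OF measurable_Pair1'[OF xs] upd] by simp
    then have "(\<lambda>y. f (?x(j := y))) \<in> borel_measurable borel"
      using measurable_compose fm by blast
    from nn_integral_real_affine[OF this sj, of "a j"] show ?thesis unfolding eq g_def by simp
  qed
  have "(\<Prod>i\<in>?I. ennreal \<bar>s i\<bar>) * (\<integral>\<^sup>+c. f (\<lambda>i\<in>?I. a i + s i * c i) \<partial>lpi ?I)
     = (\<Prod>i\<in>J. ennreal \<bar>s i\<bar>) * (ennreal \<bar>s j\<bar> * (\<integral>\<^sup>+x. \<integral>\<^sup>+y. f (\<lambda>i\<in>?I. a i + s i * (x(j := y)) i) \<partial>lborel \<partial>lpi J))"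
    using insert.hyps measurable_compose[OF aff fm]
    by (subst lpi.product_nn_integral_insert) (auto simp: mult_ac)
  also have "ennreal \<bar>s j\<bar> * (\<integral>\<^sup>+x. \<integral>\<^sup>+y. f (\<lambda>i\<in>?I. a i + s i * (x(j := y)) i) \<partial>lborel \<partial>lpi J)
      = (\<integral>\<^sup>+x. ennreal \<bar>s j\<bar> * (\<integral>\<^sup>+y. f (\<lambda>i\<in>?I. a i + s i * (x(j := y)) i) \<partial>lborel) \<partial>lpi J)"
  proof (rule nn_integral_cmult[symmetric])
    have "(\<lambda>p. f (\<lambda>i\<in>?I. a i + s i * ((fst p)(j := snd p)) i)) \<in> borel_measurable (lpi J \<Otimes>\<^sub>M lborel)"
      using measurable_compose[OF measurable_compose[OF upd aff] fm] by (simp add: case_prod_beta)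
    then show "(\<lambda>x. \<integral>\<^sup>+y. f (\<lambda>i\<in>?I. a i + s i * (x(j := y)) i) \<partial>lborel) \<in> borel_measurable (lpi J)"
      by (intro lborel.borel_measurable_nn_integral) (simp add: case_prod_beta)
  qed
  also have "\<dots> = (\<integral>\<^sup>+x. g (\<lambda>i\<in>J. a i + s i * x i) \<partial>lpi J)"
    by (intro nn_integral_cong inner)
  also have "(\<Prod>i\<in>J. ennreal \<bar>s i\<bar>) * \<dots> = (\<integral>\<^sup>+c. g c \<partial>lpi J)"
    by (rule insert.IH) (use insert.prems gm in auto)
  also have "\<dots> = (\<integral>\<^sup>+c. f c \<partial>lpi ?I)"
    unfolding g_def using insert.hyps by (subst lpi.product_nn_integral_insert) auto
  finally show ?case .
qed

section \<open>Uniqueness of translation-invariant measures on a subspace\<close>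

lemma measurable_restrict_borel:
  "f \<in> borel_measurable borel \<Longrightarrow> f \<in> borel_measurable (restrict_space borel E)"
  by (rule measurable_restrict_space1)

lemma ennreal_mult_right_cancel:
  fixes a b c :: ennreal
  assumes "a * c = b * c" "0 < c" "c < \<infinity>"
  shows "a = b"
proof -
  have "a = a * c / c" "b = b * c / c"
    using assms(2,3) by (simp_all add: ennreal_mult_divide_eq)
  then show ?thesis using assms(1) by simp
qed

text \<open>Tonelli's theorem for \<open>f (x + y) * g y\<close>, translating first in \<open>x\<close> and then in \<open>y\<close>. Since \<open>g\<close>
  is arbitrary, \<open>M\<close> and \<open>N\<close> are proportional.\<close>
lemma translation_invariant_unique:
  fixes M N :: "fseq measure"
  assumes E: "subspace E"
    and M: "sigma_finite_measure M" "sets M = sets (restrict_space borel E)"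
    and N: "sigma_finite_measure N" "sets N = sets (restrict_space borel E)"
    and Minv: "\<And>f y. f \<in> borel_measurable borel \<Longrightarrow> y \<in> E \<Longrightarrow> (\<integral>\<^sup>+x. f (x + y) \<partial>M) = (\<integral>\<^sup>+x. f x \<partial>M)"
    and Ninv: "\<And>f y. f \<in> borel_measurable borel \<Longrightarrow> y \<in> E \<Longrightarrow> (\<integral>\<^sup>+x. f (x + y) \<partial>N) = (\<integral>\<^sup>+x. f x \<partial>N)"
    and f: "f \<in> borel_measurable borel" and g: "g \<in> borel_measurable borel"
  shows "(\<integral>\<^sup>+x. f x \<partial>M) * (\<integral>\<^sup>+y. g y \<partial>N) = (\<integral>\<^sup>+y. f y \<partial>N) * (\<integral>\<^sup>+x. g (- x) \<partial>M)"
proof -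
  interpret M: sigma_finite_measure M by fact
  interpret N: sigma_finite_measure N by fact
  interpret pair_sigma_finite M N ..
  have sM: "space M = E" and sN: "space N = E"
    using sets_eq_imp_space_eq[OF M(2)] sets_eq_imp_space_eq[OF N(2)] by (auto simp: space_restrict_space)
  have id_M: "(\<lambda>x. x) \<in> M \<rightarrow>\<^sub>M borel" and id_N: "(\<lambda>x. x) \<in> N \<rightarrow>\<^sub>M borel"
    by (subst measurable_cong_sets[OF M(2) refl], rule measurable_restrict_space1, simp)
      (subst measurable_cong_sets[OF N(2) refl], rule measurable_restrict_space1, simp)
  have mM: "h \<in> borel_measurable M" if "h \<in> borel_measurable borel" for h :: "fseq \<Rightarrow> ennreal"
    by (rule measurable_compose[OF id_M that])
  have mN: "h \<in> borel_measurable N" if "h \<in> borel_measurable borel" for h :: "fseq \<Rightarrow> ennreal"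
    by (rule measurable_compose[OF id_N that])
  have mP: "case_prod H \<in> borel_measurable (M \<Otimes>\<^sub>M N)"
    if "(\<lambda>p. H (fst p) (snd p)) \<in> borel_measurable (borel \<Otimes>\<^sub>M borel)" for H :: "fseq \<Rightarrow> fseq \<Rightarrow> ennreal"
  proof -
    have "(\<lambda>p. (fst p, snd p)) \<in> M \<Otimes>\<^sub>M N \<rightarrow>\<^sub>M borel \<Otimes>\<^sub>M borel"
      by (intro measurable_Pair measurable_compose[OF measurable_fst id_M] measurable_compose[OF measurable_snd id_N])
    from measurable_compose[OF this that] show ?thesis by (simp add: case_prod_beta)
  qed
  note f [measurable] note g [measurable]
  have "(\<integral>\<^sup>+x. f x \<partial>M) * (\<integral>\<^sup>+y. g y \<partial>N) = (\<integral>\<^sup>+y. (\<integral>\<^sup>+x. f x \<partial>M) * g y \<partial>N)"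
    by (rule nn_integral_cmult[symmetric]) (rule mN[OF g])
  also have "\<dots> = (\<integral>\<^sup>+y. (\<integral>\<^sup>+x. f (x + y) * g y \<partial>M) \<partial>N)"
  proof (rule nn_integral_cong)
    fix y assume y: "y \<in> space N"
    have "(\<integral>\<^sup>+x. f (x + y) * g y \<partial>M) = (\<integral>\<^sup>+x. f (x + y) \<partial>M) * g y"
      by (rule nn_integral_multc, rule mM) measurable
    then show "(\<integral>\<^sup>+x. f x \<partial>M) * g y = (\<integral>\<^sup>+x. f (x + y) * g y \<partial>M)"
      using Minv[OF f] y sN by simp
  qed
  also have "\<dots> = (\<integral>\<^sup>+x. (\<integral>\<^sup>+y. f (x + y) * g y \<partial>N) \<partial>M)"
    by (rule Fubini', rule mP) measurable
  also have "\<dots> = (\<integral>\<^sup>+x. (\<integral>\<^sup>+y. f y * g (y - x) \<partial>N) \<partial>M)"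
  proof (rule nn_integral_cong)
    fix x assume x: "x \<in> space M"
    have "(\<integral>\<^sup>+y. f y * g (y - x) \<partial>N) = (\<integral>\<^sup>+y. f (y + x) * g (y + x - x) \<partial>N)"
      using x sM by (intro Ninv[symmetric]) auto
    then show "(\<integral>\<^sup>+y. f (x + y) * g y \<partial>N) = (\<integral>\<^sup>+y. f y * g (y - x) \<partial>N)"
      by (simp add: add.commute)
  qed
  also have "\<dots> = (\<integral>\<^sup>+y. (\<integral>\<^sup>+x. f y * g (y - x) \<partial>M) \<partial>N)"
    by (rule Fubini'[symmetric], rule mP) measurable
  also have "\<dots> = (\<integral>\<^sup>+y. f y * (\<integral>\<^sup>+x. g (- x) \<partial>M) \<partial>N)"
  proof (rule nn_integral_cong)
    fix y assume y: "y \<in> space N"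
    have "(\<integral>\<^sup>+x. g (y - x) \<partial>M) = (\<integral>\<^sup>+x. g (y - (x + y)) \<partial>M)"
      using y sN by (intro Minv[symmetric]) auto
    then show "(\<integral>\<^sup>+x. f y * g (y - x) \<partial>M) = f y * (\<integral>\<^sup>+x. g (- x) \<partial>M)"
      by (subst nn_integral_cmult, intro mM) auto
  qed
  also have "\<dots> = (\<integral>\<^sup>+y. f y \<partial>N) * (\<integral>\<^sup>+x. g (- x) \<partial>M)"
    by (rule nn_integral_multc) (rule mN[OF f])
  finally show ?thesis .
qed

text \<open>Lebesgue measure built from a given basis. \<open>lebesgue_sub\<close> takes its basis
  from the choice operator; \<open>lcomb_unique\<close> shows that every basis yields the same
  measure.\<close>

definition lcomb :: "fseq set \<Rightarrow> nat \<Rightarrow> (nat \<Rightarrow> fseq) \<Rightarrow> fseq measure" where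
  "lcomb E m b = distr (lpi {..<m}) (restrict_space borel E) (comb m b)"

lemma measurable_comb_restrict:
  assumes "onb E m b"
  shows "comb m b \<in> lpi {..<m} \<rightarrow>\<^sub>M restrict_space borel E"
  by (rule measurable_restrict_space2) (auto intro: comb_in[OF assms])

lemma sets_lcomb [simp]: "sets (lcomb E m b) = sets (restrict_space borel E)"
  by (simp add: lcomb_def)

lemma space_lcomb [simp]: "space (lcomb E m b) = E"
  by (simp add: lcomb_def space_restrict_space)

lemma Int_in_sets_restrict: "A \<in> sets borel \<Longrightarrow> A \<inter> E \<in> sets (restrict_space borel E)"
  by (subst Int_commute) (simp add: sets_restrict_space)

lemma nn_integral_lcomb:
  assumes "onb E m b" "f \<in> borel_measurable borel"
  shows "(\<integral>\<^sup>+x. f x \<partial>lcomb E m b) = (\<integral>\<^sup>+c. f (comb m b c) \<partial>lpi {..<m})"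
  unfolding lcomb_def using assms
  by (subst nn_integral_distr) (auto intro: measurable_comb_restrict measurable_restrict_borel)

text \<open>The coordinate functionals invert \<open>comb m b\<close>, so the push-forward along
  them is the product measure again, and preimages of a sigma-finite cover form such a
  cover.\<close>

lemma sigma_finite_lcomb:
  assumes b: "onb E m b"
  shows "sigma_finite_measure (lcomb E m b)"
proof (rule sigma_finite_measure_distr)
  let ?g = "\<lambda>x. \<lambda>i\<in>{..<m}. x \<bullet> b i"
  have gm: "?g \<in> lcomb E m b \<rightarrow>\<^sub>M lpi {..<m}"
  proof (rule measurable_restrict)
    fix i
    have "(\<lambda>x. x \<bullet> b i) \<in> borel_measurable (restrict_space borel E)"
      by (rule measurable_restrict_borel) measurable
    then show "(\<lambda>x. x \<bullet> b i) \<in> lcomb E m b \<rightarrow>\<^sub>M lborel"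
      by (simp add: lcomb_def)
  qed
  show "?g \<in> lcomb E m b \<rightarrow>\<^sub>M lpi {..<m}" by fact
  have "distr (lcomb E m b) (lpi {..<m}) ?g = distr (lpi {..<m}) (lpi {..<m}) (?g \<circ> comb m b)"
    using gm unfolding lcomb_def by (subst distr_distr) (auto intro: measurable_comb_restrict[OF b])
  also have "\<dots> = distr (lpi {..<m}) (lpi {..<m}) (\<lambda>c. c)"
  proof (rule distr_cong)
    fix c assume "c \<in> space (lpi {..<m})"
    then show "(?g \<circ> comb m b) c = c"
      by (auto simp: space_PiM comb_inner[OF b] fun_eq_iff PiE_def extensional_def)
  qed auto
  also have "\<dots> = lpi {..<m}" by (rule distr_id2) simp
  finally show "sigma_finite_measure (distr (lcomb E m b) (lpi {..<m}) ?g)"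
    by (simp add: sigma_finite_lpi)
qed

lemma lcomb_translation:
  assumes b: "onb E m b" and f: "f \<in> borel_measurable borel" and y: "y \<in> E"
  shows "(\<integral>\<^sup>+x. f (x + y) \<partial>lcomb E m b) = (\<integral>\<^sup>+x. f x \<partial>lcomb E m b)"
proof -
  note f [measurable]
  have e: "comb m b (\<lambda>i\<in>{..<m}. y \<bullet> b i + 1 * c i) = comb m b c + y" for c
  proof -
    have "comb m b (\<lambda>i\<in>{..<m}. y \<bullet> b i + 1 * c i) = comb m b (\<lambda>i. c i) + comb m b (\<lambda>i. y \<bullet> b i)"
      unfolding comb_def by (simp add: scaleR_add_left sum.distrib add.commute)
    then show ?thesis using onb_expand[OF b y] by simp
  qed
  have "(\<integral>\<^sup>+c. f (comb m b (\<lambda>i\<in>{..<m}. y \<bullet> b i + 1 * c i)) \<partial>lpi {..<m}) = (\<integral>\<^sup>+c. f (comb m b c) \<partial>lpi {..<m})"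
    using nn_integral_lpi_affine[of "{..<m}" "\<lambda>_. 1" "\<lambda>c. f (comb m b c)" "\<lambda>i. y \<bullet> b i"] by simp
  moreover have "(\<lambda>x. f (x + y)) \<in> borel_measurable borel" by measurable
  ultimately show ?thesis using b f by (simp add: nn_integral_lcomb e[simplified])
qed

text \<open>The right-hand side depends on \<open>m\<close> and \<open>r\<close> but not on the
  basis, so the unit ball can serve as the common normalisation.\<close>

lemma emeasure_lcomb_ball:
  assumes b: "onb E m b" and r: "0 \<le> r"
  shows "emeasure (lcomb E m b) (cball 0 r \<inter> E) = emeasure (lpi {..<m}) {c \<in> space (lpi {..<m}). (\<Sum>i<m. (c i)\<^sup>2) \<le> r\<^sup>2}"
proof -
  have s: "cball 0 r \<inter> E \<in> sets (restrict_space borel E)" by (rule Int_in_sets_restrict) simp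
  have iff: "norm (comb m b c) \<le> r \<longleftrightarrow> (\<Sum>i<m. (c i)\<^sup>2) \<le> r\<^sup>2" for c
    unfolding norm_comb[OF b, symmetric] using r by (simp add: power_mono_iff)
  have "comb m b -` (cball 0 r \<inter> E) \<inter> space (lpi {..<m}) = {c \<in> space (lpi {..<m}). (\<Sum>i<m. (c i)\<^sup>2) \<le> r\<^sup>2}"
    using comb_in[OF b] iff by auto
  then show ?thesis
    unfolding lcomb_def by (subst emeasure_distr[OF measurable_comb_restrict[OF b] s]) simp
qed

lemma emeasure_lpi_box:
  "finite I \<Longrightarrow> (\<And>i. i \<in> I \<Longrightarrow> l i \<le> u i) \<Longrightarrow>
   emeasure (lpi I) (Pi\<^sub>E I (\<lambda>i. {l i..u i})) = ennreal (\<Prod>i\<in>I. u i - l i)"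
  by (subst lpi.emeasure_PiM) (auto simp: prod_ennreal)

lemma emeasure_lcomb_ball_pos_fin:
  assumes b: "onb E m b" and r: "r > 0"
  shows "0 < emeasure (lcomb E m b) (cball 0 r \<inter> E)" "emeasure (lcomb E m b) (cball 0 r \<inter> E) < \<infinity>"
proof -
  let ?B = "{c \<in> space (lpi {..<m}). (\<Sum>i<m. (c i)\<^sup>2) \<le> r\<^sup>2}"
  have Bm: "?B \<in> sets (lpi {..<m})" by measurable
  note ball = emeasure_lcomb_ball[OF b less_imp_le[OF r]]
  have "?B \<subseteq> Pi\<^sub>E {..<m} (\<lambda>i. {-r..r})"
  proof
    fix c assume c: "c \<in> ?B"
    have "\<bar>c i\<bar> \<le> r" if "i < m" for i
    proof -
      have "(c i)\<^sup>2 \<le> (\<Sum>i<m. (c i)\<^sup>2)" using that by (intro member_le_sum) auto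
      also have "\<dots> \<le> r\<^sup>2" using c r by simp
      finally show ?thesis using r abs_le_square_iff[of "c i" r] by simp
    qed
    then show "c \<in> Pi\<^sub>E {..<m} (\<lambda>i. {-r..r})" using c by (auto simp: space_PiM PiE_iff abs_le_iff minus_le_iff)
  qed
  then have "emeasure (lpi {..<m}) ?B \<le> emeasure (lpi {..<m}) (Pi\<^sub>E {..<m} (\<lambda>i. {-r..r}))"
    by (intro emeasure_mono sets_PiM_I_finite) auto
  also have "\<dots> < \<infinity>" using r by (subst emeasure_lpi_box) auto
  finally show "emeasure (lcomb E m b) (cball 0 r \<inter> E) < \<infinity>" unfolding ball .
  \<comment> \<open>The cube of half side \<open>\<delta>\<close> fits into the ball because
    \<open>m * \<delta>\<^sup>2 \<le> r\<^sup>2\<close>; the summand 1 avoids division by zero at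
    \<open>m = 0\<close>.\<close>
  define \<delta> where "\<delta> = r / (real m + 1)"
  have \<delta>: "\<delta> > 0" using r by (simp add: \<delta>_def)
  have "Pi\<^sub>E {..<m} (\<lambda>i. {-\<delta>..\<delta>}) \<subseteq> ?B"
  proof
    fix c assume c: "c \<in> Pi\<^sub>E {..<m} (\<lambda>i. {-\<delta>..\<delta>})"
    have "(\<Sum>i<m. (c i)\<^sup>2) \<le> (\<Sum>i<m. \<delta>\<^sup>2)"
      using c \<delta> by (intro sum_mono) (auto simp: PiE_iff abs_le_square_iff[symmetric] abs_le_iff minus_le_iff)
    also have "\<dots> \<le> (real m + 1)\<^sup>2 * \<delta>\<^sup>2"
    proof -
      have "real m \<le> (real m + 1)\<^sup>2" by (simp add: power2_eq_square algebra_simps)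
      from mult_right_mono[OF this, of "\<delta>\<^sup>2"] show ?thesis by simp
    qed
    also have "\<dots> = r\<^sup>2" by (simp add: \<delta>_def power_divide)
    finally show "c \<in> ?B" using c r by (auto simp: space_PiM PiE_iff)
  qed
  then have "emeasure (lpi {..<m}) (Pi\<^sub>E {..<m} (\<lambda>i. {-\<delta>..\<delta>})) \<le> emeasure (lpi {..<m}) ?B"
    using Bm by (intro emeasure_mono)
  moreover have "0 < emeasure (lpi {..<m}) (Pi\<^sub>E {..<m} (\<lambda>i. {-\<delta>..\<delta>}))"
    using \<delta> by (subst emeasure_lpi_box) (auto intro!: prod_pos)
  ultimately show "0 < emeasure (lcomb E m b) (cball 0 r \<inter> E)"
    unfolding ball by (rule less_le_trans[rotated])
qed

text \<open>Translation-invariant measures are proportional. The unit ball fixes the factor: it is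
  symmetric about 0, which removes the reflection from the proportionality, and it has the same
  measure for both bases.\<close>

lemma lcomb_unique:
  assumes b: "onb E m b" and b': "onb E m' b'"
  shows "lcomb E m b = lcomb E m' b'"
proof (rule measure_eqI)
  fix A assume "A \<in> sets (lcomb E m b)"
  then obtain A' where A': "A' \<in> sets borel" "A = A' \<inter> E" by (auto simp: sets_restrict_space)
  have m': "m' = m" using onb_dim b b' by blast
  let ?B = "cball (0::fseq) 1"
  have Bm: "?B \<in> sets borel" by simp
  have [measurable]: "A' \<in> sets borel" by fact
  have emb: "(\<integral>\<^sup>+x. indicator S x \<partial>lcomb E m'' b'') = emeasure (lcomb E m'' b'') (S \<inter> E)"
    if "onb E m'' b''" "S \<in> sets borel" for S m'' b''
  proof -
    have "(\<integral>\<^sup>+x. indicator S x \<partial>lcomb E m'' b'') = (\<integral>\<^sup>+x. indicator (S \<inter> E) x \<partial>lcomb E m'' b'')"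
      by (intro nn_integral_cong) (auto simp: indicator_def)
    also have "\<dots> = emeasure (lcomb E m'' b'') (S \<inter> E)"
      using that(2) by (intro nn_integral_indicator) (simp add: Int_in_sets_restrict)
    finally show ?thesis .
  qed
  have rf: "indicator ?B (- x) = (indicator ?B x :: ennreal)" for x by (simp add: indicator_def)
  have "(\<integral>\<^sup>+x. indicator A' x \<partial>lcomb E m b) * (\<integral>\<^sup>+y. indicator ?B y \<partial>lcomb E m' b')
     = (\<integral>\<^sup>+y. indicator A' y \<partial>lcomb E m' b') * (\<integral>\<^sup>+x. indicator ?B (- x) \<partial>lcomb E m b)"
    by (rule translation_invariant_unique[OF onb_subspace[OF b]])
      (assumption | rule sigma_finite_lcomb sets_lcomb lcomb_translation borel_measurable_indicator b b' A'(1) Bm)+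
  then have "emeasure (lcomb E m b) A * emeasure (lcomb E m' b') (?B \<inter> E)
     = emeasure (lcomb E m' b') A * emeasure (lcomb E m b) (?B \<inter> E)"
    by (simp only: rf emb[OF b A'(1)] emb[OF b' A'(1)] emb[OF b Bm] emb[OF b' Bm] A'(2))
  moreover have "emeasure (lcomb E m' b') (?B \<inter> E) = emeasure (lcomb E m b) (?B \<inter> E)"
    by (simp add: emeasure_lcomb_ball[OF b] emeasure_lcomb_ball[OF b'[unfolded m']] m')
  ultimately have "emeasure (lcomb E m b) A * emeasure (lcomb E m b) (?B \<inter> E)
     = emeasure (lcomb E m' b') A * emeasure (lcomb E m b) (?B \<inter> E)"
    by (simp only:)
  then show "emeasure (lcomb E m b) A = emeasure (lcomb E m' b') A"
    by (rule ennreal_mult_right_cancel) (rule emeasure_lcomb_ball_pos_fin[OF b zero_less_one])+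
qed (simp only: sets_lcomb)

lemma lebesgue_sub_eq:
  assumes b: "onb E m b"
  shows "lebesgue_sub E = lcomb E m b"
proof -
  have m: "m = dim E" using onb_dim[OF b] by simp
  have "onb E (dim E) (SOME b. orthonormal_basis E b)"
    unfolding onb_iff[symmetric] by (rule someI[of _ b]) (use b m in \<open>simp add: onb_iff\<close>)
  from lcomb_unique[OF this b] show ?thesis
    unfolding lebesgue_sub_def Let_def lcomb_def comb_def .
qed

lemma nn_integral_lebesgue_sub:
  assumes "onb E m b" "f \<in> borel_measurable borel"
  shows "(\<integral>\<^sup>+x. f x \<partial>lebesgue_sub E) = (\<integral>\<^sup>+c. f (comb m b c) \<partial>lpi {..<m})"
  using nn_integral_lcomb[OF assms] lebesgue_sub_eq[OF assms(1)] by simp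

lemma sets_lebesgue_sub: "onb E m b \<Longrightarrow> sets (lebesgue_sub E) = sets (restrict_space borel E)"
  by (simp add: lebesgue_sub_eq)

lemma space_lebesgue_sub: "onb E m b \<Longrightarrow> space (lebesgue_sub E) = E"
  by (simp add: lebesgue_sub_eq)

lemma sigma_finite_lebesgue_sub: "onb E m b \<Longrightarrow> sigma_finite_measure (lebesgue_sub E)"
  by (simp add: lebesgue_sub_eq sigma_finite_lcomb)

lemma measurable_lebesgue_sub:
  "onb E m b \<Longrightarrow> f \<in> borel \<rightarrow>\<^sub>M N \<Longrightarrow> f \<in> lebesgue_sub E \<rightarrow>\<^sub>M N"
  by (subst measurable_cong_sets[OF sets_lebesgue_sub refl]) (auto intro: measurable_restrict_space1)

lemma in_sets_lebesgue_sub: "onb E m b \<Longrightarrow> A \<in> sets borel \<Longrightarrow> A \<subseteq> E \<Longrightarrow> A \<in> sets (lebesgue_sub E)"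
  using Int_in_sets_restrict[of A E] by (simp add: sets_lebesgue_sub Int_absorb2)

lemma emeasure_lebesgue_sub:
  assumes "onb E m b" "A \<in> sets borel" "A \<subseteq> E"
  shows "emeasure (lebesgue_sub E) A = (\<integral>\<^sup>+x. indicator A x \<partial>lebesgue_sub E)"
  using in_sets_lebesgue_sub[OF assms] by simp

lemma emeasure_lebesgue_sub_coord:
  assumes "onb E m b" "A \<in> sets borel" "A \<subseteq> E"
  shows "emeasure (lebesgue_sub E) A = emeasure (lpi {..<m}) {c \<in> space (lpi {..<m}). comb m b c \<in> A}"
proof -
  note assms(2) [measurable]
  have "emeasure (lebesgue_sub E) A = (\<integral>\<^sup>+c. indicator A (comb m b c) \<partial>lpi {..<m})"
    unfolding emeasure_lebesgue_sub[OF assms] by (rule nn_integral_lebesgue_sub[OF assms(1)]) measurable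
  also have "\<dots> = (\<integral>\<^sup>+c. indicator {c \<in> space (lpi {..<m}). comb m b c \<in> A} c \<partial>lpi {..<m})"
    by (intro nn_integral_cong) (simp add: indicator_def)
  also have "\<dots> = emeasure (lpi {..<m}) {c \<in> space (lpi {..<m}). comb m b c \<in> A}"
    by (rule nn_integral_indicator) measurable
  finally show ?thesis .
qed

lemma lebesgue_sub_translation:
  "onb E m b \<Longrightarrow> f \<in> borel_measurable borel \<Longrightarrow> y \<in> E \<Longrightarrow>
   (\<integral>\<^sup>+x. f (x + y) \<partial>lebesgue_sub E) = (\<integral>\<^sup>+x. f x \<partial>lebesgue_sub E)"
  by (simp add: lebesgue_sub_eq lcomb_translation)

lemma lebesgue_sub_ball_pos_fin:
  assumes "onb E m b" "r > 0"
  shows "0 < emeasure (lebesgue_sub E) (cball 0 r \<inter> E)" "emeasure (lebesgue_sub E) (cball 0 r \<inter> E) < \<infinity>"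
  using emeasure_lcomb_ball_pos_fin[OF assms] lebesgue_sub_eq[OF assms(1)] by simp_all

section \<open>Tonelli's theorem on subspaces, and linear changes of variables\<close>

lemma nn_integral_comb_Suc:
  assumes [measurable]: "f \<in> borel_measurable borel"
  shows "(\<integral>\<^sup>+c. f (comb (Suc m) b c) \<partial>lpi {..<Suc m})
    = (\<integral>\<^sup>+t. \<integral>\<^sup>+c. f (comb m b c + t *\<^sub>R b m) \<partial>lpi {..<m} \<partial>lborel)"
proof -
  have e: "comb (Suc m) b (x(m := y)) = comb m b x + y *\<^sub>R b m" for x y
    by (simp add: comb_def)
  show ?thesis
    unfolding lessThan_Suc
    by (subst lpi.product_nn_integral_insert_rev)
      (auto simp: e lessThan_Suc[symmetric] intro!: measurable_compose[OF measurable_comb])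
qed

lemma nn_integral_lebesgue_sub_slices:
  assumes E: "subspace E" and b: "onb (E \<inter> {x. x \<bullet> \<eta> = 0}) m b" and \<eta>: "\<eta> \<in> E" "norm \<eta> = 1"
    and f: "f \<in> borel_measurable borel"
  shows "(\<integral>\<^sup>+x. f x \<partial>lebesgue_sub E)
    = (\<integral>\<^sup>+t. \<integral>\<^sup>+y. f (y + t *\<^sub>R \<eta>) \<partial>lebesgue_sub (E \<inter> {x. x \<bullet> \<eta> = 0}) \<partial>lborel)"
proof -
  note f [measurable]
  have c: "comb m (b(m := \<eta>)) = comb m b"
    by (auto simp: comb_def fun_eq_iff)
  have "(\<integral>\<^sup>+x. f x \<partial>lebesgue_sub E)
     = (\<integral>\<^sup>+t. \<integral>\<^sup>+c. f (comb m b c + t *\<^sub>R \<eta>) \<partial>lpi {..<m} \<partial>lborel)"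
    unfolding nn_integral_lebesgue_sub[OF onb_add_normal[OF E b \<eta>] f] nn_integral_comb_Suc[OF f] c by simp
  also have "\<dots> = (\<integral>\<^sup>+t. \<integral>\<^sup>+y. f (y + t *\<^sub>R \<eta>) \<partial>lebesgue_sub (E \<inter> {x. x \<bullet> \<eta> = 0}) \<partial>lborel)"
    by (intro nn_integral_cong nn_integral_lebesgue_sub[OF b, symmetric]) measurable
  finally show ?thesis .
qed

lemma onb_orthogonal_image:
  assumes U: "orthogonal_transformation U" "U ` E = E" and b: "onb E m b"
  shows "onb E m (U \<circ> b)"
proof -
  have lin: "linear U" and inn: "\<And>v w. U v \<bullet> U w = v \<bullet> w"
    using U(1) by (auto simp: orthogonal_transformation_def)
  have "span (U ` (b ` {..<m})) = U ` span (b ` {..<m})" by (rule linear_span_image[OF lin])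
  then show ?thesis using b U(2) inn by (simp add: onb_def image_comp)
qed

lemma lebesgue_sub_orthogonal:
  assumes U: "orthogonal_transformation U" "U ` E = E" and b: "onb E m b" and f: "f \<in> borel_measurable borel"
  shows "(\<integral>\<^sup>+x. f (U x) \<partial>lebesgue_sub E) = (\<integral>\<^sup>+x. f x \<partial>lebesgue_sub E)"
proof -
  have lin: "linear U" using U(1) by (simp add: orthogonal_transformation_def)
  have e: "U (comb m b c) = comb m (U \<circ> b) c" for c
    using lin by (simp add: comb_def linear_sum linear_scale)
  have "U v \<bullet> U v = v \<bullet> v" for v using U(1) by (simp add: orthogonal_transformation_def)
  then have "dist (U x) (U y) = dist x y" for x y
    unfolding dist_norm linear_diff[OF lin, symmetric] norm_eq_sqrt_inner by simp
  then have "continuous_on UNIV U" by (auto simp: continuous_on_iff)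
  then have "U \<in> borel_measurable borel" by (rule borel_measurable_continuous_onI)
  then have "(\<lambda>x. f (U x)) \<in> borel_measurable borel" using f by measurable
  then show ?thesis
    by (simp add: nn_integral_lebesgue_sub[OF b] nn_integral_lebesgue_sub[OF onb_orthogonal_image[OF U b] f] e)
qed

lemma lebesgue_sub_diagonal:
  assumes b: "onb E m b" and s: "\<And>i. i < m \<Longrightarrow> s i > 0" and f: "f \<in> borel_measurable borel"
  shows "ennreal (\<Prod>i<m. s i) * (\<integral>\<^sup>+x. f (comb m b (\<lambda>i. s i * (x \<bullet> b i))) \<partial>lebesgue_sub E) = (\<integral>\<^sup>+x. f x \<partial>lebesgue_sub E)"
proof -
  note f [measurable]
  have [measurable]: "(\<lambda>x. comb m b (\<lambda>i. s i * (x \<bullet> b i))) \<in> borel_measurable borel"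
    unfolding comb_def by measurable
  have e: "comb m b (\<lambda>i\<in>{..<m}. 0 + s i * c i) = comb m b (\<lambda>i. s i * (comb m b c \<bullet> b i))" for c
    by (rule comb_cong) (simp add: comb_inner[OF b])
  have p: "(\<Prod>i<m. ennreal \<bar>s i\<bar>) = ennreal (\<Prod>i<m. s i)"
    using s by (subst prod_ennreal[symmetric]) (auto intro!: prod.cong simp: less_imp_le)
  have "(\<Prod>i<m. ennreal \<bar>s i\<bar>) * (\<integral>\<^sup>+c. f (comb m b (\<lambda>i\<in>{..<m}. 0 + s i * c i)) \<partial>lpi {..<m})
     = (\<integral>\<^sup>+c. f (comb m b c) \<partial>lpi {..<m})"
    by (rule nn_integral_lpi_affine) (use s in \<open>auto simp: less_imp_neq[symmetric]\<close>)
  then show ?thesis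
    unfolding p e by (subst (1 2) nn_integral_lebesgue_sub[OF b]) measurable
qed

text \<open>The push-forward of Lebesgue measure under \<open>T\<close> is again
  translation-invariant, hence proportional to it. This takes the place of determinants; the factor
  is evaluated for diagonal maps by \<open>diag_map_modulus\<close>.\<close>

lemma lebesgue_sub_linear:
  assumes b: "onb E m b" and T: "linear T" "bij_betw T E E"
  shows "\<exists>\<kappa>>0. \<forall>f\<in>borel_measurable borel.
    (\<integral>\<^sup>+x. f (T x) \<partial>lebesgue_sub E) = ennreal \<kappa> * (\<integral>\<^sup>+x. f x \<partial>lebesgue_sub E)"
proof -
  let ?N = "lebesgue_sub E"
  note sp = space_lebesgue_sub[OF b] and st = sets_lebesgue_sub[OF b]
  have E: "subspace E" using onb_subspace[OF b] .
  have TE: "T x \<in> E" if "x \<in> E" for x using T(2) that by (auto simp: bij_betw_def)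
  define T' where "T' = inv_into E T"
  have T'E: "T' x \<in> E" if "x \<in> E" for x
    using T(2) that unfolding T'_def bij_betw_def by (metis inv_into_into)
  have TT': "T (T' x) = x" if "x \<in> E" for x
    using T(2) that unfolding T'_def bij_betw_def by (metis f_inv_into_f)
  have T'T: "T' (T x) = x" if "x \<in> E" for x
    using T(2) that unfolding T'_def bij_betw_def by (metis inv_into_f_f)
  \<comment> \<open>A linear map of the infinite-dimensional ambient space need not be continuous,
    so \<open>T\<close> and its inverse are shown to be measurable on \<open>E\<close> through their
    expressions in coordinates.\<close>
  have lin_meas: "S \<in> ?N \<rightarrow>\<^sub>M restrict_space borel E"
    if S: "\<And>x. x \<in> E \<Longrightarrow> S x \<in> E"
      "\<And>c. S (comb m b c) = comb m (S \<circ> b) c" for S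
  proof (rule measurable_restrict_space2)
    have "(\<lambda>x. comb m (S \<circ> b) (\<lambda>i. x \<bullet> b i)) \<in> borel_measurable borel"
      unfolding comb_def by measurable
    then have "(\<lambda>x. comb m (S \<circ> b) (\<lambda>i. x \<bullet> b i)) \<in> borel_measurable ?N"
      by (rule measurable_lebesgue_sub[OF b])
    moreover have "comb m (S \<circ> b) (\<lambda>i. x \<bullet> b i) = S x" if "x \<in> space ?N" for x
      using S(2)[of "\<lambda>i. x \<bullet> b i"] onb_expand[OF b] that sp by simp
    ultimately show "S \<in> borel_measurable ?N" by (simp cong: measurable_cong)
  qed (use S sp in auto)
  have Tc: "T (comb m b c) = comb m (T \<circ> b) c" for c
    using T(1) by (simp add: comb_def linear_sum linear_scale)
  have T'c: "T' (comb m b c) = comb m (T' \<circ> b) c" for c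
  proof -
    have "T (comb m (T' \<circ> b) c) = comb m b c"
      using T(1) TT' onb_in[OF b] by (simp add: comb_def linear_sum linear_scale)
    moreover have "comb m (T' \<circ> b) c \<in> E"
      unfolding comb_def using T'E onb_in[OF b] E by (intro subspace_sum subspace_scale) auto
    ultimately show ?thesis using T'T by metis
  qed
  have Tm: "T \<in> ?N \<rightarrow>\<^sub>M restrict_space borel E" by (rule lin_meas) (use TE Tc in auto)
  have T'm: "T' \<in> ?N \<rightarrow>\<^sub>M restrict_space borel E" by (rule lin_meas) (use T'E T'c in auto)
  have T'm0: "T' \<in> restrict_space borel E \<rightarrow>\<^sub>M restrict_space borel E"
    using T'm unfolding measurable_cong_sets[OF st refl] .
  define M where "M = distr ?N (restrict_space borel E) T"
  have sM: "sets M = sets (restrict_space borel E)" by (simp add: M_def)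
  have M_int: "(\<integral>\<^sup>+x. f x \<partial>M) = (\<integral>\<^sup>+x. f (T x) \<partial>?N)" if "f \<in> borel_measurable borel" for f :: "fseq \<Rightarrow> ennreal"
    unfolding M_def using that by (subst nn_integral_distr[OF Tm]) (auto intro: measurable_restrict_borel)
  have MT': "distr M (restrict_space borel E) T' = ?N"
  proof -
    have "distr M (restrict_space borel E) T' = distr ?N (restrict_space borel E) (T' \<circ> T)"
      unfolding M_def by (rule distr_distr[OF T'm0 Tm])
    also have "\<dots> = distr ?N ?N (\<lambda>x. x)"
      using T'T sp st by (intro distr_cong) auto
    also have "\<dots> = ?N" by (rule distr_id2) simp
    finally show ?thesis .
  qed
  have T'M: "T' \<in> M \<rightarrow>\<^sub>M restrict_space borel E"
    unfolding measurable_cong_sets[OF sM refl] by (rule T'm0)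
  have sfM: "sigma_finite_measure M"
    by (rule sigma_finite_measure_distr[of _ "restrict_space borel E" T'])
      (simp_all only: MT' T'M sigma_finite_lebesgue_sub[OF b])
  have Minv: "(\<integral>\<^sup>+x. f (x + y) \<partial>M) = (\<integral>\<^sup>+x. f x \<partial>M)"
    if f: "f \<in> borel_measurable borel" and y: "y \<in> E" for f y
  proof -
    note f [measurable]
    have m': "(\<lambda>x. comb m (T \<circ> b) (\<lambda>i. x \<bullet> b i)) \<in> borel_measurable borel"
      unfolding comb_def by measurable
    have e: "T x = comb m (T \<circ> b) (\<lambda>i. x \<bullet> b i)" if "x \<in> E" for x
      using Tc[of "\<lambda>i. x \<bullet> b i"] onb_expand[OF b that] by simp
    let ?f = "\<lambda>x. f (comb m (T \<circ> b) (\<lambda>i. x \<bullet> b i))"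
    have "(\<integral>\<^sup>+x. f (x + y) \<partial>M) = (\<integral>\<^sup>+x. f (T x + y) \<partial>?N)" by (rule M_int) measurable
    also have "\<dots> = (\<integral>\<^sup>+x. ?f (x + T' y) \<partial>?N)"
    proof (rule nn_integral_cong)
      fix x assume x: "x \<in> space ?N"
      have "T (x + T' y) = T x + y" using TT'[OF y] T(1) by (simp add: linear_add)
      moreover have "x + T' y \<in> E" using x sp T'E[OF y] E by (auto intro: subspace_add)
      ultimately show "f (T x + y) = ?f (x + T' y)" using e by metis
    qed
    also have "\<dots> = (\<integral>\<^sup>+x. ?f x \<partial>?N)"
      by (rule lebesgue_sub_translation[OF b measurable_compose[OF m' f] T'E[OF y]])
    also have "\<dots> = (\<integral>\<^sup>+x. f (T x) \<partial>?N)" using e sp by (intro nn_integral_cong) auto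
    finally show ?thesis using M_int[OF f] by simp
  qed
  let ?B = "cball (0::fseq) 1"
  let ?m = "emeasure ?N (?B \<inter> E)"
  have gm: "indicator ?B \<in> borel_measurable (borel :: fseq measure)" by (intro borel_measurable_indicator) simp
  have IN: "(\<integral>\<^sup>+y. indicator ?B y \<partial>?N) = ?m"
  proof -
    have "(\<integral>\<^sup>+y. indicator ?B y \<partial>?N) = (\<integral>\<^sup>+y. indicator (?B \<inter> E) y \<partial>?N)"
      using sp by (intro nn_integral_cong) (auto simp: indicator_def)
    also have "\<dots> = ?m" by (intro nn_integral_indicator in_sets_lebesgue_sub[OF b]) (auto intro: borel_closed closed_Int closed_onb[OF b])
    finally show ?thesis .
  qed
  have refl': "indicator ?B (- x) = (indicator ?B x :: ennreal)" for x by (simp add: indicator_def)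
  \<comment> \<open>The mass that the push-forward gives to the unit ball. The factor sought is
    \<open>k\<close> divided by the Lebesgue measure of the ball, so \<open>k\<close> must be
    neither 0 nor infinite.\<close>
  define k where "k = (\<integral>\<^sup>+x. indicator ?B x \<partial>M)"
  have key: "(\<integral>\<^sup>+x. f (T x) \<partial>?N) * ?m = (\<integral>\<^sup>+y. f y \<partial>?N) * k"
    if f: "f \<in> borel_measurable borel" for f
    using translation_invariant_unique[OF E sfM sM sigma_finite_lebesgue_sub[OF b] st Minv lebesgue_sub_translation[OF b] f gm]
    by (simp only: M_int[OF f] IN refl' k_def)
  note mm = lebesgue_sub_ball_pos_fin[OF b, of 1]
  have k0: "k \<noteq> 0"
  proof
    assume "k = 0"
    have "(\<integral>\<^sup>+x. 1 \<partial>?N) * ?m = (\<integral>\<^sup>+y. 1 \<partial>?N) * k" by (rule key) simp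
    then have "emeasure ?N (space ?N) * ?m = 0" using \<open>k = 0\<close> by simp
    moreover have "?m \<le> emeasure ?N (space ?N)" using sp by (intro emeasure_space)
    ultimately show False using mm by (auto simp: le_zero_eq)
  qed
  have kfin: "k \<noteq> \<infinity>"
  proof
    assume k: "k = \<infinity>"
    \<comment> \<open>On \<open>E\<close> this is the indicator of the image of the unit ball under
      \<open>T\<close>. It pulls back to the ball itself, whose measure is positive and finite,
      which an infinite \<open>k\<close> would contradict.\<close>
    define q where "q = (\<lambda>x. indicator ?B (comb m (T' \<circ> b) (\<lambda>i. x \<bullet> b i)) :: ennreal)"
    have [measurable]: "(\<lambda>x. comb m (T' \<circ> b) (\<lambda>i. x \<bullet> b i)) \<in> borel_measurable borel"
      unfolding comb_def by measurable
    have qm: "q \<in> borel_measurable borel" unfolding q_def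
      by (rule measurable_compose[OF _ gm]) measurable
    have "q (T x) = indicator ?B x" if "x \<in> E" for x
    proof -
      have "comb m (T' \<circ> b) (\<lambda>i. T x \<bullet> b i) = T' (T x)"
        using T'c[of "\<lambda>i. T x \<bullet> b i"] onb_expand[OF b TE[OF that]] by simp
      then show ?thesis using T'T[OF that] by (simp add: q_def)
    qed
    then have "(\<integral>\<^sup>+x. q (T x) \<partial>?N) = ?m" unfolding IN[symmetric] using sp by (intro nn_integral_cong) auto
    then have e: "?m * ?m = (\<integral>\<^sup>+y. q y \<partial>?N) * \<infinity>" using key[OF qm] k by simp
    have "?m * ?m < \<infinity>" using mm by (simp add: ennreal_mult_less_top)
    moreover have "?m * ?m \<noteq> 0" using mm by simp
    ultimately show False using e by (cases "(\<integral>\<^sup>+y. q y \<partial>?N) = 0") (auto simp: ennreal_mult_top)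
  qed
  define m' k' where "m' = enn2real ?m" and "k' = enn2real k"
  have m': "?m = ennreal m'" "0 < m'"
    using mm by (simp_all add: m'_def enn2real_positive_iff)
  have k': "k = ennreal k'" "0 < k'"
    using k0 kfin by (simp_all add: k'_def enn2real_positive_iff less_top zero_less_iff_neq_zero)
  have "(\<integral>\<^sup>+x. f (T x) \<partial>?N) = ennreal (k' / m') * (\<integral>\<^sup>+x. f x \<partial>?N)" if f: "f \<in> borel_measurable borel" for f
  proof (rule ennreal_mult_right_cancel)
    have "ennreal (k' / m') * ennreal m' = ennreal k'"
      using m' k' by (simp flip: ennreal_mult)
    then have "(ennreal (k' / m') * (\<integral>\<^sup>+x. f x \<partial>?N)) * ?m = (\<integral>\<^sup>+x. f x \<partial>?N) * k"
      unfolding m'(1) k'(1) by (metis mult.assoc mult.commute)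
    then show "(\<integral>\<^sup>+x. f (T x) \<partial>?N) * ?m = (ennreal (k' / m') * (\<integral>\<^sup>+x. f x \<partial>?N)) * ?m"
      using key[OF f] by simp
  qed (use mm in auto)
  then show ?thesis using m'(2) k'(2) by (intro exI[of _ "k' / m'"]) auto
qed

section \<open>Sections of convex bodies\<close>

text \<open>The section function of \<open>K\<close>: the volume of the section by the affine
  subspace through \<open>v\<close> parallel to \<open>W\<close>, moved back into \<open>W\<close>.
  Letting \<open>v\<close> range over the whole space makes it one function whose log-concavity can
  be stated; \<open>v = 0\<close> gives the central section.\<close>

definition slice :: "fseq set \<Rightarrow> fseq set \<Rightarrow> fseq \<Rightarrow> real" where
  "slice W K v = measure (lebesgue_sub W) {y \<in> W. v + y \<in> K}"

lemma slice_set_borel: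
  assumes "onb W m b" "K \<in> sets borel"
  shows "{y \<in> W. v + y \<in> K} \<in> sets borel"
proof -
  note assms(2) [measurable]
  have "W \<in> sets borel" using closed_onb[OF assms(1)] by (rule borel_closed)
  moreover have "{y. v + y \<in> K} \<in> sets borel"
    using measurable_sets_borel[of "\<lambda>y. v + y" borel K] assms(2) by (simp add: vimage_def)
  moreover have "{y \<in> W. v + y \<in> K} = W \<inter> {y. v + y \<in> K}" by auto
  ultimately show ?thesis by simp
qed

text \<open>Each coordinate of a point of the set ranges over an interval of length
  \<open>2 * R\<close>. The bound does not depend on \<open>v\<close>, \<open>W\<close> or the basis
  and is what dominates the limits below.\<close>

lemma emeasure_slice_le:
  assumes b: "onb W m b" and K: "K \<in> sets borel" "\<And>x. x \<in> K \<Longrightarrow> norm x \<le> R" and R: "0 \<le> R"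
  shows "emeasure (lebesgue_sub W) {y \<in> W. v + y \<in> K} \<le> ennreal ((2 * R) ^ m)"
proof -
  have "emeasure (lebesgue_sub W) {y \<in> W. v + y \<in> K}
      = emeasure (lpi {..<m}) {c \<in> space (lpi {..<m}). comb m b c \<in> {y \<in> W. v + y \<in> K}}"
    by (rule emeasure_lebesgue_sub_coord[OF b slice_set_borel[OF b K(1)]]) auto
  also have "\<dots> \<le> emeasure (lpi {..<m}) (Pi\<^sub>E {..<m} (\<lambda>i. {- (v \<bullet> b i) - R..- (v \<bullet> b i) + R}))"
  proof (rule emeasure_mono)
    show "{c \<in> space (lpi {..<m}). comb m b c \<in> {y \<in> W. v + y \<in> K}} \<subseteq> Pi\<^sub>E {..<m} (\<lambda>i. {- (v \<bullet> b i) - R..- (v \<bullet> b i) + R})"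
    proof
      fix c assume c: "c \<in> {c \<in> space (lpi {..<m}). comb m b c \<in> {y \<in> W. v + y \<in> K}}"
      have "\<bar>v \<bullet> b i + c i\<bar> \<le> R" if i: "i < m" for i
      proof -
        have "\<bar>(v + comb m b c) \<bullet> b i\<bar> \<le> norm (v + comb m b c)"
          using Cauchy_Schwarz_ineq2[of "v + comb m b c" "b i"] onb_norm[OF b i] by simp
        also have "\<dots> \<le> R" using c K(2) by auto
        finally show ?thesis by (simp add: inner_add_left comb_inner[OF b i])
      qed
      then have "c i \<in> {- (v \<bullet> b i) - R..- (v \<bullet> b i) + R}" if "i < m" for i
        using that unfolding abs_le_iff atLeastAtMost_iff by (smt (verit))
      then show "c \<in> Pi\<^sub>E {..<m} (\<lambda>i. {- (v \<bullet> b i) - R..- (v \<bullet> b i) + R})"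
        using c by (simp add: space_PiM PiE_iff)
    qed
  qed (intro sets_PiM_I_finite, auto)
  also have "\<dots> = ennreal ((2 * R) ^ m)" using R by (subst emeasure_lpi_box) auto
  finally show ?thesis .
qed

lemma slice_nonneg [simp]: "0 \<le> slice W K v" by (simp add: slice_def)

lemma emeasure_slice:
  assumes b: "onb W m b" and K: "K \<in> sets borel" "\<And>x. x \<in> K \<Longrightarrow> norm x \<le> R" and R: "0 \<le> R"
  shows "emeasure (lebesgue_sub W) {y \<in> W. v + y \<in> K} = ennreal (slice W K v)" "slice W K v \<le> (2 * R) ^ m"
proof -
  have "ennreal ((2 * R) ^ m) \<noteq> \<top>" by (rule ennreal_neq_top)
  then have "emeasure (lebesgue_sub W) {y \<in> W. v + y \<in> K} \<noteq> \<top>"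
    using emeasure_slice_le[OF b K R, of v] by (metis top_unique)
  then show e: "emeasure (lebesgue_sub W) {y \<in> W. v + y \<in> K} = ennreal (slice W K v)"
    unfolding slice_def by (rule emeasure_eq_ennreal_measure)
  then show "slice W K v \<le> (2 * R) ^ m"
    using emeasure_slice_le[OF b K R, of v] R by (simp add: ennreal_le_iff)
qed

lemma slice_add_normal:
  assumes E: "subspace E" and b: "onb (E \<inter> {x. x \<bullet> \<eta> = 0}) m b" and \<eta>: "\<eta> \<in> E" "norm \<eta> = 1"
    and K: "K \<in> sets borel" "\<And>x. x \<in> K \<Longrightarrow> norm x \<le> R" and R: "0 \<le> R"
  shows "ennreal (slice E K v) = (\<integral>\<^sup>+t. ennreal (slice (E \<inter> {x. x \<bullet> \<eta> = 0}) K (v + t *\<^sub>R \<eta>)) \<partial>lborel)"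
proof -
  note b1 = onb_add_normal[OF E b \<eta>]
  have "ennreal (slice E K v) = (\<integral>\<^sup>+x. indicator {y \<in> E. v + y \<in> K} x \<partial>lebesgue_sub E)"
    using emeasure_slice(1)[OF b1 K R, of v] emeasure_lebesgue_sub[OF b1 slice_set_borel[OF b1 K(1)], of v] by simp
  also have "\<dots> = (\<integral>\<^sup>+t. \<integral>\<^sup>+y. indicator {y \<in> E. v + y \<in> K} (y + t *\<^sub>R \<eta>) \<partial>lebesgue_sub (E \<inter> {x. x \<bullet> \<eta> = 0}) \<partial>lborel)"
    by (rule nn_integral_lebesgue_sub_slices[OF E b \<eta>]) (intro borel_measurable_indicator slice_set_borel[OF b1 K(1)])
  also have "\<dots> = (\<integral>\<^sup>+t. ennreal (slice (E \<inter> {x. x \<bullet> \<eta> = 0}) K (v + t *\<^sub>R \<eta>)) \<partial>lborel)"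
  proof (rule nn_integral_cong)
    fix t
    let ?W = "E \<inter> {x. x \<bullet> \<eta> = 0}"
    have "(\<integral>\<^sup>+y. indicator {y \<in> E. v + y \<in> K} (y + t *\<^sub>R \<eta>) \<partial>lebesgue_sub ?W)
       = (\<integral>\<^sup>+y. indicator {y \<in> ?W. (v + t *\<^sub>R \<eta>) + y \<in> K} y \<partial>lebesgue_sub ?W)"
      using \<eta>(1) E by (intro nn_integral_cong)
        (auto simp: space_lebesgue_sub[OF b] indicator_def add_ac subspace_add subspace_scale)
    also have "\<dots> = emeasure (lebesgue_sub ?W) {y \<in> ?W. (v + t *\<^sub>R \<eta>) + y \<in> K}"
      by (rule emeasure_lebesgue_sub[OF b slice_set_borel[OF b K(1)], symmetric]) auto
    also have "\<dots> = ennreal (slice ?W K (v + t *\<^sub>R \<eta>))" by (rule emeasure_slice(1)[OF b K R])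
    finally show "(\<integral>\<^sup>+y. indicator {y \<in> E. v + y \<in> K} (y + t *\<^sub>R \<eta>) \<partial>lebesgue_sub ?W)
       = ennreal (slice ?W K (v + t *\<^sub>R \<eta>))" .
  qed
  finally show ?thesis .
qed

lemma slice_support:
  assumes "\<And>x. x \<in> W \<Longrightarrow> x \<bullet> \<eta> = 0" "norm \<eta> = 1" "\<And>x. x \<in> K \<Longrightarrow> norm x \<le> R"
    and "slice W K (v + t *\<^sub>R \<eta>) \<noteq> 0"
  shows "\<bar>t\<bar> \<le> R + norm v"
proof -
  have "{y \<in> W. v + t *\<^sub>R \<eta> + y \<in> K} \<noteq> {}"
    using assms(4) unfolding slice_def by (metis measure_empty)
  then obtain y where y: "y \<in> W" "v + t *\<^sub>R \<eta> + y \<in> K" by blast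
  have "\<bar>v \<bullet> \<eta> + t\<bar> = \<bar>(v + t *\<^sub>R \<eta> + y) \<bullet> \<eta>\<bar>"
    using assms(1)[OF y(1)] assms(2) by (simp add: inner_add_left norm_eq_1)
  also have "\<dots> \<le> norm (v + t *\<^sub>R \<eta> + y)" using Cauchy_Schwarz_ineq2[of _ \<eta>] assms(2) by simp
  also have "\<dots> \<le> R" using assms(3) y by simp
  moreover have "\<bar>v \<bullet> \<eta>\<bar> \<le> norm v" using Cauchy_Schwarz_ineq2[of v \<eta>] assms(2) by simp
  ultimately show ?thesis by linarith
qed

lemma slice_zero:
  assumes b: "onb W 0 b"
  shows "slice W K v = indicator K v"
proof -
  have W: "W = {0}" using b by (simp add: onb_def)
  have "emeasure (lebesgue_sub W) {y \<in> W. v + y \<in> K} = indicator K v"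
  proof (cases "v \<in> K")
    case True
    then have e: "{y \<in> W. v + y \<in> K} = {0}" using W by auto
    have "emeasure (lebesgue_sub W) {0} = emeasure (lpi {..<0}) {c \<in> space (lpi {..<0}). comb 0 b c \<in> {0}}"
      by (rule emeasure_lebesgue_sub_coord[OF b]) (auto simp: W)
    also have "{c \<in> space (lpi {..<0}). comb 0 b c \<in> {0}} = Pi\<^sub>E {} (\<lambda>_. UNIV)" by (auto simp: comb_def space_PiM)
    also have "emeasure (lpi {..<0}) \<dots> = 1" by (simp add: PiM_empty)
    finally show ?thesis using True e by simp
  next
    case False
    then have "{y \<in> W. v + y \<in> K} = {}" using W by auto
    then show ?thesis using False by (simp only: emeasure_empty) simp
  qed
  then show ?thesis by (simp add: slice_def measure_def indicator_def)
qed

text \<open>The Brunn-Minkowski theorem for sections, by induction on the dimension of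
  \<open>W\<close>: for \<open>W = {0}\<close> the section function is the indicator of
  \<open>K\<close>, and every further basis vector of \<open>W\<close> is integrated out by
  \<open>log_concave_marginal\<close>.\<close>

lemma slice_log_concave:
  assumes b: "onb W m b" and K: "compact K" "convex K"
  shows "log_concave (slice W K)"
  using b
proof (induction m arbitrary: W)
  case 0
  then have "slice W K = indicat_real K" by (intro ext slice_zero)
  then show ?case using log_concave_indicator[OF K(2)] by simp
next
  case (Suc m)
  let ?\<eta> = "b m"
  let ?W = "W \<inter> {x. x \<bullet> ?\<eta> = 0}"
  have W: "subspace W" using onb_subspace[OF Suc.prems] .
  have \<eta>: "?\<eta> \<in> W" "norm ?\<eta> = 1" using onb_in[OF Suc.prems] onb_norm[OF Suc.prems] by auto
  have "span (b ` {..<m}) = ?W"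
  proof
    show "span (b ` {..<m}) \<subseteq> ?W"
      using onb_in[OF Suc.prems] onb_inner[OF Suc.prems]
      by (intro span_minimal subspace_hyperplane_Int W) auto
    show "?W \<subseteq> span (b ` {..<m})"
    proof
      fix x assume x: "x \<in> ?W"
      then have "x = comb (Suc m) b (\<lambda>i. x \<bullet> b i)" using onb_expand[OF Suc.prems] by simp
      also have "\<dots> = (\<Sum>i<m. (x \<bullet> b i) *\<^sub>R b i)" using x by (simp add: comb_def)
      also have "\<dots> \<in> span (b ` {..<m})" by (intro span_sum span_scale span_base) auto
      finally show "x \<in> span (b ` {..<m})" .
    qed
  qed
  then have b: "onb ?W m b" using Suc.prems by (auto simp: onb_def)
  obtain R where R: "\<And>x. x \<in> K \<Longrightarrow> norm x \<le> R" "0 \<le> R"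
    using compact_imp_bounded[OF K(1)] unfolding bounded_pos by (meson less_imp_le)
  have Kb: "K \<in> sets borel" using compact_imp_closed[OF K(1)] by (rule borel_closed)
  have lc: "log_concave (slice ?W K)" by (rule Suc.IH[OF b])
  have supp: "\<bar>t\<bar> \<le> R + norm v" if "slice ?W K (v + t *\<^sub>R ?\<eta>) \<noteq> 0" for v t
    by (rule slice_support[OF _ \<eta>(2) R(1) that]) auto
  have "slice W K v = (\<integral>t. slice ?W K (v + t *\<^sub>R ?\<eta>) \<partial>lborel)" for v
  proof -
    have "(\<integral>t. slice ?W K (v + t *\<^sub>R ?\<eta>) \<partial>lborel) = enn2real (\<integral>\<^sup>+t. ennreal (slice ?W K (v + t *\<^sub>R ?\<eta>)) \<partial>lborel)"
      using log_concave_measurable[OF log_concave_line[OF lc]]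
      by (intro integral_eq_nn_integral) auto
    then show ?thesis
      using slice_add_normal[OF W b \<eta> Kb R, of v] by (metis enn2real_ennreal slice_nonneg)
  qed
  then have "slice W K = (\<lambda>v. \<integral>t. slice ?W K (v + t *\<^sub>R ?\<eta>) \<partial>lborel)" by (rule ext)
  then show ?case
    using log_concave_marginal[OF lc emeasure_slice(2)[OF b Kb R] supp] by simp
qed

section \<open>The invariant measure on the sphere\<close>

lemma emeasure_lebesgue_sub_0:
  assumes b: "onb E m b" and m: "m > 0"
  shows "emeasure (lebesgue_sub E) {0} = 0"
proof -
  have "0 \<in> E" using onb_subspace[OF b] subspace_0 by blast
  then have "emeasure (lebesgue_sub E) {0} = emeasure (lpi {..<m}) {c \<in> space (lpi {..<m}). comb m b c \<in> {0}}"
    by (intro emeasure_lebesgue_sub_coord[OF b]) auto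
  also have "\<dots> \<le> emeasure (lpi {..<m}) (Pi\<^sub>E {..<m} (\<lambda>i. {0..0}))"
  proof (rule emeasure_mono)
    show "{c \<in> space (lpi {..<m}). comb m b c \<in> {0}} \<subseteq> Pi\<^sub>E {..<m} (\<lambda>i. {0..0})"
    proof
      fix c assume c: "c \<in> {c \<in> space (lpi {..<m}). comb m b c \<in> {0}}"
      have "c i = 0" if "i < m" for i using comb_inner[OF b that, of c] c by simp
      then show "c \<in> Pi\<^sub>E {..<m} (\<lambda>i. {0..0})" using c by (auto simp: space_PiM PiE_iff extensional_def)
    qed
  qed (intro sets_PiM_I_finite, auto)
  also have "\<dots> = 0" using m by (subst emeasure_lpi_box) auto
  finally show ?thesis by simp
qed

lemma norm_orthogonal: "orthogonal_transformation U \<Longrightarrow> norm (U x) = norm x"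
  by (simp add: orthogonal_transformation_def norm_eq_sqrt_inner)

lemma borel_orthogonal:
  fixes U :: "fseq \<Rightarrow> fseq"
  assumes "orthogonal_transformation U"
  shows "U \<in> borel_measurable borel"
proof (rule borel_measurable_continuous_onI)
  have "linear U" using assms by (simp add: orthogonal_transformation_def)
  then have "dist (U x) (U y) = dist x y" for x y
    unfolding dist_norm using norm_orthogonal[OF assms, of "x - y"] by (simp add: linear_diff)
  then show "continuous_on UNIV U" by (auto simp: continuous_on_iff)
qed

text \<open>Normalised Lebesgue measure on the ball, pushed to the sphere by radial projection,
  inherits invariance under orthogonal maps. Existence is what gives the choice in
  \<open>sphere_measure\<close> its defining property.\<close>

lemma ex_rotation_invariant_prob:
  assumes b: "onb E m b" and m: "m > 0"
  shows "\<exists>\<sigma>. rotation_invariant_prob E \<sigma>"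
proof -
  let ?\<mu> = "lebesgue_sub E" and ?S = "sphere 0 1 \<inter> E"
  define u where "u = b 0"
  have u: "u \<in> E" "norm u = 1" using onb_in[OF b m] onb_norm[OF b m] by (auto simp: u_def)
  have E: "subspace E" using onb_subspace[OF b] .
  have Eb: "E \<in> sets borel" using closed_onb[OF b] by (rule borel_closed)
  define B where "B = cball 0 1 \<inter> E - {0}"
  have Bb [measurable]: "B \<in> sets borel" using Eb by (simp add: B_def)
  have BE: "B \<subseteq> E" by (auto simp: B_def)
  have Bs: "B \<in> sets ?\<mu>" by (rule in_sets_lebesgue_sub[OF b Bb BE])
  have "emeasure ?\<mu> (cball 0 1 \<inter> E) \<le> emeasure ?\<mu> (B \<union> {0})"
    using Bs in_sets_lebesgue_sub[OF b, of "{0}"] subspace_0[OF E]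
    by (intro emeasure_mono sets.Un) (auto simp: B_def)
  also have "\<dots> \<le> emeasure ?\<mu> B + emeasure ?\<mu> {0}"
    using Bs in_sets_lebesgue_sub[OF b, of "{0}"] subspace_0[OF E] by (intro emeasure_subadditive) auto
  finally have Bpos: "0 < emeasure ?\<mu> B"
    using lebesgue_sub_ball_pos_fin(1)[OF b zero_less_one] emeasure_lebesgue_sub_0[OF b m] by (metis add.right_neutral less_le_trans)
  have "emeasure ?\<mu> B \<le> emeasure ?\<mu> (cball 0 1 \<inter> E)"
    using Eb by (intro emeasure_mono in_sets_lebesgue_sub[OF b]) (auto simp: B_def)
  then have Bfin: "emeasure ?\<mu> B < \<infinity>" using lebesgue_sub_ball_pos_fin(2)[OF b zero_less_one] by (rule le_less_trans)
  define N where "N = density ?\<mu> (\<lambda>x. indicator B x / emeasure ?\<mu> B)"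
  \<comment> \<open>The value \<open>u\<close> off \<open>E - {0}\<close> keeps all values of
    \<open>p\<close> in the sphere; the density of \<open>N\<close> vanishes there, since 0 has been
    taken out of \<open>B\<close>.\<close>
  define p where "p = (\<lambda>x. if x \<in> E - {0} then x /\<^sub>R norm x else u)"
  have pm [measurable]: "p \<in> borel_measurable borel" unfolding p_def using Eb by measurable
  have pS: "p x \<in> ?S" for x using u E by (auto simp: p_def subspace_scale)
  have ind: "(\<lambda>x. indicator B x / emeasure ?\<mu> B) \<in> borel_measurable ?\<mu>"
    by (rule measurable_lebesgue_sub[OF b]) measurable
  have "emeasure N (space N) = (\<integral>\<^sup>+x. indicator B x / emeasure ?\<mu> B \<partial>?\<mu>)"
    unfolding N_def by (subst emeasure_density[OF ind]) (auto intro!: nn_integral_cong simp: indicator_def)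
  also have "\<dots> = emeasure ?\<mu> B / emeasure ?\<mu> B"
    using Bs by (simp add: nn_integral_divide)
  also have "\<dots> = 1" using Bpos Bfin by (simp add: ennreal_divide_self)
  finally have N: "prob_space N" by (rule prob_spaceI)
  have sN: "sets N = sets (restrict_space borel E)" unfolding N_def by (simp add: sets_lebesgue_sub[OF b])
  have pN: "p \<in> N \<rightarrow>\<^sub>M restrict_space borel ?S"
    unfolding measurable_cong_sets[OF sN refl]
    using pS by (intro measurable_restrict_space2 measurable_restrict_space1 pm) auto
  define \<sigma> where "\<sigma> = distr N (restrict_space borel ?S) p"
  have s\<sigma>: "sets \<sigma> = sets (restrict_space borel ?S)" by (simp add: \<sigma>_def)
  have sp\<sigma>: "space \<sigma> = ?S" by (simp add: \<sigma>_def space_restrict_space)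
  have int: "(\<integral>\<^sup>+x. q x \<partial>\<sigma>) = (\<integral>\<^sup>+x. (indicator B x / emeasure ?\<mu> B) * q (p x) \<partial>?\<mu>)"
    if q: "q \<in> borel_measurable borel" for q
  proof -
    note q [measurable]
    have "(\<integral>\<^sup>+x. q x \<partial>\<sigma>) = (\<integral>\<^sup>+x. q (p x) \<partial>N)"
      unfolding \<sigma>_def by (rule nn_integral_distr[OF pN]) (simp add: measurable_restrict_space1)
    also have "\<dots> = (\<integral>\<^sup>+x. (indicator B x / emeasure ?\<mu> B) * q (p x) \<partial>?\<mu>)"
      unfolding N_def by (rule nn_integral_density[OF ind]) (rule measurable_lebesgue_sub[OF b], measurable)
    finally show ?thesis .
  qed
  have "distr \<sigma> \<sigma> U = \<sigma>" if U: "orthogonal_transformation U" "U ` E = E" for U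
  proof (rule measure_eqI)
    fix A assume "A \<in> sets (distr \<sigma> \<sigma> U)"
    then have As: "A \<in> sets \<sigma>" by simp
    then have "A \<in> (\<inter>) ?S ` sets borel" unfolding s\<sigma> sets_restrict_space .
    then obtain A' where A': "A' \<in> sets borel" "A = ?S \<inter> A'" by blast
    have Ub [measurable]: "U \<in> borel_measurable borel" by (rule borel_orthogonal[OF U(1)])
    have US: "U x \<in> ?S" if "x \<in> ?S" for x
      using that U norm_orthogonal[OF U(1), of x] by auto
    have Um: "U \<in> \<sigma> \<rightarrow>\<^sub>M \<sigma>"
      unfolding measurable_cong_sets[OF s\<sigma> s\<sigma>]
      using US by (intro measurable_restrict_space2 measurable_restrict_space1 Ub) (auto simp: space_restrict_space)
    have eA: "emeasure \<sigma> A = (\<integral>\<^sup>+x. indicator A' x \<partial>\<sigma>)"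
    proof -
      have "(\<integral>\<^sup>+x. indicator A' x \<partial>\<sigma>) = (\<integral>\<^sup>+x. indicator A x \<partial>\<sigma>)"
        using A' sp\<sigma> by (intro nn_integral_cong) (auto simp: indicator_def)
      then show ?thesis using As by simp
    qed
    let ?h = "\<lambda>x. (indicator B x / emeasure ?\<mu> B) * indicator A' (p x)"
    have [measurable]: "A' \<in> sets borel" by fact
    have "emeasure (distr \<sigma> \<sigma> U) A = (\<integral>\<^sup>+x. indicator A x \<partial>distr \<sigma> \<sigma> U)" using As by simp
    also have "\<dots> = (\<integral>\<^sup>+x. indicator A (U x) \<partial>\<sigma>)" by (rule nn_integral_distr[OF Um]) (use As in simp)
    also have "\<dots> = (\<integral>\<^sup>+x. indicator A' (U x) \<partial>\<sigma>)"
      using A' US sp\<sigma> by (intro nn_integral_cong) (auto simp: indicator_def)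
    also have "\<dots> = (\<integral>\<^sup>+x. (indicator B x / emeasure ?\<mu> B) * indicator A' (U (p x)) \<partial>?\<mu>)"
      by (rule int) measurable
    also have "\<dots> = (\<integral>\<^sup>+x. ?h (U x) \<partial>?\<mu>)"
    proof (rule nn_integral_cong)
      fix x assume x: "x \<in> space ?\<mu>"
      then have xE: "x \<in> E" by (simp add: space_lebesgue_sub[OF b])
      have lin: "linear U" using U(1) by (simp add: orthogonal_transformation_def)
      have UE: "U x \<in> E" using xE U(2) by blast
      have nU: "norm (U x) = norm x" using norm_orthogonal[OF U(1)] .
      have U0: "U x = 0 \<longleftrightarrow> x = 0" using nU by (metis norm_eq_zero)
      have iB: "indicator B (U x) = (indicator B x :: ennreal)" using xE UE nU U0 by (simp add: B_def indicator_def)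
      have "p (U x) = U (p x)" if "x \<noteq> 0"
        using that xE UE nU U0 lin by (simp add: p_def linear_scale)
      then show "(indicator B x / emeasure ?\<mu> B) * indicator A' (U (p x)) = ?h (U x)"
        unfolding iB by (cases "x = 0") (auto simp: B_def)
    qed
    also have "\<dots> = (\<integral>\<^sup>+x. ?h x \<partial>?\<mu>)" by (rule lebesgue_sub_orthogonal[OF U b]) measurable
    also have "\<dots> = emeasure \<sigma> A" unfolding eA by (rule int[symmetric]) measurable
    finally show "emeasure (distr \<sigma> \<sigma> U) A = emeasure \<sigma> A" .
  qed simp
  moreover have "prob_space \<sigma>" unfolding \<sigma>_def by (rule prob_space.prob_space_distr[OF N pN])
  ultimately show ?thesis using s\<sigma> unfolding rotation_invariant_prob_def by blast
qed

lemma rotation_invariant_sphere_measure: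
  "onb E m b \<Longrightarrow> m > 0 \<Longrightarrow> rotation_invariant_prob E (sphere_measure E)"
  unfolding sphere_measure_def by (rule someI_ex) (rule ex_rotation_invariant_prob)

lemma
  assumes b: "onb E m b" and m: "m > 0"
  shows prob_sphere_measure: "prob_space (sphere_measure E)"
    and space_sphere_measure: "space (sphere_measure E) = sphere 0 1 \<inter> E"
    and measurable_sphere_measure: "\<And>f N. f \<in> borel \<rightarrow>\<^sub>M N \<Longrightarrow> f \<in> sphere_measure E \<rightarrow>\<^sub>M N"
    and sphere_measure_orthogonal: "\<And>f U. f \<in> borel_measurable borel \<Longrightarrow> orthogonal_transformation U \<Longrightarrow> U ` E = E \<Longrightarrow>
      (\<integral>\<^sup>+x. f (U x) \<partial>sphere_measure E) = (\<integral>\<^sup>+x. (f x :: ennreal) \<partial>sphere_measure E)"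
proof -
  let ?\<sigma> = "sphere_measure E" and ?S = "sphere 0 1 \<inter> E"
  note R = rotation_invariant_sphere_measure[OF assms, unfolded rotation_invariant_prob_def]
  show "prob_space ?\<sigma>" using R by blast
  have s: "sets ?\<sigma> = sets (restrict_space borel ?S)" using R by blast
  show sp: "space ?\<sigma> = ?S" using sets_eq_imp_space_eq[OF s] by (simp add: space_restrict_space)
  show meas: "f \<in> ?\<sigma> \<rightarrow>\<^sub>M N" if "f \<in> borel \<rightarrow>\<^sub>M N" for f and N :: "'z measure"
    unfolding measurable_cong_sets[OF s refl] by (rule measurable_restrict_space1[OF that])
  fix f :: "fseq \<Rightarrow> ennreal" and U assume f: "f \<in> borel_measurable borel" and U: "orthogonal_transformation U" "U ` E = E"
  have "U x \<in> ?S" if "x \<in> ?S" for x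
    using that U norm_orthogonal[OF U(1), of x] by auto
  then have Um: "U \<in> ?\<sigma> \<rightarrow>\<^sub>M ?\<sigma>"
    unfolding measurable_cong_sets[OF s s]
    by (intro measurable_restrict_space2 measurable_restrict_space1 borel_orthogonal[OF U(1)]) (auto simp: space_restrict_space)
  have D: "distr ?\<sigma> ?\<sigma> U = ?\<sigma>" using R U by blast
  have f': "f \<in> borel_measurable ?\<sigma>"
    unfolding measurable_cong_sets[OF s refl] by (rule measurable_restrict_space1[OF f])
  have "(\<integral>\<^sup>+x. f x \<partial>distr ?\<sigma> ?\<sigma> U) = (\<integral>\<^sup>+x. f (U x) \<partial>?\<sigma>)"
    by (rule nn_integral_distr[OF Um]) (simp add: f')
  then show "(\<integral>\<^sup>+x. f (U x) \<partial>?\<sigma>) = (\<integral>\<^sup>+x. f x \<partial>?\<sigma>)" unfolding D by simp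
qed

section \<open>Integration over the sphere without polar coordinates\<close>

context
  fixes E m b
  assumes b: "onb E m b" and m: "m > 0"
begin

interpretation \<sigma>: prob_space "sphere_measure E"
  by (rule prob_sphere_measure[OF b m])

interpretation \<mu>: sigma_finite_measure "lebesgue_sub E"
  by (rule sigma_finite_lebesgue_sub[OF b])

interpretation \<sigma>\<mu>: pair_sigma_finite "sphere_measure E" "lebesgue_sub E" ..

lemma case_prod_borel_sphere_lebesgue:
  assumes "(\<lambda>p. H (fst p) (snd p)) \<in> borel_measurable (borel \<Otimes>\<^sub>M borel)"
  shows "case_prod H \<in> borel_measurable (sphere_measure E \<Otimes>\<^sub>M lebesgue_sub E)"
proof -
  have "(\<lambda>p. (fst p, snd p)) \<in> sphere_measure E \<Otimes>\<^sub>M lebesgue_sub E \<rightarrow>\<^sub>M borel \<Otimes>\<^sub>M borel"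
    by (intro measurable_Pair measurable_compose[OF measurable_fst measurable_sphere_measure[OF b m]]
        measurable_compose[OF measurable_snd measurable_lebesgue_sub[OF b]]) auto
  from measurable_compose[OF this assms] show ?thesis by (simp add: case_prod_beta)
qed

text \<open>By rotation invariance the integral of \<open>h (y \<bullet> \<eta>)\<close> depends only on the norm of \<open>y\<close>, so that Tonelli's theorem
  applies without polar coordinates.\<close>
lemma zonal_integral:
  fixes \<omega> h :: "real \<Rightarrow> ennreal"
  assumes [measurable]: "\<omega> \<in> borel_measurable borel" "h \<in> borel_measurable borel"
    and \<omega>0: "\<omega> 0 = 0" and y: "y \<in> E"
  shows "(\<integral>\<^sup>+x. \<omega> (norm x) * h (y \<bullet> (x /\<^sub>R norm x)) \<partial>lebesgue_sub E)
    = (\<integral>\<^sup>+x. \<omega> (norm x) \<partial>lebesgue_sub E) * (\<integral>\<^sup>+\<eta>. h (y \<bullet> \<eta>) \<partial>sphere_measure E)"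
proof -
  have E: "subspace E" using onb_subspace[OF b] .
  let ?\<sigma> = "sphere_measure E" and ?\<mu> = "lebesgue_sub E"
  define M1 where "M1 = (\<lambda>y. \<integral>\<^sup>+\<eta>. h (y \<bullet> \<eta>) \<partial>?\<sigma>)"
  define M2 where "M2 = (\<lambda>y. \<integral>\<^sup>+x. \<omega> (norm x) * h (y \<bullet> (x /\<^sub>R norm x)) \<partial>?\<mu>)"
  have inv: "M1 z = M1 z'" "M2 z = M2 z'" if z: "z \<in> E" "z' \<in> E" "norm z = norm z'" for z z'
  proof -
    obtain U where U: "orthogonal_transformation U" "U ` E = E" "U z = z'"
      using ex_reflection[OF E z] by blast
    have inn: "U v \<bullet> U w = v \<bullet> w" and lin: "linear U" for v w
      using U(1) by (auto simp: orthogonal_transformation_def)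
    have "M1 z' = (\<integral>\<^sup>+\<eta>. h (U z \<bullet> U \<eta>) \<partial>?\<sigma>)"
      unfolding M1_def U(3)[symmetric] by (rule sphere_measure_orthogonal[OF b m _ U(1,2), symmetric]) measurable
    then show "M1 z = M1 z'" unfolding inn M1_def by simp
    have "M2 z' = (\<integral>\<^sup>+x. \<omega> (norm (U x)) * h (U z \<bullet> (U x /\<^sub>R norm (U x))) \<partial>?\<mu>)"
      unfolding M2_def U(3)[symmetric] by (rule lebesgue_sub_orthogonal[OF U(1,2) b, symmetric]) measurable
    also have "\<dots> = M2 z"
      unfolding M2_def norm_orthogonal[OF U(1)] by (simp add: linear_scale[OF lin, symmetric] inn)
    finally show "M2 z = M2 z'" ..
  qed
  let ?t = "norm y"
  have "(\<integral>\<^sup>+x. \<omega> (norm x) \<partial>?\<mu>) * M1 y = (\<integral>\<^sup>+x. \<omega> (norm x) * M1 y \<partial>?\<mu>)"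
    by (rule nn_integral_multc[symmetric]) (rule measurable_lebesgue_sub[OF b], measurable)
  also have "\<dots> = (\<integral>\<^sup>+x. (\<integral>\<^sup>+\<eta>. \<omega> (norm x) * h (?t * (\<eta> \<bullet> (x /\<^sub>R norm x))) \<partial>?\<sigma>) \<partial>?\<mu>)"
  proof (rule nn_integral_cong)
    fix x assume "x \<in> space ?\<mu>"
    then have x: "x \<in> E" by (simp add: space_lebesgue_sub[OF b])
    show "\<omega> (norm x) * M1 y = (\<integral>\<^sup>+\<eta>. \<omega> (norm x) * h (?t * (\<eta> \<bullet> (x /\<^sub>R norm x))) \<partial>?\<sigma>)"
    proof (cases "x = 0")
      case False
      \<comment> \<open>Replacing \<open>y\<close> by the multiple of \<open>x\<close> with the same
        norm exchanges the roles of \<open>\<eta>\<close> and the direction of \<open>x\<close> in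
        the inner product. After the integrals are interchanged, \<open>M2\<close> is treated in the
        same way.\<close>
      have "M1 y = M1 (?t *\<^sub>R (x /\<^sub>R norm x))"
        using x y False E by (intro inv) (auto simp: subspace_scale)
      also have "\<dots> = (\<integral>\<^sup>+\<eta>. h (?t * (\<eta> \<bullet> (x /\<^sub>R norm x))) \<partial>?\<sigma>)"
        by (simp add: M1_def inner_commute mult.assoc)
      finally show ?thesis
        by (subst nn_integral_cmult) (auto intro!: measurable_sphere_measure[OF b m])
    qed (simp add: \<omega>0)
  qed
  also have "\<dots> = (\<integral>\<^sup>+\<eta>. (\<integral>\<^sup>+x. \<omega> (norm x) * h (?t * (\<eta> \<bullet> (x /\<^sub>R norm x))) \<partial>?\<mu>) \<partial>?\<sigma>)"
    by (rule \<sigma>\<mu>.Fubini', rule case_prod_borel_sphere_lebesgue) measurable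
  also have "\<dots> = (\<integral>\<^sup>+\<eta>. M2 y \<partial>?\<sigma>)"
  proof (rule nn_integral_cong)
    fix \<eta> assume "\<eta> \<in> space ?\<sigma>"
    then have \<eta>: "\<eta> \<in> E" "norm \<eta> = 1" by (auto simp: space_sphere_measure[OF b m])
    have "M2 y = M2 (?t *\<^sub>R \<eta>)" using y \<eta> E by (intro inv) (auto simp: subspace_scale)
    then show "(\<integral>\<^sup>+x. \<omega> (norm x) * h (?t * (\<eta> \<bullet> (x /\<^sub>R norm x))) \<partial>?\<mu>) = M2 y"
      by (simp add: M2_def mult.left_commute)
  qed
  also have "\<dots> = M2 y" by (simp add: \<sigma>.emeasure_space_1)
  finally show ?thesis unfolding M1_def M2_def by simp
qed

end

lemma onb_hyperplane:
  assumes b: "onb E m b" and E: "E \<subseteq> Rn n" and \<eta>: "\<eta> \<in> E" "norm \<eta> = 1"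
  obtains b' where "onb (E \<inter> {x. x \<bullet> \<eta> = 0}) (m - 1) b'" "m > 0"
proof -
  have s: "subspace (E \<inter> {x. x \<bullet> \<eta> = 0})" using subspace_hyperplane_Int onb_subspace[OF b] by blast
  obtain b' where b': "onb (E \<inter> {x. x \<bullet> \<eta> = 0}) (dim (E \<inter> {x. x \<bullet> \<eta> = 0})) b'"
    using ex_onb[OF s, of n] E by auto
  have "m = Suc (dim (E \<inter> {x. x \<bullet> \<eta> = 0}))"
    using onb_dim[OF b] onb_dim[OF onb_add_normal[OF onb_subspace[OF b] b' \<eta>]] by simp
  then show ?thesis using that[of b'] b' by simp
qed

section \<open>Average sections\<close>

lemma section_eq_slice:
  "A \<subseteq> E \<Longrightarrow> vol (E \<inter> {y. y \<bullet> x = 0}) (A \<inter> {y. y \<bullet> x = 0}) = slice (E \<inter> {y. y \<bullet> x = 0}) A 0"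
  unfolding vol_def slice_def by (rule arg_cong2[where f = measure]) auto

lemma slice_integrable:
  assumes b: "onb W m b" and K: "compact K" "convex K" and \<eta>: "\<And>x. x \<in> W \<Longrightarrow> x \<bullet> \<eta> = 0" "norm \<eta> = 1"
  shows "integrable lborel (\<lambda>t. slice W K (v + t *\<^sub>R \<eta>))"
proof -
  obtain R where R: "\<And>x. x \<in> K \<Longrightarrow> norm x \<le> R" "0 \<le> R"
    using compact_imp_bounded[OF K(1)] unfolding bounded_pos by (meson less_imp_le)
  have Kb: "K \<in> sets borel" using compact_imp_closed[OF K(1)] by (rule borel_closed)
  note lc = log_concave_line[OF slice_log_concave[OF b K], of v \<eta>]
  show ?thesis
  proof (rule integral_layer_cake(1)[where M = "(2 * R) ^ m + 1"])
    show "slice W K (v + x *\<^sub>R \<eta>) \<le> (2 * R) ^ m + 1" for x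
      using emeasure_slice(2)[OF b Kb R, of "v + x *\<^sub>R \<eta>"] by linarith
    show "\<bar>x\<bar> \<le> R + norm v" if "slice W K (v + x *\<^sub>R \<eta>) \<noteq> 0" for x
      by (rule slice_support[OF \<eta> R(1) that])
    show "0 < (2 * R) ^ m + 1" using R(2) by (simp add: add_nonneg_pos)
  qed (use log_concave_measurable[OF lc] in simp_all)
qed

lemma slice_pos:
  assumes b: "onb W m b" and W: "W \<subseteq> E" and K: "compact K" and r: "cball 0 r \<inter> E \<subseteq> K" and v: "v \<in> E" "norm v < r"
    and E: "subspace E"
  shows "0 < slice W K v"
proof -
  obtain R where R: "\<And>x. x \<in> K \<Longrightarrow> norm x \<le> R" "0 \<le> R"
    using compact_imp_bounded[OF K(1)] unfolding bounded_pos by (meson less_imp_le)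
  have Kb: "K \<in> sets borel" using compact_imp_closed[OF K(1)] by (rule borel_closed)
  have "cball 0 (r - norm v) \<inter> W \<subseteq> {y \<in> W. v + y \<in> K}"
  proof
    fix y assume y: "y \<in> cball 0 (r - norm v) \<inter> W"
    have "norm (v + y) \<le> r" using norm_triangle_ineq[of v y] y by simp
    moreover have "v + y \<in> E" using v y W E by (auto intro: subspace_add)
    ultimately show "y \<in> {y \<in> W. v + y \<in> K}" using y r by auto
  qed
  then have "emeasure (lebesgue_sub W) (cball 0 (r - norm v) \<inter> W) \<le> emeasure (lebesgue_sub W) {y \<in> W. v + y \<in> K}"
    by (intro emeasure_mono in_sets_lebesgue_sub[OF b slice_set_borel[OF b Kb]]) auto
  moreover have "0 < emeasure (lebesgue_sub W) (cball 0 (r - norm v) \<inter> W)"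
    using lebesgue_sub_ball_pos_fin(1)[OF b] v(2) by simp
  moreover have "emeasure (lebesgue_sub W) {y \<in> W. v + y \<in> K} = ennreal (slice W K v)"
    by (rule emeasure_slice(1)[OF b Kb R])
  ultimately have "0 < ennreal (slice W K v)" by (metis less_le_trans)
  then show ?thesis by simp
qed

section \<open>Central sections as limits of thin slabs\<close>

context
  fixes E m b n A r
  assumes b: "onb E m b" and En: "E \<subseteq> Rn n" and m: "m > 0"
    and A: "compact A" "convex A" "A \<subseteq> E" and r: "r > 0" "cball 0 r \<inter> E \<subseteq> A"
begin

lemma slab_emeasure:
  assumes \<eta>: "\<eta> \<in> E" "norm \<eta> = 1"
  shows "emeasure (lebesgue_sub E) {y \<in> A. \<bar>y \<bullet> \<eta>\<bar> \<le> \<epsilon>}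
    = ennreal (\<integral>t. indicator {-\<epsilon>..\<epsilon>} t * slice (E \<inter> {x. x \<bullet> \<eta> = 0}) A (0 + t *\<^sub>R \<eta>) \<partial>lborel)"
proof -
  let ?W = "E \<inter> {x. x \<bullet> \<eta> = 0}"
  have E: "subspace E" using onb_subspace[OF b] .
  obtain b' where b': "onb ?W (m - 1) b'" using onb_hyperplane[OF b En \<eta>] by blast
  obtain R where R: "\<And>x. x \<in> A \<Longrightarrow> norm x \<le> R" "0 \<le> R"
    using compact_imp_bounded[OF A(1)] unfolding bounded_pos by (meson less_imp_le)
  have Ab [measurable]: "A \<in> sets borel" using compact_imp_closed[OF A(1)] by (rule borel_closed)
  have Sb: "{y \<in> A. \<bar>y \<bullet> \<eta>\<bar> \<le> \<epsilon>} \<in> sets borel"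
  proof -
    have "{y. \<bar>y \<bullet> \<eta>\<bar> \<le> \<epsilon>} \<in> sets borel" by measurable
    moreover have "{y \<in> A. \<bar>y \<bullet> \<eta>\<bar> \<le> \<epsilon>} = A \<inter> {y. \<bar>y \<bullet> \<eta>\<bar> \<le> \<epsilon>}" by auto
    ultimately show ?thesis by simp
  qed
  have "emeasure (lebesgue_sub E) {y \<in> A. \<bar>y \<bullet> \<eta>\<bar> \<le> \<epsilon>} = (\<integral>\<^sup>+x. indicator {y \<in> A. \<bar>y \<bullet> \<eta>\<bar> \<le> \<epsilon>} x \<partial>lebesgue_sub E)"
    by (rule emeasure_lebesgue_sub[OF b Sb]) (use A in auto)
  also have "\<dots> = (\<integral>\<^sup>+t. \<integral>\<^sup>+y. indicator {y \<in> A. \<bar>y \<bullet> \<eta>\<bar> \<le> \<epsilon>} (y + t *\<^sub>R \<eta>) \<partial>lebesgue_sub ?W \<partial>lborel)"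
    by (rule nn_integral_lebesgue_sub_slices[OF E b' \<eta>]) (intro borel_measurable_indicator Sb)
  also have "\<dots> = (\<integral>\<^sup>+t. ennreal (indicator {-\<epsilon>..\<epsilon>} t * slice ?W A (0 + t *\<^sub>R \<eta>)) \<partial>lborel)"
  proof (rule nn_integral_cong)
    fix t :: real
    have "(\<integral>\<^sup>+y. indicator {y \<in> A. \<bar>y \<bullet> \<eta>\<bar> \<le> \<epsilon>} (y + t *\<^sub>R \<eta>) \<partial>lebesgue_sub ?W)
      = (\<integral>\<^sup>+y. indicator {-\<epsilon>..\<epsilon>} t * indicator {y \<in> ?W. (0 + t *\<^sub>R \<eta>) + y \<in> A} y \<partial>lebesgue_sub ?W)"
    proof (rule nn_integral_cong)
      fix y assume "y \<in> space (lebesgue_sub ?W)"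
      then have y: "y \<in> ?W" by (simp add: space_lebesgue_sub[OF b'])
      have "(y + t *\<^sub>R \<eta>) \<bullet> \<eta> = t" using y \<eta>(2) by (simp add: inner_add_left norm_eq_1)
      then show "indicator {y \<in> A. \<bar>y \<bullet> \<eta>\<bar> \<le> \<epsilon>} (y + t *\<^sub>R \<eta>)
        = (indicator {-\<epsilon>..\<epsilon>} t * indicator {y \<in> ?W. (0 + t *\<^sub>R \<eta>) + y \<in> A} y :: ennreal)"
        using y by (auto simp: indicator_def add.commute abs_le_iff)
    qed
    also have "\<dots> = indicator {-\<epsilon>..\<epsilon>} t * emeasure (lebesgue_sub ?W) {y \<in> ?W. (0 + t *\<^sub>R \<eta>) + y \<in> A}"
      by (rule nn_integral_cmult_indicator, rule in_sets_lebesgue_sub[OF b' slice_set_borel[OF b' Ab]]) auto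
    also have "\<dots> = ennreal (indicator {-\<epsilon>..\<epsilon>} t * slice ?W A (0 + t *\<^sub>R \<eta>))"
    proof -
      have "emeasure (lebesgue_sub ?W) {y \<in> ?W. (0 + t *\<^sub>R \<eta>) + y \<in> A} = ennreal (slice ?W A (0 + t *\<^sub>R \<eta>))"
        by (rule emeasure_slice(1)[OF b' Ab R])
      then show ?thesis by (simp only:) (simp add: indicator_def)
    qed
    finally show "(\<integral>\<^sup>+y. indicator {y \<in> A. \<bar>y \<bullet> \<eta>\<bar> \<le> \<epsilon>} (y + t *\<^sub>R \<eta>) \<partial>lebesgue_sub ?W)
      = ennreal (indicator {-\<epsilon>..\<epsilon>} t * slice ?W A (0 + t *\<^sub>R \<eta>))" .
  qed
  also have "\<dots> = ennreal (\<integral>t. indicator {-\<epsilon>..\<epsilon>} t * slice ?W A (0 + t *\<^sub>R \<eta>) \<partial>lborel)"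
  proof (rule nn_integral_eq_integral)
    have "integrable lborel (\<lambda>t. slice ?W A (0 + t *\<^sub>R \<eta>))" by (rule slice_integrable[OF b' A(1,2) _ \<eta>(2)]) auto
    from integrable_mult_indicator[OF _ this, of "{-\<epsilon>..\<epsilon>}"]
    show "integrable lborel (\<lambda>t. indicator {-\<epsilon>..\<epsilon>} t * slice ?W A (0 + t *\<^sub>R \<eta>))" by simp
  qed simp
  finally show ?thesis .
qed

text \<open>Near 0 the section function in direction \<open>\<eta>\<close> is positive, because
  \<open>A\<close> contains a ball, and it is log-concave, hence continuous there; so its averages
  converge to its value at 0.\<close>

lemma slab_limit:
  assumes \<eta>: "\<eta> \<in> E" "norm \<eta> = 1" and \<epsilon>: "\<And>j. \<epsilon> j > 0" "\<epsilon> \<longlonglongrightarrow> 0"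
  shows "(\<lambda>j. measure (lebesgue_sub E) {y \<in> A. \<bar>y \<bullet> \<eta>\<bar> \<le> \<epsilon> j} / (2 * \<epsilon> j)) \<longlonglongrightarrow> slice (E \<inter> {x. x \<bullet> \<eta> = 0}) A 0"
proof -
  let ?W = "E \<inter> {x. x \<bullet> \<eta> = 0}"
  let ?s = "\<lambda>t. slice ?W A (0 + t *\<^sub>R \<eta>)"
  have E: "subspace E" using onb_subspace[OF b] .
  obtain b' where b': "onb ?W (m - 1) b'" using onb_hyperplane[OF b En \<eta>] by blast
  have int: "integrable lborel ?s" by (rule slice_integrable[OF b' A(1,2) _ \<eta>(2)]) auto
  have pos: "0 < ?s t" if "\<bar>t\<bar> < r" for t
    using that \<eta> E by (intro slice_pos[OF b' _ A(1) r(2)]) (auto simp: subspace_scale)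
  have "continuous_on {-r<..<r} ?s"
    by (rule log_concave_continuous_on[OF log_concave_line[OF slice_log_concave[OF b' A(1,2)]] pos])
  then have "isCont ?s 0" using r(1) by (simp add: continuous_on_eq_continuous_at)
  from slab_average_tendsto[OF int this \<epsilon>]
  have "(\<lambda>j. (\<integral>t. indicator {-\<epsilon> j..\<epsilon> j} t * ?s t \<partial>lborel) / (2 * \<epsilon> j)) \<longlonglongrightarrow> ?s 0" .
  moreover have "measure (lebesgue_sub E) {y \<in> A. \<bar>y \<bullet> \<eta>\<bar> \<le> \<epsilon> j} = (\<integral>t. indicator {-\<epsilon> j..\<epsilon> j} t * ?s t \<partial>lborel)" for j
    unfolding measure_def slab_emeasure[OF \<eta>]
    by (intro enn2real_ennreal Bochner_Integration.integral_nonneg) simp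
  ultimately show ?thesis by simp
qed

lemma slab_bound:
  assumes \<eta>: "\<eta> \<in> E" "norm \<eta> = 1" and \<epsilon>: "\<epsilon> > 0" and R: "\<And>x. x \<in> A \<Longrightarrow> norm x \<le> R" "0 \<le> R"
  shows "measure (lebesgue_sub E) {y \<in> A. \<bar>y \<bullet> \<eta>\<bar> \<le> \<epsilon>} / (2 * \<epsilon>) \<le> (2 * R) ^ (m - 1)"
proof -
  let ?W = "E \<inter> {x. x \<bullet> \<eta> = 0}"
  obtain b' where b': "onb ?W (m - 1) b'" using onb_hyperplane[OF b En \<eta>] by blast
  have Ab: "A \<in> sets borel" using compact_imp_closed[OF A(1)] by (rule borel_closed)
  have int: "integrable lborel (\<lambda>t. slice ?W A (0 + t *\<^sub>R \<eta>))" by (rule slice_integrable[OF b' A(1,2) _ \<eta>(2)]) auto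
  have "measure (lebesgue_sub E) {y \<in> A. \<bar>y \<bullet> \<eta>\<bar> \<le> \<epsilon>} = (\<integral>t. indicator {-\<epsilon>..\<epsilon>} t * slice ?W A (0 + t *\<^sub>R \<eta>) \<partial>lborel)"
    unfolding measure_def slab_emeasure[OF \<eta>]
    by (intro enn2real_ennreal Bochner_Integration.integral_nonneg) simp
  also have "\<dots> \<le> (\<integral>t. indicator {-\<epsilon>..\<epsilon>} t * (2 * R) ^ (m - 1) \<partial>lborel)"
  proof (rule Bochner_Integration.integral_mono)
    show "integrable lborel (\<lambda>t. indicator {-\<epsilon>..\<epsilon>} t * slice ?W A (0 + t *\<^sub>R \<eta>))"
      using integrable_mult_indicator[OF _ int, of "{-\<epsilon>..\<epsilon>}"] by simp
    show "integrable lborel (\<lambda>t. indicator {-\<epsilon>..\<epsilon>} t * (2 * R) ^ (m - 1))"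
      by (intro integrable_mult_left) (simp add: emeasure_lborel_Icc_eq)
    show "indicator {-\<epsilon>..\<epsilon>} t * slice ?W A (0 + t *\<^sub>R \<eta>) \<le> indicator {-\<epsilon>..\<epsilon>} t * (2 * R) ^ (m - 1)" for t
      using emeasure_slice(2)[OF b' Ab R] by (intro mult_left_mono) auto
  qed
  also have "\<dots> = 2 * \<epsilon> * (2 * R) ^ (m - 1)" using \<epsilon> by simp
  finally show ?thesis using \<epsilon> by (simp add: field_simps)
qed

text \<open>Tonelli's theorem makes slab volumes measurable in the direction; section volumes
  inherit measurability as their limits.\<close>

lemma slab_measurable:
  "(\<lambda>\<eta>. \<integral>\<^sup>+y. indicator A y * indicator {-\<epsilon>..\<epsilon>} (y \<bullet> \<eta>) \<partial>lebesgue_sub E) \<in> borel_measurable borel"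
proof -
  interpret \<mu>: sigma_finite_measure "lebesgue_sub E" by (rule sigma_finite_lebesgue_sub[OF b])
  have [measurable]: "A \<in> sets borel" using compact_imp_closed[OF A(1)] by (rule borel_closed)
  have "(\<lambda>p. (fst p, snd p)) \<in> (borel :: fseq measure) \<Otimes>\<^sub>M lebesgue_sub E \<rightarrow>\<^sub>M borel \<Otimes>\<^sub>M borel"
    by (intro measurable_Pair measurable_fst measurable_compose[OF measurable_snd measurable_lebesgue_sub[OF b]]) auto
  moreover have "(\<lambda>p. indicator A (snd p) * indicator {-\<epsilon>..\<epsilon>} (snd p \<bullet> fst p) :: ennreal)
     \<in> borel_measurable ((borel :: fseq measure) \<Otimes>\<^sub>M borel)"
    by measurable
  ultimately have "(\<lambda>p. indicator A (snd p) * indicator {-\<epsilon>..\<epsilon>} (snd p \<bullet> fst p) :: ennreal)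
     \<in> borel_measurable ((borel :: fseq measure) \<Otimes>\<^sub>M lebesgue_sub E)"
    using measurable_compose by fastforce
  then show ?thesis by (intro \<mu>.borel_measurable_nn_integral) (simp add: case_prod_beta)
qed

lemma slab_nn_integral:
  "(\<integral>\<^sup>+y. indicator A y * indicator {-\<epsilon>..\<epsilon>} (y \<bullet> \<eta>) \<partial>lebesgue_sub E) = ennreal (measure (lebesgue_sub E) {y \<in> A. \<bar>y \<bullet> \<eta>\<bar> \<le> \<epsilon>})"
proof -
  obtain R where R: "\<And>x. x \<in> A \<Longrightarrow> norm x \<le> R" "0 \<le> R"
    using compact_imp_bounded[OF A(1)] unfolding bounded_pos by (meson less_imp_le)
  have Ab: "A \<in> sets borel" using compact_imp_closed[OF A(1)] by (rule borel_closed)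
  have Sb: "{y \<in> A. \<bar>y \<bullet> \<eta>\<bar> \<le> \<epsilon>} \<in> sets borel"
  proof -
    have "{y. \<bar>y \<bullet> \<eta>\<bar> \<le> \<epsilon>} \<in> sets borel" by measurable
    moreover have "{y \<in> A. \<bar>y \<bullet> \<eta>\<bar> \<le> \<epsilon>} = A \<inter> {y. \<bar>y \<bullet> \<eta>\<bar> \<le> \<epsilon>}" by auto
    ultimately show ?thesis using Ab by simp
  qed
  have "(\<integral>\<^sup>+y. indicator A y * indicator {-\<epsilon>..\<epsilon>} (y \<bullet> \<eta>) \<partial>lebesgue_sub E)
      = (\<integral>\<^sup>+y. indicator {y \<in> A. \<bar>y \<bullet> \<eta>\<bar> \<le> \<epsilon>} y \<partial>lebesgue_sub E)"
    by (intro nn_integral_cong) (auto simp: indicator_def abs_le_iff)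
  also have "\<dots> = emeasure (lebesgue_sub E) {y \<in> A. \<bar>y \<bullet> \<eta>\<bar> \<le> \<epsilon>}"
    by (rule emeasure_lebesgue_sub[OF b Sb, symmetric]) (use A in auto)
  also have "\<dots> = ennreal (measure (lebesgue_sub E) {y \<in> A. \<bar>y \<bullet> \<eta>\<bar> \<le> \<epsilon>})"
  proof (rule emeasure_eq_ennreal_measure)
    have "emeasure (lebesgue_sub E) {y \<in> A. \<bar>y \<bullet> \<eta>\<bar> \<le> \<epsilon>} \<le> emeasure (lebesgue_sub E) {y \<in> E. 0 + y \<in> A}"
      using A(3) by (intro emeasure_mono in_sets_lebesgue_sub[OF b slice_set_borel[OF b Ab]]) auto
    also have "\<dots> \<le> ennreal ((2 * R) ^ m)" by (rule emeasure_slice_le[OF b Ab R])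
    finally show "emeasure (lebesgue_sub E) {y \<in> A. \<bar>y \<bullet> \<eta>\<bar> \<le> \<epsilon>} \<noteq> \<top>" by (auto simp: top_unique)
  qed
  finally show ?thesis .
qed

text \<open>After the order of integration is exchanged, \<open>zonal_integral\<close> applies at
  each point \<open>y\<close> of \<open>A\<close>, with the indicator of an interval as
  \<open>h\<close>. Slabs are needed because the argument integrates over the points of
  \<open>A\<close>, for which a hyperplane section is a null set.\<close>

lemma slab_average_identity:
  fixes \<omega> :: "real \<Rightarrow> ennreal"
  assumes \<omega>: "\<omega> \<in> borel_measurable borel" "\<omega> 0 = 0"
  shows "(\<integral>\<^sup>+x. \<omega> (norm x) \<partial>lebesgue_sub E) * (\<integral>\<^sup>+\<eta>. ennreal (measure (lebesgue_sub E) {y \<in> A. \<bar>y \<bullet> \<eta>\<bar> \<le> \<epsilon>}) \<partial>sphere_measure E)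
    = (\<integral>\<^sup>+x. \<omega> (norm x) * ennreal (measure (lebesgue_sub E) {y \<in> A. \<bar>y \<bullet> (x /\<^sub>R norm x)\<bar> \<le> \<epsilon>}) \<partial>lebesgue_sub E)"
proof -
  let ?\<mu> = "lebesgue_sub E" and ?\<sigma> = "sphere_measure E"
  interpret \<sigma>: prob_space ?\<sigma> by (rule prob_sphere_measure[OF b m])
  interpret \<mu>: sigma_finite_measure ?\<mu> by (rule sigma_finite_lebesgue_sub[OF b])
  interpret \<sigma>\<mu>: pair_sigma_finite ?\<sigma> ?\<mu> ..
  interpret \<mu>\<mu>: pair_sigma_finite ?\<mu> ?\<mu> ..
  note \<omega>(1) [measurable]
  have Ab [measurable]: "A \<in> sets borel" using compact_imp_closed[OF A(1)] by (rule borel_closed)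
  let ?h = "indicator {-\<epsilon>..\<epsilon>} :: real \<Rightarrow> ennreal"
  let ?J = "\<integral>\<^sup>+x. \<omega> (norm x) \<partial>?\<mu>"
  have \<mu>\<mu>m: "case_prod H \<in> borel_measurable (?\<mu> \<Otimes>\<^sub>M ?\<mu>)"
    if "(\<lambda>p. H (fst p) (snd p)) \<in> borel_measurable (borel \<Otimes>\<^sub>M borel)" for H :: "fseq \<Rightarrow> fseq \<Rightarrow> ennreal"
  proof -
    have "(\<lambda>p. (fst p, snd p)) \<in> ?\<mu> \<Otimes>\<^sub>M ?\<mu> \<rightarrow>\<^sub>M borel \<Otimes>\<^sub>M borel"
      by (intro measurable_Pair measurable_compose[OF measurable_fst measurable_lebesgue_sub[OF b]]
          measurable_compose[OF measurable_snd measurable_lebesgue_sub[OF b]]) auto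
    from measurable_compose[OF this that] show ?thesis by (simp add: case_prod_beta)
  qed
  have "?J * (\<integral>\<^sup>+\<eta>. (\<integral>\<^sup>+y. indicator A y * ?h (y \<bullet> \<eta>) \<partial>?\<mu>) \<partial>?\<sigma>)
      = ?J * (\<integral>\<^sup>+y. (\<integral>\<^sup>+\<eta>. indicator A y * ?h (y \<bullet> \<eta>) \<partial>?\<sigma>) \<partial>?\<mu>)"
    by (rule arg_cong[where f = "\<lambda>z. ?J * z"], rule \<sigma>\<mu>.Fubini'[symmetric], rule case_prod_borel_sphere_lebesgue[OF b m]) measurable
  also have "\<dots> = (\<integral>\<^sup>+y. ?J * (\<integral>\<^sup>+\<eta>. indicator A y * ?h (y \<bullet> \<eta>) \<partial>?\<sigma>) \<partial>?\<mu>)"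
  proof (rule nn_integral_cmult[symmetric])
    have "case_prod (\<lambda>\<eta> y. indicator A y * ?h (y \<bullet> \<eta>)) \<in> borel_measurable (?\<sigma> \<Otimes>\<^sub>M ?\<mu>)"
      by (rule case_prod_borel_sphere_lebesgue[OF b m]) measurable
    then have "(\<lambda>p. indicator A (fst p) * ?h (fst p \<bullet> snd p)) \<in> borel_measurable (?\<mu> \<Otimes>\<^sub>M ?\<sigma>)"
      using measurable_pair_swap by fastforce
    then show "(\<lambda>y. \<integral>\<^sup>+\<eta>. indicator A y * ?h (y \<bullet> \<eta>) \<partial>?\<sigma>) \<in> borel_measurable ?\<mu>"
      by (intro \<sigma>.borel_measurable_nn_integral) (simp add: case_prod_beta)
  qed
  also have "\<dots> = (\<integral>\<^sup>+y. (\<integral>\<^sup>+x. \<omega> (norm x) * (indicator A y * ?h (y \<bullet> (x /\<^sub>R norm x))) \<partial>?\<mu>) \<partial>?\<mu>)"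
  proof (rule nn_integral_cong)
    fix y assume "y \<in> space ?\<mu>"
    then have y: "y \<in> E" by (simp add: space_lebesgue_sub[OF b])
    have "?J * (\<integral>\<^sup>+\<eta>. indicator A y * ?h (y \<bullet> \<eta>) \<partial>?\<sigma>) = indicator A y * (?J * (\<integral>\<^sup>+\<eta>. ?h (y \<bullet> \<eta>) \<partial>?\<sigma>))"
      by (subst nn_integral_cmult) (auto intro!: measurable_sphere_measure[OF b m] simp: mult_ac)
    also have "\<dots> = indicator A y * (\<integral>\<^sup>+x. \<omega> (norm x) * ?h (y \<bullet> (x /\<^sub>R norm x)) \<partial>?\<mu>)"
      using zonal_integral[OF b m \<omega>(1) _ \<omega>(2) y, of ?h] by simp
    also have "\<dots> = (\<integral>\<^sup>+x. indicator A y * (\<omega> (norm x) * ?h (y \<bullet> (x /\<^sub>R norm x))) \<partial>?\<mu>)"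
      by (rule nn_integral_cmult[symmetric], rule measurable_lebesgue_sub[OF b]) measurable
    finally show "?J * (\<integral>\<^sup>+\<eta>. indicator A y * ?h (y \<bullet> \<eta>) \<partial>?\<sigma>)
       = (\<integral>\<^sup>+x. \<omega> (norm x) * (indicator A y * ?h (y \<bullet> (x /\<^sub>R norm x))) \<partial>?\<mu>)"
      by (simp only: mult_ac)
  qed
  also have "\<dots> = (\<integral>\<^sup>+x. (\<integral>\<^sup>+y. \<omega> (norm x) * (indicator A y * ?h (y \<bullet> (x /\<^sub>R norm x))) \<partial>?\<mu>) \<partial>?\<mu>)"
    by (rule \<mu>\<mu>.Fubini', rule \<mu>\<mu>m) measurable
  also have "\<dots> = (\<integral>\<^sup>+x. \<omega> (norm x) * (\<integral>\<^sup>+y. indicator A y * ?h (y \<bullet> (x /\<^sub>R norm x)) \<partial>?\<mu>) \<partial>?\<mu>)"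
    by (intro nn_integral_cong nn_integral_cmult measurable_lebesgue_sub[OF b]) measurable
  finally show ?thesis unfolding slab_nn_integral .
qed

text \<open>This turns an average section into a Lebesgue integral with a radial weight of one's
  choice, since the section depends only on the direction of \<open>x\<close>. The slab identity
  passes to the limit by dominated convergence on both sides; \<open>\<omega> 0 = 0\<close> removes
  the point at which \<open>x\<close> has no direction.\<close>

lemma avg_section_eq:
  fixes \<omega> :: "real \<Rightarrow> real"
  assumes \<omega>: "\<omega> \<in> borel_measurable borel" "\<omega> 0 = 0" "\<And>t. 0 \<le> \<omega> t"
    and int: "integrable (lebesgue_sub E) (\<lambda>x. \<omega> (norm x))"
  shows "integrable (lebesgue_sub E) (\<lambda>x. \<omega> (norm x) * vol (E \<inter> {y. y \<bullet> x = 0}) (A \<inter> {y. y \<bullet> x = 0}))"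
    and "avg_section E A * (\<integral>x. \<omega> (norm x) \<partial>lebesgue_sub E)
      = (\<integral>x. \<omega> (norm x) * vol (E \<inter> {y. y \<bullet> x = 0}) (A \<inter> {y. y \<bullet> x = 0}) \<partial>lebesgue_sub E)"
proof -
  let ?\<mu> = "lebesgue_sub E" and ?\<sigma> = "sphere_measure E"
  interpret \<sigma>: prob_space ?\<sigma> by (rule prob_sphere_measure[OF b m])
  note \<omega>(1) [measurable]
  have E: "subspace E" using onb_subspace[OF b] .
  obtain R where R: "\<And>x. x \<in> A \<Longrightarrow> norm x \<le> R" "0 \<le> R"
    using compact_imp_bounded[OF A(1)] unfolding bounded_pos by (meson less_imp_le)
  define \<epsilon> :: "nat \<Rightarrow> real" where "\<epsilon> j = 1 / real (Suc j)" for j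
  have \<epsilon>: "\<epsilon> j > 0" "\<epsilon> \<longlonglongrightarrow> 0" for j
    unfolding \<epsilon>_def using LIMSEQ_Suc[OF lim_1_over_n] by auto
  define Q where "Q j \<eta> = measure ?\<mu> {y \<in> A. \<bar>y \<bullet> \<eta>\<bar> \<le> \<epsilon> j} / (2 * \<epsilon> j)" for j \<eta>
  define q where "q x = vol (E \<inter> {y. y \<bullet> x = 0}) (A \<inter> {y. y \<bullet> x = 0})" for x
  have Qm [measurable]: "Q j \<in> borel_measurable borel" for j
  proof -
    have "(\<lambda>\<eta>. enn2real (\<integral>\<^sup>+y. indicator A y * indicator {-\<epsilon> j..\<epsilon> j} (y \<bullet> \<eta>) \<partial>?\<mu>) / (2 * \<epsilon> j)) \<in> borel_measurable borel"
      using slab_measurable by measurable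
    then show ?thesis unfolding slab_nn_integral Q_def[abs_def] by simp
  qed
  have Q0: "0 \<le> Q j \<eta>" for j \<eta> using \<epsilon>(1)[of j] by (simp add: Q_def)
  have lim: "(\<lambda>j. Q j \<eta>) \<longlonglongrightarrow> q \<eta>" if "\<eta> \<in> E" "norm \<eta> = 1" for \<eta>
    unfolding Q_def q_def section_eq_slice[OF A(3)] by (rule slab_limit[OF that \<epsilon>])
  have bound: "Q j \<eta> \<le> (2 * R) ^ (m - 1)" if "\<eta> \<in> E" "norm \<eta> = 1" for j \<eta>
    unfolding Q_def by (rule slab_bound[OF that \<epsilon>(1) R])
  have ident: "(\<integral>x. \<omega> (norm x) \<partial>?\<mu>) * (\<integral>\<eta>. Q j \<eta> \<partial>?\<sigma>) = (\<integral>x. \<omega> (norm x) * Q j (x /\<^sub>R norm x) \<partial>?\<mu>)" for j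
  proof -
    have e: "ennreal (Q j \<eta>) = ennreal (measure ?\<mu> {y \<in> A. \<bar>y \<bullet> \<eta>\<bar> \<le> \<epsilon> j}) * ennreal (1 / (2 * \<epsilon> j))" for \<eta>
      using \<epsilon>(1)[of j] by (simp add: Q_def ennreal_mult[symmetric])
    have m1: "(\<lambda>\<eta>. ennreal (measure ?\<mu> {y \<in> A. \<bar>y \<bullet> \<eta>\<bar> \<le> \<epsilon> j})) \<in> borel_measurable borel"
      using slab_measurable[of "\<epsilon> j"] unfolding slab_nn_integral .
    have m2: "(\<lambda>x. ennreal (measure ?\<mu> {y \<in> A. \<bar>y \<bullet> (x /\<^sub>R norm x)\<bar> \<le> \<epsilon> j})) \<in> borel_measurable borel"
      by (rule measurable_compose[OF _ m1]) measurable
    have "(\<integral>\<^sup>+x. ennreal (\<omega> (norm x)) \<partial>?\<mu>) * (\<integral>\<^sup>+\<eta>. ennreal (Q j \<eta>) \<partial>?\<sigma>)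
       = (\<integral>\<^sup>+x. ennreal (\<omega> (norm x)) \<partial>?\<mu>) * ((\<integral>\<^sup>+\<eta>. ennreal (measure ?\<mu> {y \<in> A. \<bar>y \<bullet> \<eta>\<bar> \<le> \<epsilon> j}) \<partial>?\<sigma>) * ennreal (1 / (2 * \<epsilon> j)))"
      unfolding e by (subst nn_integral_multc[OF measurable_sphere_measure[OF b m m1]]) (rule refl)
    also have "\<dots> = (\<integral>\<^sup>+x. ennreal (\<omega> (norm x)) * ennreal (measure ?\<mu> {y \<in> A. \<bar>y \<bullet> (x /\<^sub>R norm x)\<bar> \<le> \<epsilon> j}) \<partial>?\<mu>) * ennreal (1 / (2 * \<epsilon> j))"
      using slab_average_identity[of "\<lambda>t. ennreal (\<omega> t)" "\<epsilon> j"] \<omega>(2) by (simp add: mult.assoc[symmetric])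
    also have "\<dots> = (\<integral>\<^sup>+x. ennreal (\<omega> (norm x)) * ennreal (Q j (x /\<^sub>R norm x)) \<partial>?\<mu>)"
      unfolding e mult.assoc[symmetric]
      by (rule nn_integral_multc[symmetric], rule measurable_lebesgue_sub[OF b]) (use m2 in measurable)
    also have "\<dots> = (\<integral>\<^sup>+x. ennreal (\<omega> (norm x) * Q j (x /\<^sub>R norm x)) \<partial>?\<mu>)"
      using Q0 \<omega>(3) by (simp add: ennreal_mult)
    finally have nn: "(\<integral>\<^sup>+x. ennreal (\<omega> (norm x)) \<partial>?\<mu>) * (\<integral>\<^sup>+\<eta>. ennreal (Q j \<eta>) \<partial>?\<sigma>)
       = (\<integral>\<^sup>+x. ennreal (\<omega> (norm x) * Q j (x /\<^sub>R norm x)) \<partial>?\<mu>)" .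
    have "(\<integral>x. \<omega> (norm x) \<partial>?\<mu>) = enn2real (\<integral>\<^sup>+x. ennreal (\<omega> (norm x)) \<partial>?\<mu>)"
      by (rule integral_eq_nn_integral) (auto intro!: measurable_lebesgue_sub[OF b] \<omega>(3))
    moreover have "(\<integral>\<eta>. Q j \<eta> \<partial>?\<sigma>) = enn2real (\<integral>\<^sup>+\<eta>. ennreal (Q j \<eta>) \<partial>?\<sigma>)"
      by (rule integral_eq_nn_integral) (auto intro!: measurable_sphere_measure[OF b m] Q0)
    moreover have "(\<integral>x. \<omega> (norm x) * Q j (x /\<^sub>R norm x) \<partial>?\<mu>) = enn2real (\<integral>\<^sup>+x. ennreal (\<omega> (norm x) * Q j (x /\<^sub>R norm x)) \<partial>?\<mu>)"
      by (rule integral_eq_nn_integral, rule measurable_lebesgue_sub[OF b]) (auto intro!: mult_nonneg_nonneg Q0 \<omega>(3))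
    ultimately show ?thesis unfolding nn[symmetric] by (simp add: enn2real_mult)
  qed
  have sp: "\<eta> \<in> E" "norm \<eta> = 1" if "\<eta> \<in> space ?\<sigma>" for \<eta>
    using that by (auto simp: space_sphere_measure[OF b m])
  have qm: "q \<in> borel_measurable ?\<sigma>"
    by (rule borel_measurable_LIMSEQ_real[OF lim[OF sp]]) (auto intro: measurable_sphere_measure[OF b m])
  have lim\<sigma>: "(\<lambda>j. \<integral>\<eta>. Q j \<eta> \<partial>?\<sigma>) \<longlonglongrightarrow> (\<integral>\<eta>. q \<eta> \<partial>?\<sigma>)"
    by (rule integral_dominated_convergence[where w = "\<lambda>_. (2 * R) ^ (m - 1)"])
      (use qm lim[OF sp] bound[OF sp] Q0 in \<open>auto intro: measurable_sphere_measure[OF b m]\<close>)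
  have lim\<mu>': "(\<lambda>j. \<omega> (norm x) * Q j (x /\<^sub>R norm x)) \<longlonglongrightarrow> \<omega> (norm x) * q x" if x: "x \<in> space ?\<mu>" for x
  proof (cases "x = 0")
    case False
    have xE: "x \<in> E" using x by (simp add: space_lebesgue_sub[OF b])
    have "q (x /\<^sub>R norm x) = q x" using False by (simp add: q_def)
    then show ?thesis
      using lim[of "x /\<^sub>R norm x"] xE False E by (intro tendsto_mult tendsto_const) (simp add: subspace_scale)
  qed (simp add: \<omega>(2))
  have wQm: "(\<lambda>x. \<omega> (norm x) * Q j (x /\<^sub>R norm x)) \<in> borel_measurable ?\<mu>" for j
    by (rule measurable_lebesgue_sub[OF b]) measurable
  have wqm: "(\<lambda>x. \<omega> (norm x) * q x) \<in> borel_measurable ?\<mu>"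
    by (rule borel_measurable_LIMSEQ_real[OF lim\<mu>' wQm])
  have wbound: "norm (\<omega> (norm x) * Q j (x /\<^sub>R norm x)) \<le> \<omega> (norm x) * (2 * R) ^ (m - 1)" if x: "x \<in> space ?\<mu>" for x j
  proof (cases "x = 0")
    case False
    have xE: "x \<in> E" using x by (simp add: space_lebesgue_sub[OF b])
    have "Q j (x /\<^sub>R norm x) \<le> (2 * R) ^ (m - 1)" using False xE E by (intro bound) (auto simp: subspace_scale)
    then show ?thesis using \<omega>(3) Q0 by (simp add: abs_mult mult_left_mono)
  qed (simp add: \<omega>(2))
  have wint: "integrable ?\<mu> (\<lambda>x. \<omega> (norm x) * (2 * R) ^ (m - 1))" using int by (rule integrable_mult_left)
  have AEl: "AE x in ?\<mu>. (\<lambda>j. \<omega> (norm x) * Q j (x /\<^sub>R norm x)) \<longlonglongrightarrow> \<omega> (norm x) * q x"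
    by (rule AE_I2) (rule lim\<mu>')
  have AEb: "AE x in ?\<mu>. norm (\<omega> (norm x) * Q j (x /\<^sub>R norm x)) \<le> \<omega> (norm x) * (2 * R) ^ (m - 1)" for j
    by (rule AE_I2) (rule wbound)
  note dc = integrable_dominated_convergence[OF wqm wQm wint AEl AEb]
    integral_dominated_convergence[OF wqm wQm wint AEl AEb]
  show "integrable ?\<mu> (\<lambda>x. \<omega> (norm x) * vol (E \<inter> {y. y \<bullet> x = 0}) (A \<inter> {y. y \<bullet> x = 0}))"
    using dc(1) by (simp add: q_def)
  have "(\<lambda>j. \<integral>x. \<omega> (norm x) * Q j (x /\<^sub>R norm x) \<partial>?\<mu>) \<longlonglongrightarrow> (\<integral>x. \<omega> (norm x) \<partial>?\<mu>) * (\<integral>\<eta>. q \<eta> \<partial>?\<sigma>)"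
    unfolding ident[symmetric] by (intro tendsto_mult tendsto_const lim\<sigma>)
  from LIMSEQ_unique[OF this dc(2)]
  show "avg_section E A * (\<integral>x. \<omega> (norm x) \<partial>?\<mu>) = (\<integral>x. \<omega> (norm x) * vol (E \<inter> {y. y \<bullet> x = 0}) (A \<inter> {y. y \<bullet> x = 0}) \<partial>?\<mu>)"
    by (simp add: avg_section_def q_def mult.commute)
qed

end

text \<open>The bound depends on the radius and the dimension but not on \<open>E\<close>, so
  average sections are bounded over a whole Grassmannian.\<close>

lemma avg_section_le:
  assumes b: "onb E m b" and En: "E \<subseteq> Rn n" and m: "m > 0"
    and A: "A \<in> sets borel" "A \<subseteq> E" and R: "\<And>x. x \<in> A \<Longrightarrow> norm x \<le> R" "0 \<le> R"
  shows "avg_section E A \<le> (2 * R) ^ (m - 1)"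
proof -
  interpret \<sigma>: prob_space "sphere_measure E" by (rule prob_sphere_measure[OF b m])
  let ?q = "\<lambda>x. vol (E \<inter> {y. y \<bullet> x = 0}) (A \<inter> {y. y \<bullet> x = 0})"
  have q: "?q x \<le> (2 * R) ^ (m - 1)" if "x \<in> space (sphere_measure E)" for x
  proof -
    have x: "x \<in> E" "norm x = 1" using that by (auto simp: space_sphere_measure[OF b m])
    obtain b' where b': "onb (E \<inter> {y. y \<bullet> x = 0}) (m - 1) b'" using onb_hyperplane[OF b En x] by blast
    show ?thesis unfolding section_eq_slice[OF A(2)] by (rule emeasure_slice(2)[OF b' A(1) R])
  qed
  show ?thesis
  proof (cases "integrable (sphere_measure E) ?q")
    case True
    then have "avg_section E A \<le> (\<integral>x. (2 * R) ^ (m - 1) \<partial>sphere_measure E)"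
      unfolding avg_section_def by (intro Bochner_Integration.integral_mono) (use q in auto)
    then show ?thesis by (simp add: \<sigma>.prob_space)
  next
    \<comment> \<open>A section function that is not integrable has Bochner integral 0 by
      convention.\<close>
    case False
    then show ?thesis using R(2) by (simp add: avg_section_def not_integrable_integral_eq)
  qed
qed

section \<open>Centered convex bodies\<close>

lemma convex_body_ball:
  assumes "convex_body n K"
  obtains a r where "a \<in> Rn n" "r > 0" "cball a r \<inter> Rn n \<subseteq> K"
proof -
  obtain a where "a \<in> top_of_set (Rn n) interior_of K" using assms by (auto simp: convex_body_def)
  then obtain T where T: "openin (top_of_set (Rn n)) T" "a \<in> T" "T \<subseteq> K" by (auto simp: interior_of_def)
  then obtain U where U: "open U" "T = Rn n \<inter> U" by (auto simp: openin_open)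
  then obtain r where "r > 0" "cball a r \<subseteq> U" using T(2) by (auto simp: open_contains_cball)
  then show ?thesis using that[of a r] T U by blast
qed

lemma compact_norm_bound:
  fixes K :: "'a::real_normed_vector set"
  assumes "compact K"
  obtains R where "\<And>x. x \<in> K \<Longrightarrow> norm x \<le> R" "0 \<le> R"
  using compact_imp_bounded[OF assms] unfolding bounded_pos by (meson less_imp_le)

lemma lebesgue_sub_compact_finite:
  assumes b: "onb E m b" and K: "compact K" "K \<subseteq> E"
  shows "emeasure (lebesgue_sub E) K < \<infinity>"
proof -
  obtain R where R: "\<And>x. x \<in> K \<Longrightarrow> norm x \<le> R" "0 \<le> R" using compact_norm_bound[OF K(1)] by blast
  have Kb: "K \<in> sets borel" using compact_imp_closed[OF K(1)] by (rule borel_closed)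
  have "emeasure (lebesgue_sub E) {y \<in> E. 0 + y \<in> K} \<le> ennreal ((2 * R) ^ m)" by (rule emeasure_slice_le[OF b Kb R])
  moreover have "{y \<in> E. 0 + y \<in> K} = K" using K(2) by auto
  ultimately have "emeasure (lebesgue_sub E) K \<le> ennreal ((2 * R) ^ m)" by simp
  also have "\<dots> < \<infinity>" by simp
  finally show ?thesis .
qed

lemma integrable_on_compact:
  fixes f :: "fseq \<Rightarrow> real"
  assumes b: "onb E m b" and K: "compact K" "K \<subseteq> E" and f: "f \<in> borel_measurable borel" "\<And>x. x \<in> K \<Longrightarrow> \<bar>f x\<bar> \<le> C"
  shows "integrable (lebesgue_sub E) (\<lambda>x. indicator K x * f x)"
proof (rule Bochner_Integration.integrable_bound[where f = "\<lambda>x. indicator K x * C"])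
  note f(1) [measurable]
  have Kb [measurable]: "K \<in> sets borel" using compact_imp_closed[OF K(1)] by (rule borel_closed)
  show "integrable (lebesgue_sub E) (\<lambda>x. indicator K x * C)"
    using lebesgue_sub_compact_finite[OF b K] in_sets_lebesgue_sub[OF b Kb K(2)]
    by (intro integrable_mult_left integrable_real_indicator) auto
  show "(\<lambda>x. indicator K x * f x) \<in> borel_measurable (lebesgue_sub E)"
    by (rule measurable_lebesgue_sub[OF b]) measurable
  show "AE x in lebesgue_sub E. norm (indicator K x * f x) \<le> norm (indicator K x * C)"
    using f(2) by (intro AE_I2) (auto simp: indicator_def abs_mult intro: order_trans[OF _ abs_ge_self])
qed

lemma integral_indicator_compact:
  assumes b: "onb E m b" and K: "compact K" "K \<subseteq> E"
  shows "(\<integral>x. indicator K x * c \<partial>lebesgue_sub E) = c * vol E K"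
proof -
  have "K \<in> sets (lebesgue_sub E)"
    using compact_imp_closed[OF K(1)] by (intro in_sets_lebesgue_sub[OF b borel_closed K(2)])
  then show ?thesis
    using lebesgue_sub_compact_finite[OF b K] by (simp add: vol_def)
qed

lemma vol_ball_pos:
  assumes b: "onb E m b" and K: "compact K" "K \<subseteq> E" and a: "a \<in> E" "r > 0" "cball a r \<inter> E \<subseteq> K"
  shows "0 < vol E K"
proof -
  have E: "subspace E" using onb_subspace[OF b] .
  have Kb: "K \<in> sets borel" using compact_imp_closed[OF K(1)] by (rule borel_closed)
  have "closed (cball a r \<inter> E)" using closed_onb[OF b] by (intro closed_Int) auto
  then have Bb: "cball a r \<inter> E \<in> sets borel" by (rule borel_closed)
  have "0 < emeasure (lebesgue_sub E) (cball 0 r \<inter> E)" by (rule lebesgue_sub_ball_pos_fin(1)[OF b a(2)])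
  also have "\<dots> = (\<integral>\<^sup>+x. indicator (cball 0 r \<inter> E) x \<partial>lebesgue_sub E)"
    using closed_onb[OF b] by (intro emeasure_lebesgue_sub[OF b]) (auto intro: borel_closed closed_Int)
  also have "\<dots> = (\<integral>\<^sup>+x. indicator (cball a r \<inter> E) (x + a) \<partial>lebesgue_sub E)"
  proof (rule nn_integral_cong)
    fix x assume "x \<in> space (lebesgue_sub E)"
    then have "x \<in> E" by (simp add: space_lebesgue_sub[OF b])
    moreover have "dist a (x + a) = norm x" by (simp add: dist_norm)
    ultimately show "indicator (cball 0 r \<inter> E) x = (indicator (cball a r \<inter> E) (x + a) :: ennreal)"
      using a(1) E by (simp add: indicator_def subspace_add)
  qed
  also have "\<dots> = (\<integral>\<^sup>+x. indicator (cball a r \<inter> E) x \<partial>lebesgue_sub E)"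
    by (rule lebesgue_sub_translation[OF b _ a(1)]) (rule borel_measurable_indicator[OF Bb])
  also have "\<dots> = emeasure (lebesgue_sub E) (cball a r \<inter> E)"
    by (rule emeasure_lebesgue_sub[OF b Bb, symmetric]) auto
  also have "\<dots> \<le> emeasure (lebesgue_sub E) K"
    using a(3) by (intro emeasure_mono in_sets_lebesgue_sub[OF b Kb K(2)])
  finally have "0 < emeasure (lebesgue_sub E) K" .
  then show ?thesis using lebesgue_sub_compact_finite[OF b K]
    by (simp add: vol_def measure_def enn2real_positive_iff)
qed

text \<open>If \<open>z\<close> lay outside \<open>C\<close>, integrating the separating linear form
  against \<open>w\<close> would contradict the moment identity. A general weight in place of an
  indicator permits the removal of half a ball in \<open>centered_ball\<close>.\<close>

lemma weighted_barycenter_in: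
  assumes C: "compact C" "convex C" "C \<subseteq> Rn n" "C \<noteq> {}"
    and w: "integrable (lebesgue_sub (Rn n)) w" "w \<in> borel_measurable borel" "\<And>x. 0 \<le> w x" "\<And>x. x \<notin> C \<Longrightarrow> w x = 0"
    and W: "0 < integral\<^sup>L (lebesgue_sub (Rn n)) w"
    and z: "z \<in> Rn n" "\<And>v. v \<in> Rn n \<Longrightarrow> (z \<bullet> v) * integral\<^sup>L (lebesgue_sub (Rn n)) w = (\<integral>x. w x * (x \<bullet> v) \<partial>lebesgue_sub (Rn n))"
  shows "z \<in> C"
proof (rule ccontr)
  assume "z \<notin> C"
  then obtain p where p: "p \<in> C" "z \<noteq> p" "\<And>x. x \<in> C \<Longrightarrow> (x - p) \<bullet> (z - p) \<le> 0"
    using closest_point_separation[OF C(1,2,4)] by blast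
  let ?\<mu> = "lebesgue_sub (Rn n)" and ?v = "z - p"
  have v: "?v \<in> Rn n" using z(1) p(1) C(3) subspace_Rn by (auto intro: subspace_diff)
  obtain R where R: "\<And>x. x \<in> C \<Longrightarrow> norm x \<le> R" "0 \<le> R" using compact_norm_bound[OF C(1)] by blast
  note w(2) [measurable]
  have i1: "integrable ?\<mu> (\<lambda>x. w x * (x \<bullet> ?v))"
  proof (rule Bochner_Integration.integrable_bound[where f = "\<lambda>x. w x * (R * norm ?v)"])
    show "integrable ?\<mu> (\<lambda>x. w x * (R * norm ?v))" using w(1) by (rule integrable_mult_left)
    show "(\<lambda>x. w x * (x \<bullet> ?v)) \<in> borel_measurable ?\<mu>" by (rule measurable_lebesgue_sub[OF onb_Rn]) measurable
    have "\<bar>w x * (x \<bullet> ?v)\<bar> \<le> \<bar>w x * (R * norm ?v)\<bar>" for x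
    proof (cases "x \<in> C")
      case True
      have "\<bar>x \<bullet> ?v\<bar> \<le> norm x * norm ?v" by (rule Cauchy_Schwarz_ineq2)
      also have "\<dots> \<le> R * norm ?v" using R(1)[OF True] by (intro mult_right_mono) auto
      finally have "\<bar>x \<bullet> ?v\<bar> \<le> \<bar>R * norm ?v\<bar>" by linarith
      then show ?thesis by (simp add: abs_mult mult_left_mono)
    qed (simp add: w(4))
    then show "AE x in ?\<mu>. norm (w x * (x \<bullet> ?v)) \<le> norm (w x * (R * norm ?v))" by simp
  qed
  have i2: "integrable ?\<mu> (\<lambda>x. w x * (p \<bullet> ?v))" using w(1) by (rule integrable_mult_left)
  have "(\<integral>x. w x * (x \<bullet> ?v) \<partial>?\<mu>) \<le> (\<integral>x. w x * (p \<bullet> ?v) \<partial>?\<mu>)"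
  proof (rule Bochner_Integration.integral_mono[OF i1 i2])
    fix x
    show "w x * (x \<bullet> ?v) \<le> w x * (p \<bullet> ?v)"
      using p(3)[of x] w(3)[of x] w(4)[of x] by (cases "x \<in> C") (auto simp: inner_diff_left intro: mult_left_mono)
  qed
  then have "(z \<bullet> ?v) * integral\<^sup>L ?\<mu> w \<le> (p \<bullet> ?v) * integral\<^sup>L ?\<mu> w"
    using z(2)[OF v] by (simp add: mult.commute)
  then have "?v \<bullet> ?v \<le> 0" using W by (simp add: inner_diff_left)
  moreover have "0 < ?v \<bullet> ?v" unfolding inner_gt_zero_iff using p(2) by simp
  ultimately show False by linarith
qed

lemma ex_weighted_barycenter:
  assumes w: "integrable (lebesgue_sub (Rn n)) w" "w \<in> borel_measurable borel" and C: "compact C" "\<And>x. x \<notin> C \<Longrightarrow> w x = 0"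
    and W: "0 < integral\<^sup>L (lebesgue_sub (Rn n)) w"
  shows "\<exists>z\<in>Rn n. \<forall>v\<in>Rn n. (z \<bullet> v) * integral\<^sup>L (lebesgue_sub (Rn n)) w = (\<integral>x. w x * (x \<bullet> v) \<partial>lebesgue_sub (Rn n))"
proof -
  let ?\<mu> = "lebesgue_sub (Rn n)"
  obtain R where R: "\<And>x. x \<in> C \<Longrightarrow> norm x \<le> R" "0 \<le> R" using compact_norm_bound[OF C(1)] by blast
  note w(2) [measurable]
  have i1: "integrable ?\<mu> (\<lambda>x. w x * (x \<bullet> v))" for v
  proof (rule Bochner_Integration.integrable_bound[where f = "\<lambda>x. w x * (R * norm v)"])
    show "integrable ?\<mu> (\<lambda>x. w x * (R * norm v))" using w(1) by (rule integrable_mult_left)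
    show "(\<lambda>x. w x * (x \<bullet> v)) \<in> borel_measurable ?\<mu>" by (rule measurable_lebesgue_sub[OF onb_Rn]) measurable
    have "\<bar>w x * (x \<bullet> v)\<bar> \<le> \<bar>w x * (R * norm v)\<bar>" for x
    proof (cases "x \<in> C")
      case True
      have "\<bar>x \<bullet> v\<bar> \<le> norm x * norm v" by (rule Cauchy_Schwarz_ineq2)
      also have "\<dots> \<le> R * norm v" using R(1)[OF True] by (intro mult_right_mono) auto
      finally have "\<bar>x \<bullet> v\<bar> \<le> \<bar>R * norm v\<bar>" by linarith
      then show ?thesis by (simp add: abs_mult mult_left_mono)
    qed (simp add: C(2))
    then show "AE x in ?\<mu>. norm (w x * (x \<bullet> v)) \<le> norm (w x * (R * norm v))" by simp
  qed
  define W' where "W' = integral\<^sup>L ?\<mu> w"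
  have W': "W' > 0" using W by (simp add: W'_def)
  define z where "z = comb n unit_fseq (\<lambda>i. (\<integral>x. w x * (x \<bullet> unit_fseq i) \<partial>?\<mu>) / W')"
  have "z \<in> Rn n" unfolding z_def by (rule comb_in[OF onb_Rn])
  moreover have "(z \<bullet> v) * W' = (\<integral>x. w x * (x \<bullet> v) \<partial>?\<mu>)" if v: "v \<in> Rn n" for v
  proof -
    have ve: "v = comb n unit_fseq (\<lambda>i. coord v i)" using onb_expand[OF onb_Rn v] by simp
    have xv: "x \<bullet> v = (\<Sum>i<n. (x \<bullet> unit_fseq i) * coord v i)" for x
      by (subst ve) (simp add: comb_def inner_sum_right mult.commute)
    have "(z \<bullet> v) * W' = (\<Sum>i<n. (\<integral>x. w x * (x \<bullet> unit_fseq i) \<partial>?\<mu>) * coord v i)"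
      unfolding xv z_def sum_distrib_right
      by (intro sum.cong refl, subst comb_inner[OF onb_Rn]) (use W' in auto)
    also have "\<dots> = (\<integral>x. (\<Sum>i<n. (w x * (x \<bullet> unit_fseq i)) * coord v i) \<partial>?\<mu>)"
      by (subst Bochner_Integration.integral_sum)
        (auto intro!: integrable_mult_left i1 sum.cong simp del: inner_unit_fseq')
    also have "\<dots> = (\<integral>x. w x * (x \<bullet> v) \<partial>?\<mu>)"
      unfolding xv by (simp add: sum_distrib_left mult.assoc)
    finally show ?thesis .
  qed
  ultimately show ?thesis unfolding W'_def by blast
qed

lemma centered_integral:
  assumes K: "centered_convex_body n K" and v: "v \<in> Rn n"
  shows "(\<integral>x. indicator K x * (x \<bullet> v) \<partial>lebesgue_sub (Rn n)) = 0"
proof -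
  let ?\<mu> = "lebesgue_sub (Rn n)"
  have cb: "convex_body n K" and bc: "barycenter n K = 0" using K by (auto simp: centered_convex_body_def)
  have Kc: "compact K" "K \<subseteq> Rn n" using cb by (auto simp: convex_body_def)
  obtain a r where "a \<in> Rn n" "r > 0" "cball a r \<inter> Rn n \<subseteq> K" using convex_body_ball[OF cb] by blast
  then have vp: "0 < vol (Rn n) K" using vol_ball_pos[OF onb_Rn Kc] by blast
  obtain R where R: "\<And>x. x \<in> K \<Longrightarrow> norm x \<le> R" "0 \<le> R" using compact_norm_bound[OF Kc(1)] by blast
  have c0: "(\<integral>x. indicator K x * coord x i \<partial>?\<mu>) = 0" if "i < n" for i
  proof -
    have e: "barycenter n K = comb n unit_fseq (\<lambda>i. (\<integral>x. indicator K x * coord x i \<partial>?\<mu>) / vol (Rn n) K)"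
      unfolding barycenter_def comb_def set_lebesgue_integral_def by simp
    have "barycenter n K \<bullet> unit_fseq i = (\<integral>x. indicator K x * coord x i \<partial>?\<mu>) / vol (Rn n) K"
      unfolding e by (rule comb_inner[OF onb_Rn that])
    then show ?thesis using bc vp by simp
  qed
  have int: "integrable ?\<mu> (\<lambda>x. indicator K x * coord x i)" for i
  proof (rule integrable_on_compact[OF onb_Rn Kc])
    have "(\<lambda>x. x \<bullet> unit_fseq i) \<in> borel_measurable borel" by measurable
    then show "(\<lambda>x. coord x i) \<in> borel_measurable borel" by simp
    show "\<bar>coord x i\<bar> \<le> R" if "x \<in> K" for x
      using Cauchy_Schwarz_ineq2[of x "unit_fseq i"] R(1)[OF that] by simp
  qed
  have ve: "v = comb n unit_fseq (\<lambda>i. coord v i)" using onb_expand[OF onb_Rn v] by simp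
  have xv: "x \<bullet> v = (\<Sum>i<n. coord x i * coord v i)" for x
    by (subst ve) (simp add: comb_def inner_sum_right mult.commute)
  have "(\<integral>x. indicator K x * (x \<bullet> v) \<partial>?\<mu>) = (\<integral>x. (\<Sum>i<n. (indicator K x * coord x i) * coord v i) \<partial>?\<mu>)"
    unfolding xv by (simp add: sum_distrib_left mult.assoc)
  also have "\<dots> = (\<Sum>i<n. (\<integral>x. (indicator K x * coord x i) * coord v i \<partial>?\<mu>))"
    by (rule Bochner_Integration.integral_sum) (intro integrable_mult_left int)
  also have "\<dots> = 0" using c0 by simp
  finally show ?thesis .
qed

text \<open>The barycenter is an interior point. Taking half the mass of a small ball
  \<open>B\<close> away from \<open>K\<close> leaves a weight whose barycenter
  \<open>- s *\<^sub>R \<beta>\<close> still lies in \<open>K\<close>, where \<open>\<beta>\<close>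
  is the barycenter of \<open>B\<close>. So 0 is a proper convex combination of a point of
  \<open>K\<close> and of \<open>\<beta>\<close>, around which \<open>K\<close> contains a ball of
  \<open>Rn n\<close>.\<close>

lemma centered_ball:
  assumes K: "centered_convex_body n K"
  obtains r where "r > 0" "cball 0 r \<inter> Rn n \<subseteq> K"
proof -
  let ?\<mu> = "lebesgue_sub (Rn n)"
  have cb: "convex_body n K" using K by (auto simp: centered_convex_body_def)
  have Kc: "compact K" "K \<subseteq> Rn n" "convex K" using cb by (auto simp: convex_body_def)
  have Kb [measurable]: "K \<in> sets borel" using compact_imp_closed[OF Kc(1)] by (rule borel_closed)
  obtain a r where a: "a \<in> Rn n" "r > 0" "cball a r \<inter> Rn n \<subseteq> K" using convex_body_ball[OF cb] by blast
  \<comment> \<open>Half the radius, so that the ball of radius \<open>r / 2\<close> about any point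
    of \<open>B\<close>, in particular about its barycenter, stays in
    \<open>cball a r\<close>.\<close>
  define B where "B = cball a (r / 2) \<inter> Rn n"
  have "cball a (r / 2) \<inter> Rn n = cball a (r / 2) \<inter> (cball 0 (norm a + r) \<inter> Rn n)"
    using norm_triangle_ineq[of a] a(2) by (auto simp: dist_norm; smt (verit) norm_triangle_ineq2 norm_minus_commute)
  then have Bc: "compact B" unfolding B_def
    using closed_Int_compact[OF closed_cball compact_cball_Int[OF onb_Rn]] by metis
  have Bcv: "convex B" unfolding B_def using subspace_imp_convex[OF subspace_Rn] by (intro convex_Int convex_cball)
  have BR: "B \<subseteq> Rn n" by (auto simp: B_def)
  have BK: "B \<subseteq> K" using a by (auto simp: B_def)
  have Bb [measurable]: "B \<in> sets borel" using compact_imp_closed[OF Bc] by (rule borel_closed)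
  have aB: "a \<in> B" using a by (simp add: B_def)
  have vB: "0 < vol (Rn n) B"
    using a by (intro vol_ball_pos[OF onb_Rn Bc BR a(1), of "r / 2"]) (auto simp: B_def)
  have iB: "integrable ?\<mu> (indicator B :: fseq \<Rightarrow> real)" and iK: "integrable ?\<mu> (indicator K :: fseq \<Rightarrow> real)"
    using integrable_on_compact[OF onb_Rn Bc BR, of "\<lambda>_. 1" 1] integrable_on_compact[OF onb_Rn Kc(1,2), of "\<lambda>_. 1" 1]
    by simp_all
  have IB: "integral\<^sup>L ?\<mu> (indicator B :: fseq \<Rightarrow> real) = vol (Rn n) B"
    and IK: "integral\<^sup>L ?\<mu> (indicator K :: fseq \<Rightarrow> real) = vol (Rn n) K"
    using integral_indicator_compact[OF onb_Rn Bc BR, of 1] integral_indicator_compact[OF onb_Rn Kc(1,2), of 1]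
    by simp_all
  have vBK: "vol (Rn n) B \<le> vol (Rn n) K"
    unfolding IB[symmetric] IK[symmetric] using BK
    by (intro Bochner_Integration.integral_mono iB iK) (auto simp: indicator_def)
  obtain \<beta> where \<beta>: "\<beta> \<in> Rn n" "\<And>v. v \<in> Rn n \<Longrightarrow> (\<beta> \<bullet> v) * vol (Rn n) B = (\<integral>x. indicator B x * (x \<bullet> v) \<partial>?\<mu>)"
    using ex_weighted_barycenter[OF iB _ Bc] vB unfolding IB by (auto simp: Bb)
  have "\<beta> \<in> B"
    by (rule weighted_barycenter_in[OF Bc Bcv BR _ iB]) (use \<beta> vB IB aB in \<open>auto simp: Bb\<close>)
  define W where "W = vol (Rn n) K - vol (Rn n) B / 2"
  have W: "W > 0" using vB vBK by (simp add: W_def)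
  \<comment> \<open>Removing only half of \<open>B\<close> keeps the total mass positive by
    \<open>vol (Rn n) B \<le> vol (Rn n) K\<close> alone.\<close>
  define w :: "fseq \<Rightarrow> real" where "w x = indicator K x - indicator B x / 2" for x
  have iw: "integrable ?\<mu> w" unfolding w_def using iB iK by simp
  have Iw: "integral\<^sup>L ?\<mu> w = W" unfolding w_def W_def IB[symmetric] IK[symmetric] using iB iK by simp
  obtain R where R: "\<And>x. x \<in> K \<Longrightarrow> norm x \<le> R" "0 \<le> R" using compact_norm_bound[OF Kc(1)] by blast
  have ixv: "integrable ?\<mu> (\<lambda>x. indicator A x * (x \<bullet> v))" if "A = K \<or> A = B" for A v
  proof -
    have "\<bar>x \<bullet> v\<bar> \<le> R * norm v" if "x \<in> K" for x
      using Cauchy_Schwarz_ineq2[of x v] mult_right_mono[OF R(1)[OF that], of "norm v"] by simp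
    then show ?thesis
      using that BK Bc BR Kc(1,2) by (intro integrable_on_compact[OF onb_Rn, where C = "R * norm v"]) auto
  qed
  define s where "s = vol (Rn n) B / 2 / W"
  have s: "s > 0" using vB W by (simp add: s_def)
  have zR: "- s *\<^sub>R \<beta> \<in> Rn n" using \<beta>(1) by (intro subspace_scale subspace_Rn)
  have "- s *\<^sub>R \<beta> \<in> K"
  proof (rule weighted_barycenter_in[OF Kc(1,3,2) _ iw])
    show "K \<noteq> {}" using aB BK by auto
    show "w \<in> borel_measurable borel" unfolding w_def by measurable
    show "0 \<le> w x" "x \<notin> K \<Longrightarrow> w x = 0" for x using BK by (auto simp: w_def indicator_def)
    show "0 < integral\<^sup>L ?\<mu> w" using W Iw by simp
    fix v assume v: "v \<in> Rn n"
    have "(\<integral>x. w x * (x \<bullet> v) \<partial>?\<mu>) = (\<integral>x. indicator K x * (x \<bullet> v) - indicator B x * (x \<bullet> v) / 2 \<partial>?\<mu>)"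
      by (simp add: w_def algebra_simps)
    also have "\<dots> = - ((\<beta> \<bullet> v) * vol (Rn n) B / 2)"
      using ixv centered_integral[OF K v] \<beta>(2)[OF v] by simp
    finally show "(- s *\<^sub>R \<beta> \<bullet> v) * integral\<^sup>L ?\<mu> w = (\<integral>x. w x * (x \<bullet> v) \<partial>?\<mu>)"
      using W by (simp add: Iw s_def)
  qed (rule zR)
  \<comment> \<open>The weight with \<open>(1 - \<theta>) * s = \<theta>\<close>, for which the
    contributions of \<open>\<beta>\<close> and \<open>- s *\<^sub>R \<beta>\<close> cancel.\<close>
  define \<theta> where "\<theta> = s / (1 + s)"
  have \<theta>: "0 < \<theta>" "\<theta> < 1" using s by (auto simp: \<theta>_def)
  have "cball 0 (\<theta> * (r / 2)) \<inter> Rn n \<subseteq> K"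
  proof
    fix y assume y: "y \<in> cball 0 (\<theta> * (r / 2)) \<inter> Rn n"
    have z: "norm ((1 / \<theta>) *\<^sub>R y) \<le> r / 2" using y \<theta> by (simp add: field_simps)
    have "dist a (\<beta> + (1 / \<theta>) *\<^sub>R y) = norm ((a - \<beta>) - (1 / \<theta>) *\<^sub>R y)"
      by (simp add: dist_norm algebra_simps)
    also have "\<dots> \<le> norm (a - \<beta>) + norm ((1 / \<theta>) *\<^sub>R y)" by (rule norm_triangle_ineq4)
    also have "\<dots> \<le> r / 2 + r / 2" using \<open>\<beta> \<in> B\<close> by (intro add_mono z) (simp add: B_def dist_norm)
    also have "\<dots> = r" by simp
    finally have "dist a (\<beta> + (1 / \<theta>) *\<^sub>R y) \<le> r" .
    moreover have "\<beta> + (1 / \<theta>) *\<^sub>R y \<in> Rn n" using \<beta>(1) y by (intro subspace_add subspace_scale subspace_Rn) auto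
    ultimately have "\<beta> + (1 / \<theta>) *\<^sub>R y \<in> K" using a(3) by auto
    then have "\<theta> *\<^sub>R (\<beta> + (1 / \<theta>) *\<^sub>R y) + (1 - \<theta>) *\<^sub>R (- s *\<^sub>R \<beta>) \<in> K"
      using \<theta> by (intro convexD[OF Kc(3)] \<open>- s *\<^sub>R \<beta> \<in> K\<close>) auto
    moreover have "(1 - \<theta>) * s = \<theta>" using s by (simp add: \<theta>_def field_simps)
    ultimately show "y \<in> K" using \<theta> by (simp add: scaleR_add_right)
  qed
  then show ?thesis using that[of "\<theta> * (r / 2)"] \<theta> a(2) by simp
qed

section \<open>Volume bounds for central sections\<close>

lemma vol_eq_slice: "K \<subseteq> E \<Longrightarrow> vol E K = slice E K 0"
  unfolding vol_def slice_def by (rule arg_cong2[where f = measure]) auto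

text \<open>\<open>log_concave_second_moment\<close> applied to the section function along
  \<open>\<xi>\<close>, whose mass and second moment are those of \<open>K\<close> by Tonelli's
  theorem. The form without division includes central sections of volume 0.\<close>

lemma section_moment_bound:
  assumes b: "onb E m b" and En: "E \<subseteq> Rn n" and K: "compact K" "convex K" "K \<subseteq> E" and \<xi>: "\<xi> \<in> E" "norm \<xi> = 1"
  shows "(slice (E \<inter> {x. x \<bullet> \<xi> = 0}) K 0)\<^sup>2 * (\<integral>x. indicator K x * (x \<bullet> \<xi>)\<^sup>2 \<partial>lebesgue_sub E) \<le> 2 * (vol E K) ^ 3"
proof -
  let ?W = "E \<inter> {x. x \<bullet> \<xi> = 0}" and ?\<mu> = "lebesgue_sub E"
  have E: "subspace E" using onb_subspace[OF b] .
  obtain b' where b': "onb ?W (m - 1) b'" using onb_hyperplane[OF b En \<xi>] by blast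
  obtain R where R: "\<And>x. x \<in> K \<Longrightarrow> norm x \<le> R" "0 \<le> R" using compact_norm_bound[OF K(1)] by blast
  have Kb [measurable]: "K \<in> sets borel" using compact_imp_closed[OF K(1)] by (rule borel_closed)
  define s where "s t = slice ?W K (0 + t *\<^sub>R \<xi>)" for t
  have s0: "s 0 = slice ?W K 0" by (simp add: s_def)
  have lc: "log_concave s" unfolding s_def[abs_def] by (rule log_concave_line[OF slice_log_concave[OF b' K(1,2)]])
  have sint: "integrable lborel s" unfolding s_def[abs_def] by (rule slice_integrable[OF b' K(1,2) _ \<xi>(2)]) auto
  have supp: "\<bar>t\<bar> \<le> R" if "s t \<noteq> 0" for t
    using slice_support[OF _ \<xi>(2) R(1), where W = ?W and v = 0 and t = t] that by (simp add: s_def)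
  have sb: "s t \<le> (2 * R) ^ (m - 1)" for t unfolding s_def by (rule emeasure_slice(2)[OF b' Kb R])
  have sm [measurable]: "s \<in> borel_measurable borel" by (rule log_concave_measurable[OF lc])
  have s_nn: "0 \<le> s t" for t by (simp add: s_def)
  have I0: "integral\<^sup>L lborel s = vol E K"
  proof -
    have "ennreal (vol E K) = (\<integral>\<^sup>+t. ennreal (s t) \<partial>lborel)"
      unfolding vol_eq_slice[OF K(3)] s_def by (rule slice_add_normal[OF E b' \<xi> Kb R])
    also have "\<dots> = ennreal (integral\<^sup>L lborel s)" using sint s_nn by (intro nn_integral_eq_integral) auto
    finally show ?thesis using s_nn by (simp add: vol_def)
  qed
  have I2: "(\<integral>t. t\<^sup>2 * s t \<partial>lborel) = (\<integral>x. indicator K x * (x \<bullet> \<xi>)\<^sup>2 \<partial>?\<mu>)"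
  proof -
    have m1: "(\<lambda>x. ennreal (indicator K x * (x \<bullet> \<xi>)\<^sup>2)) \<in> borel_measurable borel" by measurable
    have "(\<integral>\<^sup>+x. ennreal (indicator K x * (x \<bullet> \<xi>)\<^sup>2) \<partial>?\<mu>)
       = (\<integral>\<^sup>+t. \<integral>\<^sup>+y. ennreal (indicator K (y + t *\<^sub>R \<xi>) * ((y + t *\<^sub>R \<xi>) \<bullet> \<xi>)\<^sup>2) \<partial>lebesgue_sub ?W \<partial>lborel)"
      by (rule nn_integral_lebesgue_sub_slices[OF E b' \<xi> m1])
    also have "\<dots> = (\<integral>\<^sup>+t. ennreal (t\<^sup>2 * s t) \<partial>lborel)"
    proof (rule nn_integral_cong)
      fix t :: real
      have "(\<integral>\<^sup>+y. ennreal (indicator K (y + t *\<^sub>R \<xi>) * ((y + t *\<^sub>R \<xi>) \<bullet> \<xi>)\<^sup>2) \<partial>lebesgue_sub ?W)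
        = (\<integral>\<^sup>+y. ennreal (t\<^sup>2) * indicator {y \<in> ?W. (0 + t *\<^sub>R \<xi>) + y \<in> K} y \<partial>lebesgue_sub ?W)"
      proof (rule nn_integral_cong)
        fix y assume "y \<in> space (lebesgue_sub ?W)"
        then have y: "y \<in> ?W" by (simp add: space_lebesgue_sub[OF b'])
        have "(y + t *\<^sub>R \<xi>) \<bullet> \<xi> = t" using y \<xi>(2) by (simp add: inner_add_left norm_eq_1)
        then show "ennreal (indicator K (y + t *\<^sub>R \<xi>) * ((y + t *\<^sub>R \<xi>) \<bullet> \<xi>)\<^sup>2)
          = ennreal (t\<^sup>2) * indicator {y \<in> ?W. (0 + t *\<^sub>R \<xi>) + y \<in> K} y"
          using y by (simp add: indicator_def add.commute)
      qed
      also have "\<dots> = ennreal (t\<^sup>2) * emeasure (lebesgue_sub ?W) {y \<in> ?W. (0 + t *\<^sub>R \<xi>) + y \<in> K}"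
        by (rule nn_integral_cmult_indicator, rule in_sets_lebesgue_sub[OF b' slice_set_borel[OF b' Kb]]) auto
      also have "emeasure (lebesgue_sub ?W) {y \<in> ?W. (0 + t *\<^sub>R \<xi>) + y \<in> K} = ennreal (s t)"
        unfolding s_def by (rule emeasure_slice(1)[OF b' Kb R])
      finally show "(\<integral>\<^sup>+y. ennreal (indicator K (y + t *\<^sub>R \<xi>) * ((y + t *\<^sub>R \<xi>) \<bullet> \<xi>)\<^sup>2) \<partial>lebesgue_sub ?W) = ennreal (t\<^sup>2 * s t)"
        using s_nn[of t] by (simp add: ennreal_mult)
    qed
    finally have nn: "(\<integral>\<^sup>+x. ennreal (indicator K x * (x \<bullet> \<xi>)\<^sup>2) \<partial>?\<mu>) = (\<integral>\<^sup>+t. ennreal (t\<^sup>2 * s t) \<partial>lborel)" .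
    have "(\<integral>t. t\<^sup>2 * s t \<partial>lborel) = enn2real (\<integral>\<^sup>+t. ennreal (t\<^sup>2 * s t) \<partial>lborel)"
      by (rule integral_eq_nn_integral) (use s_nn in auto)
    moreover have "(\<integral>x. indicator K x * (x \<bullet> \<xi>)\<^sup>2 \<partial>?\<mu>) = enn2real (\<integral>\<^sup>+x. ennreal (indicator K x * (x \<bullet> \<xi>)\<^sup>2) \<partial>?\<mu>)"
      by (rule integral_eq_nn_integral, rule measurable_lebesgue_sub[OF b]) auto
    ultimately show ?thesis using nn by simp
  qed
  show ?thesis
  proof (cases "s 0 = 0")
    case False
    then have p: "s 0 > 0" using s_nn[of 0] by simp
    have "(\<integral>t. t\<^sup>2 * s t \<partial>lborel) \<le> 2 * (integral\<^sup>L lborel s) ^ 3 / (s 0)\<^sup>2"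
      by (rule log_concave_second_moment[OF lc p sb supp])
    then show ?thesis unfolding I0 I2 s0[symmetric] using p by (simp add: field_simps)
  next
    case True
    then show ?thesis unfolding s0[symmetric] by (simp add: vol_def)
  qed
qed

section \<open>A lower bound for central sections of a centered body\<close>

lemma onb_prefix:
  assumes b: "onb E m b" and j: "j \<le> m"
  shows "onb (span (b ` {..<j})) j b" "span (b ` {..<j}) \<subseteq> E"
proof -
  show "onb (span (b ` {..<j})) j b" using assms by (simp add: onb_def)
  have "b ` {..<j} \<subseteq> b ` {..<m}" using j by auto
  then show "span (b ` {..<j}) \<subseteq> E" using b span_mono by (simp add: onb_def) blast
qed

lemma comb_merge:
  assumes "j \<le> m"
  shows "comb m b (merge {j..<m} {..<j} (x, y)) = comb j b y + (\<Sum>i\<in>{j..<m}. x i *\<^sub>R b i)"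
proof -
  have I: "{..<m} = {..<j} \<union> {j..<m}" using assms by auto
  have "comb m b z = (\<Sum>i<j. z i *\<^sub>R b i) + (\<Sum>i\<in>{j..<m}. z i *\<^sub>R b i)" for z
    unfolding comb_def I by (rule sum.union_disjoint) auto
  moreover have "(\<Sum>i<j. merge {j..<m} {..<j} (x, y) i *\<^sub>R b i) = comb j b y"
    unfolding comb_def by (intro sum.cong) (auto simp: merge_def)
  moreover have "(\<Sum>i\<in>{j..<m}. merge {j..<m} {..<j} (x, y) i *\<^sub>R b i) = (\<Sum>i\<in>{j..<m}. x i *\<^sub>R b i)"
    by (intro sum.cong) (auto simp: merge_def)
  ultimately show ?thesis by (simp only:)
qed

text \<open>The coordinates from \<open>j\<close> on stay explicit because a Gaussian density will
  be integrated in them; the first \<open>j\<close> are gathered into a subspace, so that the fibres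
  of a body are its sections.\<close>

lemma nn_integral_lebesgue_sub_split:
  assumes b: "onb E m b" and j: "j \<le> m" and f: "f \<in> borel_measurable borel"
  shows "(\<integral>\<^sup>+x. f x \<partial>lebesgue_sub E)
    = (\<integral>\<^sup>+c. \<integral>\<^sup>+y. f ((\<Sum>i\<in>{j..<m}. c i *\<^sub>R b i) + y) \<partial>lebesgue_sub (span (b ` {..<j})) \<partial>lpi {j..<m})"
proof -
  note f [measurable]
  have I: "{..<m} = {j..<m} \<union> {..<j}" using j by auto
  have "(\<integral>\<^sup>+x. f x \<partial>lebesgue_sub E) = (\<integral>\<^sup>+c. f (comb m b c) \<partial>lpi {..<m})"
    by (rule nn_integral_lebesgue_sub[OF b f])
  also have "\<dots> = (\<integral>\<^sup>+c. f (comb m b c) \<partial>lpi ({j..<m} \<union> {..<j}))" using I by simp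
  also have "\<dots> = (\<integral>\<^sup>+c. \<integral>\<^sup>+y. f (comb m b (merge {j..<m} {..<j} (c, y))) \<partial>lpi {..<j} \<partial>lpi {j..<m})"
  proof (rule lpi.product_nn_integral_fold)
    show "(\<lambda>c. f (comb m b c)) \<in> borel_measurable (lpi ({j..<m} \<union> {..<j}))"
      unfolding I[symmetric] by measurable
  qed auto
  also have "\<dots> = (\<integral>\<^sup>+c. \<integral>\<^sup>+y. f ((\<Sum>i\<in>{j..<m}. c i *\<^sub>R b i) + y) \<partial>lebesgue_sub (span (b ` {..<j})) \<partial>lpi {j..<m})"
    unfolding comb_merge[OF j]
    by (subst nn_integral_lebesgue_sub[OF onb_prefix(1)[OF b j]]) (auto simp: add.commute)
  finally show ?thesis .
qed

text \<open>The section function \<open>\<phi>\<close> of \<open>K\<close> is log-concave, hence \<open>\<phi> 0\<close> dominates \<open>\<phi> c\<close> times an exponential of a linear form.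
  Integrating against a Gaussian with the variances \<open>lam\<close> and applying Jensen's inequality on \<open>K\<close>, the linear form
  vanishes because \<open>K\<close> is centered.\<close>
lemma section_lower_bound:
  assumes b: "onb (Rn n) n b" and j: "j < n"
    and K: "compact K" "convex K" "K \<subseteq> Rn n" and r: "r > 0" "cball 0 r \<inter> Rn n \<subseteq> K"
    and cent: "\<And>v. v \<in> Rn n \<Longrightarrow> (\<integral>x. indicator K x * (x \<bullet> v) \<partial>lebesgue_sub (Rn n)) = 0"
    and G: "G = \<gamma> *\<^sub>R b j + (\<Sum>i\<in>{j<..<n}. h i *\<^sub>R b i)" "\<gamma> > 0"
    and u: "u j = G" "\<And>i. j < i \<Longrightarrow> i < n \<Longrightarrow> u i = b i"
    and lam: "\<And>i. j \<le> i \<Longrightarrow> i < n \<Longrightarrow> lam i > 0"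
    and var: "\<And>i. j \<le> i \<Longrightarrow> i < n \<Longrightarrow> (\<integral>x. indicator K x * (x \<bullet> u i)\<^sup>2 \<partial>lebesgue_sub (Rn n)) = lam i * vol (Rn n) K"
  shows "\<gamma> * vol (Rn n) K * (\<Prod>i\<in>{j..<n}. exp (- (1 / 2)) / sqrt (2 * pi * lam i)) \<le> slice (span (b ` {..<j})) K 0"
proof -
  let ?\<mu> = "lebesgue_sub (Rn n)" and ?W = "span (b ` {..<j})" and ?I = "{j..<n}"
  have jn: "j \<le> n" using j by simp
  note bW = onb_prefix[OF b jn]
  obtain R where R: "\<And>x. x \<in> K \<Longrightarrow> norm x \<le> R" "0 \<le> R" using compact_norm_bound[OF K(1)] by blast
  have Kb [measurable]: "K \<in> sets borel" using compact_imp_closed[OF K(1)] by (rule borel_closed)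
  have Ij: "?I = insert j {j<..<n}" using j by auto
  have uR: "u i \<in> Rn n" if "i \<in> ?I" for i
  proof (cases "i = j")
    case True
    have "(\<Sum>i\<in>{j<..<n}. h i *\<^sub>R b i) \<in> Rn n"
      using onb_in[OF b] by (intro subspace_sum subspace_scale subspace_Rn) auto
    moreover have "\<gamma> *\<^sub>R b j \<in> Rn n" using onb_in[OF b j] by (intro subspace_scale subspace_Rn)
    ultimately show ?thesis using True u(1) G(1) by (auto intro: subspace_add subspace_Rn)
  next
    case False
    then show ?thesis using u(2)[of i] onb_in[OF b, of i] that by simp
  qed
  define \<phi> where "\<phi> = slice ?W K"
  have lc: "log_concave \<phi>" unfolding \<phi>_def by (rule slice_log_concave[OF bW(1) K(1,2)])
  have \<phi>pos: "\<phi> v > 0" if "v \<in> Rn n" "norm v < r" for v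
    unfolding \<phi>_def by (rule slice_pos[OF bW K(1) r(2) that subspace_Rn])
  have \<phi>0: "\<phi> 0 > 0" using \<phi>pos[of 0] r(1) subspace_0[OF subspace_Rn] by simp
  have dir: "\<exists>\<delta>>0. \<phi> (\<delta> *\<^sub>R b (j + i)) > 0 \<and> \<phi> (- \<delta> *\<^sub>R b (j + i)) > 0" if "i < n - j" for i
  proof (intro exI[of _ "r / 2"] conjI)
    have "b (j + i) \<in> Rn n" "norm (b (j + i)) = 1" using that onb_in[OF b] onb_norm[OF b] by auto
    then show "\<phi> ((r / 2) *\<^sub>R b (j + i)) > 0" "\<phi> (- (r / 2) *\<^sub>R b (j + i)) > 0"
      using r(1) by (auto intro!: \<phi>pos subspace_scale subspace_neg subspace_Rn)
  qed (use r in simp)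
  \<comment> \<open>The supporting exponential is taken along the basis vectors from
    \<open>b j\<close> on, renumbered from 0; \<open>v\<close> undoes the shift.\<close>
  from log_concave_subgradient[OF lc \<phi>0, of "n - j" "\<lambda>i. b (j + i)", OF dir]
  obtain v' where v': "\<And>c. \<phi> (\<Sum>i<n - j. c i *\<^sub>R b (j + i)) \<le> \<phi> 0 * exp (\<Sum>i<n - j. c i * v' i)" by blast
  define v where "v i = v' (i - j)" for i
  have v: "\<phi> (\<Sum>i\<in>?I. c i *\<^sub>R b i) \<le> \<phi> 0 * exp (\<Sum>i\<in>?I. c i * v i)" for c
  proof -
    have "(\<Sum>i\<in>?I. c i *\<^sub>R b i) = (\<Sum>i<n - j. c (j + i) *\<^sub>R b (j + i))"
      by (rule sum.reindex_bij_witness[where i = "\<lambda>i. j + i" and j = "\<lambda>i. i - j"]) auto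
    moreover have "(\<Sum>i\<in>?I. c i * v i) = (\<Sum>i<n - j. c (j + i) * v' i)"
      by (rule sum.reindex_bij_witness[where i = "\<lambda>i. j + i" and j = "\<lambda>i. i - j"]) (auto simp: v_def)
    ultimately show ?thesis using v'[of "\<lambda>i. c (j + i)"] by simp
  qed
  \<comment> \<open>The normalisation of a Gaussian with variances \<open>lam i\<close> in the
    variables \<open>x \<bullet> u i\<close>. These depend on the coordinates
    \<open>x \<bullet> b i\<close> through a triangular matrix of determinant
    \<open>\<gamma>\<close>, since only \<open>u j\<close> differs from the basis vector.\<close>
  define C where "C = \<gamma> * (\<Prod>i\<in>?I. 1 / sqrt (2 * pi * lam i))"
  have Cpos: "C > 0" unfolding C_def using G(2) lam by (intro mult_pos_pos prod_pos) auto
  \<comment> \<open>The exponent of that Gaussian. The subtracted linear form compensates exactly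
    for the exponential growth that the supporting bound \<open>v\<close> allows to
    \<open>\<phi>\<close>.\<close>
  define q where "q x = - (\<Sum>i\<in>?I. (x \<bullet> u i)\<^sup>2 / (2 * lam i)) - (\<Sum>i\<in>?I. (x \<bullet> b i) * v i)" for x
  have qm [measurable]: "q \<in> borel_measurable borel" unfolding q_def[abs_def] by measurable
  define V where "V = vol (Rn n) K"
  have V: "V > 0" unfolding V_def using subspace_0[OF subspace_Rn] r by (intro vol_ball_pos[OF b K(1,3), of 0 r]) auto
  have iu: "integrable ?\<mu> (\<lambda>x. indicator K x * (x \<bullet> w)\<^sup>2)" for w
  proof (rule integrable_on_compact[OF b K(1,3), where C = "(R * norm w)\<^sup>2"])
    fix x assume "x \<in> K"
    then have "\<bar>x \<bullet> w\<bar> \<le> R * norm w"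
      using Cauchy_Schwarz_ineq2[of x w] mult_right_mono[OF R(1), of x "norm w"] by force
    from power_mono[OF this, of 2] show "\<bar>(x \<bullet> w)\<^sup>2\<bar> \<le> (R * norm w)\<^sup>2" by simp
  qed measurable
  have il: "integrable ?\<mu> (\<lambda>x. indicator K x * (x \<bullet> w))" for w
  proof (rule integrable_on_compact[OF b K(1,3), where C = "R * norm w"])
    fix x assume "x \<in> K"
    then show "\<bar>x \<bullet> w\<bar> \<le> R * norm w"
      using Cauchy_Schwarz_ineq2[of x w] mult_right_mono[OF R(1), of x "norm w"] by force
  qed measurable
  have iK: "integrable ?\<mu> (\<lambda>x. indicator K x * (1 :: real))"
    by (rule integrable_on_compact[OF b K(1,3), where C = 1]) auto
  \<comment> \<open>The average of \<open>q\<close> over \<open>K\<close>: each of the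
    \<open>n - j\<close> squares contributes \<open>- 1 / 2\<close>, and the linear part vanishes
    because \<open>K\<close> is centered.\<close>
  define a where "a = - (real (n - j) / 2)"
  have qi: "integrable ?\<mu> (\<lambda>x. indicator K x * q x)" and qI: "(\<integral>x. indicator K x * q x \<partial>?\<mu>) = a * V"
  proof -
    have e: "indicator K x * q x = - (\<Sum>i\<in>?I. (indicator K x * (x \<bullet> u i)\<^sup>2) / (2 * lam i)) - (\<Sum>i\<in>?I. (indicator K x * (x \<bullet> b i)) * v i)" for x
      by (simp add: q_def right_diff_distrib sum_distrib_left mult.assoc)
    show "integrable ?\<mu> (\<lambda>x. indicator K x * q x)"
      unfolding e by (intro Bochner_Integration.integrable_diff integrable_minus Bochner_Integration.integrable_sum integrable_divide integrable_mult_left iu il)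
    have "(\<integral>x. indicator K x * q x \<partial>?\<mu>)
        = - (\<Sum>i\<in>?I. (\<integral>x. indicator K x * (x \<bullet> u i)\<^sup>2 \<partial>?\<mu>) / (2 * lam i)) - (\<Sum>i\<in>?I. (\<integral>x. indicator K x * (x \<bullet> b i) \<partial>?\<mu>) * v i)"
      unfolding e
      by (subst Bochner_Integration.integral_diff, (intro integrable_minus Bochner_Integration.integrable_sum integrable_divide integrable_mult_left iu il)+)
        (simp add: Bochner_Integration.integral_sum iu il)
    also have "(\<Sum>i\<in>?I. (\<integral>x. indicator K x * (x \<bullet> u i)\<^sup>2 \<partial>?\<mu>) / (2 * lam i)) = (\<Sum>i\<in>?I. V / 2)"
    proof (rule sum.cong[OF refl])
      fix i assume i: "i \<in> ?I"
      then have "lam i \<noteq> 0" using lam[of i] by simp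
      then show "(\<integral>x. indicator K x * (x \<bullet> u i)\<^sup>2 \<partial>?\<mu>) / (2 * lam i) = V / 2" using var[of i] i by (simp add: V_def)
    qed
    also have "(\<Sum>i\<in>?I. (\<integral>x. indicator K x * (x \<bullet> b i) \<partial>?\<mu>) * v i) = 0"
      using cent onb_in[OF b] by (intro sum.neutral) auto
    finally show "(\<integral>x. indicator K x * q x \<partial>?\<mu>) = a * V" using jn by (simp add: a_def)
  qed
  define F where "F x = indicator K x * (C * exp (q x))" for x
  have Fm: "F \<in> borel_measurable borel" unfolding F_def[abs_def] by measurable
  have F0: "0 \<le> F x" for x using Cpos by (simp add: F_def)
  have lower: "ennreal (C * V * exp a) \<le> (\<integral>\<^sup>+x. ennreal (F x) \<partial>?\<mu>)"
  proof -
    have "q x \<le> (\<Sum>i\<in>?I. R * \<bar>v i\<bar>)" if x: "x \<in> K" for x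
    proof -
      have "0 \<le> (\<Sum>i\<in>?I. (x \<bullet> u i)\<^sup>2 / (2 * lam i))"
        using lam by (intro sum_nonneg divide_nonneg_nonneg) (auto simp: less_imp_le)
      moreover have "- (\<Sum>i\<in>?I. (x \<bullet> b i) * v i) \<le> (\<Sum>i\<in>?I. R * \<bar>v i\<bar>)"
        unfolding sum_negf[symmetric]
      proof (rule sum_mono)
        fix i assume "i \<in> ?I"
        then have "\<bar>x \<bullet> b i\<bar> \<le> R"
          using Cauchy_Schwarz_ineq2[of x "b i"] onb_norm[OF b, of i] R(1)[OF x] by simp
        then have "\<bar>x \<bullet> b i\<bar> * \<bar>v i\<bar> \<le> R * \<bar>v i\<bar>" by (intro mult_right_mono) auto
        then show "- ((x \<bullet> b i) * v i) \<le> R * \<bar>v i\<bar>" by (simp flip: abs_mult)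
      qed
      ultimately show ?thesis by (simp add: q_def)
    qed
    then have iF: "integrable ?\<mu> F"
      unfolding F_def[abs_def] using Cpos
      by (intro integrable_on_compact[OF b K(1,3), where C = "C * exp (\<Sum>i\<in>?I. R * \<bar>v i\<bar>)"]) auto
    \<comment> \<open>The tangent line of \<open>exp\<close> at the average \<open>a\<close>,
      evaluated at \<open>q\<close>; integrating it is Jensen's inequality.\<close>
    let ?l = "\<lambda>x. C * exp a * (1 - a) * (indicator K x * 1) + C * exp a * (indicator K x * q x)"
    have il: "integrable ?\<mu> ?l"
      by (intro Bochner_Integration.integrable_add integrable_mult_right iK qi)
    have "integral\<^sup>L ?\<mu> ?l = C * exp a * (1 - a) * V + C * exp a * (a * V)"
    proof (rule has_bochner_integral_integral_eq)
      have h1: "has_bochner_integral ?\<mu> (\<lambda>x. indicator K x * (1 :: real)) V"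
        using iK integral_indicator_compact[OF b K(1,3), of 1] by (simp add: has_bochner_integral_iff V_def)
      have h2: "has_bochner_integral ?\<mu> (\<lambda>x. indicator K x * q x) (a * V)"
        using qi qI by (simp add: has_bochner_integral_iff)
      show "has_bochner_integral ?\<mu> ?l (C * exp a * (1 - a) * V + C * exp a * (a * V))"
        by (intro has_bochner_integral_add has_bochner_integral_mult_right h1 h2)
    qed
    then have "C * V * exp a = integral\<^sup>L ?\<mu> ?l" by (simp add: algebra_simps)
    also have "\<dots> \<le> integral\<^sup>L ?\<mu> F"
    proof (rule Bochner_Integration.integral_mono[OF il iF])
      fix x
      have "1 + (q x - a) \<le> exp (q x - a)" by (rule exp_ge_add_one_self)
      then have "exp a * (1 + (q x - a)) \<le> exp a * exp (q x - a)" by (rule mult_left_mono) simp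
      also have "\<dots> = exp (q x)" by (simp flip: exp_add)
      finally have "C * (exp a * (1 + (q x - a))) \<le> C * exp (q x)" using Cpos by simp
      then show "?l x \<le> F x" by (simp add: F_def indicator_def algebra_simps)
    qed
    also have "ennreal (integral\<^sup>L ?\<mu> F) = (\<integral>\<^sup>+x. ennreal (F x) \<partial>?\<mu>)"
      using iF F0 by (intro nn_integral_eq_integral[symmetric]) auto
    finally show ?thesis using ennreal_leI by auto
  qed
  define N where "N i t = exp (- (t\<^sup>2 / (2 * lam i))) / sqrt (2 * pi * lam i)" for i and t :: real
  define L where "L c = \<gamma> * c j + (\<Sum>i\<in>{j<..<n}. h i * c i)" for c :: "nat \<Rightarrow> real"
  \<comment> \<open>The Gaussian density in the coordinates \<open>c\<close>, where
    \<open>L c\<close> is the inner product with \<open>G\<close>. In \<open>g1\<close> the variable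
    \<open>c j\<close> is integrated first, and its substitution uses up the factor
    \<open>\<gamma>\<close>.\<close>
  define g where "g c = \<gamma> * N j (L c) * (\<Prod>i\<in>{j<..<n}. N i (c i))" for c
  have N0: "0 \<le> N i t" if "i \<in> ?I" for i t using lam[of i] that by (simp add: N_def)
  have Nm [measurable]: "N i \<in> borel_measurable borel" for i unfolding N_def[abs_def] by measurable
  have N1: "(\<integral>\<^sup>+t. ennreal (N i t) \<partial>lborel) = 1" if "i \<in> ?I" for i
  proof -
    have l: "lam i > 0" using lam[of i] that by simp
    have "N i t = normal_density 0 (sqrt (lam i)) t" for t
      using l by (simp add: N_def normal_density_def)
    then have "(\<integral>\<^sup>+t. ennreal (N i t) \<partial>lborel) = ennreal (\<integral>t. normal_density 0 (sqrt (lam i)) t \<partial>lborel)"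
      using l by (simp add: nn_integral_eq_integral)
    then show ?thesis using l by simp
  qed
  have Lm [measurable]: "L \<in> borel_measurable (lpi ?I)"
  proof -
    have "(\<lambda>c. c i) \<in> borel_measurable (lpi ?I)" if "i \<in> ?I" for i using that by simp
    then show ?thesis unfolding L_def[abs_def] using j
      by (intro borel_measurable_add borel_measurable_times borel_measurable_sum) auto
  qed
  have gm: "(\<lambda>c. ennreal (g c)) \<in> borel_measurable (lpi ?I)"
  proof -
    have "(\<lambda>c. N i (c i)) \<in> borel_measurable (lpi ?I)" if "i \<in> ?I" for i
      using that by (intro measurable_compose[OF _ Nm]) simp
    then have "(\<lambda>c. \<Prod>i\<in>{j<..<n}. N i (c i)) \<in> borel_measurable (lpi ?I)"
      by (intro borel_measurable_prod) auto
    then show ?thesis unfolding g_def[abs_def] by measurable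
  qed
  have g1: "(\<integral>\<^sup>+c. ennreal (g c) \<partial>lpi ?I) = 1"
  proof -
    let ?J = "{j<..<n}"
    have "(\<integral>\<^sup>+c. ennreal (g c) \<partial>lpi ?I) = (\<integral>\<^sup>+c. \<integral>\<^sup>+t. ennreal (g (c(j := t))) \<partial>lborel \<partial>lpi ?J)"
      using gm unfolding Ij by (intro lpi.product_nn_integral_insert) auto
    also have "\<dots> = (\<integral>\<^sup>+c. (\<Prod>i\<in>?J. ennreal (N i (c i))) \<partial>lpi ?J)"
    proof (rule nn_integral_cong)
      fix c :: "nat \<Rightarrow> real"
      let ?P = "\<Prod>i\<in>?J. N i (c i)" and ?s = "\<Sum>i\<in>?J. h i * c i"
      have P0: "0 \<le> ?P" by (intro prod_nonneg) (auto intro: N0)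
      have "g (c(j := t)) = ?P * (\<gamma> * N j (?s + \<gamma> * t))" for t
      proof -
        have "(\<Prod>i\<in>?J. N i ((c(j := t)) i)) = ?P" by (intro prod.cong) auto
        moreover have "(\<Sum>i\<in>?J. h i * (c(j := t)) i) = ?s" by (intro sum.cong) auto
        ultimately show ?thesis by (simp add: g_def L_def mult_ac add.commute)
      qed
      then have "(\<integral>\<^sup>+t. ennreal (g (c(j := t))) \<partial>lborel) = (\<integral>\<^sup>+t. ennreal ?P * (ennreal \<gamma> * ennreal (N j (?s + \<gamma> * t))) \<partial>lborel)"
        using P0 G(2) N0[of j] j by (simp add: ennreal_mult)
      also have "\<dots> = ennreal ?P * (ennreal \<gamma> * (\<integral>\<^sup>+t. ennreal (N j (?s + \<gamma> * t)) \<partial>lborel))"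
        by (simp add: nn_integral_cmult)
      also have "ennreal \<gamma> * (\<integral>\<^sup>+t. ennreal (N j (?s + \<gamma> * t)) \<partial>lborel) = (\<integral>\<^sup>+t. ennreal (N j t) \<partial>lborel)"
        using nn_integral_real_affine[of "\<lambda>t. ennreal (N j t)" \<gamma> ?s] G(2) by simp
      also have "\<dots> = 1" using N1[of j] j by simp
      also have "ennreal ?P * 1 = (\<Prod>i\<in>?J. ennreal (N i (c i)))"
        unfolding mult_1_right using N0 by (intro prod_ennreal[symmetric]) auto
      finally show "(\<integral>\<^sup>+t. ennreal (g (c(j := t))) \<partial>lborel) = (\<Prod>i\<in>?J. ennreal (N i (c i)))" .
    qed
    also have "\<dots> = (\<Prod>i\<in>?J. (\<integral>\<^sup>+t. ennreal (N i t) \<partial>lborel))"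
      by (intro lpi.product_nn_integral_prod) auto
    also have "\<dots> = 1" using N1 by (intro prod.neutral) auto
    finally show ?thesis .
  qed
  have "(\<integral>\<^sup>+x. ennreal (F x) \<partial>?\<mu>)
     = (\<integral>\<^sup>+c. \<integral>\<^sup>+y. ennreal (F ((\<Sum>i\<in>?I. c i *\<^sub>R b i) + y)) \<partial>lebesgue_sub ?W \<partial>lpi ?I)"
    using Fm by (intro nn_integral_lebesgue_sub_split[OF b jn]) measurable
  \<comment> \<open>For fixed \<open>c\<close> the function \<open>F\<close> is constant on the part
    of the fibre that lies in \<open>K\<close>. The measure of that part is at most
    \<open>\<phi> 0\<close> times an exponential which cancels the linear part of \<open>q\<close>,
    so \<open>\<phi> 0\<close> times the density \<open>g\<close> remains.\<close>
  also have "\<dots> \<le> (\<integral>\<^sup>+c. ennreal (\<phi> 0) * ennreal (g c) \<partial>lpi ?I)"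
  proof (rule nn_integral_mono)
    fix c
    let ?x = "\<Sum>i\<in>?I. c i *\<^sub>R b i"
    have xb: "?x \<bullet> b l = c l" if "l \<in> ?I" for l
    proof -
      have "?x \<bullet> b l = (\<Sum>i\<in>?I. c i * (if i = l then 1 else 0))"
        unfolding inner_sum_left using that by (intro sum.cong) (auto simp: onb_inner[OF b])
      then show ?thesis using that by (simp add: if_distrib[of "(*) _"] cong: if_cong)
    qed
    have yb: "y \<bullet> b l = 0" if "y \<in> ?W" "l \<in> ?I" for y l
    proof -
      have "y = comb j b (\<lambda>i. y \<bullet> b i)" using onb_expand[OF bW(1) that(1)] by simp
      moreover have "comb j b z \<bullet> b l = 0" for z
        unfolding comb_def inner_sum_left using that(2) by (intro sum.neutral) (auto simp: onb_inner[OF b])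
      ultimately show ?thesis by metis
    qed
    have qxy: "q (?x + y) = - (L c)\<^sup>2 / (2 * lam j) - (\<Sum>i\<in>{j<..<n}. (c i)\<^sup>2 / (2 * lam i)) - (\<Sum>i\<in>?I. c i * v i)"
      if y: "y \<in> ?W" for y
    proof -
      have xyb: "(?x + y) \<bullet> b l = c l" if "l \<in> ?I" for l
        using xb[OF that] yb[OF y that] by (simp add: inner_add_left)
      have xu: "(?x + y) \<bullet> u j = L c"
        unfolding u(1) G(1) inner_add_right inner_sum_right inner_scaleR_right L_def
        using xyb j by (auto intro!: arg_cong2[where f = "(+)"] sum.cong)
      have "(\<Sum>i\<in>?I. ((?x + y) \<bullet> u i)\<^sup>2 / (2 * lam i)) = (L c)\<^sup>2 / (2 * lam j) + (\<Sum>i\<in>{j<..<n}. (c i)\<^sup>2 / (2 * lam i))"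
      proof -
        have si: "sum f ?I = f j + sum f {j<..<n}" for f :: "nat \<Rightarrow> real"
          unfolding Ij by simp
        have "(\<Sum>i\<in>{j<..<n}. ((?x + y) \<bullet> u i)\<^sup>2 / (2 * lam i)) = (\<Sum>i\<in>{j<..<n}. (c i)\<^sup>2 / (2 * lam i))"
        proof (rule sum.cong[OF refl])
          fix i assume "i \<in> {j<..<n}"
          then show "((?x + y) \<bullet> u i)\<^sup>2 / (2 * lam i) = (c i)\<^sup>2 / (2 * lam i)"
            using u(2)[of i] xyb[of i] by simp
        qed
        then show ?thesis using xu unfolding si by simp
      qed
      moreover have "(\<Sum>i\<in>?I. ((?x + y) \<bullet> b i) * v i) = (\<Sum>i\<in>?I. c i * v i)" using xyb by (intro sum.cong) auto
      ultimately show ?thesis by (simp add: q_def)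
    qed
    define e where "e = C * exp (- (L c)\<^sup>2 / (2 * lam j) - (\<Sum>i\<in>{j<..<n}. (c i)\<^sup>2 / (2 * lam i)))"
    have eg: "e = g c"
    proof -
      have "exp (- (\<Sum>i\<in>{j<..<n}. (c i)\<^sup>2 / (2 * lam i))) = (\<Prod>i\<in>{j<..<n}. exp (- ((c i)\<^sup>2 / (2 * lam i))))"
        by (simp add: exp_sum sum_negf[symmetric])
      then have "exp (- (L c)\<^sup>2 / (2 * lam j) - (\<Sum>i\<in>{j<..<n}. (c i)\<^sup>2 / (2 * lam i)))
         = exp (- ((L c)\<^sup>2 / (2 * lam j))) * (\<Prod>i\<in>{j<..<n}. exp (- ((c i)\<^sup>2 / (2 * lam i))))"
        by (simp add: exp_diff exp_minus field_simps)
      moreover have "(\<Prod>i\<in>?I. 1 / sqrt (2 * pi * lam i)) = 1 / sqrt (2 * pi * lam j) * (\<Prod>i\<in>{j<..<n}. 1 / sqrt (2 * pi * lam i))"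
        unfolding Ij by simp
      moreover have "(\<Prod>i\<in>{j<..<n}. N i (c i)) = (\<Prod>i\<in>{j<..<n}. exp (- ((c i)\<^sup>2 / (2 * lam i)))) * (\<Prod>i\<in>{j<..<n}. 1 / sqrt (2 * pi * lam i))"
        unfolding N_def prod.distrib[symmetric] by simp
      moreover have "N j (L c) = exp (- ((L c)\<^sup>2 / (2 * lam j))) * (1 / sqrt (2 * pi * lam j))"
        by (simp add: N_def)
      ultimately show ?thesis unfolding e_def C_def g_def by (simp only: mult_ac)
    qed
    have "(\<integral>\<^sup>+y. ennreal (F (?x + y)) \<partial>lebesgue_sub ?W)
       = (\<integral>\<^sup>+y. ennreal (e * exp (- (\<Sum>i\<in>?I. c i * v i))) * indicator {y \<in> ?W. ?x + y \<in> K} y \<partial>lebesgue_sub ?W)"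
    proof (rule nn_integral_cong)
      fix y assume "y \<in> space (lebesgue_sub ?W)"
      then have y: "y \<in> ?W" by (simp add: space_lebesgue_sub[OF bW(1)])
      have "C * exp (q (?x + y)) = e * exp (- (\<Sum>i\<in>?I. c i * v i))"
        unfolding qxy[OF y] e_def by (simp add: mult.assoc flip: exp_add)
      then show "ennreal (F (?x + y)) = ennreal (e * exp (- (\<Sum>i\<in>?I. c i * v i))) * indicator {y \<in> ?W. ?x + y \<in> K} y"
        using y by (simp add: F_def indicator_def)
    qed
    also have "\<dots> = ennreal (e * exp (- (\<Sum>i\<in>?I. c i * v i))) * emeasure (lebesgue_sub ?W) {y \<in> ?W. ?x + y \<in> K}"
      by (rule nn_integral_cmult_indicator, rule in_sets_lebesgue_sub[OF bW(1) slice_set_borel[OF bW(1) Kb]]) auto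
    also have "emeasure (lebesgue_sub ?W) {y \<in> ?W. ?x + y \<in> K} = ennreal (\<phi> ?x)"
      unfolding \<phi>_def by (rule emeasure_slice(1)[OF bW(1) Kb R])
    also have "ennreal (e * exp (- (\<Sum>i\<in>?I. c i * v i))) * ennreal (\<phi> ?x) \<le> ennreal (\<phi> 0) * ennreal (g c)"
    proof -
      have e0: "0 \<le> e" using Cpos by (simp add: e_def)
      have "e * exp (- (\<Sum>i\<in>?I. c i * v i)) * \<phi> ?x \<le> e * exp (- (\<Sum>i\<in>?I. c i * v i)) * (\<phi> 0 * exp (\<Sum>i\<in>?I. c i * v i))"
        using v e0 by (intro mult_left_mono) auto
      also have "\<dots> = \<phi> 0 * e" by (simp add: exp_minus field_simps)
      finally have "e * exp (- (\<Sum>i\<in>?I. c i * v i)) * \<phi> ?x \<le> \<phi> 0 * e" .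
      then show ?thesis
        unfolding eg[symmetric] using e0 \<phi>0 by (subst (1 2) ennreal_mult[symmetric]) (auto simp: \<phi>_def intro: ennreal_leI)
    qed
    finally show "(\<integral>\<^sup>+y. ennreal (F (?x + y)) \<partial>lebesgue_sub ?W) \<le> ennreal (\<phi> 0) * ennreal (g c)" .
  qed
  also have "\<dots> = ennreal (\<phi> 0)" using gm g1 by (subst nn_integral_cmult) auto
  finally have "ennreal (C * V * exp a) \<le> ennreal (\<phi> 0)" using lower by (rule order_trans[rotated])
  then have "C * V * exp a \<le> \<phi> 0" using \<phi>0 by (simp add: ennreal_le_iff)
  moreover have "exp a = (\<Prod>i\<in>?I. exp (- (1 / 2)))"
    by (simp add: a_def flip: exp_of_nat_mult)
  ultimately show ?thesis
    unfolding \<phi>_def[symmetric] C_def V_def by (simp add: prod_dividef mult_ac)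
qed

section \<open>Gaussian integrals\<close>

lemma nn_integral_gaussian:
  assumes s: "s > 0"
  shows "(\<integral>\<^sup>+t. ennreal (exp (- (s * t\<^sup>2 / 2))) \<partial>lborel) = ennreal (sqrt (2 * pi / s))"
proof -
  have e: "exp (- (s * t\<^sup>2 / 2)) = sqrt (2 * pi / s) * normal_density 0 (1 / sqrt s) t" for t
    using s by (simp add: normal_density_def power_divide real_sqrt_divide real_sqrt_mult field_simps)
  have "(\<integral>\<^sup>+t. ennreal (normal_density 0 (1 / sqrt s) t) \<partial>lborel) = ennreal (\<integral>t. normal_density 0 (1 / sqrt s) t \<partial>lborel)"
    using s by (intro nn_integral_eq_integral) auto
  also have "\<dots> = 1" using s by simp
  finally have "(\<integral>\<^sup>+t. ennreal (normal_density 0 (1 / sqrt s) t) \<partial>lborel) = 1" .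
  moreover have "(\<integral>\<^sup>+t. ennreal (exp (- (s * t\<^sup>2 / 2))) \<partial>lborel)
    = (\<integral>\<^sup>+t. ennreal (sqrt (2 * pi / s)) * ennreal (normal_density 0 (1 / sqrt s) t) \<partial>lborel)"
    unfolding e using s by (intro nn_integral_cong ennreal_mult) auto
  ultimately show ?thesis by (simp add: nn_integral_cmult)
qed

lemma nn_integral_lpi_gaussian:
  assumes "finite I" "s > 0"
  shows "(\<integral>\<^sup>+c. ennreal (exp (- (s * (\<Sum>i\<in>I. (c i)\<^sup>2) / 2))) \<partial>lpi I) = ennreal (sqrt (2 * pi / s) ^ card I)"
proof -
  have "ennreal (exp (- (s * (\<Sum>i\<in>I. (c i)\<^sup>2) / 2))) = (\<Prod>i\<in>I. ennreal (exp (- (s * (c i)\<^sup>2 / 2))))" for c :: "nat \<Rightarrow> real"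
    using assms(1) by (simp add: prod_ennreal exp_sum[symmetric] sum_negf sum_distrib_left sum_divide_distrib)
  then have "(\<integral>\<^sup>+c. ennreal (exp (- (s * (\<Sum>i\<in>I. (c i)\<^sup>2) / 2))) \<partial>lpi I)
      = (\<integral>\<^sup>+c. (\<Prod>i\<in>I. ennreal (exp (- (s * (c i)\<^sup>2 / 2)))) \<partial>lpi I)" by simp
  also have "\<dots> = (\<Prod>i\<in>I. (\<integral>\<^sup>+t. ennreal (exp (- (s * t\<^sup>2 / 2))) \<partial>lborel))"
    by (rule lpi.product_nn_integral_prod[OF assms(1)]) measurable
  also have "\<dots> = (\<Prod>i\<in>I. ennreal (sqrt (2 * pi / s)))" by (simp only: nn_integral_gaussian[OF assms(2)])
  also have "\<dots> = ennreal (sqrt (2 * pi / s) ^ card I)" using assms(2) by (simp add: ennreal_power)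
  finally show ?thesis .
qed

lemma nn_integral_lebesgue_sub_gaussian:
  assumes b: "onb E m b" and s: "s > 0"
  shows "(\<integral>\<^sup>+x. ennreal (exp (- (s * (norm x)\<^sup>2 / 2))) \<partial>lebesgue_sub E) = ennreal (sqrt (2 * pi / s) ^ m)"
proof -
  have "(\<integral>\<^sup>+x. ennreal (exp (- (s * (norm x)\<^sup>2 / 2))) \<partial>lebesgue_sub E)
      = (\<integral>\<^sup>+c. ennreal (exp (- (s * (norm (comb m b c))\<^sup>2 / 2))) \<partial>lpi {..<m})"
    by (rule nn_integral_lebesgue_sub[OF b]) measurable
  then show ?thesis using nn_integral_lpi_gaussian[of "{..<m}" s] s by (simp add: norm_comb[OF b])
qed

section \<open>Gaussian integrals of inverse norms and inverse square roots of quadratic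
  forms\<close>

lemma one_plus_power_le_exp:
  assumes "0 \<le> x" "m > 0"
  shows "(1 + x / real m) ^ m \<le> exp x"
proof -
  have "(1 + x / real m) ^ m \<le> exp (x / real m) ^ m"
    using assms exp_ge_add_one_self by (intro power_mono) auto
  also have "\<dots> = exp x" using assms by (simp flip: exp_of_nat_mult)
  finally show ?thesis .
qed

text \<open>The inequality \<open>ln u \<le> u - 1\<close> with \<open>u = r\<^sup>2 / m\<close>
  bounds \<open>1 / r\<close> from below by a Gaussian that touches it at the typical norm
  \<open>r = sqrt m\<close>. A Gaussian integral thus replaces quotients of Gamma functions.\<close>

lemma gaussian_inverse_norm_lower:
  assumes b: "onb E m b" and m: "m > 0"
  shows "ennreal (sqrt (2 * pi) ^ m / sqrt m) \<le> (\<integral>\<^sup>+x. ennreal (exp (- ((norm x)\<^sup>2 / 2)) / norm x) \<partial>lebesgue_sub E)"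
proof -
  \<comment> \<open>The new Gaussian is narrower by this factor. Since
    \<open>s ^ m \<le> exp 1\<close>, the loss is paid for by the factor \<open>exp (1 / 2)\<close>
    in \<open>pw\<close>.\<close>
  define s where "s = 1 + 1 / real m"
  have s: "s > 0" by (simp add: s_def add_pos_nonneg)
  have "{0} \<in> null_sets (lebesgue_sub E)"
    using emeasure_lebesgue_sub_0[OF b m] subspace_0[OF onb_subspace[OF b]]
    by (intro null_setsI in_sets_lebesgue_sub[OF b]) auto
  then have ae: "AE x in lebesgue_sub E. x \<notin> {0}" by (rule AE_not_in)
  have pw: "exp (1 / 2) / sqrt m * exp (- (s * r\<^sup>2 / 2)) \<le> exp (- (r\<^sup>2 / 2)) / r" if r: "r > 0" for r
  proof -
    define u where "u = r\<^sup>2 / real m"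
    have u: "u > 0" using r m by (simp add: u_def)
    have "ln u \<le> u - 1" using ln_le_minus_one[OF u] .
    then have "exp ((1 - u) / 2) \<le> exp (- (ln u / 2))" by simp
    also have "\<dots> = 1 / sqrt u" using u by (simp add: exp_minus ln_sqrt[symmetric] inverse_eq_divide)
    also have "\<dots> = sqrt m / r" using r m by (simp add: u_def real_sqrt_divide)
    finally have "exp ((1 - u) / 2) / sqrt m \<le> 1 / r" using m by (simp add: field_simps)
    then have "exp (- (r\<^sup>2 / 2)) * (exp ((1 - u) / 2) / sqrt m) \<le> exp (- (r\<^sup>2 / 2)) * (1 / r)" by (intro mult_left_mono) auto
    moreover have "exp (- (r\<^sup>2 / 2)) * exp ((1 - u) / 2) = exp (1 / 2) * exp (- (s * r\<^sup>2 / 2))"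
      unfolding exp_add[symmetric] by (simp add: s_def u_def field_simps)
    ultimately show ?thesis by simp
  qed
  have "sqrt (2 * pi) ^ m / sqrt m \<le> exp (1 / 2) / sqrt m * sqrt (2 * pi / s) ^ m"
  proof -
    have "s ^ m \<le> exp 1" using one_plus_power_le_exp[of 1 m] m by (simp add: s_def)
    then have "sqrt (s ^ m) \<le> sqrt (exp 1)" by simp
    also have "exp 1 = (exp (1 / 2 :: real))\<^sup>2" by (simp add: power2_eq_square flip: exp_add)
    finally have "sqrt s ^ m \<le> exp (1 / 2)" by (simp add: real_sqrt_power)
    then have "1 \<le> exp (1 / 2) / sqrt s ^ m" using s by simp
    then have "sqrt (2 * pi) ^ m / sqrt m * 1 \<le> sqrt (2 * pi) ^ m / sqrt m * (exp (1 / 2) / sqrt s ^ m)"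
      by (intro mult_left_mono) auto
    then show ?thesis by (simp add: real_sqrt_divide power_divide mult_ac)
  qed
  then have "ennreal (sqrt (2 * pi) ^ m / sqrt m) \<le> ennreal (exp (1 / 2) / sqrt m) * ennreal (sqrt (2 * pi / s) ^ m)"
    using s by (subst ennreal_mult[symmetric]) (auto intro: ennreal_leI)
  also have "\<dots> = (\<integral>\<^sup>+x. ennreal (exp (1 / 2) / sqrt m) * ennreal (exp (- (s * (norm x)\<^sup>2 / 2))) \<partial>lebesgue_sub E)"
    unfolding nn_integral_lebesgue_sub_gaussian[OF b s, symmetric]
    by (rule nn_integral_cmult[symmetric], rule measurable_lebesgue_sub[OF b]) measurable
  also have "\<dots> \<le> (\<integral>\<^sup>+x. ennreal (exp (- ((norm x)\<^sup>2 / 2)) / norm x) \<partial>lebesgue_sub E)"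
  proof (rule nn_integral_mono_AE)
    show "AE x in lebesgue_sub E. ennreal (exp (1 / 2) / sqrt m) * ennreal (exp (- (s * (norm x)\<^sup>2 / 2)))
        \<le> ennreal (exp (- ((norm x)\<^sup>2 / 2)) / norm x)"
      using ae
    proof eventually_elim
      case (elim x)
      then have "exp (1 / 2) / sqrt m * exp (- (s * (norm x)\<^sup>2 / 2)) \<le> exp (- ((norm x)\<^sup>2 / 2)) / norm x"
        by (intro pw) simp
      then show ?case by (subst ennreal_mult[symmetric]) (auto intro: ennreal_leI)
    qed
  qed
  finally show ?thesis .
qed

text \<open>One coordinate factor of a product that will bound an inverse square root times a
  Gaussian. The value at 0 is infinite, and not the 0 that \<open>powr\<close> would give, so that
  the bound also holds where a coordinate vanishes.\<close>

definition inv_sqrt_gauss :: "real \<Rightarrow> real \<Rightarrow> ennreal" where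
  "inv_sqrt_gauss p t = (if t = 0 then \<infinity> else ennreal (exp (- (t\<^sup>2 / 2)) * \<bar>t\<bar> powr (- p)))"

lemma measurable_inv_sqrt_gauss [measurable]: "inv_sqrt_gauss p \<in> borel_measurable borel"
  unfolding inv_sqrt_gauss_def[abs_def] by measurable

lemma inv_sqrt_gauss_half_finite: "(\<integral>\<^sup>+t. inv_sqrt_gauss (1 / 2) t \<partial>lborel) < \<infinity>"
proof -
  let ?f = "\<lambda>t::real. t powr (- (1 / 2))"
  let ?F = "\<lambda>t::real. ennreal (indicator {0..1} t * ?f t)"
  have F: "(\<integral>\<^sup>+t. ?F t \<partial>lborel) = ennreal 2"
  proof -
    have "(?f has_integral (1 powr (- (1 / 2) + 1) / (- (1 / 2) + 1))) {0..1}"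
      by (rule has_integral_powr_from_0) auto
    then have "(?f has_integral 2) {0..1}" by simp
    then have "((\<lambda>t. if t \<in> {0..1} then ?f t else 0) has_integral 2) UNIV"
      unfolding has_integral_restrict_UNIV .
    moreover have "(\<lambda>t. if t \<in> {0..1} then ?f t else 0) = (\<lambda>t. indicator {0..1} t * ?f t)"
      by (auto simp: fun_eq_iff indicator_def)
    ultimately have "((\<lambda>t. indicator {0..1} t * ?f t) has_integral 2) UNIV" by simp
    then show ?thesis by (intro nn_integral_has_integral_lborel) auto
  qed
  have F': "(\<integral>\<^sup>+t. ?F (- t) \<partial>lborel) = ennreal 2"
    using nn_integral_real_affine[of ?F "-1" 0] F by simp
  have "(\<integral>\<^sup>+t. inv_sqrt_gauss (1 / 2) t \<partial>lborel) \<le> (\<integral>\<^sup>+t. (?F t + ?F (- t)) + ennreal (exp (- (1 * t\<^sup>2 / 2))) \<partial>lborel)"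
  proof (rule nn_integral_mono_AE)
    show "AE t in lborel. inv_sqrt_gauss (1 / 2) t \<le> (?F t + ?F (- t)) + ennreal (exp (- (1 * t\<^sup>2 / 2)))"
      using AE_lborel_singleton[of 0]
    proof eventually_elim
      case (elim t)
      show ?case
      proof (cases "\<bar>t\<bar> \<le> 1")
        case True
        have "exp (- (t\<^sup>2 / 2)) * \<bar>t\<bar> powr (- (1 / 2)) \<le> 1 * \<bar>t\<bar> powr (- (1 / 2))"
          by (intro mult_right_mono) auto
        then have "inv_sqrt_gauss (1 / 2) t \<le> ennreal (\<bar>t\<bar> powr (- (1 / 2)))"
          using elim by (simp add: inv_sqrt_gauss_def ennreal_leI)
        also have "\<dots> \<le> ?F t + ?F (- t)"
          using True elim by (cases "t > 0") (auto simp: indicator_def)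
        finally show ?thesis by (rule order_trans) simp
      next
        case False
        then have "\<bar>t\<bar> powr (- (1 / 2)) \<le> 1 powr (- (1 / 2))" by (intro powr_mono2') auto
        then have "exp (- (t\<^sup>2 / 2)) * \<bar>t\<bar> powr (- (1 / 2)) \<le> exp (- (t\<^sup>2 / 2)) * 1"
          by (intro mult_left_mono) auto
        then have "inv_sqrt_gauss (1 / 2) t \<le> ennreal (exp (- (1 * t\<^sup>2 / 2)))"
          using elim by (simp add: inv_sqrt_gauss_def ennreal_leI)
        then show ?thesis by (rule order_trans) simp
      qed
    qed
  qed
  also have "\<dots> = (ennreal 2 + ennreal 2) + ennreal (sqrt (2 * pi / 1))"
    using F F' nn_integral_gaussian[of 1] by (simp add: nn_integral_add)
  also have "\<dots> < \<infinity>" by (simp add: less_top[symmetric])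
  finally show ?thesis .
qed

text \<open>By Young's inequality \<open>\<bar>t\<bar> powr (- (1 / m))\<close> exceeds 1 by at most
  \<open>2 / m\<close> times \<open>\<bar>t\<bar> powr (- (1 / 2))\<close>, which is integrable
  against the Gaussian. Each integral is therefore \<open>sqrt (2 * pi)\<close> up to a relative
  error of order \<open>1 / m\<close>, and the \<open>m\<close>-th power costs only a constant
  factor.\<close>

lemma inv_sqrt_gauss_bound:
  fixes m :: nat
  assumes m: "m \<ge> 2"
  shows "(\<integral>\<^sup>+t. inv_sqrt_gauss (1 / real m) t \<partial>lborel) ^ m
    \<le> ennreal (sqrt (2 * pi) ^ m * exp (2 * enn2real (\<integral>\<^sup>+t. inv_sqrt_gauss (1 / 2) t \<partial>lborel)))"
proof -
  define \<beta> where "\<beta> = enn2real (\<integral>\<^sup>+t. inv_sqrt_gauss (1 / 2) t \<partial>lborel)"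
  have \<beta>: "(\<integral>\<^sup>+t. inv_sqrt_gauss (1 / 2) t \<partial>lborel) = ennreal \<beta>" "0 \<le> \<beta>"
    using inv_sqrt_gauss_half_finite by (simp_all add: \<beta>_def)
  have pw: "inv_sqrt_gauss (1 / real m) t \<le> ennreal (exp (- (1 * t\<^sup>2 / 2))) + ennreal (2 / real m) * inv_sqrt_gauss (1 / 2) t" for t
  proof (cases "t = 0")
    case False
    define y where "y = \<bar>t\<bar> powr (- (1 / 2))"
    have y: "y > 0" using False by (simp add: y_def)
    have "y powr (2 / real m) * (1::real) powr (1 - 2 / real m) \<le> (2 / real m) * y + (1 - 2 / real m) * 1"
      using m y by (intro Youngs_inequality_0) auto
    moreover have "0 \<le> 2 / real m" by simp
    ultimately have "y powr (2 / real m) \<le> 1 + (2 / real m) * y"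
      unfolding powr_one_eq_one mult_1_right by linarith
    moreover have "y powr (2 / real m) = \<bar>t\<bar> powr (- (1 / real m))" by (simp add: y_def powr_powr)
    ultimately have "exp (- (t\<^sup>2 / 2)) * \<bar>t\<bar> powr (- (1 / real m)) \<le> exp (- (t\<^sup>2 / 2)) * (1 + (2 / real m) * y)"
      by (intro mult_left_mono) auto
    also have "\<dots> = exp (- (1 * t\<^sup>2 / 2)) + (2 / real m) * (exp (- (t\<^sup>2 / 2)) * y)" by (simp add: algebra_simps)
    finally have "ennreal (exp (- (t\<^sup>2 / 2)) * \<bar>t\<bar> powr (- (1 / real m)))
       \<le> ennreal (exp (- (1 * t\<^sup>2 / 2)) + (2 / real m) * (exp (- (t\<^sup>2 / 2)) * y))"
      by (rule ennreal_leI)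
    also have "\<dots> = ennreal (exp (- (1 * t\<^sup>2 / 2))) + ennreal ((2 / real m) * (exp (- (t\<^sup>2 / 2)) * y))"
      using y by (intro ennreal_plus) auto
    finally have "ennreal (exp (- (t\<^sup>2 / 2)) * \<bar>t\<bar> powr (- (1 / real m)))
       \<le> ennreal (exp (- (1 * t\<^sup>2 / 2))) + ennreal ((2 / real m) * (exp (- (t\<^sup>2 / 2)) * y))" .
    moreover have "ennreal ((2 / real m) * (exp (- (t\<^sup>2 / 2)) * y)) = ennreal (2 / real m) * ennreal (exp (- (t\<^sup>2 / 2)) * y)"
      using y by (intro ennreal_mult) auto
    ultimately show ?thesis using False by (simp add: inv_sqrt_gauss_def y_def)
  qed (use m in \<open>simp add: inv_sqrt_gauss_def ennreal_mult_top\<close>)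
  have "(\<integral>\<^sup>+t. inv_sqrt_gauss (1 / real m) t \<partial>lborel)
     \<le> (\<integral>\<^sup>+t. ennreal (exp (- (1 * t\<^sup>2 / 2))) + ennreal (2 / real m) * inv_sqrt_gauss (1 / 2) t \<partial>lborel)"
    by (intro nn_integral_mono pw)
  also have "\<dots> = ennreal (sqrt (2 * pi)) + ennreal (2 / real m) * ennreal \<beta>"
    using nn_integral_gaussian[of 1] \<beta>(1) by (simp add: nn_integral_add nn_integral_cmult)
  also have "ennreal (2 / real m) * ennreal \<beta> = ennreal (2 / real m * \<beta>)"
    using \<beta>(2) by (intro ennreal_mult[symmetric]) auto
  also have "ennreal (sqrt (2 * pi)) + \<dots> = ennreal (sqrt (2 * pi) + 2 / real m * \<beta>)"
    using \<beta>(2) by (intro ennreal_plus[symmetric]) auto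
  also have "\<dots> \<le> ennreal (sqrt (2 * pi) * (1 + 2 * \<beta> / real m))"
  proof (rule ennreal_leI)
    have "1 \<le> sqrt (2 * pi)" using pi_gt3 by simp
    then have "2 / real m * \<beta> * 1 \<le> 2 / real m * \<beta> * sqrt (2 * pi)" using \<beta>(2) by (intro mult_left_mono) auto
    then show "sqrt (2 * pi) + 2 / real m * \<beta> \<le> sqrt (2 * pi) * (1 + 2 * \<beta> / real m)" by (simp add: algebra_simps)
  qed
  finally have "(\<integral>\<^sup>+t. inv_sqrt_gauss (1 / real m) t \<partial>lborel) ^ m \<le> ennreal (sqrt (2 * pi) * (1 + 2 * \<beta> / real m)) ^ m"
    by (intro power_mono) auto
  also have "\<dots> = ennreal (sqrt (2 * pi) ^ m * (1 + 2 * \<beta> / real m) ^ m)"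
    using \<beta>(2) by (simp add: ennreal_power power_mult_distrib)
  also have "\<dots> \<le> ennreal (sqrt (2 * pi) ^ m * exp (2 * \<beta>))"
    using one_plus_power_le_exp[of "2 * \<beta>" m] \<beta>(2) m by (intro ennreal_leI mult_left_mono) auto
  finally show ?thesis unfolding \<beta>_def .
qed

text \<open>The arithmetic-geometric mean inequality; it turns an integral over \<open>E\<close> into a product of
  one-dimensional integrals.\<close>
lemma inverse_sqrt_sum_le:
  fixes a :: "nat \<Rightarrow> real"
  assumes m: "m > 0" and a: "\<And>i. i < m \<Longrightarrow> a i > 0"
  shows "1 / sqrt (\<Sum>i<m. a i) \<le> 1 / sqrt m * (\<Prod>i<m. a i powr (- (1 / (2 * real m))))"
proof -
  define S where "S = (\<Sum>i<m. a i)"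
  have S: "S > 0" unfolding S_def using m a by (intro sum_pos) auto
  define A where "A = S / m"
  have A: "A > 0" using S m by (simp add: A_def)
  have "(\<Sum>i<m. ln (a i / A)) \<le> (\<Sum>i<m. a i / A - 1)"
    using a A by (intro sum_mono ln_le_minus_one) auto
  also have "\<dots> = S / A - m" by (simp add: sum_subtractf sum_divide_distrib S_def)
  also have "\<dots> = 0" using m S by (simp add: A_def)
  also have "(\<Sum>i<m. ln (a i / A)) = (\<Sum>i<m. ln (a i) - ln A)"
  proof (rule sum.cong[OF refl])
    fix i assume "i \<in> {..<m}"
    then have "a i > 0" using a by simp
    then show "ln (a i / A) = ln (a i) - ln A" using A by (simp add: ln_div)
  qed
  also have "\<dots> = (\<Sum>i<m. ln (a i)) - m * ln A" by (simp add: sum_subtractf)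
  finally have ln: "(\<Sum>i<m. ln (a i)) \<le> m * ln A" by simp
  have "1 / sqrt S = 1 / sqrt m * exp (- (ln A / 2))"
  proof -
    have "exp (- (ln A / 2)) = 1 / sqrt A" using A by (simp add: exp_minus ln_sqrt[symmetric] inverse_eq_divide)
    then show ?thesis using S m by (simp add: A_def real_sqrt_divide)
  qed
  also have "\<dots> \<le> 1 / sqrt m * exp (\<Sum>i<m. - (1 / (2 * real m)) * ln (a i))"
  proof (intro mult_left_mono)
    have "- (ln A / 2) \<le> - (1 / (2 * real m)) * (\<Sum>i<m. ln (a i))" using ln m by (simp add: field_simps)
    then show "exp (- (ln A / 2)) \<le> exp (\<Sum>i<m. - (1 / (2 * real m)) * ln (a i))" by (simp only: sum_distrib_left exp_le_cancel_iff)
  qed simp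
  also have "exp (\<Sum>i<m. - (1 / (2 * real m)) * ln (a i)) = (\<Prod>i<m. a i powr (- (1 / (2 * real m))))"
    unfolding exp_sum[OF finite_lessThan]
  proof (rule prod.cong[OF refl])
    fix i assume "i \<in> {..<m}"
    then have "a i > 0" using a by simp
    then show "exp (- (1 / (2 * real m)) * ln (a i)) = a i powr (- (1 / (2 * real m)))" by (simp add: powr_def)
  qed
  finally show ?thesis unfolding S_def .
qed

text \<open>\<open>inverse_sqrt_sum_le\<close> spreads the singularity evenly: each coordinate
  receives \<open>\<bar>t\<bar> powr (- (1 / m))\<close>, which is locally integrable for
  \<open>m \<ge> 2\<close>. The \<open>lam i\<close> come out as a power of their geometric mean,
  the quantity that can be compared with the isotropic constant.\<close>

lemma gaussian_inverse_sqrt_upper: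
  shows "\<exists>C>0. \<forall>E m b lam. onb E m b \<and> m \<ge> 2 \<and> (\<forall>i<m. lam i > 0) \<longrightarrow>
    (\<integral>\<^sup>+x. ennreal (exp (- ((norm x)\<^sup>2 / 2)) / sqrt (\<Sum>i<m. lam i * (x \<bullet> b i)\<^sup>2)) \<partial>lebesgue_sub E)
      \<le> ennreal (C * (sqrt (2 * pi) ^ m / sqrt m) * (\<Prod>i<m. lam i powr (- (1 / (2 * real m)))))"
proof (intro exI conjI allI impI)
  let ?C = "exp (2 * enn2real (\<integral>\<^sup>+t. inv_sqrt_gauss (1 / 2) t \<partial>lborel))"
  show "?C > 0" by simp
  fix E m b and lam :: "nat \<Rightarrow> real" assume H: "onb E m b \<and> m \<ge> 2 \<and> (\<forall>i<m. lam i > 0)"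
  then have b: "onb E m b" and m: "m \<ge> 2" and lam: "\<And>i. i < m \<Longrightarrow> lam i > 0" by auto
  define D where "D = 1 / sqrt m * (\<Prod>i<m. lam i powr (- (1 / (2 * real m))))"
  have D: "D \<ge> 0" unfolding D_def by (intro mult_nonneg_nonneg prod_nonneg) auto
  have pw: "ennreal (exp (- ((norm (comb m b c))\<^sup>2 / 2)) / sqrt (\<Sum>i<m. lam i * (comb m b c \<bullet> b i)\<^sup>2))
     \<le> ennreal D * (\<Prod>i<m. inv_sqrt_gauss (1 / real m) (c i))" for c
  proof -
    have l: "exp (- ((norm (comb m b c))\<^sup>2 / 2)) / sqrt (\<Sum>i<m. lam i * (comb m b c \<bullet> b i)\<^sup>2)
       = exp (- ((\<Sum>i<m. (c i)\<^sup>2) / 2)) * (1 / sqrt (\<Sum>i<m. lam i * (c i)\<^sup>2))"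
      by (simp add: norm_comb[OF b] comb_inner[OF b])
    show ?thesis
    proof (cases "\<forall>i<m. c i \<noteq> 0")
      case True
      have "1 / sqrt (\<Sum>i<m. lam i * (c i)\<^sup>2) \<le> 1 / sqrt m * (\<Prod>i<m. (lam i * (c i)\<^sup>2) powr (- (1 / (2 * real m))))"
        using m lam True by (intro inverse_sqrt_sum_le) auto
      also have "(\<Prod>i<m. (lam i * (c i)\<^sup>2) powr (- (1 / (2 * real m)))) = (\<Prod>i<m. lam i powr (- (1 / (2 * real m))) * \<bar>c i\<bar> powr (- (1 / real m)))"
      proof (rule prod.cong[OF refl])
        fix i assume i: "i \<in> {..<m}"
        have "(c i)\<^sup>2 = \<bar>c i\<bar> powr 2" using True i by simp
        then have "((c i)\<^sup>2) powr (- (1 / (2 * real m))) = \<bar>c i\<bar> powr (- (1 / real m))" by (simp only: powr_powr) simp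
        then show "(lam i * (c i)\<^sup>2) powr (- (1 / (2 * real m))) = lam i powr (- (1 / (2 * real m))) * \<bar>c i\<bar> powr (- (1 / real m))"
          using lam[of i] i by (simp add: powr_mult less_imp_le)
      qed
      finally have le: "1 / sqrt (\<Sum>i<m. lam i * (c i)\<^sup>2) \<le> D * (\<Prod>i<m. \<bar>c i\<bar> powr (- (1 / real m)))"
        by (simp add: D_def prod.distrib mult_ac)
      have ex: "exp (- ((\<Sum>i<m. (c i)\<^sup>2) / 2)) = (\<Prod>i<m. exp (- ((c i)\<^sup>2 / 2)))"
        by (simp add: exp_sum[symmetric] sum_negf sum_divide_distrib)
      have "exp (- ((\<Sum>i<m. (c i)\<^sup>2) / 2)) * (1 / sqrt (\<Sum>i<m. lam i * (c i)\<^sup>2))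
        \<le> exp (- ((\<Sum>i<m. (c i)\<^sup>2) / 2)) * (D * (\<Prod>i<m. \<bar>c i\<bar> powr (- (1 / real m))))"
        by (intro mult_left_mono le) simp
      also have "\<dots> = D * (\<Prod>i<m. exp (- ((c i)\<^sup>2 / 2)) * \<bar>c i\<bar> powr (- (1 / real m)))"
        unfolding ex by (simp add: prod.distrib mult_ac)
      finally have "ennreal (exp (- ((\<Sum>i<m. (c i)\<^sup>2) / 2)) * (1 / sqrt (\<Sum>i<m. lam i * (c i)\<^sup>2)))
        \<le> ennreal D * ennreal (\<Prod>i<m. exp (- ((c i)\<^sup>2 / 2)) * \<bar>c i\<bar> powr (- (1 / real m)))"
        using D by (subst ennreal_mult[symmetric]) (auto intro!: ennreal_leI prod_nonneg)
      also have "ennreal (\<Prod>i<m. exp (- ((c i)\<^sup>2 / 2)) * \<bar>c i\<bar> powr (- (1 / real m))) = (\<Prod>i<m. inv_sqrt_gauss (1 / real m) (c i))"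
        using True by (subst prod_ennreal[symmetric]) (auto simp: inv_sqrt_gauss_def intro!: prod.cong)
      finally show ?thesis unfolding l .
    next
      \<comment> \<open>A vanishing coordinate makes the right-hand side infinite, since no factor
        is 0.\<close>
      case False
      then obtain i where i: "i < m" "c i = 0" by blast
      have "inv_sqrt_gauss (1 / real m) t \<noteq> 0" for t by (simp add: inv_sqrt_gauss_def)
      then have "(\<Prod>i<m. inv_sqrt_gauss (1 / real m) (c i)) = \<infinity>"
        using i by (subst prod.remove[of _ i]) (auto simp: inv_sqrt_gauss_def ennreal_top_mult)
      moreover have "D > 0" unfolding D_def using m lam by (intro mult_pos_pos prod_pos) (auto simp: less_imp_neq[symmetric])
      ultimately show ?thesis by (simp add: ennreal_mult_top)
    qed
  qed
  have "(\<integral>\<^sup>+x. ennreal (exp (- ((norm x)\<^sup>2 / 2)) / sqrt (\<Sum>i<m. lam i * (x \<bullet> b i)\<^sup>2)) \<partial>lebesgue_sub E)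
     = (\<integral>\<^sup>+c. ennreal (exp (- ((norm (comb m b c))\<^sup>2 / 2)) / sqrt (\<Sum>i<m. lam i * (comb m b c \<bullet> b i)\<^sup>2)) \<partial>lpi {..<m})"
    by (rule nn_integral_lebesgue_sub[OF b]) measurable
  also have "\<dots> \<le> (\<integral>\<^sup>+c. ennreal D * (\<Prod>i<m. inv_sqrt_gauss (1 / real m) (c i)) \<partial>lpi {..<m})"
    by (intro nn_integral_mono pw)
  also have "\<dots> = ennreal D * (\<integral>\<^sup>+c. (\<Prod>i<m. inv_sqrt_gauss (1 / real m) (c i)) \<partial>lpi {..<m})"
    by (rule nn_integral_cmult) measurable
  also have "(\<integral>\<^sup>+c. (\<Prod>i<m. inv_sqrt_gauss (1 / real m) (c i)) \<partial>lpi {..<m}) = (\<integral>\<^sup>+t. inv_sqrt_gauss (1 / real m) t \<partial>lborel) ^ m"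
    by (subst lpi.product_nn_integral_prod) auto
  also have "ennreal D * \<dots> \<le> ennreal D * ennreal (sqrt (2 * pi) ^ m * ?C)"
    by (intro mult_left_mono inv_sqrt_gauss_bound m) simp
  also have "\<dots> = ennreal (?C * (sqrt (2 * pi) ^ m / sqrt m) * (\<Prod>i<m. lam i powr (- (1 / (2 * real m)))))"
    using D by (subst ennreal_mult[symmetric]) (auto simp: D_def mult_ac)
  finally show "(\<integral>\<^sup>+x. ennreal (exp (- ((norm x)\<^sup>2 / 2)) / sqrt (\<Sum>i<m. lam i * (x \<bullet> b i)\<^sup>2)) \<partial>lebesgue_sub E)
      \<le> ennreal (?C * (sqrt (2 * pi) ^ m / sqrt m) * (\<Prod>i<m. lam i powr (- (1 / (2 * real m)))))" .
qed

text \<open>Deleting a largest element does not raise the average, and downward induction on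
  \<open>k\<close> starts from \<open>I\<close> itself. Averages are compared after
  cross-multiplication, so \<open>k = 0\<close> causes no division.\<close>

lemma ex_subset_average_le:
  fixes f :: "'a \<Rightarrow> real"
  assumes "finite I" "k \<le> card I"
  shows "\<exists>S\<subseteq>I. card S = k \<and> card I * sum f S \<le> k * sum f I"
  using assms(2)
proof (induction k rule: inc_induct)
  case base
  then show ?case by (intro exI[of _ I]) simp
next
  case (step k)
  then obtain S where S: "S \<subseteq> I" "card S = Suc k" "card I * sum f S \<le> Suc k * sum f I" by blast
  have finS: "finite S" using S(1) assms(1) finite_subset by blast
  have "S \<noteq> {}" using S(2) by auto
  then have "Max (f ` S) \<in> f ` S" using finS by (intro Max_in) auto
  then obtain x where x: "x \<in> S" "f x = Max (f ` S)" by (metis imageE)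
  then have x: "x \<in> S" "\<And>y. y \<in> S \<Longrightarrow> f y \<le> f x" using finS by auto
  have "sum f S \<le> (\<Sum>y\<in>S. f x)" using x(2) by (rule sum_mono)
  then have "sum f S \<le> Suc k * f x" using S(2) by simp
  then have "Suc k * sum f (S - {x}) \<le> k * sum f S"
    using finS x(1) by (simp add: sum_diff1 algebra_simps)
  then have "card I * (Suc k * sum f (S - {x})) \<le> card I * (k * sum f S)" by (intro mult_left_mono) auto
  also have "\<dots> = k * (card I * sum f S)" by simp
  also have "\<dots> \<le> k * (Suc k * sum f I)" using S(3) by (intro mult_left_mono) auto
  finally have "Suc k * (card I * sum f (S - {x})) \<le> Suc k * (k * sum f I)" by (simp add: mult_ac)
  then have "card I * sum f (S - {x}) \<le> k * sum f I" by (simp del: of_nat_Suc)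
  moreover have "card (S - {x}) = k" using S(2) x(1) finS by simp
  ultimately show ?case using S(1) by (intro exI[of _ "S - {x}"]) auto
qed

section \<open>Principal axes and the isotropic constant\<close>

text \<open>For centered \<open>K\<close> this is the covariance form up to division by the
  volume.\<close>

definition second_moment :: "nat \<Rightarrow> fseq set \<Rightarrow> fseq \<Rightarrow> fseq \<Rightarrow> real" where
  "second_moment n K x y = (\<integral>z. indicator K z * ((z \<bullet> x) * (z \<bullet> y)) \<partial>lebesgue_sub (Rn n))"

lemma second_moment_integrable:
  assumes b: "onb E m b" and K: "compact K" "K \<subseteq> E"
  shows "integrable (lebesgue_sub E) (\<lambda>z. indicator K z * ((z \<bullet> x) * (z \<bullet> y)))"
proof -
  obtain R where R: "\<And>x. x \<in> K \<Longrightarrow> norm x \<le> R" "0 \<le> R" using compact_norm_bound[OF K(1)] by blast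
  have "\<bar>(z \<bullet> x) * (z \<bullet> y)\<bar> \<le> (R * norm x) * (R * norm y)" if "z \<in> K" for z
    unfolding abs_mult
  proof (rule mult_mono)
    show "\<bar>z \<bullet> x\<bar> \<le> R * norm x"
      using Cauchy_Schwarz_ineq2[of z x] mult_right_mono[OF R(1)[OF that], of "norm x"] by simp
    show "\<bar>z \<bullet> y\<bar> \<le> R * norm y"
      using Cauchy_Schwarz_ineq2[of z y] mult_right_mono[OF R(1)[OF that], of "norm y"] by simp
  qed (use R(2) in auto)
  then show ?thesis by (intro integrable_on_compact[OF b K, where C = "(R * norm x) * (R * norm y)"]) auto
qed

lemma second_moment_bilinear:
  assumes K: "compact K" "K \<subseteq> Rn n"
  shows "second_moment n K (x + y) z = second_moment n K x z + second_moment n K y z"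
    "second_moment n K (r *\<^sub>R x) z = r * second_moment n K x z"
    "second_moment n K x y = second_moment n K y x"
proof -
  note int = second_moment_integrable[OF onb_Rn K]
  have "second_moment n K (x + y) z = (\<integral>w. indicator K w * ((w \<bullet> x) * (w \<bullet> z)) + indicator K w * ((w \<bullet> y) * (w \<bullet> z)) \<partial>lebesgue_sub (Rn n))"
    unfolding second_moment_def by (simp add: inner_add_right algebra_simps)
  then show "second_moment n K (x + y) z = second_moment n K x z + second_moment n K y z"
    unfolding second_moment_def using Bochner_Integration.integral_add[OF int[of x z] int[of y z]] by simp
  have "second_moment n K (r *\<^sub>R x) z = (\<integral>w. r * (indicator K w * ((w \<bullet> x) * (w \<bullet> z))) \<partial>lebesgue_sub (Rn n))"
    unfolding second_moment_def by (simp add: mult_ac)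
  then show "second_moment n K (r *\<^sub>R x) z = r * second_moment n K x z"
    unfolding second_moment_def by simp
  show "second_moment n K x y = second_moment n K y x"
    unfolding second_moment_def by (simp add: mult_ac)
qed

text \<open>\<open>K\<close> contains the ball of radius \<open>r / 4\<close> about
  \<open>(r / 2) *\<^sub>R u\<close> within \<open>Rn n\<close>, and on it the inner product with
  \<open>u\<close> is at least \<open>r / 4\<close>.\<close>

lemma second_moment_pos:
  assumes K: "compact K" "K \<subseteq> Rn n" and r: "r > 0" "cball 0 r \<inter> Rn n \<subseteq> K" and u: "u \<in> Rn n" "norm u = 1"
  shows "second_moment n K u u > 0"
proof -
  let ?\<mu> = "lebesgue_sub (Rn n)"
  define a where "a = (r / 2) *\<^sub>R u"
  define B where "B = cball a (r / 4) \<inter> Rn n"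
  have aR: "a \<in> Rn n" unfolding a_def using u by (intro subspace_scale subspace_Rn)
  have na: "norm a = r / 2" using r u by (simp add: a_def)
  have BK: "B \<subseteq> K"
  proof
    fix x assume x: "x \<in> B"
    have "norm x \<le> norm a + norm (a - x)" using norm_triangle_ineq4[of a "a - x"] by simp
    then have "norm x \<le> r" using x na r by (simp add: B_def dist_norm)
    then show "x \<in> K" using x r by (auto simp: B_def)
  qed
  have "B = K \<inter> cball a (r / 4)" using BK K(2) by (auto simp: B_def)
  then have Bc: "compact B" using K(1) by (simp add: compact_Int_closed)
  have BR: "B \<subseteq> Rn n" by (auto simp: B_def)
  have vB: "0 < vol (Rn n) B" using r by (intro vol_ball_pos[OF onb_Rn Bc BR aR, of "r / 4"]) (auto simp: B_def)
  have "0 < (r / 4)\<^sup>2 * vol (Rn n) B" using vB r by simp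
  also have "\<dots> = (\<integral>z. indicator B z * (r / 4)\<^sup>2 \<partial>?\<mu>)" by (rule integral_indicator_compact[OF onb_Rn Bc BR, symmetric])
  also have "\<dots> \<le> second_moment n K u u" unfolding second_moment_def
  proof (rule Bochner_Integration.integral_mono)
    show "integrable ?\<mu> (\<lambda>z. indicator B z * (r / 4)\<^sup>2)"
      by (rule integrable_on_compact[OF onb_Rn Bc BR, where C = "\<bar>(r / 4)\<^sup>2\<bar>"]) auto
    show "integrable ?\<mu> (\<lambda>z. indicator K z * (z \<bullet> u * (z \<bullet> u)))" by (rule second_moment_integrable[OF onb_Rn K])
    fix z
    have "(r / 4)\<^sup>2 \<le> z \<bullet> u * (z \<bullet> u)" if z: "z \<in> B"
    proof -
      have "a \<bullet> u = r / 2" using u by (simp add: a_def dot_square_norm)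
      moreover have "\<bar>(a - z) \<bullet> u\<bar> \<le> r / 4"
        using Cauchy_Schwarz_ineq2[of "a - z" u] u z by (simp add: B_def dist_norm)
      ultimately have "r / 4 \<le> z \<bullet> u" unfolding inner_diff_left abs_le_iff by linarith
      then have "(r / 4)\<^sup>2 \<le> (z \<bullet> u)\<^sup>2" using r by (intro power_mono) auto
      then show ?thesis by (simp add: power2_eq_square)
    qed
    then show "indicator B z * (r / 4)\<^sup>2 \<le> indicator K z * (z \<bullet> u * (z \<bullet> u))"
      using BK by (auto simp: indicator_def)
  qed
  finally show ?thesis .
qed

lemma onb_reindex:
  assumes b: "onb E m b" and p: "bij_betw p {..<m} {..<m}"
  shows "onb E m (b \<circ> p)"
  unfolding onb_def
proof (intro conjI allI impI)
  fix i j assume ij: "i < m" "j < m"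
  then have "p i < m" "p j < m" "p i = p j \<longleftrightarrow> i = j"
    using p by (auto simp: bij_betw_def inj_on_def)
  then show "(b \<circ> p) i \<bullet> (b \<circ> p) j = (if i = j then 1 else 0)" using onb_inner[OF b] by simp
next
  have "(b \<circ> p) ` {..<m} = b ` {..<m}" using p by (simp add: bij_betw_def flip: image_image image_comp)
  then show "span ((b \<circ> p) ` {..<m}) = E" using b by (simp add: onb_def)
qed

text \<open>With the discarded axes moved to the end, the remaining ones form a prefix of the basis,
  to which \<open>onb_prefix\<close> and the splitting of integrals apply.\<close>

lemma ex_bij_last:
  assumes "S \<subseteq> {..<n}" "card S = k"
  shows "\<exists>p. bij_betw p {..<n} {..<n} \<and> p ` {n - k..<n} = S"
proof -
  have finS: "finite S" using assms(1) finite_subset by blast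
  have kn: "k \<le> n" using assms card_mono[of "{..<n}" S] by simp
  obtain f where f: "bij_betw f {n - k..<n} S"
    using finite_same_card_bij[of "{n - k..<n}" S] finS assms kn by auto
  have "card ({..<n} - S) = n - k" using assms finS by (simp add: card_Diff_subset)
  then obtain g where g: "bij_betw g {..<n - k} ({..<n} - S)"
    using finite_same_card_bij[of "{..<n - k}" "{..<n} - S"] by auto
  define p where "p i = (if i \<in> {n - k..<n} then f i else g i)" for i
  have pf: "bij_betw p {n - k..<n} S" using f by (subst bij_betw_cong[of _ _ f]) (auto simp: p_def)
  have pg: "bij_betw p {..<n - k} ({..<n} - S)" using g by (subst bij_betw_cong[of _ _ g]) (auto simp: p_def)
  have "bij_betw p ({n - k..<n} \<union> {..<n - k}) (S \<union> ({..<n} - S))"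
    using pf pg by (rule bij_betw_combine) auto
  moreover have "{n - k..<n} \<union> {..<n - k} = {..<n}" by auto
  moreover have "S \<union> ({..<n} - S) = {..<n}" using assms(1) by auto
  ultimately show ?thesis using pf by (intro exI[of _ p]) (auto simp: bij_betw_def)
qed

text \<open>The last condition holds for a suitable order of the axes because some \<open>k\<close> of the numbers \<open>ln (lam i)\<close>
  have at most the average of all of them.\<close>
lemma ex_principal_axes:
  assumes K: "compact K" "K \<subseteq> Rn n" and r: "r > 0" "cball 0 r \<inter> Rn n \<subseteq> K" and k: "k \<le> n" "0 < n"
  obtains b lam where "onb (Rn n) n b" "\<And>i. i < n \<Longrightarrow> lam i > 0"
    "\<And>i j. i < n \<Longrightarrow> j < n \<Longrightarrow> second_moment n K (b i) (b j) = (if i = j then lam i * vol (Rn n) K else 0)"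
    "(\<Prod>i\<in>{n - k..<n}. sqrt (lam i)) \<le> (\<Prod>i<n. sqrt (lam i)) powr (real k / real n)"
proof -
  have V: "0 < vol (Rn n) K" using subspace_0[OF subspace_Rn] r by (intro vol_ball_pos[OF onb_Rn K, of 0 r]) auto
  obtain b where b: "onb (Rn n) n b"
    "\<And>i j. i < n \<Longrightarrow> j < n \<Longrightarrow> i \<noteq> j \<Longrightarrow> second_moment n K (b i) (b j) = 0"
    using ex_diagonalizing_onb[OF subspace_Rn subset_refl, of "second_moment n K"] second_moment_bilinear[OF K]
    unfolding dim_Rn by metis
  define l where "l i = second_moment n K (b i) (b i) / vol (Rn n) K" for i
  have l: "l i > 0" if "i < n" for i
    unfolding l_def using second_moment_pos[OF K r onb_in[OF b(1) that] onb_norm[OF b(1) that]] V by simp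
  obtain S where S: "S \<subseteq> {..<n}" "card S = k" "n * (\<Sum>i\<in>S. ln (l i)) \<le> k * (\<Sum>i<n. ln (l i))"
    using ex_subset_average_le[of "{..<n}" k "\<lambda>i. ln (l i)"] k by auto
  obtain p where p: "bij_betw p {..<n} {..<n}" "p ` {n - k..<n} = S" using ex_bij_last[OF S(1,2)] by blast
  have pn: "p i < n" if "i < n" for i using p(1) that by (auto simp: bij_betw_def)
  have pinj: "p i = p j \<longleftrightarrow> i = j" if "i < n" "j < n" for i j using p(1) that by (auto simp: bij_betw_def inj_on_def)
  have exps: "(\<Prod>i\<in>I. sqrt (l (p i))) = exp ((\<Sum>i\<in>I. ln (l (p i))) / 2)" if "I \<subseteq> {..<n}" for I
  proof -
    have "(\<Prod>i\<in>I. sqrt (l (p i))) = (\<Prod>i\<in>I. exp (ln (l (p i)) / 2))"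
    proof (rule prod.cong[OF refl])
      fix i assume "i \<in> I"
      then have "l (p i) > 0" using that l pn by auto
      then show "sqrt (l (p i)) = exp (ln (l (p i)) / 2)" by (simp add: ln_sqrt[symmetric])
    qed
    also have "\<dots> = exp ((\<Sum>i\<in>I. ln (l (p i))) / 2)"
      using that finite_subset by (subst exp_sum[symmetric]) (auto simp: sum_divide_distrib)
    finally show ?thesis .
  qed
  have "(\<Sum>i\<in>{n - k..<n}. ln (l (p i))) = (\<Sum>i\<in>S. ln (l i))"
    unfolding p(2)[symmetric] using p(1) by (subst sum.reindex) (auto simp: bij_betw_def inj_on_def)
  moreover have "(\<Sum>i<n. ln (l (p i))) = (\<Sum>i<n. ln (l i))"
    using sum.reindex_bij_betw[OF p(1), of "\<lambda>i. ln (l i)"] by simp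
  ultimately have "(\<Sum>i\<in>{n - k..<n}. ln (l (p i))) / 2 \<le> (real k / real n) * ((\<Sum>i<n. ln (l (p i))) / 2)"
    using S(3) k by (simp add: field_simps)
  then have prod: "(\<Prod>i\<in>{n - k..<n}. sqrt (l (p i))) \<le> (\<Prod>i<n. sqrt (l (p i))) powr (real k / real n)"
    by (subst (1 2) exps) (auto simp: powr_def)
  show ?thesis
  proof (rule that[of "b \<circ> p" "l \<circ> p"])
    show "onb (Rn n) n (b \<circ> p)" by (rule onb_reindex[OF b(1) p(1)])
    show "(l \<circ> p) i > 0" if "i < n" for i using l pn that by simp
    show "second_moment n K ((b \<circ> p) i) ((b \<circ> p) j) = (if i = j then (l \<circ> p) i * vol (Rn n) K else 0)" if "i < n" "j < n" for i j
      using b(2)[OF pn[OF that(1)] pn[OF that(2)]] pinj[OF that] V by (auto simp: l_def)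
    show "(\<Prod>i\<in>{n - k..<n}. sqrt ((l \<circ> p) i)) \<le> (\<Prod>i<n. sqrt ((l \<circ> p) i)) powr (real k / real n)"
      using prod by simp
  qed
qed

lemma second_moment_quadratic:
  assumes K: "compact K" "K \<subseteq> Rn n" and b: "onb (Rn n) n b"
    and sm: "\<And>i j. i < n \<Longrightarrow> j < n \<Longrightarrow> second_moment n K (b i) (b j) = (if i = j then lam i * V else 0)"
  shows "second_moment n K (\<Sum>i<n. c i *\<^sub>R b i) (\<Sum>i<n. c i *\<^sub>R b i) = (\<Sum>i<n. lam i * (c i)\<^sup>2) * V"
proof -
  note B = second_moment_bilinear[OF K]
  have B0: "second_moment n K 0 z = 0" for z using B(2)[of 0 0 z] by simp
  have Bsum: "second_moment n K (\<Sum>i\<in>I. f i) z = (\<Sum>i\<in>I. second_moment n K (f i) z)" for f z and I :: "nat set"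
    by (induction I rule: infinite_finite_induct) (auto simp: B(1) B0)
  have inner: "second_moment n K (b i) (\<Sum>j<n. c j *\<^sub>R b j) = c i * (lam i * V)" if i: "i < n" for i
  proof -
    have "second_moment n K (b i) (\<Sum>j<n. c j *\<^sub>R b j) = (\<Sum>j<n. c j * second_moment n K (b j) (b i))"
      unfolding B(3)[of "b i"] Bsum B(2) ..
    also have "\<dots> = (\<Sum>j<n. if j = i then c i * (lam i * V) else 0)"
      using sm i by (intro sum.cong) auto
    finally show ?thesis using i by simp
  qed
  have "second_moment n K (\<Sum>i<n. c i *\<^sub>R b i) (\<Sum>i<n. c i *\<^sub>R b i) = (\<Sum>i<n. c i * (c i * (lam i * V)))"
    unfolding Bsum B(2) using inner by (intro sum.cong) auto
  then show ?thesis unfolding sum_distrib_right by (simp only: power2_eq_square mult_ac)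
qed

lemma second_moment_norm_sq:
  assumes K: "compact K" "K \<subseteq> Rn n" and b: "onb (Rn n) n b"
    and sm: "\<And>i j. i < n \<Longrightarrow> j < n \<Longrightarrow> second_moment n K (b i) (b j) = (if i = j then lam i * V else 0)"
    and x: "x \<in> Rn n"
  shows "second_moment n K x x = (\<Sum>i<n. lam i * (x \<bullet> b i)\<^sup>2) * V"
  using second_moment_quadratic[OF K b sm, of "\<lambda>i. x \<bullet> b i"] onb_expand[OF b x] unfolding comb_def by simp

section \<open>Linear images and their volumes\<close>

lemma linear_comb_image:
  assumes "linear T" "onb E m b" "x \<in> E"
  shows "T x = (\<Sum>i<m. (x \<bullet> b i) *\<^sub>R T (b i))"
proof -
  have "T x = T (comb m b (\<lambda>i. x \<bullet> b i))" using onb_expand[OF assms(2,3)] by simp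
  then show ?thesis using assms(1) by (simp add: comb_def linear_sum linear_scale)
qed

text \<open>Coordinates give continuity of \<open>T\<close> on \<open>E\<close>, which linearity
  alone does not ensure in infinite dimension.\<close>

lemma compact_linear_image_onb:
  fixes T :: "fseq \<Rightarrow> fseq"
  assumes T: "linear T" and b: "onb E m b" and K: "compact K" "K \<subseteq> E"
  shows "compact (T ` K)"
proof -
  have "continuous_on K (\<lambda>x. \<Sum>i<m. (x \<bullet> b i) *\<^sub>R T (b i))" by (intro continuous_intros)
  then have "continuous_on K T"
    by (rule continuous_on_eq) (use linear_comb_image[OF T b] K(2) in auto)
  then show ?thesis using K(1) by (rule compact_continuous_image)
qed

text \<open>\<open>\<kappa>\<close> is the inverse of the modulus of the determinant.\<close>
lemma lebesgue_sub_linear_image: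
  assumes b: "onb E m b" and T: "linear T" "bij_betw T E E"
  obtains \<kappa> where "\<kappa> > 0"
    "\<And>f. f \<in> borel_measurable borel \<Longrightarrow> (\<integral>\<^sup>+x. f (T x) \<partial>lebesgue_sub E) = ennreal \<kappa> * (\<integral>\<^sup>+x. f x \<partial>lebesgue_sub E)"
    "\<And>A. compact A \<Longrightarrow> A \<subseteq> E \<Longrightarrow> vol E A = \<kappa> * vol E (T ` A)"
    "\<And>A f. compact A \<Longrightarrow> A \<subseteq> E \<Longrightarrow> f \<in> borel_measurable borel \<Longrightarrow> (\<And>x. 0 \<le> f x) \<Longrightarrow>
      (\<integral>x. indicator A x * f (T x) \<partial>lebesgue_sub E) = \<kappa> * (\<integral>x. indicator (T ` A) x * f x \<partial>lebesgue_sub E)"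
proof -
  let ?\<mu> = "lebesgue_sub E"
  obtain \<kappa> where \<kappa>: "\<kappa> > 0" "\<And>f. f \<in> borel_measurable borel \<Longrightarrow> (\<integral>\<^sup>+x. f (T x) \<partial>?\<mu>) = ennreal \<kappa> * (\<integral>\<^sup>+x. f x \<partial>?\<mu>)"
    using lebesgue_sub_linear[OF b T] by blast
  have int: "(\<integral>x. indicator A x * f (T x) \<partial>?\<mu>) = \<kappa> * (\<integral>x. indicator (T ` A) x * f x \<partial>?\<mu>)"
    if A: "compact A" "A \<subseteq> E" and f: "f \<in> borel_measurable borel" "\<And>x. 0 \<le> f x" for A and f :: "fseq \<Rightarrow> real"
  proof -
    note f(1) [measurable]
    have TA: "compact (T ` A)" by (rule compact_linear_image_onb[OF T(1) b A])
    have [measurable]: "T ` A \<in> sets borel" "A \<in> sets borel" using TA A compact_imp_closed borel_closed by auto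
    have inj: "T x \<in> T ` A \<longleftrightarrow> x \<in> A" if "x \<in> E" for x
      using T(2) A(2) that by (auto simp: bij_betw_def inj_on_def)
    have "(\<integral>\<^sup>+x. ennreal (indicator A x * f (T x)) \<partial>?\<mu>) = (\<integral>\<^sup>+x. ennreal (indicator (T ` A) (T x) * f (T x)) \<partial>?\<mu>)"
      using inj by (intro nn_integral_cong) (simp add: space_lebesgue_sub[OF b] indicator_def)
    also have "\<dots> = ennreal \<kappa> * (\<integral>\<^sup>+x. ennreal (indicator (T ` A) x * f x) \<partial>?\<mu>)" by (rule \<kappa>(2)) measurable
    finally have nn: "(\<integral>\<^sup>+x. ennreal (indicator A x * f (T x)) \<partial>?\<mu>) = ennreal \<kappa> * (\<integral>\<^sup>+x. ennreal (indicator (T ` A) x * f x) \<partial>?\<mu>)" .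
    have "(\<lambda>x. indicator A x * f (\<Sum>i<m. (x \<bullet> b i) *\<^sub>R T (b i))) \<in> borel_measurable ?\<mu>"
      by (rule measurable_lebesgue_sub[OF b]) measurable
    then have "(\<lambda>x. indicator A x * f (T x)) \<in> borel_measurable ?\<mu>"
      by (rule measurable_cong[THEN iffD1, rotated]) (use linear_comb_image[OF T(1) b] space_lebesgue_sub[OF b] in auto)
    then have "(\<integral>x. indicator A x * f (T x) \<partial>?\<mu>) = enn2real (\<integral>\<^sup>+x. ennreal (indicator A x * f (T x)) \<partial>?\<mu>)"
      using f(2) by (intro integral_eq_nn_integral) auto
    moreover have "(\<integral>x. indicator (T ` A) x * f x \<partial>?\<mu>) = enn2real (\<integral>\<^sup>+x. ennreal (indicator (T ` A) x * f x) \<partial>?\<mu>)"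
      using f(2) by (intro integral_eq_nn_integral measurable_lebesgue_sub[OF b]) auto
    ultimately show ?thesis unfolding nn using \<kappa>(1) by (simp add: enn2real_mult)
  qed
  have "vol E A = \<kappa> * vol E (T ` A)" if A: "compact A" "A \<subseteq> E" for A
  proof -
    have TAE: "T ` A \<subseteq> E" using T(2) A(2) by (auto simp: bij_betw_def)
    show ?thesis
      using int[OF A, of "\<lambda>_. 1"] integral_indicator_compact[OF b A, of 1]
        integral_indicator_compact[OF b compact_linear_image_onb[OF T(1) b A] TAE, of 1] by simp
  qed
  then show ?thesis using that \<kappa> int by blast
qed

text \<open>The formula makes sense on the whole ambient space, through the orthogonal projection
  onto the span of the basis, and so yields elements of \<open>GL n\<close>, which are maps of the
  ambient space.\<close>

definition diag_map :: "nat \<Rightarrow> (nat \<Rightarrow> fseq) \<Rightarrow> (nat \<Rightarrow> real) \<Rightarrow> fseq \<Rightarrow> fseq" where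
  "diag_map m b s x = comb m b (\<lambda>i. s i * (x \<bullet> b i))"

lemma linear_diag_map: "linear (diag_map m b s)"
  by (rule linearI) (simp_all add: diag_map_def comb_def inner_add_left algebra_simps sum.distrib scaleR_sum_right)

lemma diag_map_inner: "onb E m b \<Longrightarrow> i < m \<Longrightarrow> diag_map m b s x \<bullet> b i = s i * (x \<bullet> b i)"
  by (simp add: diag_map_def comb_inner)

lemma diag_map_in: "onb E m b \<Longrightarrow> diag_map m b s x \<in> E"
  by (simp add: diag_map_def comb_in)

lemma diag_map_inverse:
  assumes b: "onb E m b" and s: "\<And>i. i < m \<Longrightarrow> s i \<noteq> 0" and x: "x \<in> E"
  shows "diag_map m b s (diag_map m b (\<lambda>i. 1 / s i) x) = x" "diag_map m b (\<lambda>i. 1 / s i) (diag_map m b s x) = x"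
proof -
  have "comb m b (\<lambda>i. x \<bullet> b i) = x" by (rule onb_expand[OF b x])
  moreover have "diag_map m b s (diag_map m b (\<lambda>i. 1 / s i) x) = comb m b (\<lambda>i. x \<bullet> b i)"
    unfolding diag_map_def[of m b s] using s by (intro comb_cong) (simp add: diag_map_inner[OF b])
  moreover have "diag_map m b (\<lambda>i. 1 / s i) (diag_map m b s x) = comb m b (\<lambda>i. x \<bullet> b i)"
    unfolding diag_map_def[of m b "\<lambda>i. 1 / s i"] using s by (intro comb_cong) (simp add: diag_map_inner[OF b])
  ultimately show "diag_map m b s (diag_map m b (\<lambda>i. 1 / s i) x) = x" "diag_map m b (\<lambda>i. 1 / s i) (diag_map m b s x) = x"
    by simp_all
qed

lemma bij_betw_diag_map:
  assumes b: "onb E m b" and s: "\<And>i. i < m \<Longrightarrow> s i \<noteq> 0"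
  shows "bij_betw (diag_map m b s) E E"
  by (rule bij_betw_byWitness[where f' = "diag_map m b (\<lambda>i. 1 / s i)"])
    (use diag_map_inverse[OF b s] diag_map_in[OF b] in auto)

text \<open>Both change-of-variables formulas are evaluated on the unit ball, whose measure is
  positive and finite.\<close>

lemma diag_map_modulus:
  assumes b: "onb E m b" and s: "\<And>i. i < m \<Longrightarrow> s i > 0" and \<kappa>: "\<kappa> > 0"
    and eq: "\<And>f. f \<in> borel_measurable borel \<Longrightarrow>
      (\<integral>\<^sup>+x. f (diag_map m b s x) \<partial>lebesgue_sub E) = ennreal \<kappa> * (\<integral>\<^sup>+x. f x \<partial>lebesgue_sub E)"
  shows "(\<Prod>i<m. s i) * \<kappa> = 1"
proof -
  let ?B = "cball 0 1 \<inter> E" and ?\<mu> = "lebesgue_sub E"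
  have Bb: "?B \<in> sets borel" using closed_onb[OF b] by (intro borel_closed closed_Int) auto
  define f where "f = (indicator ?B :: fseq \<Rightarrow> ennreal)"
  have fm: "f \<in> borel_measurable borel" unfolding f_def using Bb by (rule borel_measurable_indicator)
  have I: "(\<integral>\<^sup>+x. f x \<partial>?\<mu>) = emeasure ?\<mu> ?B"
    unfolding f_def by (rule emeasure_lebesgue_sub[OF b Bb, symmetric]) auto
  have "ennreal (\<Prod>i<m. s i) * (ennreal \<kappa> * emeasure ?\<mu> ?B) = emeasure ?\<mu> ?B"
  proof -
    have "ennreal (\<Prod>i<m. s i) * (\<integral>\<^sup>+x. f (comb m b (\<lambda>i. s i * (x \<bullet> b i))) \<partial>?\<mu>) = (\<integral>\<^sup>+x. f x \<partial>?\<mu>)"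
      by (rule lebesgue_sub_diagonal[OF b _ fm]) (rule s)
    then show ?thesis using eq[OF fm] unfolding I diag_map_def by simp
  qed
  moreover have p: "0 \<le> (\<Prod>i<m. s i)" using s by (intro prod_nonneg) (simp add: less_imp_le)
  ultimately have "ennreal ((\<Prod>i<m. s i) * \<kappa>) * emeasure ?\<mu> ?B = 1 * emeasure ?\<mu> ?B"
    using \<kappa> p by (simp add: ennreal_mult mult.assoc)
  then have "ennreal ((\<Prod>i<m. s i) * \<kappa>) = 1"
    by (rule ennreal_mult_right_cancel) (rule lebesgue_sub_ball_pos_fin[OF b zero_less_one])+
  then show ?thesis by (simp add: ennreal_eq_1)
qed

lemma vol_diag_map:
  assumes b: "onb E m b" and s: "\<And>i. i < m \<Longrightarrow> s i > 0" and A: "compact A" "A \<subseteq> E"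
  shows "vol E (diag_map m b s ` A) = (\<Prod>i<m. s i) * vol E A"
proof -
  have bij: "bij_betw (diag_map m b s) E E" by (rule bij_betw_diag_map[OF b]) (use s in force)
  obtain \<kappa> where \<kappa>: "\<kappa> > 0"
    "\<And>f. f \<in> borel_measurable borel \<Longrightarrow> (\<integral>\<^sup>+x. f (diag_map m b s x) \<partial>lebesgue_sub E) = ennreal \<kappa> * (\<integral>\<^sup>+x. f x \<partial>lebesgue_sub E)"
    "\<And>A. compact A \<Longrightarrow> A \<subseteq> E \<Longrightarrow> vol E A = \<kappa> * vol E (diag_map m b s ` A)"
    "\<And>A f. compact A \<Longrightarrow> A \<subseteq> E \<Longrightarrow> f \<in> borel_measurable borel \<Longrightarrow> (\<And>x. 0 \<le> f x) \<Longrightarrow>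
      (\<integral>x. indicator A x * f (diag_map m b s x) \<partial>lebesgue_sub E) = \<kappa> * (\<integral>x. indicator (diag_map m b s ` A) x * f x \<partial>lebesgue_sub E)"
    using lebesgue_sub_linear_image[OF b linear_diag_map bij] by blast
  have "(\<Prod>i<m. s i) * \<kappa> = 1" by (rule diag_map_modulus[OF b _ \<kappa>(1,2)]) (rule s)
  then show ?thesis unfolding \<kappa>(3)[OF A] mult.assoc[symmetric] by simp
qed

lemma subset_cball_Int_interior:
  assumes "K \<subseteq> Rn n" "r > 0" "cball 0 r \<inter> Rn n \<subseteq> K"
  shows "top_of_set (Rn n) interior_of K \<noteq> {}"
proof -
  have "0 \<in> top_of_set (Rn n) interior_of K"
    unfolding interior_of_def
  proof (intro CollectI exI conjI)
    show "openin (top_of_set (Rn n)) (Rn n \<inter> ball 0 r)" by (rule openin_open_Int) simp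
    show "0 \<in> Rn n \<inter> ball 0 r" using assms(2) subspace_0[OF subspace_Rn] by simp
    show "Rn n \<inter> ball 0 r \<subseteq> K" using assms(3) by auto
  qed
  then show ?thesis by blast
qed

lemma diag_map_ball:
  assumes b: "onb E m b" and s: "\<And>i. i < m \<Longrightarrow> s i > 0" and r: "r > 0" "cball 0 r \<inter> E \<subseteq> K"
  shows "\<exists>\<rho>>0. cball 0 \<rho> \<inter> E \<subseteq> diag_map m b s ` K"
proof -
  \<comment> \<open>A bound for the norm of the inverse map on \<open>E\<close>; in the radius
    \<open>r / (1 + M)\<close> the summand 1 covers \<open>M = 0\<close>.\<close>
  define M where "M = (\<Sum>i<m. 1 / s i)"
  have M: "M \<ge> 0" unfolding M_def using s by (intro sum_nonneg) (auto simp: less_imp_le)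
  have "cball 0 (r / (1 + M)) \<inter> E \<subseteq> diag_map m b s ` K"
  proof
    fix y assume y: "y \<in> cball 0 (r / (1 + M)) \<inter> E"
    let ?x = "diag_map m b (\<lambda>i. 1 / s i) y"
    have "norm ?x \<le> (\<Sum>i<m. norm ((1 / s i * (y \<bullet> b i)) *\<^sub>R b i))"
      unfolding diag_map_def comb_def by (rule norm_sum)
    also have "\<dots> \<le> (\<Sum>i<m. 1 / s i * norm y)"
    proof (rule sum_mono)
      fix i assume i: "i \<in> {..<m}"
      have "\<bar>y \<bullet> b i\<bar> \<le> norm y" using Cauchy_Schwarz_ineq2[of y "b i"] onb_norm[OF b] i by simp
      then have "1 / s i * \<bar>y \<bullet> b i\<bar> \<le> 1 / s i * norm y" using s[of i] i by (intro mult_left_mono) auto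
      then show "norm ((1 / s i * (y \<bullet> b i)) *\<^sub>R b i) \<le> 1 / s i * norm y"
        using s[of i] i onb_norm[OF b, of i] by (simp add: abs_mult)
    qed
    also have "\<dots> = M * norm y" by (simp add: M_def sum_distrib_right)
    also have "\<dots> \<le> M * (r / (1 + M))" using y M by (intro mult_left_mono) auto
    also have "\<dots> \<le> r" using M r(1) by (simp add: field_simps)
    finally have "?x \<in> K" using r(2) diag_map_in[OF b] by auto
    moreover have "diag_map m b s ?x = y" using y by (intro diag_map_inverse(1)[OF b]) (use s in force)+
    ultimately show "y \<in> diag_map m b s ` K" by force
  qed
  then show ?thesis using M r(1) by (intro exI[of _ "r / (1 + M)"]) (simp add: add_pos_nonneg)
qed

lemma vol_nonneg [simp]: "0 \<le> vol E A" by (simp add: vol_def)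

text \<open>Dividing the principal axes by \<open>sqrt (lam i)\<close> makes the covariance a
  multiple of the identity, and the common factor \<open>\<alpha>\<close> adjusts the volume. This
  lemma is what gives \<open>isotropic_constant\<close> its meaning, as a value picked by the choice
  operator.\<close>

lemma ex_isotropic_position:
  assumes K: "centered_convex_body n K" and n: "n > 0"
  shows "\<exists>L. \<exists>T\<in>GL n. isotropic_with n (T ` K) L"
proof -
  let ?\<mu> = "lebesgue_sub (Rn n)"
  have cb: "convex_body n K" using K by (auto simp: centered_convex_body_def)
  have Kc: "compact K" "K \<subseteq> Rn n" "convex K" using cb by (auto simp: convex_body_def)
  obtain r where r: "r > 0" "cball 0 r \<inter> Rn n \<subseteq> K" using centered_ball[OF K] by blast
  obtain b lam where b: "onb (Rn n) n b" and lam: "\<And>i. i < n \<Longrightarrow> lam i > 0"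
    and sm: "\<And>i j. i < n \<Longrightarrow> j < n \<Longrightarrow> second_moment n K (b i) (b j) = (if i = j then lam i * vol (Rn n) K else 0)"
    using ex_principal_axes[OF Kc(1,2) r, of 0] n by (metis le0)
  define V where "V = vol (Rn n) K"
  have V: "V > 0" unfolding V_def using subspace_0[OF subspace_Rn] r by (intro vol_ball_pos[OF onb_Rn Kc(1,2), of 0 r]) auto
  define P where "P = (\<Prod>i<n. sqrt (lam i))"
  have P: "P > 0" unfolding P_def using lam by (intro prod_pos) auto
  \<comment> \<open>The determinant of \<open>T\<close> is \<open>\<alpha> ^ n / P\<close>, and it
    has to equal \<open>1 / V\<close>.\<close>
  define \<alpha> where "\<alpha> = (P / V) powr (1 / real n)"
  have \<alpha>: "\<alpha> > 0" using P V by (simp add: \<alpha>_def)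
  have \<alpha>n: "\<alpha> ^ n = P / V" using P V n by (simp add: \<alpha>_def powr_realpow[symmetric] powr_powr)
  define s where "s i = \<alpha> / sqrt (lam i)" for i
  have s: "s i > 0" if "i < n" for i using \<alpha> lam[OF that] by (simp add: s_def)
  have s': "s i \<noteq> 0" if "i < n" for i using s[OF that] by simp
  define T where "T = diag_map n b s"
  have lin: "linear T" unfolding T_def by (rule linear_diag_map)
  have bij: "bij_betw T (Rn n) (Rn n)" unfolding T_def by (rule bij_betw_diag_map[OF b]) (rule s')
  have TGL: "T \<in> GL n" using lin bij by (simp add: GL_def)
  obtain \<kappa> where \<kappa>: "\<kappa> > 0"
    "\<And>f. f \<in> borel_measurable borel \<Longrightarrow> (\<integral>\<^sup>+x. f (T x) \<partial>?\<mu>) = ennreal \<kappa> * (\<integral>\<^sup>+x. f x \<partial>?\<mu>)"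
    "\<And>A. compact A \<Longrightarrow> A \<subseteq> Rn n \<Longrightarrow> vol (Rn n) A = \<kappa> * vol (Rn n) (T ` A)"
    "\<And>A f. compact A \<Longrightarrow> A \<subseteq> Rn n \<Longrightarrow> f \<in> borel_measurable borel \<Longrightarrow> (\<And>x. 0 \<le> f x) \<Longrightarrow>
      (\<integral>x. indicator A x * f (T x) \<partial>?\<mu>) = \<kappa> * (\<integral>x. indicator (T ` A) x * f x \<partial>?\<mu>)"
    using lebesgue_sub_linear_image[OF b lin bij] by blast
  have "(\<Prod>i<n. s i) = 1 / V"
    using \<alpha>n P V by (simp add: s_def prod_dividef P_def[symmetric])
  moreover have "(\<Prod>i<n. s i) * \<kappa> = 1" by (rule diag_map_modulus[OF b _ \<kappa>(1) \<kappa>(2)[unfolded T_def]]) (rule s)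
  ultimately have \<kappa>V: "\<kappa> = V" using V by simp
  have volT: "vol (Rn n) (T ` K) = 1" using \<kappa>(3)[OF Kc(1,2)] \<kappa>V V by (simp add: V_def)
  have TK: "compact (T ` K)" by (rule compact_linear_image_onb[OF lin b Kc(1,2)])
  have TKR: "T ` K \<subseteq> Rn n" using bij Kc(2) by (auto simp: bij_betw_def)
  have TKcv: "convex (T ` K)" using lin Kc(3) by (rule convex_linear_image)
  obtain \<rho> where \<rho>: "\<rho> > 0" "cball 0 \<rho> \<inter> Rn n \<subseteq> T ` K"
  proof -
    have "\<exists>\<rho>>0. cball 0 \<rho> \<inter> Rn n \<subseteq> diag_map n b s ` K" by (rule diag_map_ball[OF b _ r]) (rule s)
    then show thesis using that unfolding T_def by blast
  qed
  have body: "convex_body n (T ` K)"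
    unfolding convex_body_def using TK TKR TKcv subset_cball_Int_interior[OF TKR \<rho>] by blast
  have adj: "T x \<bullet> v = x \<bullet> T v" for x v
    by (simp add: T_def diag_map_def comb_def inner_sum_left inner_sum_right inner_commute mult_ac)
  obtain R where R: "\<And>x. x \<in> T ` K \<Longrightarrow> norm x \<le> R" "0 \<le> R" using compact_norm_bound[OF TK] by blast
  have lin0: "(\<integral>x. indicator (T ` K) x * (x \<bullet> v) \<partial>?\<mu>) = 0" if v: "v \<in> Rn n" for v
  proof -
    \<comment> \<open>The change of variables is available for nonnegative functions, so the linear
      form is shifted by a constant that bounds it on the image of \<open>K\<close> and is cut off
      at 0; on that image the cut has no effect.\<close>
    define C where "C = R * norm v"
    have Cb: "\<bar>x \<bullet> v\<bar> \<le> C" if "x \<in> T ` K" for x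
      using Cauchy_Schwarz_ineq2[of x v] mult_right_mono[OF R(1)[OF that], of "norm v"] by (simp add: C_def)
    have i1: "integrable ?\<mu> (\<lambda>x. indicator (T ` K) x * (x \<bullet> v))"
      by (rule integrable_on_compact[OF b TK TKR, where C = C]) (use Cb in auto)
    have iC: "integrable ?\<mu> (\<lambda>x. indicator A x * C)" if "compact A" "A \<subseteq> Rn n" for A
      by (rule integrable_on_compact[OF b that, where C = "\<bar>C\<bar>"]) auto
    have i2: "integrable ?\<mu> (\<lambda>x. indicator K x * (x \<bullet> T v))"
    proof (rule integrable_on_compact[OF b Kc(1,2), where C = C])
      show "\<bar>x \<bullet> T v\<bar> \<le> C" if "x \<in> K" for x using Cb[of "T x"] that adj by simp
    qed measurable
    have e1: "(\<integral>x. indicator K x * max 0 (T x \<bullet> v + C) \<partial>?\<mu>) = \<kappa> * (\<integral>x. indicator (T ` K) x * max 0 (x \<bullet> v + C) \<partial>?\<mu>)"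
      using \<kappa>(4)[OF Kc(1,2), of "\<lambda>x. max 0 (x \<bullet> v + C)"] by simp
    have e2: "(\<integral>x. indicator (T ` K) x * max 0 (x \<bullet> v + C) \<partial>?\<mu>)
       = (\<integral>x. indicator (T ` K) x * (x \<bullet> v) + indicator (T ` K) x * C \<partial>?\<mu>)"
      using Cb by (intro Bochner_Integration.integral_cong) (force simp: indicator_def abs_le_iff)+
    have e3: "(\<integral>x. indicator (T ` K) x * (x \<bullet> v) + indicator (T ` K) x * C \<partial>?\<mu>) = (\<integral>x. indicator (T ` K) x * (x \<bullet> v) \<partial>?\<mu>) + C"
      using Bochner_Integration.integral_add[OF i1 iC[OF TK TKR]] integral_indicator_compact[OF b TK TKR, of C] volT by simp
    have e4: "(\<integral>x. indicator K x * max 0 (T x \<bullet> v + C) \<partial>?\<mu>)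
       = (\<integral>x. indicator K x * (x \<bullet> T v) + indicator K x * C \<partial>?\<mu>)"
    proof (intro Bochner_Integration.integral_cong refl)
      fix x
      show "indicator K x * max 0 (T x \<bullet> v + C) = indicator K x * (x \<bullet> T v) + indicator K x * C"
        using Cb[of "T x"] adj[of x v] by (cases "x \<in> K") (auto simp: abs_le_iff max_def)
    qed
    have e5: "(\<integral>x. indicator K x * (x \<bullet> T v) + indicator K x * C \<partial>?\<mu>) = C * V"
      using Bochner_Integration.integral_add[OF i2 iC[OF Kc(1,2)]] integral_indicator_compact[OF b Kc(1,2), of C]
        centered_integral[OF K, of "T v"] diag_map_in[OF b] by (simp add: V_def T_def)
    have "V * ((\<integral>x. indicator (T ` K) x * (x \<bullet> v) \<partial>?\<mu>) + C) = C * V"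
      using e1 unfolding e2 e3 e4 e5 \<kappa>V by (rule sym)
    then show ?thesis using V by (simp add: algebra_simps)
  qed
  have "barycenter n (T ` K) = 0"
    unfolding barycenter_def
  proof (intro sum.neutral ballI)
    fix i assume "i \<in> {..<n}"
    then have "(\<integral>x. indicator (T ` K) x * (x \<bullet> unit_fseq i) \<partial>?\<mu>) = 0" by (intro lin0 unit_fseq_in_Rn) simp
    then show "((LINT x:T ` K|?\<mu>. coord x i) / vol (Rn n) (T ` K)) *\<^sub>R unit_fseq i = 0"
      by (simp add: set_lebesgue_integral_def)
  qed
  then have cent: "centered_convex_body n (T ` K)" using body by (simp add: centered_convex_body_def)
  have "(LINT x:T ` K|?\<mu>. (x \<bullet> \<xi>)\<^sup>2) = \<alpha>\<^sup>2" if \<xi>: "\<xi> \<in> sphere 0 1 \<inter> Rn n" for \<xi>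
  proof -
    have \<xi>': "\<xi> \<in> Rn n" "norm \<xi> = 1" using \<xi> by auto
    have "\<kappa> * (\<integral>x. indicator (T ` K) x * (x \<bullet> \<xi>)\<^sup>2 \<partial>?\<mu>) = (\<integral>x. indicator K x * (T x \<bullet> \<xi>)\<^sup>2 \<partial>?\<mu>)"
      using \<kappa>(4)[OF Kc(1,2), of "\<lambda>x. (x \<bullet> \<xi>)\<^sup>2"] by simp
    also have "\<dots> = second_moment n K (T \<xi>) (T \<xi>)"
      by (simp add: second_moment_def adj power2_eq_square)
    also have "\<dots> = (\<Sum>i<n. lam i * (T \<xi> \<bullet> b i)\<^sup>2) * V"
      unfolding V_def
      by (rule second_moment_norm_sq[OF Kc(1,2) b]) (use sm diag_map_in[OF b] in \<open>auto simp: T_def\<close>)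
    also have "(\<Sum>i<n. lam i * (T \<xi> \<bullet> b i)\<^sup>2) = (\<Sum>i<n. \<alpha>\<^sup>2 * (\<xi> \<bullet> b i)\<^sup>2)"
    proof (rule sum.cong[OF refl])
      fix i assume "i \<in> {..<n}"
      then show "lam i * (T \<xi> \<bullet> b i)\<^sup>2 = \<alpha>\<^sup>2 * (\<xi> \<bullet> b i)\<^sup>2"
        using lam[of i] by (simp add: T_def diag_map_inner[OF b] s_def power_mult_distrib power_divide)
    qed
    also have "\<dots> = \<alpha>\<^sup>2 * (\<Sum>i<n. (\<xi> \<bullet> b i)\<^sup>2)" by (simp add: sum_distrib_left)
    also have "(\<Sum>i<n. (\<xi> \<bullet> b i)\<^sup>2) = 1"
      using norm_comb[OF b, of "\<lambda>i. \<xi> \<bullet> b i"] onb_expand[OF b \<xi>'(1)] \<xi>'(2) by simp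
    finally show ?thesis using \<kappa>V V by (simp add: set_lebesgue_integral_def)
  qed
  then have "isotropic_with n (T ` K) \<alpha>"
    unfolding isotropic_with_def using cent volT \<alpha> by blast
  then show ?thesis using TGL by blast
qed

text \<open>\<open>T\<close> maps the ellipsoid with semiaxes \<open>sqrt (lam i)\<close> into the ball of radius \<open>L\<close>.\<close>
lemma isotropic_lower:
  assumes K: "centered_convex_body n K" and n: "n > 0"
    and b: "onb (Rn n) n b" and lam: "\<And>i. i < n \<Longrightarrow> lam i > 0"
    and sm: "\<And>i j. i < n \<Longrightarrow> j < n \<Longrightarrow> second_moment n K (b i) (b j) = (if i = j then lam i * vol (Rn n) K else 0)"
    and T: "T \<in> GL n" and iso: "isotropic_with n (T ` K) L"
  shows "(\<Prod>i<n. sqrt (lam i)) \<le> L ^ n * vol (Rn n) K"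
proof -
  let ?\<mu> = "lebesgue_sub (Rn n)"
  have cb: "convex_body n K" using K by (auto simp: centered_convex_body_def)
  have Kc: "compact K" "K \<subseteq> Rn n" using cb by (auto simp: convex_body_def)
  have lin: "linear T" and bij: "bij_betw T (Rn n) (Rn n)" using T by (auto simp: GL_def)
  have TR: "T x \<in> Rn n" if "x \<in> Rn n" for x using bij that by (auto simp: bij_betw_def)
  define V where "V = vol (Rn n) K"
  have L: "L > 0" and vT: "vol (Rn n) (T ` K) = 1" using iso by (simp_all only: isotropic_with_def)
  have isoI: "(LINT x:T ` K|?\<mu>. (x \<bullet> \<xi>)\<^sup>2) = L\<^sup>2" if "\<xi> \<in> sphere 0 1 \<inter> Rn n" for \<xi>
    by (rule bspec[OF iso[unfolded isotropic_with_def, THEN conjunct2, THEN conjunct2, THEN conjunct2] that])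
  obtain \<kappa> where \<kappa>: "\<kappa> > 0"
    "\<And>f. f \<in> borel_measurable borel \<Longrightarrow> (\<integral>\<^sup>+x. f (T x) \<partial>?\<mu>) = ennreal \<kappa> * (\<integral>\<^sup>+x. f x \<partial>?\<mu>)"
    "\<And>A. compact A \<Longrightarrow> A \<subseteq> Rn n \<Longrightarrow> vol (Rn n) A = \<kappa> * vol (Rn n) (T ` A)"
    "\<And>A f. compact A \<Longrightarrow> A \<subseteq> Rn n \<Longrightarrow> f \<in> borel_measurable borel \<Longrightarrow> (\<And>x. 0 \<le> f x) \<Longrightarrow>
      (\<integral>x. indicator A x * f (T x) \<partial>?\<mu>) = \<kappa> * (\<integral>x. indicator (T ` A) x * f x \<partial>?\<mu>)"
    using lebesgue_sub_linear_image[OF b lin bij] by blast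
  have \<kappa>V: "\<kappa> = V" using \<kappa>(3)[OF Kc] vT by (simp add: V_def)
  have V: "V > 0" using \<kappa>V \<kappa>(1) by simp
  \<comment> \<open>The isotropy identity of the image of \<open>K\<close> is pulled back to
    \<open>K\<close>: \<open>?z\<close> is the adjoint of \<open>T\<close> applied to
    \<open>\<xi>\<close>, and the second moment form is diagonal in the basis
    \<open>b\<close>.\<close>
  have unit: "(\<Sum>i<n. lam i * (T (b i) \<bullet> \<xi>)\<^sup>2) = L\<^sup>2" if \<xi>: "\<xi> \<in> Rn n" "norm \<xi> = 1" for \<xi>
  proof -
    let ?z = "\<Sum>i<n. (T (b i) \<bullet> \<xi>) *\<^sub>R b i"
    have Tz: "T x \<bullet> \<xi> = x \<bullet> ?z" if "x \<in> Rn n" for x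
      unfolding linear_comb_image[OF lin b that] by (simp add: inner_sum_left inner_sum_right mult_ac)
    have "\<kappa> * L\<^sup>2 = \<kappa> * (\<integral>x. indicator (T ` K) x * (x \<bullet> \<xi>)\<^sup>2 \<partial>?\<mu>)"
      using isoI[of \<xi>] \<xi> by (simp add: set_lebesgue_integral_def)
    also have "\<dots> = (\<integral>x. indicator K x * (T x \<bullet> \<xi>)\<^sup>2 \<partial>?\<mu>)"
      using \<kappa>(4)[OF Kc, of "\<lambda>x. (x \<bullet> \<xi>)\<^sup>2"] by simp
    also have "\<dots> = second_moment n K ?z ?z"
      unfolding second_moment_def using Tz Kc(2)
      by (intro Bochner_Integration.integral_cong) (auto simp: indicator_def power2_eq_square)
    also have "\<dots> = (\<Sum>i<n. lam i * (T (b i) \<bullet> \<xi>)\<^sup>2) * V"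
unfolding V_def
      by (rule second_moment_quadratic[OF Kc b]) (use sm in auto)
    finally show ?thesis using \<kappa>V V by simp
  qed
  have all: "(\<Sum>i<n. lam i * (T (b i) \<bullet> \<xi>)\<^sup>2) = L\<^sup>2 * (norm \<xi>)\<^sup>2" if \<xi>: "\<xi> \<in> Rn n" for \<xi>
  proof (cases "\<xi> = 0")
    case False
    have "(\<Sum>i<n. lam i * (T (b i) \<bullet> (\<xi> /\<^sub>R norm \<xi>))\<^sup>2) = L\<^sup>2"
      using False \<xi> by (intro unit) (auto intro: subspace_scale subspace_Rn)
    moreover have "(\<Sum>i<n. lam i * (T (b i) \<bullet> (\<xi> /\<^sub>R norm \<xi>))\<^sup>2) = (\<Sum>i<n. lam i * (T (b i) \<bullet> \<xi>)\<^sup>2) / (norm \<xi>)\<^sup>2"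
      unfolding sum_divide_distrib by (intro sum.cong) (auto simp: power_mult_distrib power_inverse field_simps)
    ultimately show ?thesis using False by (simp add: field_simps)
  qed simp
  define s where "s i = sqrt (lam i)" for i
  have s: "s i > 0" if "i < n" for i using lam[OF that] by (simp add: s_def)
  let ?D = "diag_map n b s"
  \<comment> \<open>Cauchy-Schwarz for \<open>?\<xi> \<bullet> ?\<xi>\<close>, expanded along the
    axes: by \<open>all\<close> the second factor equals \<open>L * norm ?\<xi>\<close>, and one
    factor \<open>norm ?\<xi>\<close> cancels.\<close>
  have bound: "norm (T (?D y)) \<le> L * norm y" if y: "y \<in> Rn n" for y
  proof -
    let ?\<xi> = "T (?D y)"
    have \<xi>R: "?\<xi> \<in> Rn n" by (intro TR diag_map_in[OF b])
    have "?\<xi> = (\<Sum>i<n. (?D y \<bullet> b i) *\<^sub>R T (b i))" by (rule linear_comb_image[OF lin b diag_map_in[OF b]])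
    then have "?\<xi> \<bullet> w = (\<Sum>i<n. (?D y \<bullet> b i) *\<^sub>R T (b i)) \<bullet> w" for w by (rule arg_cong)
    then have "?\<xi> \<bullet> ?\<xi> = (\<Sum>i<n. (?D y \<bullet> b i) *\<^sub>R T (b i)) \<bullet> ?\<xi>" .
    also have "\<dots> = (\<Sum>i<n. (y \<bullet> b i) * (s i * (T (b i) \<bullet> ?\<xi>)))"
      unfolding inner_sum_left by (intro sum.cong refl) (simp add: diag_map_inner[OF b])
    also have "\<dots> = comb n b (\<lambda>i. y \<bullet> b i) \<bullet> comb n b (\<lambda>i. s i * (T (b i) \<bullet> ?\<xi>))"
      by (rule comb_inner_comb[OF b, symmetric])
    also have "\<dots> \<le> norm (comb n b (\<lambda>i. y \<bullet> b i)) * norm (comb n b (\<lambda>i. s i * (T (b i) \<bullet> ?\<xi>)))"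
      by (rule norm_cauchy_schwarz)
    also have "comb n b (\<lambda>i. y \<bullet> b i) = y" by (rule onb_expand[OF b y])
    also have "norm (comb n b (\<lambda>i. s i * (T (b i) \<bullet> ?\<xi>))) = L * norm ?\<xi>"
    proof -
      have "(norm (comb n b (\<lambda>i. s i * (T (b i) \<bullet> ?\<xi>))))\<^sup>2 = (\<Sum>i<n. lam i * (T (b i) \<bullet> ?\<xi>)\<^sup>2)"
        unfolding norm_comb[OF b] using lam by (intro sum.cong) (auto simp: s_def power_mult_distrib less_imp_le)
      also have "\<dots> = (L * norm ?\<xi>)\<^sup>2" using all[OF \<xi>R] by (simp add: power_mult_distrib)
      finally show ?thesis using L by (simp add: power2_eq_iff_nonneg)
    qed
    finally have "norm ?\<xi> * norm ?\<xi> \<le> (L * norm y) * norm ?\<xi>"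
      by (simp add: dot_square_norm power2_eq_square mult_ac)
    then show ?thesis using L by (cases "norm ?\<xi> = 0") auto
  qed
  let ?B = "cball 0 1 \<inter> Rn n"
  have Bc: "compact ?B" by (rule compact_cball_Int[OF b])
  have BR: "?B \<subseteq> Rn n" by auto
  have vB: "vol (Rn n) ?B > 0" using subspace_0[OF subspace_Rn] by (intro vol_ball_pos[OF b Bc BR, of 0 1]) auto
  have DB: "compact (?D ` ?B)" by (rule compact_linear_image_onb[OF linear_diag_map b Bc BR])
  have DBR: "?D ` ?B \<subseteq> Rn n" using diag_map_in[OF b] by blast
  have TDB: "compact (T ` ?D ` ?B)" by (rule compact_linear_image_onb[OF lin b DB DBR])
  \<comment> \<open>Multiplication by \<open>L\<close> on \<open>Rn n\<close>, written as a diagonal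
    map so that \<open>vol_diag_map\<close> gives its volume factor \<open>L ^ n\<close>.\<close>
  let ?S = "diag_map n b (\<lambda>_. L)"
  have SB: "compact (?S ` ?B)" by (rule compact_linear_image_onb[OF linear_diag_map b Bc BR])
  have SBR: "?S ` ?B \<subseteq> Rn n" using diag_map_in[OF b] by blast
  have S: "?S x = L *\<^sub>R x" if "x \<in> Rn n" for x
  proof -
    have "?S x = L *\<^sub>R comb n b (\<lambda>i. x \<bullet> b i)" by (simp add: diag_map_def comb_def scaleR_sum_right)
    then show ?thesis by (simp only: onb_expand[OF b that])
  qed
  have sub: "T ` ?D ` ?B \<subseteq> ?S ` ?B"
  proof clarsimp
    fix y assume y: "norm y \<le> 1" "y \<in> Rn n"
    let ?w = "T (?D y)"
    have wR: "?w \<in> Rn n" by (intro TR diag_map_in[OF b])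
    have "norm ?w \<le> L" using bound[OF y(2)] mult_left_mono[OF y(1), of L] L by linarith
    moreover have R: "(1 / L) *\<^sub>R ?w \<in> Rn n" by (rule subspace_scale[OF subspace_Rn wR])
    ultimately have "(1 / L) *\<^sub>R ?w \<in> ?B" using L by simp
    moreover have "?S ((1 / L) *\<^sub>R ?w) = ?w" using S[OF R] L by simp
    ultimately show "?w \<in> ?S ` (cball 0 1 \<inter> Rn n)" by force
  qed
  have "(\<Prod>i<n. s i) * vol (Rn n) ?B = vol (Rn n) (?D ` ?B)" by (rule vol_diag_map[OF b _ Bc BR, symmetric]) (rule s)
  also have "\<dots> = \<kappa> * vol (Rn n) (T ` ?D ` ?B)" by (rule \<kappa>(3)[OF DB DBR])
  also have "\<dots> \<le> \<kappa> * vol (Rn n) (?S ` ?B)"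
  proof (rule mult_left_mono)
    have TDm: "T ` ?D ` ?B \<in> sets ?\<mu>" and Sm: "?S ` ?B \<in> sets ?\<mu>"
      using TDB SB sub SBR by (auto intro!: in_sets_lebesgue_sub[OF b] borel_closed compact_imp_closed)
    show "vol (Rn n) (T ` ?D ` ?B) \<le> vol (Rn n) (?S ` ?B)"
      unfolding vol_def using lebesgue_sub_compact_finite[OF b SB SBR]
      by (intro measure_mono_fmeasurable sub TDm) (auto simp: fmeasurable_def Sm)
  qed (use \<kappa>(1) in simp)
  also have "vol (Rn n) (?S ` ?B) = L ^ n * vol (Rn n) ?B"
    using vol_diag_map[OF b _ Bc BR, of "\<lambda>_. L"] L by simp
  finally have "(\<Prod>i<n. s i) \<le> \<kappa> * L ^ n" using vB by (simp add: mult.assoc[symmetric])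
  then show ?thesis unfolding \<kappa>V V_def s_def by (simp add: mult.commute)
qed

section \<open>Comparison of average sections\<close>

lemma slice_Int: "W \<subseteq> E \<Longrightarrow> slice W (K \<inter> E) 0 = slice W K 0"
  unfolding slice_def by (rule arg_cong[where f = "measure _"]) auto

text \<open>The family extends to an orthonormal basis of \<open>Rn n\<close>, and the dimension
  leaves no room for further vectors.\<close>

lemma onb_of_orthonormal:
  assumes "\<And>i j. i < n \<Longrightarrow> j < n \<Longrightarrow> b i \<bullet> b j = (if i = j then 1 else 0)" "\<And>i. i < n \<Longrightarrow> b i \<in> Rn n"
  shows "onb (Rn n) n b"
proof -
  have W: "onb (span (b ` {..<n})) n b" using assms(1) by (auto simp: onb_def)
  have sp: "span (b ` {..<n}) \<subseteq> Rn n" using assms(2) by (intro span_minimal subspace_Rn) auto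
  obtain b' where b': "onb (Rn n) n b'" "\<And>i. i < n \<Longrightarrow> b' i = b i"
    using ex_onb_extend[OF subspace_Rn subset_refl W sp] by (auto simp: dim_Rn)
  have "b' ` {..<n} = b ` {..<n}" using b'(2) by force
  then show ?thesis using b'(1) assms(1) by (simp add: onb_def)
qed

text \<open>The factor \<open>1 / \<bar>t\<bar>\<close> supplies the division by the norm in the
  section bounds. Division by zero gives the value 0 at \<open>t = 0\<close>, which
  \<open>avg_section_eq\<close> asks of a weight.\<close>

definition radial_gauss :: "real \<Rightarrow> real" where
  "radial_gauss t = exp (- (t\<^sup>2 / 2)) / \<bar>t\<bar>"

lemma radial_gauss [simp, measurable]: "radial_gauss \<in> borel_measurable borel" "radial_gauss 0 = 0" "0 \<le> radial_gauss t"
  by (simp_all add: radial_gauss_def[abs_def])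

text \<open>The property established by \<open>gaussian_inverse_sqrt_upper\<close>. Naming it allows
  one constant, fixed before any dimension or body, to be passed through the lemmas that
  follow.\<close>

definition gauss_bound :: "real \<Rightarrow> bool" where
  "gauss_bound C \<longleftrightarrow> C > 0 \<and> (\<forall>E m b lam. onb E m b \<and> m \<ge> 2 \<and> (\<forall>i<m. lam i > 0) \<longrightarrow>
    (\<integral>\<^sup>+x. ennreal (exp (- ((norm x)\<^sup>2 / 2)) / sqrt (\<Sum>i<m. lam i * (x \<bullet> b i)\<^sup>2)) \<partial>lebesgue_sub E)
      \<le> ennreal (C * (sqrt (2 * pi) ^ m / sqrt m) * (\<Prod>i<m. lam i powr (- (1 / (2 * real m))))))"

lemma sum_inner_sq:
  assumes b: "onb E m b" and x: "x \<in> E"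
  shows "(\<Sum>i<m. (x \<bullet> b i)\<^sup>2) = (norm x)\<^sup>2"
  using norm_comb[OF b, of "\<lambda>i. x \<bullet> b i"] onb_expand[OF b x] by simp

text \<open>With all \<open>lam i\<close> equal to 1 the quadratic form in
  \<open>gauss_bound\<close> is the squared norm. The mass of the weight is thus
  \<open>sqrt (2 * pi) ^ m / sqrt m\<close> up to a constant; on a line it would be
  infinite.\<close>

lemma radial_gauss_integral:
  assumes C: "gauss_bound C" and b: "onb E m b" and m: "m \<ge> 2"
  shows "integrable (lebesgue_sub E) (\<lambda>x. radial_gauss (norm x))"
    and "sqrt (2 * pi) ^ m / sqrt m \<le> (\<integral>x. radial_gauss (norm x) \<partial>lebesgue_sub E)"
    and "(\<integral>x. radial_gauss (norm x) \<partial>lebesgue_sub E) \<le> C * (sqrt (2 * pi) ^ m / sqrt m)"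
proof -
  let ?\<mu> = "lebesgue_sub E"
  have C0: "C > 0" using C by (simp add: gauss_bound_def)
  have mes: "(\<lambda>x. radial_gauss (norm x)) \<in> borel_measurable ?\<mu>"
    by (rule measurable_lebesgue_sub[OF b]) measurable
  have "(\<integral>\<^sup>+x. ennreal (radial_gauss (norm x)) \<partial>?\<mu>)
      = (\<integral>\<^sup>+x. ennreal (exp (- ((norm x)\<^sup>2 / 2)) / sqrt (\<Sum>i<m. 1 * (x \<bullet> b i)\<^sup>2)) \<partial>?\<mu>)"
    by (rule nn_integral_cong) (simp add: space_lebesgue_sub[OF b] sum_inner_sq[OF b] radial_gauss_def)
  also have "\<dots> \<le> ennreal (C * (sqrt (2 * pi) ^ m / sqrt m) * (\<Prod>i<m. 1 powr (- (1 / (2 * real m)))))"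
    using C[unfolded gauss_bound_def, THEN conjunct2, rule_format, of E m b "\<lambda>_. 1"] b m by simp
  finally have up: "(\<integral>\<^sup>+x. ennreal (radial_gauss (norm x)) \<partial>?\<mu>) \<le> ennreal (C * (sqrt (2 * pi) ^ m / sqrt m))"
    by simp
  show int: "integrable ?\<mu> (\<lambda>x. radial_gauss (norm x))"
    by (rule integrableI_nonneg[OF mes]) (use up in \<open>auto simp: le_less_trans\<close>)
  have eq: "(\<integral>\<^sup>+x. ennreal (radial_gauss (norm x)) \<partial>?\<mu>) = ennreal (\<integral>x. radial_gauss (norm x) \<partial>?\<mu>)"
    by (rule nn_integral_eq_integral[OF int]) simp
  have J0: "0 \<le> (\<integral>x. radial_gauss (norm x) \<partial>?\<mu>)" by (rule Bochner_Integration.integral_nonneg) simp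
  have "ennreal (sqrt (2 * pi) ^ m / sqrt m) \<le> ennreal (\<integral>x. radial_gauss (norm x) \<partial>?\<mu>)"
    using gaussian_inverse_norm_lower[OF b] m eq by (simp add: radial_gauss_def)
  then show "sqrt (2 * pi) ^ m / sqrt m \<le> (\<integral>x. radial_gauss (norm x) \<partial>?\<mu>)"
    using J0 by (simp add: ennreal_le_iff)
  show "(\<integral>x. radial_gauss (norm x) \<partial>?\<mu>) \<le> C * (sqrt (2 * pi) ^ m / sqrt m)"
    using up C0 unfolding eq by (subst (asm) ennreal_le_iff) auto
qed

text \<open>By \<open>sm\<close> the vectors \<open>b i\<close> are principal axes of
  \<open>K\<close>, and the \<open>lam i\<close> are the eigenvalues of its covariance matrix. The
  isotropic constant comes in only at the end, through the product of the
  \<open>sqrt (lam i)\<close>.\<close>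

locale principal_body =
  fixes n :: nat and K :: "fseq set" and b :: "nat \<Rightarrow> fseq" and lam :: "nat \<Rightarrow> real" and r :: real
  assumes Kc: "compact K" "convex K" "K \<subseteq> Rn n" and r: "r > 0" "cball 0 r \<inter> Rn n \<subseteq> K"
    and cent: "v \<in> Rn n \<Longrightarrow> (\<integral>x. indicator K x * (x \<bullet> v) \<partial>lebesgue_sub (Rn n)) = 0"
    and b: "onb (Rn n) n b" and lam: "i < n \<Longrightarrow> lam i > 0"
    and sm: "i < n \<Longrightarrow> j < n \<Longrightarrow> second_moment n K (b i) (b j) = (if i = j then lam i * vol (Rn n) K else 0)"
begin

definition Q :: "fseq \<Rightarrow> real" where "Q x = (\<Sum>i<n. lam i * (x \<bullet> b i)\<^sup>2)"

lemma vol_pos: "0 < vol (Rn n) K"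
  using subspace_0[OF subspace_Rn] r by (intro vol_ball_pos[OF b Kc(1,3), of 0 r]) auto

lemma moment_Q: "x \<in> Rn n \<Longrightarrow> (\<integral>z. indicator K z * (z \<bullet> x)\<^sup>2 \<partial>lebesgue_sub (Rn n)) = Q x * vol (Rn n) K"
  using second_moment_norm_sq[OF Kc(1,3) b, of lam "vol (Rn n) K" x] sm
  by (simp add: Q_def second_moment_def power2_eq_square)

lemma Q_scale: "Q (c *\<^sub>R x) = c\<^sup>2 * Q x"
  by (simp add: Q_def sum_distrib_left power_mult_distrib mult_ac)

lemma Q_pos:
  assumes x: "x \<in> Rn n" "x \<noteq> 0"
  shows "0 < Q x"
proof -
  have "(\<Sum>i<n. (x \<bullet> b i)\<^sup>2) > 0" using sum_inner_sq[OF b x(1)] x(2) by simp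
  then obtain i where i: "i < n" "(x \<bullet> b i)\<^sup>2 > 0"
    by (metis (no_types, lifting) lessThan_iff linorder_not_less sum_nonpos)
  show ?thesis unfolding Q_def
    by (rule sum_pos2[of _ i]) (use i lam in \<open>auto intro!: mult_nonneg_nonneg less_imp_le[OF lam]\<close>)
qed

text \<open>\<open>section_moment_bound\<close> in the unit direction of \<open>x\<close>. After
  division by \<open>norm x\<close> both sides are homogeneous of degree -1 in \<open>x\<close>, so
  the bound can be integrated over \<open>x\<close> directly.\<close>

lemma section_upper:
  assumes x: "x \<in> Rn n" "x \<noteq> 0"
  shows "slice (Rn n \<inter> {y. y \<bullet> x = 0}) K 0 / norm x \<le> sqrt 2 * vol (Rn n) K / sqrt (Q x)"
proof -
  let ?V = "vol (Rn n) K"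
  define \<xi> where "\<xi> = (1 / norm x) *\<^sub>R x"
  define s where "s = slice (Rn n \<inter> {y. y \<bullet> x = 0}) K 0"
  have \<xi>: "\<xi> \<in> Rn n" "norm \<xi> = 1" using x by (auto simp: \<xi>_def intro: subspace_scale subspace_Rn)
  have h: "{y. y \<bullet> \<xi> = 0} = {y. y \<bullet> x = 0}" using x(2) by (simp add: \<xi>_def)
  have "s\<^sup>2 * (Q \<xi> * ?V) \<le> 2 * ?V ^ 3"
    using section_moment_bound[OF b subset_refl Kc \<xi>] unfolding h moment_Q[OF \<xi>(1)] s_def .
  then have "(s\<^sup>2 * Q \<xi>) * ?V \<le> (2 * ?V\<^sup>2) * ?V" by (simp add: power2_eq_square power3_eq_cube mult_ac)
  then have "s\<^sup>2 * Q \<xi> \<le> 2 * ?V\<^sup>2" using vol_pos by simp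
  then have "(s / norm x)\<^sup>2 * Q x \<le> 2 * ?V\<^sup>2"
    unfolding \<xi>_def Q_scale by (simp add: power_divide)
  then have "(s / norm x)\<^sup>2 \<le> 2 * ?V\<^sup>2 / Q x" using Q_pos[OF x] by (simp add: pos_le_divide_eq)
  then have "s / norm x \<le> sqrt (2 * ?V\<^sup>2 / Q x)" by (rule real_le_rsqrt)
  also have "\<dots> = sqrt 2 * ?V / sqrt (Q x)" using vol_pos by (simp add: real_sqrt_divide real_sqrt_mult)
  finally show ?thesis unfolding s_def .
qed

text \<open>\<open>section_lower_bound\<close> in a basis adapted to \<open>y\<close>: a basis of
  the part of \<open>E\<close> orthogonal to \<open>y\<close>, then the unit vector
  \<open>\<eta>\<close> along \<open>y\<close>, then the discarded axes. In the Gaussian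
  \<open>\<eta>\<close> gives way to \<open>x\<close>, whose variance \<open>Q x\<close> is the
  quantity in \<open>section_upper\<close>; the component of \<open>x\<close> along
  \<open>\<eta>\<close> is \<open>norm y\<close>.\<close>

lemma section_lower:
  assumes d: "0 < d" "d \<le> n" and y: "y \<in> span (b ` {..<d})" "y \<noteq> 0"
    and x: "x = (\<Sum>i\<in>{d..<n}. c i *\<^sub>R b i) + y"
  shows "norm y * vol (Rn n) K \<le> sqrt (2 * pi * exp 1) ^ Suc (n - d) * (\<Prod>i\<in>{d..<n}. sqrt (lam i))
    * sqrt (Q x) * slice (span (b ` {..<d}) \<inter> {z. z \<bullet> y = 0}) K 0"
proof -
  define E where "E = span (b ` {..<d})"
  have bE: "onb E d b" and ER: "E \<subseteq> Rn n" unfolding E_def using onb_prefix[OF b d(2)] by auto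
  have Es: "subspace E" by (rule onb_subspace[OF bE])
  have yE: "y \<in> E" using y(1) by (simp add: E_def)
  define \<eta> where "\<eta> = (1 / norm y) *\<^sub>R y"
  have \<eta>: "\<eta> \<in> E" "norm \<eta> = 1" using y(2) yE by (auto simp: \<eta>_def intro: subspace_scale[OF Es])
  have h: "{z. z \<bullet> \<eta> = 0} = {z. z \<bullet> y = 0}" using y(2) by (simp add: \<eta>_def)
  obtain bh where bh: "onb (E \<inter> {z. z \<bullet> \<eta> = 0}) (d - 1) bh" by (rule onb_hyperplane[OF bE ER \<eta>])
  \<comment> \<open>\<open>\<eta>\<close> takes the last slot \<open>d - 1\<close> of
    \<open>E\<close>, so that the first \<open>d - 1\<close> vectors span the section and
    \<open>n - d + 1\<close> directions enter the Gaussian.\<close>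
  define be where "be = bh(d - 1 := \<eta>)"
  have be: "onb E d be" using onb_add_normal[OF Es bh \<eta>] d(1) by (simp add: be_def)
  define b' where "b' i = (if i < d then be i else b i)" for i
  have orth: "z \<bullet> b i = 0" if "z \<in> E" "d \<le> i" "i < n" for z i
  proof -
    have "comb d b (\<lambda>i. z \<bullet> b i) \<bullet> b i = 0"
      unfolding comb_def inner_sum_left using that d by (intro sum.neutral) (simp add: onb_inner[OF b])
    then show ?thesis by (simp add: onb_expand[OF bE that(1)])
  qed
  have b': "onb (Rn n) n b'"
  proof (rule onb_of_orthonormal)
    fix i j assume "i < n" "j < n"
    then show "b' i \<bullet> b' j = (if i = j then 1 else 0)"
      using onb_inner[OF be] onb_inner[OF b] orth[OF onb_in[OF be]]
      by (auto simp: b'_def inner_commute[of "b i" "be j"])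
  next
    fix i assume "i < n"
    then show "b' i \<in> Rn n" using onb_in[OF be] onb_in[OF b] ER by (auto simp: b'_def)
  qed
  have xR: "x \<in> Rn n" unfolding x using yE ER onb_in[OF b]
    by (intro subspace_add subspace_sum subspace_scale subspace_Rn) auto
  have "y \<bullet> x = (norm y)\<^sup>2"
    unfolding x by (simp add: inner_add_right inner_sum_right orth[OF yE] power2_norm_eq_inner)
  then have x0: "x \<noteq> 0" using y(2) by auto
  note Qx = Q_pos[OF xR x0]
  let ?V = "vol (Rn n) K" and ?g = "sqrt (2 * pi * exp 1)"
  define u where "u i = (if i = d - 1 then x else b i)" for i
  define lam' where "lam' i = (if i = d - 1 then Q x else lam i)" for i
  have I: "{d - 1<..<n} = {d..<n}" "{d - 1..<n} = insert (d - 1) {d..<n}" using d by auto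
  have "norm y * ?V * (\<Prod>i\<in>{d - 1..<n}. exp (- (1 / 2)) / sqrt (2 * pi * lam' i)) \<le> slice (span (b' ` {..<d - 1})) K 0"
  proof (rule section_lower_bound[OF b' _ Kc r, where G = x and u = u and h = c])
    show "d - 1 < n" using d by simp
    show "(\<integral>x. indicator K x * (x \<bullet> v) \<partial>lebesgue_sub (Rn n)) = 0" if "v \<in> Rn n" for v using cent[OF that] .
    have "b' (d - 1) = \<eta>" using d by (simp add: b'_def be_def)
    then have "norm y *\<^sub>R b' (d - 1) = y" using y(2) by (simp add: \<eta>_def)
    moreover have "(\<Sum>i\<in>{d..<n}. c i *\<^sub>R b' i) = (\<Sum>i\<in>{d..<n}. c i *\<^sub>R b i)" by (simp add: b'_def)
    ultimately show "x = norm y *\<^sub>R b' (d - 1) + (\<Sum>i\<in>{d - 1<..<n}. c i *\<^sub>R b' i)" unfolding I x by simp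
    show "norm y > 0" using y(2) by simp
    show "u (d - 1) = x" by (simp add: u_def)
    show "u i = b' i" if "d - 1 < i" "i < n" for i using that d by (auto simp: u_def b'_def)
    show "lam' i > 0" if "d - 1 \<le> i" "i < n" for i using that Qx lam by (simp add: lam'_def)
    show "(\<integral>x. indicator K x * (x \<bullet> u i)\<^sup>2 \<partial>lebesgue_sub (Rn n)) = lam' i * ?V" if "d - 1 \<le> i" "i < n" for i
      using that moment_Q[OF xR] sm[of i i] by (simp add: lam'_def u_def second_moment_def power2_eq_square)
  qed
  also have "span (b' ` {..<d - 1}) = E \<inter> {z. z \<bullet> \<eta> = 0}"
  proof -
    have "b' ` {..<d - 1} = bh ` {..<d - 1}" using d by (intro image_cong) (auto simp: b'_def be_def)
    then show ?thesis using bh by (simp add: onb_def)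
  qed
  also have "(\<Prod>i\<in>{d - 1..<n}. exp (- (1 / 2)) / sqrt (2 * pi * lam' i))
     = 1 / (?g ^ Suc (n - d) * (\<Prod>i\<in>{d..<n}. sqrt (lam i)) * sqrt (Q x))"
  proof -
    have e: "exp (- (1 / 2)) / sqrt (2 * pi * t) = 1 / (?g * sqrt t)" for t :: real
    proof -
      have "sqrt (exp 1) = exp (1 / 2 :: real)" by (rule real_sqrt_unique) (simp_all flip: exp_double)
      then show ?thesis by (simp add: real_sqrt_mult exp_minus field_simps)
    qed
    have "(\<Prod>i\<in>{d..<n}. exp (- (1 / 2)) / sqrt (2 * pi * lam' i)) = (\<Prod>i\<in>{d..<n}. 1 / (?g * sqrt (lam i)))"
      using d unfolding e by (intro prod.cong) (auto simp: lam'_def)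
    also have "\<dots> = 1 / (?g ^ (n - d) * (\<Prod>i\<in>{d..<n}. sqrt (lam i)))"
      by (simp add: prod_dividef prod.distrib)
    finally show ?thesis unfolding I(2) using d by (subst prod.insert) (auto simp: e lam'_def)
  qed
  finally have "norm y * ?V / (?g ^ Suc (n - d) * (\<Prod>i\<in>{d..<n}. sqrt (lam i)) * sqrt (Q x)) \<le> slice (E \<inter> {z. z \<bullet> y = 0}) K 0"
    unfolding h by simp
  moreover have "0 < ?g ^ Suc (n - d) * (\<Prod>i\<in>{d..<n}. sqrt (lam i)) * sqrt (Q x)"
    using Qx lam by (intro mult_pos_pos prod_pos zero_less_power) auto
  ultimately show ?thesis unfolding E_def by (simp add: pos_divide_le_eq mult_ac)
qed

end

lemma avg_section_nonneg: "0 \<le> avg_section E A"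
  unfolding avg_section_def by (rule Bochner_Integration.integral_nonneg) simp

lemma avg_section_radial_gauss:
  assumes C: "gauss_bound C" and b: "onb E m b" and En: "E \<subseteq> Rn n" and m: "m \<ge> 2"
    and A: "compact A" "convex A" "A \<subseteq> E" and r: "r > 0" "cball 0 r \<inter> E \<subseteq> A"
  shows "(\<lambda>x. ennreal (radial_gauss (norm x) * slice (E \<inter> {y. y \<bullet> x = 0}) A 0)) \<in> borel_measurable (lebesgue_sub E)"
    and "(\<integral>\<^sup>+x. ennreal (radial_gauss (norm x) * slice (E \<inter> {y. y \<bullet> x = 0}) A 0) \<partial>lebesgue_sub E)
      = ennreal (avg_section E A * (\<integral>x. radial_gauss (norm x) \<partial>lebesgue_sub E))"
proof -
  have m0: "m > 0" using m by simp
  note eq = avg_section_eq[OF b En m0 A r radial_gauss(1,2,3) radial_gauss_integral(1)[OF C b m],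
      unfolded section_eq_slice[OF A(3)]]
  show "(\<lambda>x. ennreal (radial_gauss (norm x) * slice (E \<inter> {y. y \<bullet> x = 0}) A 0)) \<in> borel_measurable (lebesgue_sub E)"
    using borel_measurable_integrable[OF eq(1)] by measurable
  show "(\<integral>\<^sup>+x. ennreal (radial_gauss (norm x) * slice (E \<inter> {y. y \<bullet> x = 0}) A 0) \<partial>lebesgue_sub E)
      = ennreal (avg_section E A * (\<integral>x. radial_gauss (norm x) \<partial>lebesgue_sub E))"
    unfolding eq(2) by (rule nn_integral_eq_integral[OF eq(1)]) simp
qed

lemma norm_add_orthogonal_sum:
  assumes b: "onb E n b" and d: "d \<le> n" and y: "y \<in> span (b ` {..<d})"
  shows "(norm ((\<Sum>i\<in>{d..<n}. c i *\<^sub>R b i) + y))\<^sup>2 = (\<Sum>i\<in>{d..<n}. (c i)\<^sup>2) + (norm y)\<^sup>2"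
proof -
  have bE: "onb (span (b ` {..<d})) d b" by (rule onb_prefix[OF b d])
  define y' where "y' i = y \<bullet> b i" for i
  define z where "z = merge {d..<n} {..<d} (c, y')"
  have "comb n b z = comb d b y' + (\<Sum>i\<in>{d..<n}. c i *\<^sub>R b i)" unfolding z_def by (rule comb_merge[OF d])
  also have "comb d b y' = y" unfolding y'_def by (rule onb_expand[OF bE y])
  finally have "(norm ((\<Sum>i\<in>{d..<n}. c i *\<^sub>R b i) + y))\<^sup>2 = (\<Sum>i<n. (z i)\<^sup>2)"
    using norm_comb[OF b, of z] by (simp add: add.commute)
  also have "{..<n} = {d..<n} \<union> {..<d}" using d by auto
  also have "(\<Sum>i\<in>{d..<n} \<union> {..<d}. (z i)\<^sup>2) = (\<Sum>i\<in>{d..<n}. (z i)\<^sup>2) + (\<Sum>i<d. (z i)\<^sup>2)"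
    by (rule sum.union_disjoint) auto
  also have "(\<Sum>i\<in>{d..<n}. (z i)\<^sup>2) = (\<Sum>i\<in>{d..<n}. (c i)\<^sup>2)" by (intro sum.cong) (auto simp: z_def merge_def)
  also have "(\<Sum>i<d. (z i)\<^sup>2) = (\<Sum>i<d. (y \<bullet> b i)\<^sup>2)" by (intro sum.cong) (auto simp: z_def merge_def y'_def)
  also have "\<dots> = (norm y)\<^sup>2" by (rule sum_inner_sq[OF bE y])
  finally show ?thesis .
qed

lemma AE_lebesgue_sub_nonzero:
  assumes b: "onb E m b" and m: "m > 0"
  shows "AE x in lebesgue_sub E. x \<in> E \<and> x \<noteq> 0"
proof (rule AE_I)
  show "{x \<in> space (lebesgue_sub E). \<not> (x \<in> E \<and> x \<noteq> 0)} \<subseteq> {0}" by (auto simp: space_lebesgue_sub[OF b])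
  show "emeasure (lebesgue_sub E) {0} = 0" by (rule emeasure_lebesgue_sub_0[OF b m])
  show "{0} \<in> sets (lebesgue_sub E)"
    using subspace_0[OF onb_subspace[OF b]] by (intro in_sets_lebesgue_sub[OF b]) auto
qed

context principal_body
begin

lemma zero_in: "0 \<in> K"
  using r subspace_0[OF subspace_Rn] by auto

text \<open>Eliminating \<open>vol (Rn n) K / sqrt (Q x)\<close> between
  \<open>section_upper\<close> and \<open>section_lower\<close> bounds the section orthogonal to
  \<open>x\<close> by the one orthogonal to its projection \<open>y\<close>. The Gaussian in the
  other coordinates integrates to the power of \<open>sqrt (2 * pi)\<close> by which the masses of
  the weight in dimensions \<open>n\<close> and \<open>d\<close> differ, apart from
  \<open>sqrt n / sqrt d\<close> and \<open>C\<close>.\<close>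

lemma avg_section_compare:
  assumes C: "gauss_bound C" and d: "2 \<le> d" "d \<le> n"
  shows "avg_section (Rn n) K \<le> sqrt 2 * C * sqrt (2 * pi * exp 1) ^ Suc (n - d) * (\<Prod>i\<in>{d..<n}. sqrt (lam i))
    * (sqrt n / sqrt d) * avg_section (span (b ` {..<d})) (K \<inter> span (b ` {..<d}))"
proof -
  define E where "E = span (b ` {..<d})"
  define G where "G = sqrt (2 * pi * exp 1) ^ Suc (n - d) * (\<Prod>i\<in>{d..<n}. sqrt (lam i))"
  have G: "0 \<le> G" unfolding G_def using lam by (intro mult_nonneg_nonneg prod_nonneg zero_le_power) (auto intro: less_imp_le)
  have bE: "onb E d b" and ER: "E \<subseteq> Rn n" unfolding E_def using onb_prefix[OF b d(2)] by auto
  have n2: "n \<ge> 2" and d0: "d > 0" using d by auto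
  have KE: "compact (K \<inter> E)" "convex (K \<inter> E)" "K \<inter> E \<subseteq> E" "cball 0 r \<inter> E \<subseteq> K \<inter> E"
    using Kc closed_onb[OF bE] onb_subspace[OF bE] r(2) ER
    by (auto intro: compact_Int_closed convex_Int subspace_imp_convex)
  let ?\<mu> = "lebesgue_sub (Rn n)" and ?\<nu> = "lebesgue_sub E"
  define f where "f x = ennreal (radial_gauss (norm x) * slice (Rn n \<inter> {y. y \<bullet> x = 0}) K 0)" for x
  define g where "g x = ennreal (radial_gauss (norm x) * slice (E \<inter> {y. y \<bullet> x = 0}) (K \<inter> E) 0)" for x
  define Jn where "Jn = (\<integral>x. radial_gauss (norm x) \<partial>?\<mu>)"
  define Jd where "Jd = (\<integral>x. radial_gauss (norm x) \<partial>?\<nu>)"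
  define a where "a = avg_section E (K \<inter> E)"
  have a0: "0 \<le> a" unfolding a_def by (rule avg_section_nonneg)
  have J0: "0 \<le> Jd" "0 \<le> Jn" unfolding Jd_def Jn_def by (auto intro: Bochner_Integration.integral_nonneg)
  have fI: "f \<in> borel_measurable ?\<mu>" "(\<integral>\<^sup>+x. f x \<partial>?\<mu>) = ennreal (avg_section (Rn n) K * Jn)"
    unfolding f_def[abs_def] Jn_def by (rule avg_section_radial_gauss[OF C b subset_refl n2 Kc r])+
  have gI: "g \<in> borel_measurable ?\<nu>" "(\<integral>\<^sup>+x. g x \<partial>?\<nu>) = ennreal (a * Jd)"
    unfolding g_def[abs_def] Jd_def a_def by (rule avg_section_radial_gauss[OF C bE ER d(1) KE(1,2,3) r(1) KE(4)])+
  \<comment> \<open>Section volumes are known to be measurable on \<open>Rn n\<close>; extended by 0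
    they are Borel on the ambient space, as the splitting of the integral requires.\<close>
  define f' where "f' x = f x * indicator (Rn n) x" for x
  have f'm: "f' \<in> borel_measurable borel"
  proof -
    have "f \<in> borel_measurable (restrict_space borel (Rn n))"
      using fI(1) unfolding measurable_cong_sets[OF sets_lebesgue_sub[OF b] refl] .
    then show ?thesis unfolding f'_def[abs_def]
      by (subst (asm) borel_measurable_restrict_space_iff_ennreal) (use closed_onb[OF b] in auto)
  qed
  have pw: "f' ((\<Sum>i\<in>{d..<n}. c i *\<^sub>R b i) + y)
      \<le> ennreal (sqrt 2 * G * exp (- (1 * (\<Sum>i\<in>{d..<n}. (c i)\<^sup>2) / 2))) * g y"
    if y: "y \<in> E" "y \<noteq> 0" for c y
  proof -
    define x where "x = (\<Sum>i\<in>{d..<n}. c i *\<^sub>R b i) + y"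
    define q where "q = slice (E \<inter> {z. z \<bullet> y = 0}) K 0"
    have q0: "0 \<le> q" by (simp add: q_def)
    let ?S = "\<Sum>i\<in>{d..<n}. (c i)\<^sup>2"
    have nx: "(norm x)\<^sup>2 = ?S + (norm y)\<^sup>2"
      unfolding x_def by (rule norm_add_orthogonal_sum[OF b d(2)]) (use y in \<open>simp add: E_def\<close>)
    have ny: "norm y > 0" using y(2) by simp
    have "(norm x)\<^sup>2 > 0" unfolding nx using ny by (intro add_nonneg_pos sum_nonneg) auto
    then have x0: "x \<noteq> 0" by auto
    have xR: "x \<in> Rn n" unfolding x_def using y ER onb_in[OF b]
      by (intro subspace_add subspace_sum subspace_scale subspace_Rn) auto
    note Qx = Q_pos[OF xR x0]
    have low: "norm y * vol (Rn n) K \<le> G * sqrt (Q x) * q"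
      using section_lower[OF d0 d(2) _ y(2) x_def] y(1) unfolding E_def[symmetric] G_def q_def by simp
    have "slice (Rn n \<inter> {z. z \<bullet> x = 0}) K 0 / norm x \<le> sqrt 2 * vol (Rn n) K / sqrt (Q x)"
      by (rule section_upper[OF xR x0])
    also have "\<dots> = sqrt 2 / (norm y * sqrt (Q x)) * (norm y * vol (Rn n) K)" using ny by simp
    also have "\<dots> \<le> sqrt 2 / (norm y * sqrt (Q x)) * (G * sqrt (Q x) * q)"
      using low Qx by (intro mult_left_mono) auto
    also have "\<dots> = sqrt 2 * G * (q / norm y)" using Qx by simp
    finally have le: "slice (Rn n \<inter> {z. z \<bullet> x = 0}) K 0 / norm x \<le> sqrt 2 * G * (q / norm y)" .
    have "radial_gauss (norm x) * slice (Rn n \<inter> {z. z \<bullet> x = 0}) K 0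
        = exp (- ((norm x)\<^sup>2 / 2)) * (slice (Rn n \<inter> {z. z \<bullet> x = 0}) K 0 / norm x)"
      by (simp add: radial_gauss_def)
    also have "\<dots> \<le> exp (- ((norm x)\<^sup>2 / 2)) * (sqrt 2 * G * (q / norm y))"
      using le by (intro mult_left_mono) auto
    also have "exp (- ((norm x)\<^sup>2 / 2)) = exp (- (1 * ?S / 2)) * exp (- ((norm y)\<^sup>2 / 2))"
      unfolding nx exp_add[symmetric] by (simp add: field_simps)
    also have "\<dots> * (sqrt 2 * G * (q / norm y)) = (sqrt 2 * G * exp (- (1 * ?S / 2))) * (radial_gauss (norm y) * q)"
      by (simp add: radial_gauss_def)
    finally have "f x \<le> ennreal ((sqrt 2 * G * exp (- (1 * ?S / 2))) * (radial_gauss (norm y) * q))"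
      unfolding f_def by (rule ennreal_leI)
    also have "\<dots> = ennreal (sqrt 2 * G * exp (- (1 * ?S / 2))) * ennreal (radial_gauss (norm y) * q)"
      using G q0 by (intro ennreal_mult) auto
    also have "ennreal (radial_gauss (norm y) * q) = g y"
      unfolding g_def q_def by (subst slice_Int) auto
    finally show ?thesis using xR by (simp add: f'_def x_def)
  qed
  have Sm: "(\<lambda>c. ennreal (exp (- (1 * (\<Sum>i\<in>{d..<n}. (c i)\<^sup>2) / 2)))) \<in> borel_measurable (lpi {d..<n})"
    by measurable
  have "ennreal (avg_section (Rn n) K * Jn) = (\<integral>\<^sup>+x. f' x \<partial>?\<mu>)"
    unfolding fI(2)[symmetric] by (rule nn_integral_cong) (simp add: f'_def space_lebesgue_sub[OF b])
  also have "\<dots> = (\<integral>\<^sup>+c. \<integral>\<^sup>+y. f' ((\<Sum>i\<in>{d..<n}. c i *\<^sub>R b i) + y) \<partial>?\<nu> \<partial>lpi {d..<n})"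
    unfolding E_def by (rule nn_integral_lebesgue_sub_split[OF b d(2) f'm])
  also have "\<dots> \<le> (\<integral>\<^sup>+c. ennreal (sqrt 2 * G * a * Jd) * ennreal (exp (- (1 * (\<Sum>i\<in>{d..<n}. (c i)\<^sup>2) / 2))) \<partial>lpi {d..<n})"
  proof (rule nn_integral_mono)
    fix c :: "nat \<Rightarrow> real"
    let ?e = "exp (- (1 * (\<Sum>i\<in>{d..<n}. (c i)\<^sup>2) / 2))"
    have "(\<integral>\<^sup>+y. f' ((\<Sum>i\<in>{d..<n}. c i *\<^sub>R b i) + y) \<partial>?\<nu>) \<le> (\<integral>\<^sup>+y. ennreal (sqrt 2 * G * ?e) * g y \<partial>?\<nu>)"
    proof (rule nn_integral_mono_AE)
      show "AE y in ?\<nu>. f' ((\<Sum>i\<in>{d..<n}. c i *\<^sub>R b i) + y) \<le> ennreal (sqrt 2 * G * ?e) * g y"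
        using AE_lebesgue_sub_nonzero[OF bE d0] by (rule eventually_mono) (rule pw, auto)
    qed
    also have "\<dots> = ennreal (sqrt 2 * G * ?e) * ennreal (a * Jd)" by (simp only: nn_integral_cmult[OF gI(1)] gI(2))
    also have "\<dots> = ennreal (sqrt 2 * G * a * Jd) * ennreal ?e"
      using G a0 J0 by (simp add: ennreal_mult[symmetric] mult_ac)
    finally show "(\<integral>\<^sup>+y. f' ((\<Sum>i\<in>{d..<n}. c i *\<^sub>R b i) + y) \<partial>?\<nu>) \<le> ennreal (sqrt 2 * G * a * Jd) * ennreal ?e" .
  qed
  also have "\<dots> = ennreal (sqrt 2 * G * a * Jd) * ennreal (sqrt (2 * pi / 1) ^ card {d..<n})"
    unfolding nn_integral_cmult[OF Sm] by (subst nn_integral_lpi_gaussian) auto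
  also have "\<dots> = ennreal (sqrt 2 * G * a * Jd * sqrt (2 * pi) ^ (n - d))"
    using G a0 J0 by (simp add: ennreal_mult[symmetric])
  finally have main: "avg_section (Rn n) K * Jn \<le> sqrt 2 * G * a * Jd * sqrt (2 * pi) ^ (n - d)"
    using G a0 J0 by (subst (asm) ennreal_le_iff) auto
  let ?s = "sqrt (2 * pi)"
  have "avg_section (Rn n) K * (?s ^ n / sqrt n) \<le> avg_section (Rn n) K * Jn"
    unfolding Jn_def by (intro mult_left_mono radial_gauss_integral(2)[OF C b n2] avg_section_nonneg)
  also note main
  also have "sqrt 2 * G * a * Jd * ?s ^ (n - d) \<le> sqrt 2 * G * a * (C * (?s ^ d / sqrt d)) * ?s ^ (n - d)"
    unfolding Jd_def using G a0 by (intro mult_right_mono mult_left_mono radial_gauss_integral(3)[OF C bE d(1)]) auto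
  also have "\<dots> = sqrt 2 * G * a * C * (?s ^ n / sqrt d)"
    using d(2) by (simp add: power_add[symmetric])
  finally have "avg_section (Rn n) K * (?s ^ n / sqrt n) \<le> (sqrt 2 * G * a * C * (sqrt n / sqrt d)) * (?s ^ n / sqrt n)"
    using n2 by (simp add: field_simps)
  moreover have "?s ^ n / sqrt n > 0" using n2 by simp
  ultimately have "avg_section (Rn n) K \<le> sqrt 2 * G * a * C * (sqrt n / sqrt d)"
    by (rule mult_right_le_imp_le)
  then show ?thesis unfolding a_def G_def E_def by (simp add: mult_ac)
qed

section \<open>The case of a one-dimensional subspace\<close>

lemma line_section:
  assumes n: "n > 0" and \<xi>: "\<xi> \<in> span (b ` {..<1})" "\<xi> \<noteq> 0"
  shows "slice (span (b ` {..<1}) \<inter> {y. y \<bullet> \<xi> = 0}) A 0 = indicator A 0"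
proof -
  define E where "E = span (b ` {..<1})"
  have bE: "onb E 1 b" and ER: "E \<subseteq> Rn n" unfolding E_def using onb_prefix[OF b, of 1] n by auto
  define \<eta> where "\<eta> = (1 / norm \<xi>) *\<^sub>R \<xi>"
  have \<eta>: "\<eta> \<in> E" "norm \<eta> = 1" using \<xi> by (auto simp: \<eta>_def E_def intro: span_scale)
  have h: "{z. z \<bullet> \<eta> = 0} = {z. z \<bullet> \<xi> = 0}" using \<xi>(2) by (simp add: \<eta>_def)
  obtain bh where "onb (E \<inter> {z. z \<bullet> \<eta> = 0}) (1 - 1) bh" by (rule onb_hyperplane[OF bE ER \<eta>])
  then have "onb (E \<inter> {z. z \<bullet> \<xi> = 0}) 0 bh" unfolding h by simp
  then show ?thesis unfolding E_def by (rule slice_zero)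
qed

lemma avg_section_line:
  assumes n: "n > 0"
  shows "avg_section (span (b ` {..<1})) (K \<inter> span (b ` {..<1})) = 1"
proof -
  define E where "E = span (b ` {..<1})"
  have bE: "onb E 1 b" unfolding E_def using onb_prefix[OF b, of 1] n by auto
  have "avg_section E (K \<inter> E) = (LINT \<xi>|sphere_measure E. 1)"
    unfolding avg_section_def
  proof (rule Bochner_Integration.integral_cong[OF refl])
    fix \<xi> assume "\<xi> \<in> space (sphere_measure E)"
    then have \<xi>: "\<xi> \<in> E" "\<xi> \<noteq> 0" using space_sphere_measure[OF bE] by auto
    have "vol (E \<inter> {x. x \<bullet> \<xi> = 0}) (K \<inter> E \<inter> {x. x \<bullet> \<xi> = 0}) = slice (E \<inter> {x. x \<bullet> \<xi> = 0}) (K \<inter> E) 0"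
      by (rule section_eq_slice) simp
    also have "\<dots> = indicator (K \<inter> E) 0"
      unfolding E_def by (rule line_section[OF n]) (use \<xi> in \<open>auto simp: E_def\<close>)
    also have "\<dots> = 1" using zero_in by (simp add: E_def span_zero)
    finally show "vol (E \<inter> {x. x \<bullet> \<xi> = 0}) (K \<inter> E \<inter> {x. x \<bullet> \<xi> = 0}) = 1" .
  qed
  also have "\<dots> = 1" using prob_sphere_measure[OF bE] by (simp add: prob_space.prob_space)
  finally show ?thesis unfolding E_def .
qed

text \<open>\<open>section_lower\<close> for \<open>d = 1\<close> and \<open>x = y = b 0\<close>:
  the section is a point, of volume 1, and \<open>Q (b 0) = lam 0\<close> completes the product over
  the other axes.\<close>

lemma vol_le_axes:
  assumes n: "n > 0"
  shows "vol (Rn n) K \<le> sqrt (2 * pi * exp 1) ^ n * (\<Prod>i<n. sqrt (lam i))"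
proof -
  have y: "b 0 \<in> span (b ` {..<1})" "b 0 \<noteq> 0" using onb_norm[OF b n] by (auto intro: span_base)
  have "norm (b 0) * vol (Rn n) K \<le> sqrt (2 * pi * exp 1) ^ Suc (n - 1) * (\<Prod>i\<in>{1..<n}. sqrt (lam i))
      * sqrt (Q (b 0)) * slice (span (b ` {..<1}) \<inter> {z. z \<bullet> b 0 = 0}) K 0"
    by (rule section_lower[OF _ _ y, where c = "\<lambda>_. 0"]) (use n in auto)
  moreover have "Q (b 0) = (\<Sum>i<n. if i = 0 then lam 0 else 0)"
    unfolding Q_def using n by (intro sum.cong) (auto simp: onb_inner[OF b])
  moreover have "(\<Prod>i<n. sqrt (lam i)) = sqrt (lam 0) * (\<Prod>i\<in>{1..<n}. sqrt (lam i))"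
    using n by (simp add: prod.atLeast_Suc_lessThan lessThan_atLeast0)
  ultimately show ?thesis
    using n onb_norm[OF b n] line_section[OF n y] zero_in by (simp add: mult_ac)
qed

text \<open>\<open>section_upper\<close> is integrated as it stands, and the Gaussian integral of
  \<open>1 / sqrt (Q x)\<close> leaves a negative power of the geometric mean of the
  \<open>sqrt (lam i)\<close>. This serves the case in which \<open>E\<close> is a line.\<close>

lemma avg_section_le_axes:
  assumes C: "gauss_bound C" and n: "n \<ge> 2"
  shows "avg_section (Rn n) K \<le> sqrt 2 * C * vol (Rn n) K * (\<Prod>i<n. sqrt (lam i)) powr (- (1 / real n))"
proof -
  let ?\<mu> = "lebesgue_sub (Rn n)" and ?V = "vol (Rn n) K" and ?s = "sqrt (2 * pi)"
  let ?R = "\<Prod>i<n. lam i powr (- (1 / (2 * real n)))"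
  have C0: "C > 0" using C by (simp add: gauss_bound_def)
  have "?R = (\<Prod>i<n. sqrt (lam i) powr (- (1 / real n)))"
    by (intro prod.cong refl) (simp add: powr_half_sqrt[symmetric] less_imp_le[OF lam] powr_powr)
  also have "\<dots> = (\<Prod>i<n. sqrt (lam i)) powr (- (1 / real n))"
    by (rule prod_powr_distrib[symmetric])
  finally have R: "?R = (\<Prod>i<n. sqrt (lam i)) powr (- (1 / real n))" .
  have hm: "(\<lambda>x. ennreal (exp (- ((norm x)\<^sup>2 / 2)) / sqrt (\<Sum>i<n. lam i * (x \<bullet> b i)\<^sup>2))) \<in> borel_measurable ?\<mu>"
    by (rule measurable_lebesgue_sub[OF b]) measurable
  have "ennreal (avg_section (Rn n) K * (\<integral>x. radial_gauss (norm x) \<partial>?\<mu>))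
      = (\<integral>\<^sup>+x. ennreal (radial_gauss (norm x) * slice (Rn n \<inter> {y. y \<bullet> x = 0}) K 0) \<partial>?\<mu>)"
    by (rule avg_section_radial_gauss(2)[OF C b subset_refl n Kc r, symmetric])
  also have "\<dots> \<le> (\<integral>\<^sup>+x. ennreal (sqrt 2 * ?V) * ennreal (exp (- ((norm x)\<^sup>2 / 2)) / sqrt (\<Sum>i<n. lam i * (x \<bullet> b i)\<^sup>2)) \<partial>?\<mu>)"
  proof (rule nn_integral_mono)
    fix x assume "x \<in> space ?\<mu>"
    then have x: "x \<in> Rn n" by (simp add: space_lebesgue_sub[OF b])
    have "radial_gauss (norm x) * slice (Rn n \<inter> {y. y \<bullet> x = 0}) K 0
      \<le> sqrt 2 * ?V * (exp (- ((norm x)\<^sup>2 / 2)) / sqrt (\<Sum>i<n. lam i * (x \<bullet> b i)\<^sup>2))"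
    proof (cases "x = 0")
      case False
      have "exp (- ((norm x)\<^sup>2 / 2)) * (slice (Rn n \<inter> {y. y \<bullet> x = 0}) K 0 / norm x)
        \<le> exp (- ((norm x)\<^sup>2 / 2)) * (sqrt 2 * ?V / sqrt (Q x))"
        by (intro mult_left_mono section_upper[OF x False]) simp
      then show ?thesis by (simp add: radial_gauss_def Q_def mult_ac)
    qed simp
    then show "ennreal (radial_gauss (norm x) * slice (Rn n \<inter> {y. y \<bullet> x = 0}) K 0)
      \<le> ennreal (sqrt 2 * ?V) * ennreal (exp (- ((norm x)\<^sup>2 / 2)) / sqrt (\<Sum>i<n. lam i * (x \<bullet> b i)\<^sup>2))"
      by (subst ennreal_mult[symmetric]) (auto intro!: ennreal_leI divide_nonneg_nonneg real_sqrt_ge_zero sum_nonneg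
          mult_nonneg_nonneg less_imp_le[OF lam])
  qed
  also have "\<dots> = ennreal (sqrt 2 * ?V) * (\<integral>\<^sup>+x. ennreal (exp (- ((norm x)\<^sup>2 / 2)) / sqrt (\<Sum>i<n. lam i * (x \<bullet> b i)\<^sup>2)) \<partial>?\<mu>)"
    by (rule nn_integral_cmult[OF hm])
  also have "\<dots> \<le> ennreal (sqrt 2 * ?V) * ennreal (C * (?s ^ n / sqrt n) * ?R)"
    using C[unfolded gauss_bound_def, THEN conjunct2, rule_format, of "Rn n" n b lam] b n lam
    by (intro mult_left_mono) auto
  also have "\<dots> = ennreal (sqrt 2 * ?V * (C * (?s ^ n / sqrt n) * ?R))"
    unfolding R using C0 by (intro ennreal_mult[symmetric]) auto
  finally have "avg_section (Rn n) K * (\<integral>x. radial_gauss (norm x) \<partial>?\<mu>) \<le> sqrt 2 * ?V * (C * (?s ^ n / sqrt n) * ?R)"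
    unfolding R using C0 by (subst (asm) ennreal_le_iff) auto
  moreover have "avg_section (Rn n) K * (?s ^ n / sqrt n) \<le> avg_section (Rn n) K * (\<integral>x. radial_gauss (norm x) \<partial>?\<mu>)"
    by (intro mult_left_mono radial_gauss_integral(2)[OF C b n] avg_section_nonneg)
  ultimately have "avg_section (Rn n) K * (?s ^ n / sqrt n) \<le> (sqrt 2 * C * ?V * ?R) * (?s ^ n / sqrt n)"
    by (simp add: mult_ac)
  moreover have "?s ^ n / sqrt n > 0" using n by simp
  ultimately have "avg_section (Rn n) K \<le> sqrt 2 * C * ?V * ?R" by (rule mult_right_le_imp_le)
  then show ?thesis unfolding R .
qed

text \<open>\<open>E\<close> is spanned by all axes but the last \<open>k\<close>. If it is a line,
  then \<open>n = k + 1\<close>, and \<open>vol_le_axes\<close> raises the exponent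
  \<open>- 1 / n\<close> of the product to \<open>k / n\<close>; otherwise
  \<open>avg_section_compare\<close> and \<open>tail\<close> apply. The factor \<open>2 ^ k\<close>
  brings both cases to one form.\<close>

lemma ex_large_section:
  assumes C: "gauss_bound C" and k: "1 \<le> k" "k \<le> n - 1"
    and tail: "(\<Prod>i\<in>{n - k..<n}. sqrt (lam i)) \<le> (\<Prod>i<n. sqrt (lam i)) powr (real k / real n)"
  shows "\<exists>E\<in>Grassmannian n (n - k). avg_section (Rn n) K \<le> sqrt 2 * C * sqrt (2 * pi * exp 1) ^ Suc k * 2 ^ k
    * (\<Prod>i<n. sqrt (lam i)) powr (real k / real n) * avg_section E (K \<inter> E)"
proof (rule bexI)
  let ?P = "\<Prod>i<n. sqrt (lam i)" and ?g = "sqrt (2 * pi * exp 1)"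
  define d where "d = n - k"
  have d: "1 \<le> d" "d \<le> n" "n = d + k" "n - d = k" "n \<ge> 2" using k by (auto simp: d_def)
  define E where "E = span (b ` {..<d})"
  have C0: "C > 0" using C by (simp add: gauss_bound_def)
  have P: "?P > 0" using lam by (intro prod_pos) auto
  have pw2: "1 + real k \<le> 2 ^ k" using Bernoulli_inequality[of 1 k] by simp
  show "span (b ` {..<n - k}) \<in> Grassmannian n (n - k)"
    using onb_prefix[OF b d(2)] onb_dim onb_subspace unfolding Grassmannian_def d_def by blast
  have "avg_section (Rn n) K \<le> sqrt 2 * C * ?g ^ Suc k * 2 ^ k * ?P powr (real k / real n) * avg_section E (K \<inter> E)"
  proof (cases "d = 1")
    case True
    then have nk: "n = Suc k" using d by simp
    have "avg_section (Rn n) K \<le> sqrt 2 * C * vol (Rn n) K * ?P powr (- (1 / real n))"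
      by (rule avg_section_le_axes[OF C d(5)])
    also have "\<dots> \<le> sqrt 2 * C * (?g ^ n * ?P) * ?P powr (- (1 / real n))"
      using C0 d(5) by (intro mult_right_mono mult_left_mono vol_le_axes) auto
    also have "\<dots> = sqrt 2 * C * ?g ^ Suc k * (?P powr 1 * ?P powr (- (1 / real n)))"
      using P by (simp add: nk)
    also have "?P powr 1 * ?P powr (- (1 / real n)) = ?P powr (real k / real n)"
      unfolding powr_add[symmetric] by (rule arg_cong[where f = "\<lambda>t. ?P powr t"]) (simp add: nk field_simps)
    also have "sqrt 2 * C * ?g ^ Suc k * ?P powr (real k / real n) = sqrt 2 * C * ?g ^ Suc k * ?P powr (real k / real n) * 1"
      by (rule mult_1_right[symmetric])
    also have "\<dots> \<le> sqrt 2 * C * ?g ^ Suc k * ?P powr (real k / real n) * 2 ^ k"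
      using C0 by (intro mult_left_mono one_le_power) auto
    finally have "avg_section (Rn n) K \<le> sqrt 2 * C * ?g ^ Suc k * 2 ^ k * ?P powr (real k / real n) * 1"
      by (simp only: mult_ac)
    moreover have "avg_section E (K \<inter> E) = 1" using avg_section_line d(5) by (simp add: E_def True)
    ultimately show ?thesis by simp
  next
    case False
    have d2: "2 \<le> d" using d(1) False by simp
    have "avg_section (Rn n) K \<le> sqrt 2 * C * ?g ^ Suc k * (\<Prod>i\<in>{d..<n}. sqrt (lam i)) * (sqrt n / sqrt d) * avg_section E (K \<inter> E)"
      using avg_section_compare[OF C d2 d(2)] unfolding d(4) E_def .
    also have "\<dots> \<le> sqrt 2 * C * ?g ^ Suc k * ?P powr (real k / real n) * 2 ^ k * avg_section E (K \<inter> E)"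
    proof (intro mult_right_mono mult_mono mult_left_mono avg_section_nonneg)
      show "(\<Prod>i\<in>{d..<n}. sqrt (lam i)) \<le> ?P powr (real k / real n)" using tail by (simp add: d_def)
      \<comment> \<open>With \<open>n = d + k\<close> and \<open>1 \<le> d\<close> the quotient
        \<open>n / d\<close> is at most \<open>1 + k\<close>, hence at most \<open>2 ^ k\<close>;
        the dependence on \<open>n\<close> thus becomes a constant factor per dimension
        removed.\<close>
      have "1 * real k \<le> real d * real k" using d(1) by (intro mult_right_mono) auto
      then have "real n \<le> real d * (1 + real k)" unfolding d(3) by (simp add: algebra_simps)
      then have "sqrt n \<le> sqrt (real d * (1 + real k))" by simp
      also have "\<dots> = sqrt d * sqrt (1 + real k)" by (rule real_sqrt_mult)
      also have "\<dots> \<le> sqrt d * (1 + real k)"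
        by (intro mult_left_mono real_le_lsqrt) (auto simp: power2_eq_square algebra_simps)
      finally have "sqrt n / sqrt d \<le> 1 + real k" using d(1) by (simp add: divide_le_eq mult.commute)
      then show "sqrt n / sqrt d \<le> 2 ^ k" using pw2 by linarith
    qed (use C0 lam in \<open>auto intro!: prod_nonneg intro: less_imp_le\<close>)
    finally show ?thesis by (simp only: mult_ac)
  qed
  then show "avg_section (Rn n) K \<le> sqrt 2 * C * ?g ^ Suc k * 2 ^ k * ?P powr (real k / real n)
    * avg_section (span (b ` {..<n - k})) (K \<inter> span (b ` {..<n - k}))"
    unfolding E_def d_def .
qed

end

text \<open>A real supremum dominates the members of a family only if the family is bounded above;
  with this the chosen \<open>E\<close> can be compared with the supremum in the theorem.\<close>

lemma bdd_above_avg_section: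
  assumes K: "compact K" and d: "d > 0"
  shows "bdd_above ((\<lambda>E. avg_section E (K \<inter> E)) ` Grassmannian n d)"
proof -
  obtain R where R: "\<And>x. x \<in> K \<Longrightarrow> norm x \<le> R" "0 \<le> R" using compact_norm_bound[OF K] by blast
  have "avg_section E (K \<inter> E) \<le> (2 * R) ^ (d - 1)" if "E \<in> Grassmannian n d" for E
  proof -
    have E: "subspace E" "E \<subseteq> Rn n" "dim E = d" using that by (auto simp: Grassmannian_def)
    obtain b where b: "onb E d b" using ex_onb[OF E(1,2)] E(3) by auto
    show ?thesis
      by (rule avg_section_le[OF b E(2) d _ _ _ R(2)])
        (use R K closed_onb[OF b] in \<open>auto intro!: borel_closed closed_Int compact_imp_closed\<close>)
  qed
  then show ?thesis by (intro bdd_aboveI2)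
qed

theorem theorem1p6:
  shows "\<exists>c\<^sub>2::real. c\<^sub>2 > 0 \<and>
    (\<forall>(n::nat) (k::nat) (K::fseq set).
       centered_convex_body n K \<and> 1 \<le> k \<and> k \<le> n - 1 \<longrightarrow>
       avg_section (Rn n) K
         \<le> (c\<^sub>2 * isotropic_constant n K) ^ k * vol (Rn n) K powr (real k / real n)
            * (SUP E\<in>Grassmannian n (n - k). avg_section E (K \<inter> E)))"
proof -
  obtain C where C: "gauss_bound C" using gaussian_inverse_sqrt_upper unfolding gauss_bound_def by blast
  have C0: "C > 0" using C by (simp add: gauss_bound_def)
  define g where "g = sqrt (2 * pi * exp 1)"
  define M where "M = max 1 (sqrt 2 * C)"
  have M: "1 \<le> M" "sqrt 2 * C \<le> M" by (auto simp: M_def)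
  have g: "1 \<le> g"
  proof -
    have "1 * 1 \<le> (2 * pi) * exp (1::real)" using pi_ge_two by (intro mult_mono) auto
    then show ?thesis by (simp add: g_def)
  qed
  \<comment> \<open>As \<open>1 \<le> k\<close>, the factor \<open>sqrt 2 * C\<close> is at most
    \<open>M ^ k\<close>, where the maximum with 1 makes powers of \<open>M\<close> increase, and
    \<open>g ^ Suc k\<close> is at most \<open>g ^ (2 * k)\<close>. Together with
    \<open>2 ^ k\<close> they make up \<open>c ^ k\<close>.\<close>
  define c where "c = 2 * M * g\<^sup>2"
  have const: "sqrt 2 * C * g ^ Suc k * 2 ^ k \<le> c ^ k" if k: "1 \<le> k" for k
  proof -
    have "sqrt 2 * C \<le> M ^ k" using M self_le_power[of M k] k by linarith
    moreover have "g ^ Suc k \<le> g ^ (2 * k)" using g k by (intro power_increasing) auto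
    ultimately have "sqrt 2 * C * g ^ Suc k * 2 ^ k \<le> M ^ k * g ^ (2 * k) * 2 ^ k"
      using M g C0 by (intro mult_right_mono mult_mono) auto
    also have "\<dots> = c ^ k" by (simp add: c_def power_mult_distrib power_mult)
    finally show ?thesis .
  qed
  show ?thesis
  proof (intro exI[of _ c] conjI allI impI)
    show "c > 0" using M g by (simp add: c_def)
  next
    fix n k :: nat and K :: "fseq set"
    assume H: "centered_convex_body n K \<and> 1 \<le> k \<and> k \<le> n - 1"
    then have K: "centered_convex_body n K" and k: "1 \<le> k" "k \<le> n - 1" and n: "n > 0" "k \<le> n" by auto
    have Kc: "compact K" "convex K" "K \<subseteq> Rn n" using K by (auto simp: centered_convex_body_def convex_body_def)
    obtain r where r: "r > 0" "cball 0 r \<inter> Rn n \<subseteq> K" using centered_ball[OF K] by blast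
    obtain b lam where b: "onb (Rn n) n b" and lam: "\<And>i. i < n \<Longrightarrow> lam i > 0"
      and sm: "\<And>i j. i < n \<Longrightarrow> j < n \<Longrightarrow> second_moment n K (b i) (b j) = (if i = j then lam i * vol (Rn n) K else 0)"
      and tail: "(\<Prod>i\<in>{n - k..<n}. sqrt (lam i)) \<le> (\<Prod>i<n. sqrt (lam i)) powr (real k / real n)"
      using ex_principal_axes[OF Kc(1,3) r n(2,1)] by blast
    interpret principal_body n K b lam r
      by unfold_locales (fact Kc r b lam sm | rule centered_integral[OF K], assumption)+
    let ?P = "\<Prod>i<n. sqrt (lam i)" and ?V = "vol (Rn n) K"
    define L where "L = isotropic_constant n K"
    \<comment> \<open>The chosen value \<open>L\<close> is attained by some isotropic position, and
      \<open>isotropic_lower\<close> applies to any of them.\<close>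
    have "\<exists>T\<in>GL n. isotropic_with n (T ` K) L"
      unfolding L_def isotropic_constant_def by (rule someI_ex[OF ex_isotropic_position[OF K n(1)]])
    then obtain T where T: "T \<in> GL n" "isotropic_with n (T ` K) L" by blast
    have L: "L > 0" using T(2) by (simp only: isotropic_with_def)
    have PL: "?P \<le> L ^ n * ?V" by (rule isotropic_lower[OF K n(1) b lam sm T])
    have P0: "0 \<le> ?P" by (intro prod_nonneg) (simp add: less_imp_le[OF lam])
    have "?P powr (real k / real n) \<le> (L ^ n * ?V) powr (real k / real n)"
      using PL P0 by (intro powr_mono2) auto
    also have "\<dots> = (L ^ n) powr (real k / real n) * ?V powr (real k / real n)"
      by (rule powr_mult)
    also have "(L ^ n) powr (real k / real n) = L ^ k"
      using L n(1) by (simp add: powr_realpow[symmetric] powr_powr)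
    finally have Pk: "?P powr (real k / real n) \<le> L ^ k * ?V powr (real k / real n)" .
    obtain E where E: "E \<in> Grassmannian n (n - k)"
      and le: "avg_section (Rn n) K \<le> sqrt 2 * C * g ^ Suc k * 2 ^ k * ?P powr (real k / real n) * avg_section E (K \<inter> E)"
      using ex_large_section[OF C k tail] unfolding g_def by blast
    have "avg_section E (K \<inter> E) \<le> (SUP E\<in>Grassmannian n (n - k). avg_section E (K \<inter> E))"
      using k by (intro cSUP_upper E bdd_above_avg_section Kc) auto
    then have "sqrt 2 * C * g ^ Suc k * 2 ^ k * ?P powr (real k / real n) * avg_section E (K \<inter> E)
      \<le> c ^ k * (L ^ k * ?V powr (real k / real n)) * (SUP E\<in>Grassmannian n (n - k). avg_section E (K \<inter> E))"
      using const[OF k(1)] Pk C0 g M L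
      by (intro mult_mono avg_section_nonneg mult_nonneg_nonneg) (auto simp: c_def)
    with le show "avg_section (Rn n) K \<le> (c * isotropic_constant n K) ^ k * ?V powr (real k / real n)
        * (SUP E\<in>Grassmannian n (n - k). avg_section E (K \<inter> E))"
      unfolding L_def by (simp add: power_mult_distrib mult_ac)
  qed
qed

end
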